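(* Let $\boldsymbol f\in L^1(0,T;L^2(\Omega)^d)$, $\boldsymbol u_0\in\boldsymbol{\mathcal Z}$ and $\boldsymbol w_{h,\tau}\in\boldsymbol{\mathcal Z}_{h,\tau}$. Any solution $\boldsymbol u_{h,\tau}\in\boldsymbol{\mathcal Z}_{h,\tau}$ of the linearized problem $$m_{h,\tau}(\boldsymbol u_{h,\tau},\boldsymbol z)+\nu\, a_{h,\tau}(\boldsymbol u_{h,\tau},\boldsymbol z)+c_{h,\tau}(\boldsymbol w_{h,\tau};\boldsymbol u_{h,\tau},\boldsymbol z)=(\boldsymbol f,\boldsymbol z)_{Q_T}+(\boldsymbol u_0,\boldsymbol z(\cdot,0))_\Omega\qquad\forall \boldsymbol z\in\boldsymbol{\mathcal Z}_{h,\tau}$$ satisfies $$|||\boldsymbol u_{h,\tau}|||_{\mathcal E;\boldsymbol w_{h,\tau}}^2\le C\big(\|\boldsymbol f\|_{L^1(0,T;L^2(\Omega)^d)}^2+\|\boldsymbol u_0\|_{L^2(\Omega)^d}^2\big),$$ where the constant $C>0$ depends only on $\ell$ (in particular, it is independent of $h$, $\tau$, $\nu$, the final time $T$ and the discrete function $\boldsymbol w_{h,\tau}$).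
   Context: Domain and meshes. $\Omega\subset\mathbb R^d$ ($d\in\{2,3\}$) is an open bounded Lipschitz domain, $T>0$, $\nu>0$, $Q_T=\Omega\times(0,T)$. $\{\mathcal T_h\}_{h>0}$ is a family of shape-regular conforming simplicial meshes of $\Omega$ (shape-regularity parameter $\rho$), $h_K=\mathrm{diam}(K)$, $h=\max_K h_K$. $\mathcal F_h=\mathcal F_{h,\circ}\cup\mathcal F_{h,\mathcal D}$ is the set of facets (interior and boundary), $h_F$ the diameter of $F$, $\mathbf n_F$ a fixed unit normal to $F$ (outward to $\Omega$ on boundary facets). $0=t_0<\dots<t_N=T$, $I_n=(t_{n-1},t_n)$, $\tau_n=t_n-t_{n-1}$, $\tau=\max_n\tau_n$, $Q_n=\Omega\times I_n$. Time jumps: $[\![z]\!]_n=z(\cdot,t_n^-)-z(\cdot,t_n^+)$, $1\le n\le N-1$, with one-sided limits; values at $t=0$ and $t=T$ are traces from inside $(0,T)$. Spatial averages and jumps: on an interior facet shared by $K_\pm$ ($\mathbf n_F$ pointing out of $K_+$), $\{\!\{\boldsymbol v\}\!\}=\frac12(\boldsymbol v|_{K_+}+\boldsymbol v|_{K_-})$, $[\![\boldsymbol v]\!]=\boldsymbol v|_{K_+}-\boldsymbol v|_{K_-}$; on boundary facets both equal $\boldsymbol v$. $\boldsymbol\nabla_h$ is the elementwise gradient (rows are gradients of components). $(\cdot,\cdot)_D$ is the $L^2(D)$ inner product. Spaces. $\boldsymbol{\mathcal Z}=\{\boldsymbol v\in H(\mathrm{div},\Omega):\mathrm{div}\,\boldsymbol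 v=0,\ \boldsymbol v\cdot\mathbf n_\Omega=0\text{ on }\partial\Omega\}$. For integers $k\ge1$, $\ell\ge0$, $\boldsymbol{\mathcal V}_h\subset H(\mathrm{div},\Omega)$ is either the Raviart–Thomas space $\mathrm{RT}_k(\mathcal T_h)$ or the Brezzi–Douglas–Marini space $\mathrm{BDM}_k(\mathcal T_h)$ of order $k$. $\boldsymbol{\mathcal V}_{h,\tau}$ is the set of $\boldsymbol v\in L^2(0,T;H(\mathrm{div},\Omega))$ with $\boldsymbol v\cdot\mathbf n_\Omega=0$ on $\partial\Omega\times(0,T)$ and $\boldsymbol v|_{Q_n}\in\mathbb P_\ell(I_n)\otimes\boldsymbol{\mathcal V}_h$ for all $n$. $\boldsymbol{\mathcal Z}_{h,\tau}=\{\boldsymbol v\in\boldsymbol{\mathcal V}_{h,\tau}:\mathrm{div}\,\boldsymbol v=0 \text{ in each } Q_n\}$. Quadrature. $\{(\omega_i^{(n)},s_i^{(n)})\}_{i=1}^{\ell+1}$ is the left-sided Gauss–Radau rule on $I_n$ ($s_1^{(n)}=t_{n-1}$, positive weights, exact for degree $\le2\ell$); $\mathsf Q_\tau^{\mathcal R,(n)}(u)=\sum_i\omega_i^{(n)}u(s_i^{(n)})$ (node values taken from inside $I_n$), $\mathsf Q_\tau^{\mathcal R}=\sum_n\mathsf Q_\tau^{\mathcal R,(n)}$; $\mathcal I_\tau^{\mathcal R}$ is the piecewise (in time, on each $I_n$) Lagrange interpolant of degree $\ell$ at these nodes, also applied pointwise in space. Forms. $\sigma>0$ is a fixed interior-penalty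 parameter, assumed sufficiently large as usual for interior-penalty DG methods (above a threshold depending only on $k,d,\rho$), and $c_S>0$ a fixed small constant; $\gamma_F(\boldsymbol w)=\max\{c_S,\|\boldsymbol w\cdot\mathbf n_F\|_{L^\infty(F)}\}$ (pointwise in time), $\gamma(\boldsymbol w)|_F=\gamma_F(\boldsymbol w)$. For $\boldsymbol w,\boldsymbol u,\boldsymbol v\in\boldsymbol{\mathcal V}_{h,\tau}$: $m_{h,\tau}(\boldsymbol u,\boldsymbol v)=\sum_{n=1}^N(\partial_t\boldsymbol u,\boldsymbol v)_{Q_n}-\sum_{n=1}^{N-1}([\![\boldsymbol u]\!]_n,\boldsymbol v(\cdot,t_n^+))_\Omega+(\boldsymbol u(\cdot,0),\boldsymbol v(\cdot,0))_\Omega$; $a_{h,\tau}(\boldsymbol u,\boldsymbol v)=\sum_{n=1}^N\big[(\boldsymbol\nabla_h\boldsymbol u,\boldsymbol\nabla_h\boldsymbol v)_{Q_n}+\sum_{F\in\mathcal F_h}\{-(\{\!\{\boldsymbol\nabla_h\boldsymbol u\}\!\}\mathbf n_F,[\![\boldsymbol v]\!])_{F\times I_n}-([\![\boldsymbol u]\!],\{\!\{\boldsymbol\nabla_h\boldsymbol v\}\!\}\mathbf n_F)_{F\times I_n}+(\sigma h_F^{-1}[\![\boldsymbol u]\!],[\![\boldsymbol v]\!])_{F\times I_n}\}\big]$; $c_{h,\tau}(\boldsymbol w;\boldsymbol u,\boldsymbol v)=\sum_{n=1}^N\big[(\mathcal I_\tau^{\mathcal R}((\boldsymbol\nabla_h\boldsymbol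 u)\boldsymbol w),\boldsymbol v)_{Q_n}+\sum_{F\in\mathcal F_{h,\circ}}\{-(\mathcal I_\tau^{\mathcal R}((\boldsymbol w\cdot\mathbf n_F)[\![\boldsymbol u]\!]),\{\!\{\boldsymbol v\}\!\})_{F\times I_n}+\frac12(\mathcal I_\tau^{\mathcal R}(\gamma(\boldsymbol w)[\![\boldsymbol u]\!]),[\![\boldsymbol v]\!])_{F\times I_n}\}\big]$. Norms. $\|\boldsymbol v_h\|_{\mathcal A,h}^2=\|\boldsymbol\nabla_h\boldsymbol v_h\|_{L^2(\Omega)^{d\times d}}^2+\sum_{F\in\mathcal F_h}\int_F\sigma h_F^{-1}|[\![\boldsymbol v_h]\!]|^2\,dS$, $\|\boldsymbol v\|_{\mathcal A}^2=\sum_n\int_{I_n}\|\boldsymbol v(\cdot,t)\|_{\mathcal A,h}^2dt$, $|\boldsymbol v|_{\mathsf J}^2=\frac12\big(\|\boldsymbol v(\cdot,T)\|_{L^2(\Omega)^d}^2+\sum_{n=1}^{N-1}\|[\![\boldsymbol v]\!]_n\|_{L^2(\Omega)^d}^2+\|\boldsymbol v(\cdot,0)\|_{L^2(\Omega)^d}^2\big)$, $|\boldsymbol v|_{\gamma,\boldsymbol w}^2=\frac12\sum_{F\in\mathcal F_{h,\circ}}\mathsf Q_\tau^{\mathcal R}\big(\gamma_F(\boldsymbol w)\|[\![\boldsymbol v]\!]\|_{L^2(F)^d}^2\big)$, $|||\boldsymbol v|||_{\mathcal E;\boldsymbol w}^2=\|\boldsymbol v\|_{L^\infty(0,T;L^2(\Omega)^d)}^2+\nu\|\boldsymbol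 v\|_{\mathcal A}^2+|\boldsymbol v|_{\mathsf J}^2+|\boldsymbol v|_{\gamma,\boldsymbol w}^2$. *)

theory Defs
  imports "HOL-Analysis.Analysis" "HOL-Computational_Algebra.Polynomial"
begin

section \<open>Lebesgue norms and inner products\<close>

text \<open>Functions in Lebesgue spaces are represented by Borel measurable functions; every Lebesgue
  class has such a representative, so no class is lost.\<close>

definition L2_on :: "(real^'n) set \<Rightarrow> (real^'n \<Rightarrow> 'b::euclidean_space) \<Rightarrow> bool" where
  "L2_on S v \<longleftrightarrow>
     set_borel_measurable lborel S v \<and> set_integrable lborel S (\<lambda>x. (norm (v x))\<^sup>2)"

definition L2_inner :: "(real^'n) set \<Rightarrow> (real^'n \<Rightarrow> 'b::euclidean_space) \<Rightarrow> (real^'n \<Rightarrow> 'b) \<Rightarrow> real" where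
  "L2_inner S u v = (LINT x:S|lborel. u x \<bullet> v x)"

definition L2_norm_on :: "(real^'n) set \<Rightarrow> (real^'n \<Rightarrow> 'b::euclidean_space) \<Rightarrow> real" where
  "L2_norm_on S v = sqrt (LINT x:S|lborel. (norm (v x))\<^sup>2)"

definition Linf_norm :: "'a measure \<Rightarrow> ('a \<Rightarrow> real) \<Rightarrow> real" where
  "Linf_norm M f = Inf {c. 0 \<le> c \<and> (AE x in M. \<bar>f x\<bar> \<le> c)}"

definition L1_L2 :: "real \<Rightarrow> (real^'n) set \<Rightarrow> (real \<Rightarrow> real^'n \<Rightarrow> real^'n) \<Rightarrow> bool" where
  "L1_L2 T \<Omega> f \<longleftrightarrow>
     set_borel_measurable (lborel \<Otimes>\<^sub>M lborel) ({0<..<T} \<times> \<Omega>) (\<lambda>(t, x). f t x) \<and>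
     (AE t in lborel. t \<in> {0<..<T} \<longrightarrow> L2_on \<Omega> (f t)) \<and>
     set_integrable lborel {0<..<T} (\<lambda>t. L2_norm_on \<Omega> (f t))"

definition L1_L2_norm :: "real \<Rightarrow> (real^'n) set \<Rightarrow> (real \<Rightarrow> real^'n \<Rightarrow> real^'n) \<Rightarrow> real" where
  "L1_L2_norm T \<Omega> f = (LINT t:{0<..<T}|lborel. L2_norm_on \<Omega> (f t))"


section \<open>The space H(div) and the domain\<close>

text \<open>\<open>C1_test S \<phi> G\<close>: \<open>\<phi>\<close> is a compactly supported continuously differentiable function with
  support in \<open>S\<close> and gradient \<open>G\<close>.  By mollification, testing with these functions defines the same
  weak divergence as testing with smooth ones.\<close>

definition C1_test :: "(real^'n) set \<Rightarrow> (real^'n \<Rightarrow> real) \<Rightarrow> (real^'n \<Rightarrow> real^'n) \<Rightarrow> bool" where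
  "C1_test S \<phi> G \<longleftrightarrow>
     (\<forall>x. GDERIV \<phi> x :> G x) \<and> continuous_on UNIV G \<and>
     bounded {x. \<phi> x \<noteq> 0} \<and> closure {x. \<phi> x \<noteq> 0} \<subseteq> S"

definition weak_div :: "(real^'n) set \<Rightarrow> (real^'n \<Rightarrow> real^'n) \<Rightarrow> (real^'n \<Rightarrow> real) \<Rightarrow> bool" where
  "weak_div \<Omega> v g \<longleftrightarrow> L2_on \<Omega> g \<and>
     (\<forall>\<phi> G. C1_test \<Omega> \<phi> G \<longrightarrow> L2_inner \<Omega> v G = - L2_inner \<Omega> g \<phi>)"

definition Hdiv :: "(real^'n) set \<Rightarrow> (real^'n \<Rightarrow> real^'n) set" where
  "Hdiv \<Omega> = {v. L2_on \<Omega> v \<and> (\<exists>g. weak_div \<Omega> v g)}"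

text \<open>The normal trace of \<open>v \<in> H(div, \<Omega>)\<close> is the functional
  \<open>\<phi> \<mapsto> (v, \<nabla>\<phi>)\<^sub>\<Omega> + (div v, \<phi>)\<^sub>\<Omega>\<close>; restrictions to \<open>\<Omega>\<close> of compactly supported
  \<open>C\<^sup>1\<close> functions on the whole space are dense in \<open>H\<^sup>1(\<Omega>)\<close> for a Lipschitz domain.\<close>

definition zero_normal_trace :: "(real^'n) set \<Rightarrow> (real^'n \<Rightarrow> real^'n) \<Rightarrow> bool" where
  "zero_normal_trace \<Omega> v \<longleftrightarrow>
     (\<forall>g \<phi> G. weak_div \<Omega> v g \<and> C1_test UNIV \<phi> G \<longrightarrow> L2_inner \<Omega> v G + L2_inner \<Omega> g \<phi> = 0)"

definition solenoidal :: "(real^'n) set \<Rightarrow> (real^'n \<Rightarrow> real^'n) set" where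
  "solenoidal \<Omega> = {v \<in> Hdiv \<Omega>. weak_div \<Omega> v (\<lambda>x. 0) \<and> zero_normal_trace \<Omega> v}"

text \<open>Near each boundary point, \<open>\<Omega>\<close> is the strict epigraph, in some direction \<open>e\<close>, of a Lipschitz
  function on the hyperplane orthogonal to \<open>e\<close>.\<close>

definition Lipschitz_domain :: "(real^'n) set \<Rightarrow> bool" where
  "Lipschitz_domain \<Omega> \<longleftrightarrow>
     \<Omega> \<noteq> {} \<and> open \<Omega> \<and> connected \<Omega> \<and> bounded \<Omega> \<and>
     (\<forall>x\<in>frontier \<Omega>. \<exists>e r L \<phi>. norm e = 1 \<and> 0 < r \<and>
        L-lipschitz_on {y. y \<bullet> e = 0} \<phi> \<and>
        (\<forall>y\<in>ball x r. y \<in> \<Omega> \<longleftrightarrow> \<phi> (y - (y \<bullet> e) *\<^sub>R e) < y \<bullet> e))"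


section \<open>Discretization data\<close>

datatype Hdiv_family = RT | BDM

text \<open>\<open>spdeg\<close> is the order \<open>k\<close> of the spatial elements, \<open>tdeg\<close> the degree \<open>\<ell>\<close> in time,
  \<open>shreg\<close> the shape-regularity parameter \<open>\<rho>\<close>, \<open>nrml\<close> the choice of unit facet normals,
  \<open>rwt n i\<close> and \<open>rnode n i\<close> (for \<open>1 \<le> i \<le> \<ell> + 1\<close>) the Radau weights and nodes on the \<open>n\<close>-th time
  interval, \<open>pen\<close> the penalty parameter \<open>\<sigma>\<close> and \<open>cstab\<close> the constant \<open>c\<^sub>S\<close>.\<close>

record ('n::finite) discretization =
  region :: "(real^'n) set"
  final :: real
  mesh :: "(real^'n) set set"
  shreg :: real
  nrml :: "(real^'n) set \<Rightarrow> real^'n"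
  steps :: nat
  tpt :: "nat \<Rightarrow> real"
  fam :: Hdiv_family
  spdeg :: nat
  tdeg :: nat
  rwt :: "nat \<Rightarrow> nat \<Rightarrow> real"
  rnode :: "nat \<Rightarrow> nat \<Rightarrow> real"
  pen :: real
  cstab :: real

definition inradius :: "(real^'n) set \<Rightarrow> real" where
  "inradius K = Sup {r. 0 \<le> r \<and> (\<exists>x. cball x r \<subseteq> K)}"

definition simplicial_mesh :: "(real^'n) set \<Rightarrow> real \<Rightarrow> (real^'n) set set \<Rightarrow> bool" where
  "simplicial_mesh \<Omega> \<rho> \<T> \<longleftrightarrow>
     triangulation \<T> \<and> (\<forall>K\<in>\<T>. int CARD('n) simplex K) \<and> \<Union>\<T> = closure \<Omega> \<and>
     (\<forall>K\<in>\<T>. diameter K \<le> \<rho> * inradius K)"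

definition facets :: "(real^'n) set set \<Rightarrow> (real^'n) set set" where
  "facets \<T> = {F. \<exists>K\<in>\<T>. F facet_of K}"

definition interior_facets :: "(real^'n) set set \<Rightarrow> (real^'n) set set" where
  "interior_facets \<T> = {F. \<exists>K\<in>\<T>. \<exists>K'\<in>\<T>. K \<noteq> K' \<and> F facet_of K \<and> F facet_of K'}"

definition boundary_facets :: "(real^'n) set set \<Rightarrow> (real^'n) set set" where
  "boundary_facets \<T> = facets \<T> - interior_facets \<T>"

definition points_out :: "(real^'n) set \<Rightarrow> real^'n \<Rightarrow> (real^'n) set \<Rightarrow> bool" where
  "points_out F m K \<longleftrightarrow> (\<forall>x\<in>K. \<forall>y\<in>F. (x - y) \<bullet> m \<le> 0)"

definition facet_normals :: "(real^'n) set set \<Rightarrow> ((real^'n) set \<Rightarrow> real^'n) \<Rightarrow> bool" where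
  "facet_normals \<T> m \<longleftrightarrow>
     (\<forall>F\<in>facets \<T>. norm (m F) = 1 \<and> (\<forall>x\<in>F. \<forall>y\<in>F. (x - y) \<bullet> m F = 0)) \<and>
     (\<forall>F\<in>boundary_facets \<T>. \<forall>K\<in>\<T>. F facet_of K \<longrightarrow> points_out F (m F) K)"

text \<open>The left-sided Gauss--Radau rule with \<open>\<ell> + 1\<close> nodes on \<open>[a, b]\<close>; these conditions determine
  it uniquely.\<close>

definition left_Gauss_Radau :: "real \<Rightarrow> real \<Rightarrow> nat \<Rightarrow> (nat \<Rightarrow> real) \<Rightarrow> (nat \<Rightarrow> real) \<Rightarrow> bool" where
  "left_Gauss_Radau a b l \<omega> s \<longleftrightarrow>
     s 1 = a \<and> strict_mono_on {1..l+1} s \<and> (\<forall>i\<in>{1..l+1}. s i \<in> {a..b} \<and> 0 < \<omega> i) \<and>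
     (\<forall>p::real poly. degree p \<le> 2 * l \<longrightarrow>
        (\<Sum>i=1..l+1. \<omega> i * poly p (s i)) = (LINT t:{a..b}|lborel. poly p t))"

definition valid_discretization :: "('n::finite) discretization \<Rightarrow> bool" where
  "valid_discretization D \<longleftrightarrow>
     Lipschitz_domain (region D) \<and> 0 < final D \<and>
     simplicial_mesh (region D) (shreg D) (mesh D) \<and> facet_normals (mesh D) (nrml D) \<and>
     1 \<le> steps D \<and> tpt D 0 = 0 \<and> tpt D (steps D) = final D \<and>
     strict_mono_on {0..steps D} (tpt D) \<and>
     1 \<le> spdeg D \<and>
     (\<forall>n\<in>{1..steps D}. left_Gauss_Radau (tpt D (n-1)) (tpt D n) (tdeg D) (rwt D n) (rnode D n)) \<and>
     0 < pen D \<and> 0 < cstab D"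

definition tint :: "('n::finite) discretization \<Rightarrow> nat \<Rightarrow> real set" where
  "tint D n = {tpt D (n-1)<..<tpt D n}"


section \<open>Piecewise polynomial spaces\<close>

text \<open>A piecewise polynomial field is represented by the family of its element polynomials: \<open>v K\<close>
  is the polynomial, defined on the whole space, with which the field agrees on the element \<open>K\<close>.
  Its trace on a facet from the side of \<open>K\<close> is thus \<open>v K\<close> itself.  Likewise \<open>u n t K x\<close> denotes the
  polynomial describing a space-time field on \<open>K \<times> I\<^sub>n\<close>, for \<open>1 \<le> n \<le> N\<close>, so that
  \<open>u(t\<^sub>n\<^sup>-)\<close> is \<open>u n (tpt D n)\<close> and \<open>u(t\<^sub>n\<^sup>+)\<close> is \<open>u (n+1) (tpt D n)\<close>.\<close>

type_synonym ('n, 'b) broken = "(real^'n) set \<Rightarrow> real^'n \<Rightarrow> 'b"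
type_synonym ('n, 'b) st_broken = "nat \<Rightarrow> real \<Rightarrow> ('n, 'b) broken"

text \<open>The function on \<open>\<Omega>\<close>, respectively on \<open>\<Omega> \<times> (0, T)\<close>, defined by the pieces.  Each sum has at
  most one term; the value on the null set where there is none is 0.\<close>

definition assemble :: "('n::finite) discretization \<Rightarrow> ('n, 'b::real_vector) broken \<Rightarrow> real^'n \<Rightarrow> 'b" where
  "assemble D v x = (\<Sum>K | K \<in> mesh D \<and> x \<in> interior K. v K x)"

definition st_assemble ::
  "('n::finite) discretization \<Rightarrow> ('n, 'b::real_vector) st_broken \<Rightarrow> real \<Rightarrow> real^'n \<Rightarrow> 'b" where
  "st_assemble D u t x = (\<Sum>n | n \<in> {1..steps D} \<and> t \<in> tint D n. assemble D (u n t) x)"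

definition Pk :: "nat \<Rightarrow> (real^'n \<Rightarrow> real) set" where
  "Pk k = {p. \<exists>c. p = (\<lambda>x. \<Sum>\<alpha> | (\<Sum>i\<in>UNIV. \<alpha> i) \<le> k. c \<alpha> * (\<Prod>i\<in>UNIV. (x $ i) ^ \<alpha> (i::'n)))}"

definition Pk_vec :: "nat \<Rightarrow> (real^'n \<Rightarrow> real^'n) set" where
  "Pk_vec k = {v. \<forall>i. (\<lambda>x. v x $ i) \<in> Pk k}"

definition RTk :: "nat \<Rightarrow> (real^'n \<Rightarrow> real^'n) set" where
  "RTk k = {\<lambda>x. p x + q x *\<^sub>R x | p q. p \<in> Pk_vec k \<and> q \<in> Pk k}"

definition local_space :: "Hdiv_family \<Rightarrow> nat \<Rightarrow> (real^'n \<Rightarrow> real^'n) set" where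
  "local_space fm k = (case fm of RT \<Rightarrow> RTk k | BDM \<Rightarrow> Pk_vec k)"

definition Vh :: "('n::finite) discretization \<Rightarrow> ('n, real^'n) broken set" where
  "Vh D = {v. (\<forall>K\<in>mesh D. v K \<in> local_space (fam D) (spdeg D)) \<and> assemble D v \<in> Hdiv (region D)}"

text \<open>Membership in \<open>L\<^sup>2(0,T; H(div, \<Omega>))\<close> is automatic, as each piece is a polynomial in time with
  coefficients in \<open>V\<^sub>h\<close>.\<close>

definition Vht :: "('n::finite) discretization \<Rightarrow> ('n, real^'n) st_broken set" where
  "Vht D = {u. \<forall>n\<in>{1..steps D}.
     (\<exists>c. (\<forall>j\<le>tdeg D. c j \<in> Vh D) \<and>
          (\<forall>t. \<forall>K\<in>mesh D. \<forall>x. u n t K x = (\<Sum>j\<le>tdeg D. t ^ j *\<^sub>R c j K x))) \<and>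
     (\<forall>t\<in>tint D n. zero_normal_trace (region D) (assemble D (u n t)))}"

definition Zht :: "('n::finite) discretization \<Rightarrow> ('n, real^'n) st_broken set" where
  "Zht D = {u \<in> Vht D. \<forall>n\<in>{1..steps D}. \<forall>t\<in>tint D n.
     weak_div (region D) (assemble D (u n t)) (\<lambda>x. 0)}"

definition grad :: "('n::finite, real^'n) broken \<Rightarrow> ('n, real^'n^'n) broken" where
  "grad v K x = jacobian (v K) (at x)"

definition time_deriv :: "('n::finite, real^'n) st_broken \<Rightarrow> ('n, real^'n) st_broken" where
  "time_deriv u n t K x = vector_derivative (\<lambda>r. u n r K x) (at t)"

definition time_jump :: "('n::finite) discretization \<Rightarrow> ('n, real^'n) st_broken \<Rightarrow> nat \<Rightarrow> ('n, real^'n) broken" where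
  "time_jump D u n K x = u n (tpt D n) K x - u (n+1) (tpt D n) K x"


section \<open>Facet integrals, averages and jumps\<close>

text \<open>For a flat facet with unit normal \<open>m\<close>, the surface measure of \<open>A \<subseteq> F\<close> is the volume of the
  right prism of height 1 over \<open>A\<close>; that is, the surface measure is the image of the Lebesgue
  measure on the prism over \<open>F\<close> under orthogonal projection onto the hyperplane of \<open>F\<close>.\<close>

definition facet_measure :: "(real^'n) set \<Rightarrow> real^'n \<Rightarrow> (real^'n) measure" where
  "facet_measure F m =
     distr (restrict_space lborel {y + s *\<^sub>R m | y s. y \<in> F \<and> s \<in> {0..1}}) borel
       (\<lambda>x. x - ((x - (SOME y. y \<in> F)) \<bullet> m) *\<^sub>R m)"

definition facet_inner ::
  "('n::finite) discretization \<Rightarrow> (real^'n) set \<Rightarrow> (real^'n \<Rightarrow> real^'n) \<Rightarrow> (real^'n \<Rightarrow> real^'n) \<Rightarrow> real" where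
  "facet_inner D F u v = (LINT x|facet_measure F (nrml D F). u x \<bullet> v x)"

text \<open>The element out of which the facet normal points, and the opposite one.  For a boundary facet,
  the former is the only adjacent element.\<close>

definition elem_plus :: "('n::finite) discretization \<Rightarrow> (real^'n) set \<Rightarrow> (real^'n) set" where
  "elem_plus D F = (THE K. K \<in> mesh D \<and> F facet_of K \<and> points_out F (nrml D F) K)"

definition elem_minus :: "('n::finite) discretization \<Rightarrow> (real^'n) set \<Rightarrow> (real^'n) set" where
  "elem_minus D F = (THE K. K \<in> mesh D \<and> F facet_of K \<and> points_out F (- nrml D F) K)"

definition avg ::
  "('n::finite) discretization \<Rightarrow> (real^'n) set \<Rightarrow> ('n, 'b::real_vector) broken \<Rightarrow> real^'n \<Rightarrow> 'b" where
  "avg D F v x =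
     (if F \<in> interior_facets (mesh D)
      then (1/2) *\<^sub>R (v (elem_plus D F) x + v (elem_minus D F) x) else v (elem_plus D F) x)"

definition jump ::
  "('n::finite) discretization \<Rightarrow> (real^'n) set \<Rightarrow> ('n, 'b::real_vector) broken \<Rightarrow> real^'n \<Rightarrow> 'b" where
  "jump D F v x =
     (if F \<in> interior_facets (mesh D)
      then v (elem_plus D F) x - v (elem_minus D F) x else v (elem_plus D F) x)"

text \<open>On interior facets the normal component of a field in \<open>V\<^sub>h\<close> is single-valued; it is written
  here as the normal component of the average.\<close>

definition normal_comp :: "('n::finite) discretization \<Rightarrow> (real^'n) set \<Rightarrow> ('n, real^'n) broken \<Rightarrow> real^'n \<Rightarrow> real" where
  "normal_comp D F w x = avg D F w x \<bullet> nrml D F"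

definition gammaF :: "('n::finite) discretization \<Rightarrow> (real^'n) set \<Rightarrow> ('n, real^'n) broken \<Rightarrow> real" where
  "gammaF D F w = max (cstab D) (Linf_norm (facet_measure F (nrml D F)) (normal_comp D F w))"


section \<open>Radau interpolation and the discrete forms\<close>

definition radau_interp ::
  "('n::finite) discretization \<Rightarrow> nat \<Rightarrow> (real \<Rightarrow> 'b::real_vector) \<Rightarrow> real \<Rightarrow> 'b" where
  "radau_interp D n g t =
     (\<Sum>i=1..tdeg D + 1.
        (\<Prod>j\<in>{1..tdeg D + 1} - {i}. (t - rnode D n j) / (rnode D n i - rnode D n j)) *\<^sub>R g (rnode D n i))"

definition radau_quad :: "('n::finite) discretization \<Rightarrow> (nat \<Rightarrow> real \<Rightarrow> real) \<Rightarrow> real" where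
  "radau_quad D g = (\<Sum>n=1..steps D. \<Sum>i=1..tdeg D + 1. rwt D n i * g n (rnode D n i))"

definition m_form :: "('n::finite) discretization \<Rightarrow> ('n, real^'n) st_broken \<Rightarrow> ('n, real^'n) st_broken \<Rightarrow> real" where
  "m_form D u v =
     (\<Sum>n=1..steps D. LINT t:tint D n|lborel.
        L2_inner (region D) (assemble D (time_deriv u n t)) (assemble D (v n t)))
     - (\<Sum>n=1..steps D - 1.
        L2_inner (region D) (assemble D (time_jump D u n)) (assemble D (v (n+1) (tpt D n))))
     + L2_inner (region D) (assemble D (u 1 0)) (assemble D (v 1 0))"

definition a_form :: "('n::finite) discretization \<Rightarrow> ('n, real^'n) st_broken \<Rightarrow> ('n, real^'n) st_broken \<Rightarrow> real" where
  "a_form D u v =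
     (\<Sum>n=1..steps D.
        (LINT t:tint D n|lborel.
           L2_inner (region D) (assemble D (grad (u n t))) (assemble D (grad (v n t))))
      + (\<Sum>F\<in>facets (mesh D).
          - (LINT t:tint D n|lborel. facet_inner D F
               (\<lambda>x. avg D F (grad (u n t)) x *v nrml D F) (jump D F (v n t)))
          - (LINT t:tint D n|lborel. facet_inner D F
               (jump D F (u n t)) (\<lambda>x. avg D F (grad (v n t)) x *v nrml D F))
          + (LINT t:tint D n|lborel. facet_inner D F
               (\<lambda>x. (pen D / diameter F) *\<^sub>R jump D F (u n t) x) (jump D F (v n t)))))"

definition c_form ::
  "('n::finite) discretization \<Rightarrow> ('n, real^'n) st_broken \<Rightarrow> ('n, real^'n) st_broken \<Rightarrow> ('n, real^'n) st_broken \<Rightarrow> real" where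
  "c_form D w u v =
     (\<Sum>n=1..steps D.
        (LINT t:tint D n|lborel. L2_inner (region D)
           (assemble D (\<lambda>K x. radau_interp D n (\<lambda>r. grad (u n r) K x *v w n r K x) t))
           (assemble D (v n t)))
      + (\<Sum>F\<in>interior_facets (mesh D).
          - (LINT t:tint D n|lborel. facet_inner D F
               (\<lambda>x. radau_interp D n (\<lambda>r. normal_comp D F (w n r) x *\<^sub>R jump D F (u n r) x) t)
               (avg D F (v n t)))
          + 1/2 * (LINT t:tint D n|lborel. facet_inner D F
               (\<lambda>x. radau_interp D n (\<lambda>r. gammaF D F (w n r) *\<^sub>R jump D F (u n r) x) t)
               (jump D F (v n t)))))"

definition source_form :: "('n::finite) discretization \<Rightarrow> (real \<Rightarrow> real^'n \<Rightarrow> real^'n) \<Rightarrow> ('n, real^'n) st_broken \<Rightarrow> real" where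
  "source_form D f z = (LINT t:{0<..<final D}|lborel. L2_inner (region D) (f t) (st_assemble D z t))"


section \<open>The energy norm\<close>

definition Ah_norm_sq :: "('n::finite) discretization \<Rightarrow> ('n, real^'n) broken \<Rightarrow> real" where
  "Ah_norm_sq D v =
     (L2_norm_on (region D) (assemble D (grad v)))\<^sup>2
     + (\<Sum>F\<in>facets (mesh D).
          LINT x|facet_measure F (nrml D F). (pen D / diameter F) * (norm (jump D F v x))\<^sup>2)"

definition A_norm_sq :: "('n::finite) discretization \<Rightarrow> ('n, real^'n) st_broken \<Rightarrow> real" where
  "A_norm_sq D v = (\<Sum>n=1..steps D. LINT t:tint D n|lborel. Ah_norm_sq D (v n t))"

definition J_norm_sq :: "('n::finite) discretization \<Rightarrow> ('n, real^'n) st_broken \<Rightarrow> real" where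
  "J_norm_sq D v =
     1/2 * ((L2_norm_on (region D) (assemble D (v (steps D) (final D))))\<^sup>2
          + (\<Sum>n=1..steps D - 1. (L2_norm_on (region D) (assemble D (time_jump D v n)))\<^sup>2)
          + (L2_norm_on (region D) (assemble D (v 1 0)))\<^sup>2)"

definition gamma_norm_sq :: "('n::finite) discretization \<Rightarrow> ('n, real^'n) st_broken \<Rightarrow> ('n, real^'n) st_broken \<Rightarrow> real" where
  "gamma_norm_sq D w v =
     1/2 * (\<Sum>F\<in>interior_facets (mesh D).
        radau_quad D (\<lambda>n t. gammaF D F (w n t) *
          (LINT x|facet_measure F (nrml D F). (norm (jump D F (v n t) x))\<^sup>2)))"

definition energy_norm_sq ::
  "('n::finite) discretization \<Rightarrow> real \<Rightarrow> ('n, real^'n) st_broken \<Rightarrow> ('n, real^'n) st_broken \<Rightarrow> real" where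
  "energy_norm_sq D \<nu> w v =
     (Linf_norm (restrict_space lborel {0<..<final D}) (\<lambda>t. L2_norm_on (region D) (st_assemble D v t)))\<^sup>2
     + \<nu> * A_norm_sq D v + J_norm_sq D v + gamma_norm_sq D w v"

definition solves_linearized ::
  "('n::finite) discretization \<Rightarrow> real \<Rightarrow> (real \<Rightarrow> real^'n \<Rightarrow> real^'n) \<Rightarrow> (real^'n \<Rightarrow> real^'n)
    \<Rightarrow> ('n, real^'n) st_broken \<Rightarrow> ('n, real^'n) st_broken \<Rightarrow> bool" where
  "solves_linearized D \<nu> f u0 w u \<longleftrightarrow>
     u \<in> Zht D \<and>
     (\<forall>z\<in>Zht D. m_form D u z + \<nu> * a_form D u z + c_form D w u z
        = source_form D f z + L2_inner (region D) u0 (assemble D (z 1 0)))"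

end

theory Submission
  imports Defs
begin

text \<open>The equation is tested with the Radau interpolant of \<open>\<theta> u\<close>, for nodal weights \<open>0 \<le> \<theta> \<le> 1\<close>. Both spatial
  forms are sums over the Radau nodes, where \<open>a\<close> is coercive and \<open>c(w; u, u)\<close> reduces, by the divergence
  theorem on each simplex, to the upwind jumps; hence only \<open>m(u, \<cdot>)\<close> matters. With \<open>\<theta> = 1\<close> up to
  \<open>t\<^sub>m\<close> and \<open>0\<close> afterwards, it contributes \<open>\<parallel>u(t\<^sub>m)\<parallel>\<^sup>2\<close> and the time jumps; with
  \<open>\<theta> = (t\<^sub>n - t) / \<tau>\<^sub>n\<close> on a single interval, the mean of \<open>\<parallel>u\<parallel>\<^sup>2\<close> over \<open>I\<^sub>n\<close>, up to the endpoint value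
  \<open>\<parallel>u(t\<^sub>n\<^sub>-\<^sub>1)\<parallel>\<^sup>2\<close> that is already controlled. Let \<open>M\<close> be the maximum of \<open>\<parallel>u\<parallel>\<close>, attained in \<open>I\<^sub>n\<close>. Since \<open>\<parallel>u\<parallel>\<^sup>2\<close> is
  a polynomial of degree at most \<open>2\<ell>\<close> on \<open>I\<^sub>n\<close>, its mean controls \<open>M\<^sup>2\<close>, whereas the right-hand side is
  at most \<open>C (\<parallel>f\<parallel> + \<parallel>u\<^sub>0\<parallel>) M\<close>. This bounds \<open>M\<close>, and \<open>\<theta> = 1\<close> then bounds the remaining terms.\<close>

section \<open>Polynomials in one variable\<close>

text \<open>The weight (t_n - t) / \<tau>_n cannot be used directly: (t_n - t) u has degree \<ell> +
  1 in time and is no admissible test function, hence the interpolant. Interpolation is harmless in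
  the forms. Products of two discrete fields have degree at most 2 \<ell> in time, for which the
  Radau rule is exact; the convective term is itself interpolated at the same nodes; and the
  weighted derivative of ||u||^2 again has degree at most 2 \<ell>. It is felt only by f, which is
  merely L^1 in time and sees the test function between the nodes. There its norm is bounded by the
  max-mean inequality for polynomials of degree 2 \<ell>, the same one that recovers M from the
  mean. This inequality is scale invariant, so its constant depends on \<ell> only and h, \<tau>, T
  and \<nu> cannot enter. The spatial part has another obstacle: \<open>Zht\<close> is defined by
  weak divergences and normal traces, whereas the cancellation in c(w; u, u) needs pointwise zero
  divergence and matching normal components. These are extracted by localized test
  functions.\<close>

definition lagrange_basis :: "(nat \<Rightarrow> real) \<Rightarrow> nat set \<Rightarrow> nat \<Rightarrow> real poly" where
  "lagrange_basis x I i = (\<Prod>j\<in>I - {i}. smult (1 / (x i - x j)) [:- x j, 1:])"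

lemma poly_lagrange_basis: "poly (lagrange_basis x I i) t = (\<Prod>j\<in>I - {i}. (t - x j) / (x i - x j))"
  by (simp add: lagrange_basis_def poly_prod algebra_simps diff_divide_distrib)

lemma degree_lagrange_basis:
  assumes "finite I" "i \<in> I"
  shows "degree (lagrange_basis x I i) \<le> card I - 1"
proof -
  have "degree (lagrange_basis x I i) \<le> (\<Sum>j\<in>I - {i}. degree (smult (1 / (x i - x j)) [:- x j, 1:]))"
    unfolding lagrange_basis_def using assms
    by (intro order_trans[OF degree_prod_sum_le]) (auto simp: comp_def)
  also have "\<dots> \<le> (\<Sum>j\<in>I - {i}. 1)"
    by (rule sum_mono) (auto intro: order_trans[OF degree_smult_le])
  also have "\<dots> = card I - 1" using assms by simp
  finally show ?thesis .
qed

lemma lagrange_basis_node: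
  assumes "finite I" "inj_on x I" "i \<in> I" "k \<in> I"
  shows "poly (lagrange_basis x I i) (x k) = (if i = k then 1 else 0)"
proof (cases "i = k")
  case True
  have "x k \<noteq> x j" if "j \<in> I - {k}" for j
    using that assms by (auto dest: inj_onD)
  then have "(\<Prod>j\<in>I - {k}. (x k - x j) / (x k - x j)) = 1" by (intro prod.neutral) auto
  then show ?thesis using True by (simp add: poly_lagrange_basis)
next
  case False
  then show ?thesis using assms by (auto simp: poly_lagrange_basis intro!: prod_zero)
qed

text \<open>The difference of both sides has degree below \<open>card I\<close> and vanishes at all
  \<open>card I\<close> nodes.\<close>

lemma poly_lagrange_interpolation:
  fixes q :: "real poly" and x :: "nat \<Rightarrow> real"
  assumes "finite I" "inj_on x I" "degree q < card I"
  shows "poly q t = (\<Sum>i\<in>I. poly (lagrange_basis x I i) t * poly q (x i))"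
proof -
  define r where "r = (\<Sum>i\<in>I. smult (poly q (x i)) (lagrange_basis x I i)) - q"
  have "degree r \<le> card I - 1" unfolding r_def using assms
    by (intro degree_diff_le degree_sum_le order_trans[OF degree_smult_le] degree_lagrange_basis) auto
  then have dr: "degree r < card I" using assms by linarith
  have "poly r (x k) = 0" if "k \<in> I" for k
  proof -
    have "(\<Sum>i\<in>I. poly q (x i) * poly (lagrange_basis x I i) (x k)) = (\<Sum>i\<in>I. if i = k then poly q (x i) else 0)"
      by (intro sum.cong) (use that assms in \<open>auto simp: lagrange_basis_node\<close>)
    then show ?thesis using that assms by (simp add: r_def poly_sum)
  qed
  then have "x ` I \<subseteq> {s. poly r s = 0}" by auto
  have "r = 0"
  proof (rule ccontr)
    assume "r \<noteq> 0"
    then have "card (x ` I) \<le> card {s. poly r s = 0}"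
      using \<open>x ` I \<subseteq> _\<close> poly_roots_finite by (intro card_mono) auto
    also have "\<dots> \<le> degree r" using \<open>r \<noteq> 0\<close> by (rule card_poly_roots_bound)
    finally show False using dr assms by (simp add: card_image)
  qed
  then have "poly (\<Sum>i\<in>I. smult (poly q (x i)) (lagrange_basis x I i)) t = poly q t" by (simp add: r_def)
  then show ?thesis by (simp add: poly_sum mult.commute)
qed

lemma set_integrable_poly:
  fixes a b :: real and p :: "real poly"
  shows "set_integrable lborel {a..b} (poly p)"
  by (rule borel_integrable_atLeastAtMost') (auto intro!: continuous_intros)

text \<open>The witness is a minimizer of |p| on the interval.\<close>

lemma poly_mean_value_bound:
  fixes c d :: real
  assumes "c < d"
  shows "\<exists>x\<in>{c..d}. (d - c) * \<bar>poly p x\<bar> \<le> (LINT t:{c..d}|lborel. \<bar>poly p t\<bar>)"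
proof -
  have "\<exists>x\<in>{c..d}. \<forall>y\<in>{c..d}. \<bar>poly p x\<bar> \<le> \<bar>poly p y\<bar>"
    using assms by (intro continuous_attains_inf) (auto intro!: continuous_intros)
  then obtain x where x: "x \<in> {c..d}" "\<And>y. y \<in> {c..d} \<Longrightarrow> \<bar>poly p x\<bar> \<le> \<bar>poly p y\<bar>" by blast
  have "(LINT t:{c..d}|lborel. \<bar>poly p x\<bar>) \<le> (LINT t:{c..d}|lborel. \<bar>poly p t\<bar>)"
    by (rule set_integral_mono) (use x in \<open>auto intro!: borel_integrable_atLeastAtMost' continuous_intros\<close>)
  then show ?thesis using x assms by (auto simp: set_integral_const intro!: bexI[of _ x])
qed

text \<open>Choosing a point of small modulus in every other one of \<open>2m + 1\<close> equal subintervals gives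
  \<open>m + 1\<close> well-separated interpolation nodes.\<close>

lemma poly_le_L1:
  "\<exists>C>0. \<forall>(p::real poly) a b t. degree p \<le> m \<and> a < b \<and> t \<in> {a..b} \<longrightarrow>
     \<bar>poly p t\<bar> \<le> C / (b - a) * (LINT s:{a..b}|lborel. \<bar>poly p s\<bar>)"
proof -
  define N :: real where "N = 2 * real m + 1"
  have N: "N \<ge> 1" by (simp add: N_def)
  \<comment> \<open>\<open>real m + 1\<close> counts the Lagrange basis polynomials,
    \<open>N ^ m\<close> bounds each of them on {a..b}, and the last \<open>N\<close> arises because
    a mean over a subinterval of length (b - a) / N costs the factor N / (b - a).\<close>
  define C where "C = (real m + 1) * N ^ m * N"
  have "\<bar>poly p t\<bar> \<le> C / (b - a) * (LINT s:{a..b}|lborel. \<bar>poly p s\<bar>)"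
    if H: "degree p \<le> m" "a < b" "t \<in> {a..b}" for p :: "real poly" and a b t
  proof -
    define \<delta> where "\<delta> = (b - a) / N"
    have \<delta>: "\<delta> > 0" using H N by (simp add: \<delta>_def)
    have N\<delta>: "N * \<delta> = b - a" using N by (simp add: \<delta>_def)
    define c where "c i = a + 2 * real i * \<delta>" for i
    define J where "J = (LINT s:{a..b}|lborel. \<bar>poly p s\<bar>)"
    have sub: "{c i..c i + \<delta>} \<subseteq> {a..b}" if "i \<le> m" for i
    proof -
      have "(2 * real i + 1) * \<delta> \<le> N * \<delta>" using that \<delta> by (intro mult_right_mono) (auto simp: N_def)
      then have "c i + \<delta> \<le> b" using N\<delta> by (simp add: c_def algebra_simps)
      moreover have "a \<le> c i" using \<delta> by (simp add: c_def)
      ultimately show ?thesis by auto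
    qed
    have "\<exists>x\<in>{c i..c i + \<delta>}. \<delta> * \<bar>poly p x\<bar> \<le> J" if "i \<le> m" for i
    proof -
      obtain x where x: "x \<in> {c i..c i + \<delta>}" "\<delta> * \<bar>poly p x\<bar> \<le> (LINT t:{c i..c i + \<delta>}|lborel. \<bar>poly p t\<bar>)"
        using poly_mean_value_bound[of "c i" "c i + \<delta>" p] \<delta> by auto
      moreover have "(LINT t:{c i..c i + \<delta>}|lborel. \<bar>poly p t\<bar>) \<le> J"
        unfolding J_def set_lebesgue_integral_def
      proof (rule integral_mono)
        have "set_integrable lborel {u..v} (\<lambda>t. \<bar>poly p t\<bar>)" for u v
          by (intro set_integrable_abs set_integrable_poly)
        then show "integrable lborel (\<lambda>t. indicator {c i..c i + \<delta>} t *\<^sub>R \<bar>poly p t\<bar>)"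
          "integrable lborel (\<lambda>t. indicator {a..b} t *\<^sub>R \<bar>poly p t\<bar>)"
          unfolding set_integrable_def by auto
      qed (use sub[OF that] in \<open>auto simp: indicator_def\<close>)
      ultimately show ?thesis by (meson order_trans)
    qed
    then obtain x where x: "\<And>i. i \<le> m \<Longrightarrow> x i \<in> {c i..c i + \<delta>}" "\<And>i. i \<le> m \<Longrightarrow> \<delta> * \<bar>poly p (x i)\<bar> \<le> J"
      by metis
    \<comment> \<open>Between two selected subintervals lies at least one skipped one, of length
      \<delta>.\<close>
    have less: "x i + \<delta> \<le> x j" if "i < j" "j \<le> m" for i j
    proof -
      have "x i \<le> c i + \<delta>" "c j \<le> x j" using x[of i] x[of j] that by auto
      moreover have "c i + 2 * \<delta> \<le> c j"
      proof -
        have "(real i + 1) * \<delta> \<le> real j * \<delta>" using that \<delta> by (intro mult_right_mono) auto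
        then show ?thesis by (simp add: c_def algebra_simps)
      qed
      ultimately show ?thesis by linarith
    qed
    have sep: "\<delta> \<le> \<bar>x i - x j\<bar>" if "i \<noteq> j" "i \<le> m" "j \<le> m" for i j
      using less[of i j] less[of j i] that by (cases "i < j") auto
    have inj: "inj_on x {..m}"
    proof (rule inj_onI, rule ccontr)
      fix i j assume "i \<in> {..m}" "j \<in> {..m}" "x i = x j" "i \<noteq> j"
      then show False using sep[of i j] \<delta> by auto
    qed
    have "poly p t = (\<Sum>i\<le>m. (\<Prod>j\<in>{..m} - {i}. (t - x j) / (x i - x j)) * poly p (x i))"
      unfolding poly_lagrange_basis[symmetric]
      by (rule poly_lagrange_interpolation) (use inj H in auto)
    also have "\<bar>\<dots>\<bar> \<le> (\<Sum>i\<le>m. \<bar>(\<Prod>j\<in>{..m} - {i}. (t - x j) / (x i - x j)) * poly p (x i)\<bar>)"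
      by (rule sum_abs)
    also have "\<dots> \<le> (\<Sum>i\<le>m. N ^ m * (J / \<delta>))"
    proof (rule sum_mono)
      fix i assume i: "i \<in> {..m}"
      have "\<bar>(t - x j) / (x i - x j)\<bar> \<le> N" if j: "j \<in> {..m} - {i}" for j
      proof -
        have "x j \<in> {a..b}" using x(1)[of j] sub[of j] j by auto
        then have "\<bar>t - x j\<bar> \<le> N * \<delta>" using H N\<delta> by auto
        moreover have "\<delta> \<le> \<bar>x i - x j\<bar>" using sep i j by auto
        ultimately have "\<bar>t - x j\<bar> \<le> N * \<bar>x i - x j\<bar>" using N
          by (meson mult_left_mono order_trans zero_le_one)
        then show ?thesis using \<open>\<delta> \<le> _\<close> \<delta> by (simp add: divide_simps)
      qed
      then have "(\<Prod>j\<in>{..m} - {i}. \<bar>(t - x j) / (x i - x j)\<bar>) \<le> (\<Prod>j\<in>{..m} - {i}. N)"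
        by (intro prod_mono) auto
      also have "\<dots> = N ^ m" using i by simp
      finally have 1: "\<bar>\<Prod>j\<in>{..m} - {i}. (t - x j) / (x i - x j)\<bar> \<le> N ^ m" by (simp only: abs_prod)
      have 2: "\<bar>poly p (x i)\<bar> \<le> J / \<delta>" using x(2)[of i] i \<delta> by (simp add: field_simps)
      show "\<bar>(\<Prod>j\<in>{..m} - {i}. (t - x j) / (x i - x j)) * poly p (x i)\<bar> \<le> N ^ m * (J / \<delta>)"
        unfolding abs_mult using 1 2 N by (intro mult_mono) auto
    qed
    also have "\<dots> = C / (b - a) * J" using H N by (simp add: C_def \<delta>_def)
    finally show ?thesis unfolding J_def .
  qed
  moreover have "C > 0" using N by (simp add: C_def)
  ultimately show ?thesis by blast
qed

section \<open>Facets and cones\<close>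

lemma nn_integral_lborel_translate:
  fixes a :: "'a::euclidean_space"
  assumes [measurable]: "g \<in> borel_measurable borel"
  shows "(\<integral>\<^sup>+z. g (a + z) \<partial>lborel) = (\<integral>\<^sup>+z. g z \<partial>lborel)"
proof -
  have "(\<integral>\<^sup>+z. g z \<partial>lborel) = (\<integral>\<^sup>+z. g z \<partial>distr lborel borel ((+) a))"
    by (simp add: lborel_distr_plus)
  also have "\<dots> = (\<integral>\<^sup>+z. g (a + z) \<partial>lborel)" by (subst nn_integral_distr) auto
  finally show ?thesis ..
qed

lemma nn_integral_lborel_affine:
  fixes t :: "'a::euclidean_space" and c :: real
  assumes [measurable]: "g \<in> borel_measurable borel" and "c \<noteq> 0"
  shows "(\<integral>\<^sup>+z. g z \<partial>lborel) = ennreal (\<bar>c\<bar> ^ DIM('a)) * (\<integral>\<^sup>+z. g (t + c *\<^sub>R z) \<partial>lborel)"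
  by (subst lborel_affine[OF assms(2), of t])
    (simp add: nn_integral_density nn_integral_distr nn_integral_cmult)

lemma nn_integral_unit_interval_affine:
  fixes a b :: real
  assumes "a \<noteq> 0"
  shows "(\<integral>\<^sup>+r. indicator {0..1} (b + a * r) \<partial>lborel) = ennreal (1 / \<bar>a\<bar>)"
proof -
  have "ennreal \<bar>a\<bar> * (\<integral>\<^sup>+r. indicator {0..1} (b + a * r) \<partial>lborel) = (\<integral>\<^sup>+r. indicator {0..1::real} r \<partial>lborel)"
    by (rule nn_integral_real_affine[symmetric]) (use assms in auto)
  also have "\<dots> = 1" by simp
  finally have *: "ennreal \<bar>a\<bar> * (\<integral>\<^sup>+r. indicator {0..1} (b + a * r) \<partial>lborel) = 1" .
  have "(\<integral>\<^sup>+r. indicator {0..1} (b + a * r) \<partial>lborel)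
      = ennreal (1 / \<bar>a\<bar>) * (ennreal \<bar>a\<bar> * (\<integral>\<^sup>+r. indicator {0..1} (b + a * r) \<partial>lborel))"
    using assms by (simp add: mult.assoc[symmetric] ennreal_mult'[symmetric])
  then show ?thesis using * by simp
qed

text \<open>Fubini in the direction \<open>m\<close>, without choosing coordinates: averaging the translation invariance
  of the Lebesgue measure over all shifts \<open>r\<close> of the slab.\<close>

lemma nn_integral_slab_Fubini:
  fixes m :: "'a::euclidean_space" and c :: real
  assumes m: "norm m = 1" and [measurable]: "g \<in> borel_measurable borel"
  defines "s \<equiv> \<lambda>z. z \<bullet> m - c"
  shows "(\<integral>\<^sup>+z. g z \<partial>lborel)
    = (\<integral>\<^sup>+z. indicator {0..1} (s z) * (\<integral>\<^sup>+r. g (z - s z *\<^sub>R m + r *\<^sub>R m) \<partial>lborel) \<partial>lborel)"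
proof -
  have [measurable]: "s \<in> borel_measurable borel" by (simp add: s_def)
  have mm: "m \<bullet> m = 1" using m by (simp add: dot_square_norm)
  have s_shift: "s (z + r *\<^sub>R m) = s z + r" for z r by (simp add: s_def inner_add_left mm)
  have inner: "(\<integral>\<^sup>+r. g (z - s z *\<^sub>R m + r *\<^sub>R m) \<partial>lborel) = (\<integral>\<^sup>+r. g (z + r *\<^sub>R m) \<partial>lborel)" for z
    by (subst nn_integral_real_affine[of _ 1 "s z"]) (auto simp: algebra_simps)
  \<comment> \<open>For each point, the shifts that bring it into the slab form an interval of
    length one; this normalizes the average.\<close>
  have one: "(\<integral>\<^sup>+r. indicator {0..1} (s z - r) \<partial>lborel) = 1" for z
    using nn_integral_unit_interval_affine[of "-1" "s z"] by simp
  have "(\<integral>\<^sup>+z. indicator {0..1} (s z) * (\<integral>\<^sup>+r. g (z - s z *\<^sub>R m + r *\<^sub>R m) \<partial>lborel) \<partial>lborel)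
      = (\<integral>\<^sup>+z. \<integral>\<^sup>+r. indicator {0..1} (s z) * g (z + r *\<^sub>R m) \<partial>lborel \<partial>lborel)"
    unfolding inner by (intro nn_integral_cong nn_integral_cmult[symmetric]) auto
  also have "\<dots> = (\<integral>\<^sup>+r. \<integral>\<^sup>+z. indicator {0..1} (s z) * g (z + r *\<^sub>R m) \<partial>lborel \<partial>lborel)"
    by (rule lborel_pair.Fubini'[symmetric]) measurable
  also have "\<dots> = (\<integral>\<^sup>+r. \<integral>\<^sup>+z. indicator {0..1} (s z - r) * g z \<partial>lborel \<partial>lborel)"
  proof (rule nn_integral_cong)
    fix r :: real
    have "(\<integral>\<^sup>+z. indicator {0..1} (s z - r) * g z \<partial>lborel)
        = (\<integral>\<^sup>+z. indicator {0..1} (s (r *\<^sub>R m + z) - r) * g (r *\<^sub>R m + z) \<partial>lborel)"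
      by (rule nn_integral_lborel_translate[symmetric]) measurable
    then show "(\<integral>\<^sup>+z. indicator {0..1} (s z) * g (z + r *\<^sub>R m) \<partial>lborel)
        = (\<integral>\<^sup>+z. indicator {0..1} (s z - r) * g z \<partial>lborel)"
      using s_shift by (simp add: add.commute)
  qed
  also have "\<dots> = (\<integral>\<^sup>+z. \<integral>\<^sup>+r. indicator {0..1} (s z - r) * g z \<partial>lborel \<partial>lborel)"
    by (rule lborel_pair.Fubini') measurable
  also have "\<dots> = (\<integral>\<^sup>+z. g z \<partial>lborel)"
    by (intro nn_integral_cong) (simp add: nn_integral_multc one)
  finally show ?thesis ..
qed

text \<open>On each fibre in direction m the projection is constant and the height is r, so the
  profile \<psi> of the height integrates separately. The remaining factor is the integral over the
  hyperplane, written as a slab of height one.\<close>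

lemma nn_integral_slab_product:
  fixes m :: "'a::euclidean_space" and c :: real
  assumes m: "norm m = 1" and [measurable]: "k \<in> borel_measurable borel" "\<psi> \<in> borel_measurable borel"
  defines "s \<equiv> \<lambda>z. z \<bullet> m - c"
  shows "(\<integral>\<^sup>+z. \<psi> (s z) * k (z - s z *\<^sub>R m) \<partial>lborel)
    = (\<integral>\<^sup>+r. \<psi> r \<partial>lborel) * (\<integral>\<^sup>+z. indicator {0..1} (s z) * k (z - s z *\<^sub>R m) \<partial>lborel)"
proof -
  have [measurable]: "s \<in> borel_measurable borel" by (simp add: s_def)
  have mm: "m \<bullet> m = 1" using m by (simp add: dot_square_norm)
  have sz: "z \<bullet> m - c = s z" for z by (simp add: s_def)
  have *: "s (z - s z *\<^sub>R m + r *\<^sub>R m) = r" for z r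
    by (simp add: s_def inner_add_left inner_diff_left mm)
  have "(\<integral>\<^sup>+z. \<psi> (s z) * k (z - s z *\<^sub>R m) \<partial>lborel)
      = (\<integral>\<^sup>+z. indicator {0..1} (s z) * (\<integral>\<^sup>+r. \<psi> r * k (z - s z *\<^sub>R m) \<partial>lborel) \<partial>lborel)"
    using nn_integral_slab_Fubini[OF m, of "\<lambda>z. \<psi> (s z) * k (z - s z *\<^sub>R m)" c, unfolded sz]
    by (simp add: *)
  also have "\<dots> = (\<integral>\<^sup>+z. (\<integral>\<^sup>+r. \<psi> r \<partial>lborel) * (indicator {0..1} (s z) * k (z - s z *\<^sub>R m)) \<partial>lborel)"
    by (simp add: nn_integral_multc mult_ac)
  also have "\<dots> = (\<integral>\<^sup>+r. \<psi> r \<partial>lborel) * (\<integral>\<^sup>+z. indicator {0..1} (s z) * k (z - s z *\<^sub>R m) \<partial>lborel)"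
    by (rule nn_integral_cmult) measurable
  finally show ?thesis .
qed

text \<open>Polar coordinates around \<open>x0\<close> over the hyperplane \<open>z \<bullet> m = c\<close>.\<close>

lemma nn_integral_cone_coordinates:
  fixes m x0 :: "'a::euclidean_space" and c :: real
  assumes m: "norm m = 1" and [measurable]: "g \<in> borel_measurable borel"
  defines "s \<equiv> \<lambda>z. z \<bullet> m - c" and "h \<equiv> c - x0 \<bullet> m"
  assumes h: "h \<noteq> 0"
  shows "(\<integral>\<^sup>+z. g z \<partial>lborel) = (\<integral>\<^sup>+r. ennreal (\<bar>h\<bar> * \<bar>r\<bar> ^ (DIM('a) - 1)) *
      (\<integral>\<^sup>+z. indicator {0..1} (s z) * g (x0 + r *\<^sub>R (z - s z *\<^sub>R m - x0)) \<partial>lborel) \<partial>lborel)"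
proof -
  have [measurable]: "s \<in> borel_measurable borel" by (simp add: s_def)
  have mm: "m \<bullet> m = 1" using m by (simp add: dot_square_norm)
  let ?d = "DIM('a)"
  have sz: "z \<bullet> m - c = s z" for z by (simp add: s_def)
  have "(\<integral>\<^sup>+z. g z \<partial>lborel)
      = (\<integral>\<^sup>+z. indicator {0..1} (s z) * (\<integral>\<^sup>+r. g (z - s z *\<^sub>R m + r *\<^sub>R m) \<partial>lborel) \<partial>lborel)"
    unfolding s_def by (rule nn_integral_slab_Fubini) (use m in auto)
  \<comment> \<open>The new parameter r is affine in the shift along m: r = 0 is the plane through
    \<open>x0\<close> parallel to the base plane, and r = 1 is the base plane.\<close>
  also have "\<dots> = (\<integral>\<^sup>+z. indicator {0..1} (s z) *
      (ennreal \<bar>h\<bar> * (\<integral>\<^sup>+r. g (z - s z *\<^sub>R m + ((r - 1) * h) *\<^sub>R m) \<partial>lborel)) \<partial>lborel)"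
    by (subst nn_integral_real_affine[of _ h "-h"]) (use h in \<open>auto simp: algebra_simps\<close>)
  also have "\<dots> = (\<integral>\<^sup>+z. \<integral>\<^sup>+r. ennreal \<bar>h\<bar> * (indicator {0..1} (s z) *
      g (z - s z *\<^sub>R m + ((r - 1) * h) *\<^sub>R m)) \<partial>lborel \<partial>lborel)"
    by (intro nn_integral_cong) (simp add: nn_integral_cmult mult_ac)
  also have "\<dots> = (\<integral>\<^sup>+r. \<integral>\<^sup>+z. ennreal \<bar>h\<bar> * (indicator {0..1} (s z) *
      g (z - s z *\<^sub>R m + ((r - 1) * h) *\<^sub>R m)) \<partial>lborel \<partial>lborel)"
    by (rule lborel_pair.Fubini'[symmetric]) measurable
  also have "\<dots> = (\<integral>\<^sup>+r. ennreal (\<bar>h\<bar> * \<bar>r\<bar> ^ (?d - 1)) *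
      (\<integral>\<^sup>+z. indicator {0..1} (s z) * g (x0 + r *\<^sub>R (z - s z *\<^sub>R m - x0)) \<partial>lborel) \<partial>lborel)"
  proof (rule nn_integral_cong_AE)
    have "AE r in lborel. r \<noteq> (0::real)" by (rule AE_lborel_singleton)
    then show "AE r in lborel. (\<integral>\<^sup>+z. ennreal \<bar>h\<bar> * (indicator {0..1} (s z) *
        g (z - s z *\<^sub>R m + ((r - 1) * h) *\<^sub>R m)) \<partial>lborel) = ennreal (\<bar>h\<bar> * \<bar>r\<bar> ^ (?d - 1)) *
      (\<integral>\<^sup>+z. indicator {0..1} (s z) * g (x0 + r *\<^sub>R (z - s z *\<^sub>R m - x0)) \<partial>lborel)"
    proof eventually_elim
      case (elim r)
      define k where "k y = g (x0 + r *\<^sub>R (y - x0))" for y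
      have [measurable]: "k \<in> borel_measurable borel" by (simp add: k_def[abs_def])
      define \<psi> :: "real \<Rightarrow> ennreal" where "\<psi> q = indicator {0..1} ((r - 1) * h + r * q)" for q
      have [measurable]: "\<psi> \<in> borel_measurable borel" by (simp add: \<psi>_def[abs_def])
      \<comment> \<open>The dilation by r about \<open>x0\<close> contributes |r|^d and turns the
        height s into (r - 1) h + r s. By the product formula the changed height only contributes
        the length 1 / |r| of an interval of heights, which leaves |r|^(d - 1).\<close>
      have s_aff: "s (x0 - r *\<^sub>R x0 + r *\<^sub>R z) = (r - 1) * h + r * s z" for z
        by (simp add: s_def h_def inner_add_left inner_diff_left algebra_simps)
      have g_aff: "x0 - r *\<^sub>R x0 + r *\<^sub>R z - ((r - 1) * h + r * s z) *\<^sub>R m + ((r - 1) * h) *\<^sub>R m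
          = x0 + r *\<^sub>R (z - s z *\<^sub>R m - x0)" for z
        by (simp add: algebra_simps)
      have "(\<integral>\<^sup>+z. indicator {0..1} (s z) * g (z - s z *\<^sub>R m + ((r - 1) * h) *\<^sub>R m) \<partial>lborel)
          = ennreal (\<bar>r\<bar> ^ ?d) * (\<integral>\<^sup>+z. \<psi> (s z) * k (z - s z *\<^sub>R m) \<partial>lborel)"
        by (subst nn_integral_lborel_affine[where c = r and t = "x0 - r *\<^sub>R x0"])
          (use elim in \<open>simp_all only: g_aff s_aff \<psi>_def k_def\<close>, measurable)
      also have "\<dots> = ennreal (\<bar>r\<bar> ^ ?d) * (ennreal (1 / \<bar>r\<bar>) *
          (\<integral>\<^sup>+z. indicator {0..1} (s z) * k (z - s z *\<^sub>R m) \<partial>lborel))"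
        using nn_integral_slab_product[OF m, of k \<psi> c, unfolded sz]
          nn_integral_unit_interval_affine[of r "(r - 1) * h"] elim
        by (simp add: \<psi>_def)
      also have "\<dots> = ennreal (\<bar>r\<bar> ^ (?d - 1)) * (\<integral>\<^sup>+z. indicator {0..1} (s z) * k (z - s z *\<^sub>R m) \<partial>lborel)"
      proof -
        obtain d where d: "?d = Suc d" using DIM_positive[where 'a='a] gr0_conv_Suc by blast
        have "\<bar>r\<bar> ^ ?d * (1 / \<bar>r\<bar>) = \<bar>r\<bar> ^ (?d - 1)" using elim by (simp add: d)
        then show ?thesis by (simp add: mult.assoc[symmetric] ennreal_mult'[symmetric])
      qed
      finally show ?case
        by (subst nn_integral_cmult) (auto simp: k_def ennreal_mult' mult_ac)
    qed
  qed
  finally show ?thesis .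
qed

text \<open>The measures \<open>\<mu>\<close> against which every continuous function can be integrated: the Lebesgue measure
  on a compact set and the surface measure of a facet.\<close>

definition compact_measure :: "'a::euclidean_space measure \<Rightarrow> bool" where
  "compact_measure \<mu> \<longleftrightarrow> sets \<mu> = sets borel \<and> finite_measure \<mu> \<and> (\<exists>S. compact S \<and> (AE x in \<mu>. x \<in> S))"

lemma compact_measure_integrable:
  fixes g :: "'a::euclidean_space \<Rightarrow> 'b::euclidean_space"
  assumes "compact_measure \<mu>" "continuous_on UNIV g"
  shows "integrable \<mu> g"
proof -
  obtain S where S: "compact S" "AE x in \<mu>. x \<in> S" and sets: "sets \<mu> = sets borel" and "finite_measure \<mu>"
    using assms by (auto simp: compact_measure_def)
  then interpret finite_measure \<mu> by simp
  have "bounded (g ` S)"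
    using S assms by (meson compact_continuous_image compact_imp_bounded continuous_on_subset subset_UNIV)
  then obtain B where "\<And>x. x \<in> S \<Longrightarrow> norm (g x) \<le> B" by (auto simp: bounded_iff)
  then have "AE x in \<mu>. norm (g x) \<le> B" using S by auto
  moreover have "g \<in> borel_measurable \<mu>"
    using assms(2) sets by (simp add: borel_measurable_continuous_onI measurable_cong_sets[OF sets refl])
  ultimately show ?thesis by (rule integrable_const_bound)
qed

lemma compact_measure_density_lborel:
  fixes K :: "'a::euclidean_space set"
  assumes "compact K"
  shows "compact_measure (density lborel (indicator K))"
proof -
  have [measurable]: "K \<in> sets borel" using assms by (simp add: compact_imp_closed)
  have "emeasure (density lborel (indicator K)) UNIV < \<infinity>"
    using emeasure_bounded_finite[OF compact_imp_bounded[OF assms]]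
    by (subst emeasure_density) auto
  then have "finite_measure (density lborel (indicator K))" by (intro finite_measureI) simp
  moreover have "AE x in density lborel (indicator K). x \<in> K"
    by (subst AE_density) (auto simp: indicator_def)
  ultimately show ?thesis using assms by (auto simp: compact_measure_def)
qed

lemma set_integral_eq_density:
  fixes g :: "'a::euclidean_space \<Rightarrow> real"
  assumes "K \<in> sets borel" "g \<in> borel_measurable borel"
  shows "(LINT x:K|lborel. g x) = (LINT x|density lborel (indicator K). g x)"
proof -
  have "(LINT x|density lborel (\<lambda>x. ennreal (indicator K x)). g x) = (LINT x|lborel. indicator K x *\<^sub>R g x)"
    by (rule integral_density) (use assms in auto)
  then show ?thesis by (simp add: set_lebesgue_integral_def ennreal_indicator)
qed

section \<open>Surface measure on a flat facet and integration over cones\<close>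

locale flat_facet =
  fixes F :: "(real^'n) set" and m :: "real^'n" and c :: real
  assumes compact_F: "compact F" and F_ne: "F \<noteq> {}" and F_plane: "\<And>y. y \<in> F \<Longrightarrow> y \<bullet> m = c"
    and norm_m: "norm m = 1"
begin

definition hgt :: "real^'n \<Rightarrow> real" where "hgt z = z \<bullet> m - c"

definition prj :: "real^'n \<Rightarrow> real^'n" where "prj z = z - hgt z *\<^sub>R m"

lemma m_m: "m \<bullet> m = 1" using norm_m by (simp add: dot_square_norm)

lemma hgt_prj [simp]: "hgt (prj z) = 0" by (simp add: hgt_def prj_def inner_diff_left m_m)

lemma hgt_F: "y \<in> F \<Longrightarrow> hgt y = 0" using F_plane by (simp add: hgt_def)

lemma hgt_add: "hgt (y + s *\<^sub>R m) = hgt y + s" by (simp add: hgt_def inner_add_left m_m)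

lemma continuous_hgt: "continuous_on UNIV hgt"
  unfolding hgt_def by (intro continuous_intros)

lemma continuous_prj: "continuous_on UNIV prj"
  unfolding prj_def hgt_def by (intro continuous_intros)

lemma hgt_measurable [measurable]: "hgt \<in> borel_measurable borel"
  by (simp add: borel_measurable_continuous_onI continuous_hgt)

lemma prj_measurable [measurable]: "prj \<in> borel_measurable borel"
  by (simp add: borel_measurable_continuous_onI continuous_prj)

lemma F_measurable [measurable]: "F \<in> sets borel"
  using compact_F by (simp add: compact_imp_closed)

definition prism :: "(real^'n) set" where "prism = {z. prj z \<in> F \<and> hgt z \<in> {0..1}}"

lemma prism_eq: "{y + s *\<^sub>R m | y s. y \<in> F \<and> s \<in> {0..1}} = prism"
proof (intro set_eqI iffI)
  fix z assume "z \<in> {y + s *\<^sub>R m | y s. y \<in> F \<and> s \<in> {0..1}}"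
  then obtain y s where "z = y + s *\<^sub>R m" "y \<in> F" "s \<in> {0..1}" by blast
  then show "z \<in> prism" by (simp add: prism_def prj_def hgt_add hgt_F)
next
  fix z assume "z \<in> prism"
  moreover have "z = prj z + hgt z *\<^sub>R m" by (simp add: prj_def)
  ultimately show "z \<in> {y + s *\<^sub>R m | y s. y \<in> F \<and> s \<in> {0..1}}" unfolding prism_def by blast
qed

lemma prism_measurable [measurable]: "prism \<in> sets borel"
proof -
  have "prism = (prj -` F \<inter> space borel) \<inter> (hgt -` {0..1} \<inter> space borel)" by (auto simp: prism_def)
  then show ?thesis by (metis F_measurable atLeastAtMost_borel hgt_measurable measurable_sets prj_measurable sets.Int)
qed

lemma facet_measure_eq: "facet_measure F m = distr (restrict_space lborel prism) borel prj"
proof -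
  have "(SOME y. y \<in> F) \<in> F" using F_ne by (simp add: some_in_eq)
  then have "x - ((x - (SOME y. y \<in> F)) \<bullet> m) *\<^sub>R m = prj x" for x
    by (simp add: prj_def hgt_def inner_diff_left F_plane)
  then show ?thesis unfolding facet_measure_def prism_eq by simp
qed

text \<open>Brings a surface integral into the form of the slab integrals that occur in the cone
  coordinates; for this the prism condition is split into height and projection.\<close>

lemma nn_integral_facet:
  assumes [measurable]: "g \<in> borel_measurable borel"
  shows "(\<integral>\<^sup>+y. g y \<partial>facet_measure F m)
    = (\<integral>\<^sup>+z. indicator {0..1} (hgt z) * (indicator F (prj z) * g (prj z)) \<partial>lborel)"
proof -
  have "(\<integral>\<^sup>+y. g y \<partial>facet_measure F m) = (\<integral>\<^sup>+z. g (prj z) \<partial>restrict_space lborel prism)"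
    unfolding facet_measure_eq by (rule nn_integral_distr) (auto intro!: measurable_restrict_space1)
  also have "\<dots> = (\<integral>\<^sup>+z. g (prj z) * indicator prism z \<partial>lborel)"
    by (rule nn_integral_restrict_space) auto
  also have "\<dots> = (\<integral>\<^sup>+z. indicator {0..1} (hgt z) * (indicator F (prj z) * g (prj z)) \<partial>lborel)"
    by (intro nn_integral_cong) (auto simp: prism_def indicator_def)
  finally show ?thesis .
qed

lemma sets_facet [simp]: "sets (facet_measure F m) = sets borel"
  by (simp add: facet_measure_eq)

lemma bounded_prism: "bounded prism"
proof -
  obtain B where B: "\<And>y. y \<in> F \<Longrightarrow> norm y \<le> B"
    using compact_F compact_imp_bounded bounded_iff by metis
  have "norm z \<le> B + 1" if z: "z \<in> prism" for z
  proof -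
    obtain y s where "z = y + s *\<^sub>R m" "y \<in> F" "s \<in> {0..1}" using z unfolding prism_eq[symmetric] by auto
    then show ?thesis using B[of y] norm_triangle_ineq[of y "s *\<^sub>R m"] norm_m by auto
  qed
  then show ?thesis by (auto simp: bounded_iff)
qed

lemma AE_facet: "AE y in facet_measure F m. y \<in> F"
proof -
  have "AE z in restrict_space lborel prism. prj z \<in> F"
    by (subst AE_restrict_space_iff) (auto simp: prism_def[symmetric], auto simp: prism_def)
  then show ?thesis unfolding facet_measure_eq
    by (subst AE_distr_iff) (auto intro!: measurable_restrict_space1)
qed

lemma compact_measure_facet: "compact_measure (facet_measure F m)"
proof -
  have "emeasure (facet_measure F m) UNIV = (\<integral>\<^sup>+y. 1 \<partial>facet_measure F m)"
    using sets_eq_imp_space_eq[OF sets_facet] by simp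
  also have "\<dots> = (\<integral>\<^sup>+z. indicator prism z \<partial>lborel)"
    by (subst nn_integral_facet) (auto simp del: nn_integral_indicator simp: prism_def indicator_def intro!: nn_integral_cong)
  also have "\<dots> = emeasure lborel prism" by (rule nn_integral_indicator) simp
  also have "\<dots> < \<infinity>" using bounded_prism by (rule emeasure_bounded_finite)
  finally have "finite_measure (facet_measure F m)"
    using sets_eq_imp_space_eq[OF sets_facet] by (intro finite_measureI) simp
  then show ?thesis using compact_F AE_facet by (auto simp: compact_measure_def)
qed

text \<open>As \<open>x0\<close> lies off the plane, the component along m identifies the radial
  parameter r with the weight of the base point in a convex combination. Then r \<noteq> 0
  determines the base point.\<close>

lemma mem_cone_iff:
  assumes "convex F" and x0: "x0 \<bullet> m \<noteq> c" and r: "r \<noteq> 0" and y: "hgt y = 0"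
  shows "x0 + r *\<^sub>R (y - x0) \<in> convex hull (insert x0 F) \<longleftrightarrow> r \<in> {0<..1} \<and> y \<in> F"
proof
  assume "x0 + r *\<^sub>R (y - x0) \<in> convex hull (insert x0 F)"
  then obtain u v b where uv: "0 \<le> u" "0 \<le> v" "u + v = 1" "b \<in> F"
    and eq: "x0 + r *\<^sub>R (y - x0) = u *\<^sub>R x0 + v *\<^sub>R b"
    using F_ne \<open>convex F\<close> by (auto simp: convex_hull_insert hull_same)
  have u: "u = 1 - v" using uv by simp
  have eq': "r *\<^sub>R (y - x0) = v *\<^sub>R (b - x0)" using eq by (simp add: u algebra_simps)
  have "(y - x0) \<bullet> m = c - x0 \<bullet> m" "(b - x0) \<bullet> m = c - x0 \<bullet> m"
    using y F_plane[OF uv(4)] by (simp_all add: hgt_def inner_diff_left)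
  then have "r * (c - x0 \<bullet> m) = v * (c - x0 \<bullet> m)" using arg_cong[OF eq', of "\<lambda>z. z \<bullet> m"] by simp
  then have "r = v" using x0 by simp
  then have "y = b" using eq' r by simp
  then show "r \<in> {0<..1} \<and> y \<in> F" using uv \<open>r = v\<close> r by auto
next
  assume A: "r \<in> {0<..1} \<and> y \<in> F"
  have "x0 + r *\<^sub>R (y - x0) = (1 - r) *\<^sub>R x0 + r *\<^sub>R y" by (simp add: algebra_simps)
  also have "\<dots> \<in> convex hull (insert x0 F)"
    using A by (intro convexD[OF convex_convex_hull]) (auto intro: hull_inc)
  finally show "x0 + r *\<^sub>R (y - x0) \<in> convex hull (insert x0 F)" .
qed

text \<open>Cone coordinates cut down by the membership criterion; the value r = 0, which the
  criterion excludes, is a null set. The Jacobian is the height of the cone times r^(d - 1).\<close>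

lemma nn_integral_cone:
  assumes "convex F" and x0: "x0 \<bullet> m \<noteq> c" and [measurable]: "g \<in> borel_measurable borel"
  defines "K \<equiv> convex hull (insert x0 F)"
  shows "(\<integral>\<^sup>+z. indicator K z * g z \<partial>lborel) = (\<integral>\<^sup>+r. \<integral>\<^sup>+y.
      ennreal (\<bar>c - x0 \<bullet> m\<bar> * r ^ (CARD('n) - 1)) * indicator {0<..1} r * g (x0 + r *\<^sub>R (y - x0))
      \<partial>facet_measure F m \<partial>lborel)"
proof -
  have "compact K" unfolding K_def using compact_F by (simp add: compact_convex_hull)
  then have [measurable]: "K \<in> sets borel" by (simp add: compact_imp_closed)
  have hz: "z \<bullet> m - c = hgt z" and pz: "z - hgt z *\<^sub>R m = prj z" for z by (simp_all add: hgt_def prj_def)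
  have "(\<integral>\<^sup>+z. indicator K z * g z \<partial>lborel) = (\<integral>\<^sup>+r. ennreal (\<bar>c - x0 \<bullet> m\<bar> * \<bar>r\<bar> ^ (CARD('n) - 1)) *
      (\<integral>\<^sup>+z. indicator {0..1} (hgt z) * (indicator K (x0 + r *\<^sub>R (prj z - x0)) * g (x0 + r *\<^sub>R (prj z - x0))) \<partial>lborel) \<partial>lborel)"
    using nn_integral_cone_coordinates[OF norm_m, of "\<lambda>z. indicator K z * g z" c x0, unfolded hz pz] x0
    by simp
  also have "\<dots> = (\<integral>\<^sup>+r. \<integral>\<^sup>+y.
      ennreal (\<bar>c - x0 \<bullet> m\<bar> * r ^ (CARD('n) - 1)) * indicator {0<..1} r * g (x0 + r *\<^sub>R (y - x0))
      \<partial>facet_measure F m \<partial>lborel)"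
  proof (rule nn_integral_cong_AE)
    have "AE r in lborel. r \<noteq> (0::real)" by (rule AE_lborel_singleton)
    then show "AE r in lborel. ennreal (\<bar>c - x0 \<bullet> m\<bar> * \<bar>r\<bar> ^ (CARD('n) - 1)) *
        (\<integral>\<^sup>+z. indicator {0..1} (hgt z) * (indicator K (x0 + r *\<^sub>R (prj z - x0)) * g (x0 + r *\<^sub>R (prj z - x0))) \<partial>lborel)
        = (\<integral>\<^sup>+y. ennreal (\<bar>c - x0 \<bullet> m\<bar> * r ^ (CARD('n) - 1)) * indicator {0<..1} r * g (x0 + r *\<^sub>R (y - x0))
        \<partial>facet_measure F m)"
    proof eventually_elim
      case (elim r)
      have K: "indicator K (x0 + r *\<^sub>R (prj z - x0)) = (indicator {0<..1} r * indicator F (prj z) :: ennreal)" for z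
        using mem_cone_iff[OF \<open>convex F\<close> x0 elim, of "prj z"] by (auto simp: K_def indicator_def)
      have "(\<integral>\<^sup>+y. ennreal (\<bar>c - x0 \<bullet> m\<bar> * r ^ (CARD('n) - 1)) * indicator {0<..1} r * g (x0 + r *\<^sub>R (y - x0))
          \<partial>facet_measure F m)
          = (\<integral>\<^sup>+z. indicator {0..1} (hgt z) * (indicator F (prj z) * (ennreal (\<bar>c - x0 \<bullet> m\<bar> * r ^ (CARD('n) - 1))
             * indicator {0<..1} r * g (x0 + r *\<^sub>R (prj z - x0)))) \<partial>lborel)"
        by (rule nn_integral_facet) measurable
      also have "\<dots> = (\<integral>\<^sup>+z. ennreal (\<bar>c - x0 \<bullet> m\<bar> * \<bar>r\<bar> ^ (CARD('n) - 1)) * (indicator {0..1} (hgt z) *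
          (indicator K (x0 + r *\<^sub>R (prj z - x0)) * g (x0 + r *\<^sub>R (prj z - x0)))) \<partial>lborel)"
        unfolding K by (intro nn_integral_cong) (auto simp: indicator_def)
      also have "\<dots> = ennreal (\<bar>c - x0 \<bullet> m\<bar> * \<bar>r\<bar> ^ (CARD('n) - 1)) * (\<integral>\<^sup>+z. indicator {0..1} (hgt z) *
          (indicator K (x0 + r *\<^sub>R (prj z - x0)) * g (x0 + r *\<^sub>R (prj z - x0))) \<partial>lborel)"
        by (rule nn_integral_cmult) measurable
      finally show ?case by simp
    qed
  qed
  finally show ?thesis .
qed

lemma finite_measure_facet: "finite_measure (facet_measure F m)"
  using compact_measure_facet by (simp add: compact_measure_def)

text \<open>The formula is first an equality of measures: Lebesgue measure on the cone is the image
  of a weighted product of the measures on the ray and on the facet. Integrands of either sign then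
  follow from integrability on the compact cone, and Fubini gives the iterated form.\<close>

lemma set_integral_cone:
  fixes g :: "real^'n \<Rightarrow> real"
  assumes "convex F" and x0: "x0 \<bullet> m \<noteq> c" and g: "continuous_on UNIV g"
  shows "(LINT z:convex hull (insert x0 F)|lborel. g z) = (LINT y|facet_measure F m.
      (LINT r:{0..1}|lborel. \<bar>c - x0 \<bullet> m\<bar> * r ^ (CARD('n) - 1) * g (x0 + r *\<^sub>R (y - x0))))"
    and "integrable (facet_measure F m) (\<lambda>y. (LINT r:{0..1}|lborel. \<bar>c - x0 \<bullet> m\<bar> * r ^ (CARD('n) - 1) * g (x0 + r *\<^sub>R (y - x0))))"
proof -
  define K where "K = convex hull (insert x0 F)"
  define w where "w r = \<bar>c - x0 \<bullet> m\<bar> * r ^ (CARD('n) - 1) * indicator {0<..1} r" for r :: real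
  let ?\<Sigma> = "facet_measure F m"
  let ?\<mu> = "density lborel (indicator K)"
  let ?q = "\<lambda>(r, y). x0 + r *\<^sub>R (y - x0)"
  interpret F: finite_measure ?\<Sigma> by (rule finite_measure_facet)
  interpret pair_sigma_finite "lborel :: real measure" ?\<Sigma> ..
  have "compact K" unfolding K_def using compact_F by (simp add: compact_convex_hull)
  then have [measurable]: "K \<in> sets borel" by (simp add: compact_imp_closed)
  have [measurable]: "g \<in> borel_measurable borel" using g by (simp add: borel_measurable_continuous_onI)
  have [measurable]: "w \<in> borel_measurable borel" by (simp add: w_def[abs_def])
  have w_nonneg: "0 \<le> w r" for r by (simp add: w_def indicator_def)
  have we: "ennreal (w r) = ennreal (\<bar>c - x0 \<bullet> m\<bar> * r ^ (CARD('n) - 1)) * indicator {0<..1} r" for r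
    by (simp add: w_def indicator_def)
  have sets_pair: "sets (lborel \<Otimes>\<^sub>M ?\<Sigma>) = sets (borel \<Otimes>\<^sub>M borel)"
    by (intro sets_pair_measure_cong) auto
  have q: "?q \<in> borel_measurable (borel \<Otimes>\<^sub>M borel)" by measurable
  have q': "?q \<in> borel_measurable (lborel \<Otimes>\<^sub>M ?\<Sigma>)"
    using q measurable_cong_sets[OF sets_pair refl] by blast
  have w': "(\<lambda>p. w (fst p)) \<in> borel_measurable (lborel \<Otimes>\<^sub>M ?\<Sigma>)" by measurable
  have eq: "?\<mu> = distr (density (lborel \<Otimes>\<^sub>M ?\<Sigma>) (\<lambda>p. ennreal (w (fst p)))) borel ?q"
  proof (rule measure_eqI)
    fix A :: "(real^'n) set" assume "A \<in> sets ?\<mu>"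
    then have [measurable]: "A \<in> sets borel" by simp
    have mA: "?q -` A \<inter> space (lborel \<Otimes>\<^sub>M ?\<Sigma>) \<in> sets (lborel \<Otimes>\<^sub>M ?\<Sigma>)"
      using q' by (rule measurable_sets) simp
    have iA: "(\<lambda>p. indicator A (?q p) :: ennreal) \<in> borel_measurable (lborel \<Otimes>\<^sub>M ?\<Sigma>)"
      using measurable_compose[OF q', of "indicator A :: _ \<Rightarrow> ennreal" borel] by simp
    have "emeasure ?\<mu> A = (\<integral>\<^sup>+z. indicator K z * indicator A z \<partial>lborel)"
      by (simp add: emeasure_density)
    also have "\<dots> = (\<integral>\<^sup>+r. \<integral>\<^sup>+y. ennreal (w r) * indicator A (x0 + r *\<^sub>R (y - x0)) \<partial>?\<Sigma> \<partial>lborel)"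
      unfolding K_def we using nn_integral_cone[OF assms(1) x0, of "indicator A"] by simp
    also have "\<dots> = (\<integral>\<^sup>+p. ennreal (w (fst p)) * indicator A (?q p) \<partial>(lborel \<Otimes>\<^sub>M ?\<Sigma>))"
      by (subst F.nn_integral_fst[symmetric]) (use w' iA in \<open>auto\<close>)
    also have "\<dots> = (\<integral>\<^sup>+p. ennreal (w (fst p)) * indicator (?q -` A \<inter> space (lborel \<Otimes>\<^sub>M ?\<Sigma>)) p \<partial>(lborel \<Otimes>\<^sub>M ?\<Sigma>))"
      by (intro nn_integral_cong) (auto simp: indicator_def)
    also have "\<dots> = emeasure (density (lborel \<Otimes>\<^sub>M ?\<Sigma>) (\<lambda>p. ennreal (w (fst p)))) (?q -` A \<inter> space (lborel \<Otimes>\<^sub>M ?\<Sigma>))"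
      by (rule emeasure_density[symmetric]) (use w' mA in auto)
    also have "\<dots> = emeasure (distr (density (lborel \<Otimes>\<^sub>M ?\<Sigma>) (\<lambda>p. ennreal (w (fst p)))) borel ?q) A"
      by (subst emeasure_distr) (use q' in auto)
    finally show "emeasure ?\<mu> A = \<dots>" .
  qed simp
  have "integrable ?\<mu> g"
    using compact_measure_density_lborel[OF \<open>compact K\<close>] g by (rule compact_measure_integrable)
  then have "integrable (density (lborel \<Otimes>\<^sub>M ?\<Sigma>) (\<lambda>p. ennreal (w (fst p)))) (\<lambda>p. g (?q p))"
    unfolding eq by (subst (asm) integrable_distr_eq) (use q' in auto)
  moreover have gq: "(\<lambda>p. g (?q p)) \<in> borel_measurable (lborel \<Otimes>\<^sub>M ?\<Sigma>)"
    using measurable_compose[OF q', of g borel] by simp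
  ultimately have int: "integrable (lborel \<Otimes>\<^sub>M ?\<Sigma>) (\<lambda>p. w (fst p) *\<^sub>R g (?q p))"
    by (subst (asm) integrable_density) (use w' w_nonneg in auto)
  have "(LINT z:K|lborel. g z) = (LINT z|?\<mu>. g z)" by (rule set_integral_eq_density) auto
  also have "\<dots> = (LINT p|density (lborel \<Otimes>\<^sub>M ?\<Sigma>) (\<lambda>p. ennreal (w (fst p))). g (?q p))"
    unfolding eq by (rule integral_distr) (use q' in auto)
  also have "\<dots> = (LINT p|(lborel \<Otimes>\<^sub>M ?\<Sigma>). w (fst p) *\<^sub>R g (?q p))"
    by (rule integral_density) (use w' gq w_nonneg in auto)
  also have "\<dots> = (LINT y|?\<Sigma>. LINT r|lborel. w r *\<^sub>R g (x0 + r *\<^sub>R (y - x0)))"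
    using integral_snd[of "\<lambda>r y. w r *\<^sub>R g (x0 + r *\<^sub>R (y - x0))"] int by (simp add: case_prod_beta')
  finally have 1: "(LINT z:K|lborel. g z) = (LINT y|?\<Sigma>. LINT r|lborel. w r *\<^sub>R g (x0 + r *\<^sub>R (y - x0)))" .
  have 2: "integrable ?\<Sigma> (\<lambda>y. LINT r|lborel. w r *\<^sub>R g (x0 + r *\<^sub>R (y - x0)))"
    using integrable_snd[of "\<lambda>r y. w r *\<^sub>R g (x0 + r *\<^sub>R (y - x0))"] int by (simp add: case_prod_beta')
  have 3: "(LINT r|lborel. w r *\<^sub>R g (x0 + r *\<^sub>R (y - x0)))
     = (LINT r:{0..1}|lborel. \<bar>c - x0 \<bullet> m\<bar> * r ^ (CARD('n) - 1) * g (x0 + r *\<^sub>R (y - x0)))" for y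
    unfolding set_lebesgue_integral_def
  proof (rule integral_cong_AE)
    have "AE r in lborel. r \<noteq> (0::real)" by (rule AE_lborel_singleton)
    then show "AE r in lborel. w r *\<^sub>R g (x0 + r *\<^sub>R (y - x0)) = indicator {0..1} r *\<^sub>R
        (\<bar>c - x0 \<bullet> m\<bar> * r ^ (CARD('n) - 1) * g (x0 + r *\<^sub>R (y - x0)))"
      by eventually_elim (auto simp: w_def indicator_def)
  qed measurable
  show "(LINT z:convex hull (insert x0 F)|lborel. g z) = (LINT y|facet_measure F m.
      (LINT r:{0..1}|lborel. \<bar>c - x0 \<bullet> m\<bar> * r ^ (CARD('n) - 1) * g (x0 + r *\<^sub>R (y - x0))))"
    using 1 unfolding 3 K_def .
  show "integrable (facet_measure F m) (\<lambda>y. (LINT r:{0..1}|lborel. \<bar>c - x0 \<bullet> m\<bar> * r ^ (CARD('n) - 1) * g (x0 + r *\<^sub>R (y - x0))))"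
    using 2 unfolding 3 .
qed

end

section \<open>Polynomials in several variables\<close>

inductive poly_le :: "nat \<Rightarrow> (real^'n \<Rightarrow> real) \<Rightarrow> bool" where
  const: "poly_le m (\<lambda>x. c)"
| coord: "1 \<le> m \<Longrightarrow> poly_le m (\<lambda>x. x $ i)"
| add: "poly_le m p \<Longrightarrow> poly_le m q \<Longrightarrow> poly_le m (\<lambda>x. p x + q x)"
| mult: "poly_le a p \<Longrightarrow> poly_le b q \<Longrightarrow> a + b \<le> m \<Longrightarrow> poly_le m (\<lambda>x. p x * q x)"

lemma poly_le_mono: "poly_le k p \<Longrightarrow> k \<le> m \<Longrightarrow> poly_le m p"
proof (induction arbitrary: m rule: poly_le.induct)
  case (mult a p b q k)
  show ?case by (rule poly_le.mult[OF mult.hyps(1,2)]) (use mult in simp)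
qed (auto intro: poly_le.intros)

lemma poly_le_sum:
  "(\<And>i. i \<in> I \<Longrightarrow> poly_le m (f i)) \<Longrightarrow> poly_le m (\<lambda>x. \<Sum>i\<in>I. f i x)"
proof (induction I rule: infinite_finite_induct)
  case (insert i I)
  then show ?case using poly_le.add[of m "f i" "\<lambda>x. \<Sum>i\<in>I. f i x"] by simp
qed (auto intro: poly_le.const)

lemma poly_le_power: "poly_le k (\<lambda>x. (x $ i) ^ k)"
proof (induction k)
  case (Suc k)
  then show ?case using poly_le.mult[OF poly_le.coord[of 1 i] Suc, of "Suc k"] by simp
qed (auto intro: poly_le.const)

lemma poly_le_prod:
  "finite I \<Longrightarrow> (\<And>i. i \<in> I \<Longrightarrow> poly_le (a i) (f i)) \<Longrightarrow> poly_le (\<Sum>i\<in>I. a i) (\<lambda>x. \<Prod>i\<in>I. f i x)"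
proof (induction I rule: finite_induct)
  case (insert i I)
  then show ?case using poly_le.mult[of "a i" "f i" "\<Sum>i\<in>I. a i" "\<lambda>x. \<Prod>i\<in>I. f i x"] by simp
qed (auto intro: poly_le.const)

lemma Pk_imp_poly_le:
  assumes "p \<in> Pk k" shows "poly_le k p"
proof -
  obtain c where p: "p = (\<lambda>x. \<Sum>\<alpha> | (\<Sum>i\<in>UNIV. \<alpha> i) \<le> k. c \<alpha> * (\<Prod>i\<in>UNIV. (x $ i) ^ \<alpha> i))"
    using assms by (auto simp: Pk_def)
  have "poly_le k (\<lambda>x. c \<alpha> * (\<Prod>i\<in>UNIV. (x $ i) ^ \<alpha> i))" if "(\<Sum>i\<in>UNIV. \<alpha> i) \<le> k" for \<alpha>
    using that poly_le_prod[OF finite, of UNIV \<alpha> "\<lambda>i x. (x $ i) ^ \<alpha> i", OF poly_le_power]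
    by (intro poly_le.mult[OF poly_le.const[of 0]]) auto
  then show ?thesis unfolding p by (intro poly_le_sum) auto
qed

text \<open>Restriction to lines reduces the trace inequality to one variable. This and the gradient
  are plain rule inductions because \<open>poly_le\<close> bounds the degree by construction,
  without a normal form.\<close>

lemma poly_le_line:
  "poly_le m p \<Longrightarrow> \<exists>P. degree P \<le> m \<and> (\<forall>r. p (x + r *\<^sub>R v) = poly P r)"
proof (induction rule: poly_le.induct)
  case (const m c)
  show ?case by (rule exI[of _ "[:c:]"]) auto
next
  case (coord m i)
  then show ?case by (intro exI[of _ "[:x $ i, v $ i:]"]) auto
next
  case (add m p q)
  then obtain P Q where "degree P \<le> m" "degree Q \<le> m"
    "\<forall>r. p (x + r *\<^sub>R v) = poly P r" "\<forall>r. q (x + r *\<^sub>R v) = poly Q r" by blast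
  then show ?case by (intro exI[of _ "P + Q"]) (auto intro: degree_add_le)
next
  case (mult a p b q m)
  then obtain P Q where "degree P \<le> a" "degree Q \<le> b"
    "\<forall>r. p (x + r *\<^sub>R v) = poly P r" "\<forall>r. q (x + r *\<^sub>R v) = poly Q r" by blast
  then show ?case using mult.hyps
    by (intro exI[of _ "P * Q"]) (auto intro: order_trans[OF degree_mult_le])
qed

text \<open>The degree bound is not lowered by one, which keeps the product case free of
  subtraction. The penalty threshold accordingly allows a gradient the full degree of its
  field.\<close>

lemma poly_le_gradient:
  fixes p :: "real^'n \<Rightarrow> real"
  shows "poly_le m p \<Longrightarrow> \<exists>g. (\<forall>x. GDERIV p x :> g x) \<and> (\<forall>i. poly_le m (\<lambda>x. g x $ i))"
proof (induction rule: poly_le.induct)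
  case (const m c)
  show ?case by (rule exI[of _ "\<lambda>x. 0"]) (auto simp: GDERIV_const intro: poly_le.const)
next
  case (coord m i)
  have "GDERIV (\<lambda>x. x $ i) x :> axis i 1" for x :: "real^'n"
    unfolding gderiv_def by (simp add: inner_axis bounded_linear_imp_has_derivative bounded_linear_vec_nth)
  then show ?case by (intro exI[of _ "\<lambda>x. axis i 1"]) (auto intro: poly_le.const)
next
  case (add m p q)
  then obtain g h where "\<forall>x. GDERIV p x :> g x" "\<forall>i. poly_le m (\<lambda>x. g x $ i)"
    "\<forall>x. GDERIV q x :> h x" "\<forall>i. poly_le m (\<lambda>x. h x $ i)" by blast
  then show ?case by (intro exI[of _ "\<lambda>x. g x + h x"]) (auto intro: GDERIV_add poly_le.add)
next
  case (mult a p b q m)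
  then obtain g h where *: "\<forall>x. GDERIV p x :> g x" "\<forall>i. poly_le a (\<lambda>x. g x $ i)"
    "\<forall>x. GDERIV q x :> h x" "\<forall>i. poly_le b (\<lambda>x. h x $ i)" by blast
  have "poly_le m (\<lambda>x. p x * h x $ i + q x * g x $ i)" for i
    using * mult.hyps by (intro poly_le.add poly_le.mult[of a p b] poly_le.mult[of b q a]) auto
  then show ?case using *
    by (intro exI[of _ "\<lambda>x. p x *\<^sub>R h x + q x *\<^sub>R g x"]) (auto intro: GDERIV_mult)
qed

lemma GDERIV_continuous_on:
  "(\<And>x. GDERIV p x :> g x) \<Longrightarrow> continuous_on UNIV p"
  by (meson GDERIV_DERIV_compose continuous_at_imp_continuous_on gderiv_def has_derivative_continuous)

lemma poly_le_continuous: "poly_le m p \<Longrightarrow> continuous_on UNIV p"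
  using poly_le_gradient GDERIV_continuous_on by metis

section \<open>Trace inequality and divergence theorem on a cone\<close>

context flat_facet
begin

text \<open>Along each ray from the apex the one-variable inequality bounds the value at r = 1, a
  point of the facet, by the integral over the ray; integrating over the facet restores the
  cone.\<close>

lemma trace_inequality:
  assumes "convex F" and x0: "x0 \<bullet> m \<noteq> c" and p: "poly_le k p"
    and C: "\<And>(P::real poly) t. degree P \<le> 2 * k + (CARD('n) - 1) \<Longrightarrow> t \<in> {0..1} \<Longrightarrow>
      \<bar>poly P t\<bar> \<le> C * (LINT s:{0..1}|lborel. \<bar>poly P s\<bar>)"
  shows "\<bar>c - x0 \<bullet> m\<bar> * (LINT y|facet_measure F m. (p y)\<^sup>2)
    \<le> C * (LINT z:convex hull (insert x0 F)|lborel. (p z)\<^sup>2)"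
proof -
  let ?h = "\<bar>c - x0 \<bullet> m\<bar>" and ?d = "CARD('n) - 1"
  define I where "I y = (LINT r:{0..1}|lborel. ?h * r ^ ?d * (p (x0 + r *\<^sub>R (y - x0)))\<^sup>2)" for y
  have cont: "continuous_on UNIV (\<lambda>x. (p x)\<^sup>2)" using poly_le_continuous[OF p] by (intro continuous_intros)
  have bd: "?h * (p y)\<^sup>2 \<le> C * I y" for y
  proof -
    obtain P where P: "degree P \<le> k" "\<And>r. p (x0 + r *\<^sub>R (y - x0)) = poly P r"
      using poly_le_line[OF p] by metis
    \<comment> \<open>The factor r^(d - 1) of the volume element is included, so that the integral
      of Q is the inner integral of the cone formula; it accounts for the extra d - 1 in the
      degree.\<close>
    define Q where "Q = smult ?h (monom 1 ?d * P\<^sup>2)"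
    have Q: "poly Q r = ?h * r ^ ?d * (p (x0 + r *\<^sub>R (y - x0)))\<^sup>2" for r
      by (simp add: Q_def P poly_monom)
    have "degree Q \<le> degree (monom 1 ?d * P\<^sup>2)" unfolding Q_def by (rule degree_smult_le)
    also have "\<dots> \<le> degree (monom (1::real) ?d) + degree (P\<^sup>2)" by (rule degree_mult_le)
    also have "\<dots> \<le> ?d + 2 * k"
      using P(1) degree_power_le[of P 2] by (intro add_mono) (auto simp: degree_monom_eq mult.commute)
    finally have "\<bar>poly Q 1\<bar> \<le> C * (LINT s:{0..1}|lborel. \<bar>poly Q s\<bar>)" by (intro C) auto
    moreover have "(LINT s:{0..1}|lborel. \<bar>poly Q s\<bar>) = I y"
      unfolding I_def set_lebesgue_integral_def
      by (intro Bochner_Integration.integral_cong) (auto simp: Q indicator_def)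
    moreover have "\<bar>poly Q 1\<bar> = ?h * (p y)\<^sup>2" by (simp add: Q abs_mult)
    ultimately show ?thesis by simp
  qed
  have "?h * (LINT y|facet_measure F m. (p y)\<^sup>2) = (LINT y|facet_measure F m. ?h * (p y)\<^sup>2)"
    by (subst integral_mult_right_zero) simp
  also have "\<dots> \<le> (LINT y|facet_measure F m. C * I y)"
  proof (rule integral_mono)
    show "integrable (facet_measure F m) (\<lambda>y. ?h * (p y)\<^sup>2)"
      by (intro integrable_mult_right compact_measure_integrable[OF compact_measure_facet cont])
    show "integrable (facet_measure F m) (\<lambda>y. C * I y)"
      unfolding I_def by (intro integrable_mult_right set_integral_cone(2) cont assms)
  qed (use bd in auto)
  also have "\<dots> = C * (LINT y|facet_measure F m. I y)" by simp
  also have "(LINT y|facet_measure F m. I y) = (LINT z:convex hull (insert x0 F)|lborel. (p z)\<^sup>2)"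
    unfolding I_def by (rule set_integral_cone(1)[symmetric]) (use assms cont in auto)
  finally show ?thesis .
qed

text \<open>The divergence theorem for the field \<open>(z - x0) g\<close>, whose flux through the lateral faces
  of the cone vanishes.\<close>

lemma divergence_cone:
  assumes "convex F" and x0: "x0 \<bullet> m \<noteq> c"
    and g: "\<And>x. GDERIV g x :> G x" and G: "continuous_on UNIV G"
  shows "(LINT z:convex hull (insert x0 F)|lborel. real CARD('n) * g z + (z - x0) \<bullet> G z)
    = \<bar>c - x0 \<bullet> m\<bar> * (LINT y|facet_measure F m. g y)"
proof -
  let ?h = "\<bar>c - x0 \<bullet> m\<bar>" and ?d = "CARD('n)"
  have gc: "continuous_on UNIV g" using GDERIV_continuous_on g by blast
  have "(LINT z:convex hull (insert x0 F)|lborel. real ?d * g z + (z - x0) \<bullet> G z)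
    = (LINT y|facet_measure F m. (LINT r:{0..1}|lborel. ?h * r ^ (?d - 1) *
        (real ?d * g (x0 + r *\<^sub>R (y - x0)) + (x0 + r *\<^sub>R (y - x0) - x0) \<bullet> G (x0 + r *\<^sub>R (y - x0)))))"
    by (rule set_integral_cone) (use assms gc in \<open>auto intro!: continuous_intros\<close>)
  also have "\<dots> = (LINT y|facet_measure F m. ?h * g y)"
  proof (rule Bochner_Integration.integral_cong)
    fix y
    define f where "f r = ?h * r ^ (?d - 1) *
        (real ?d * g (x0 + r *\<^sub>R (y - x0)) + (x0 + r *\<^sub>R (y - x0) - x0) \<bullet> G (x0 + r *\<^sub>R (y - x0)))" for r
    have d: "(?d - 1) + 1 = ?d" by simp
    \<comment> \<open>The integrand is the radial derivative of h r^d g, so the ray integral is the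
      value at r = 1; at r = 0 the factor r^d vanishes.\<close>
    have "((\<lambda>r. ?h * r ^ ?d * g (x0 + r *\<^sub>R (y - x0))) has_vector_derivative f r) (at r within {0..1})" for r
    proof -
      have "((\<lambda>r. x0 + r *\<^sub>R (y - x0)) has_derivative (\<lambda>h. h *\<^sub>R (y - x0))) (at r)"
        by (auto intro!: derivative_eq_intros)
      then have "((\<lambda>r. g (x0 + r *\<^sub>R (y - x0))) has_derivative (\<lambda>h. (h *\<^sub>R (y - x0)) \<bullet> G (x0 + r *\<^sub>R (y - x0)))) (at r)"
        using g unfolding gderiv_def by (rule has_derivative_compose)
      then have "((\<lambda>r. g (x0 + r *\<^sub>R (y - x0))) has_real_derivative ((y - x0) \<bullet> G (x0 + r *\<^sub>R (y - x0)))) (at r)"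
        unfolding has_field_derivative_def by (rule has_derivative_eq_rhs) (auto simp: fun_eq_iff)
      then have "((\<lambda>r. ?h * r ^ ?d * g (x0 + r *\<^sub>R (y - x0))) has_real_derivative
          (?h * (real ?d * r ^ (?d - 1)) * g (x0 + r *\<^sub>R (y - x0)) + ?h * r ^ ?d * ((y - x0) \<bullet> G (x0 + r *\<^sub>R (y - x0))))) (at r)"
        by (auto intro!: derivative_eq_intros)
      moreover have "(?h * (real ?d * r ^ (?d - 1)) * g (x0 + r *\<^sub>R (y - x0)) + ?h * r ^ ?d * ((y - x0) \<bullet> G (x0 + r *\<^sub>R (y - x0)))) = f r"
        unfolding f_def by (subst (2) d[symmetric], subst power_add) (simp add: algebra_simps)
      ultimately show ?thesis
        using has_field_derivative_at_within has_real_derivative_iff_has_vector_derivative by metis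
    qed
    moreover have "continuous_on {0..1} f"
      unfolding f_def by (intro continuous_intros continuous_on_compose2[OF gc] continuous_on_compose2[OF G]) auto
    ultimately have "(LBINT r. indicator {0..1} r *\<^sub>R f r)
        = ?h * 1 ^ ?d * g (x0 + 1 *\<^sub>R (y - x0)) - ?h * 0 ^ ?d * g (x0 + 0 *\<^sub>R (y - x0))"
      by (intro integral_FTC_atLeastAtMost) auto
    then show "(LINT r:{0..1}|lborel. ?h * r ^ (?d - 1) *
        (real ?d * g (x0 + r *\<^sub>R (y - x0)) + (x0 + r *\<^sub>R (y - x0) - x0) \<bullet> G (x0 + r *\<^sub>R (y - x0)))) = ?h * g y"
      by (simp add: f_def set_lebesgue_integral_def)
  qed simp
  finally show ?thesis by simp
qed

end

section \<open>The divergence theorem on a simplex\<close>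

text \<open>The sign that turns the fixed normal m into the outer normal of K. For a facet of a
  simplex, a normal that does not point outward points inward, so -1 is the right default.\<close>

definition orient :: "(real^'n) set \<Rightarrow> real^'n \<Rightarrow> (real^'n) set \<Rightarrow> real" where
  "orient F m K = (if points_out F m K then 1 else - 1)"

definition unit_normals :: "(real^'n) set \<Rightarrow> ((real^'n) set \<Rightarrow> real^'n) \<Rightarrow> bool" where
  "unit_normals K m \<longleftrightarrow> (\<forall>F. F facet_of K \<longrightarrow> norm (m F) = 1 \<and> (\<forall>x\<in>F. \<forall>y\<in>F. (x - y) \<bullet> m F = 0))"

text \<open>For a unit normal m of F, the signed distance from the point a to the plane of F; it
  does not depend on the point chosen in F.\<close>

definition facet_height :: "(real^'n) set \<Rightarrow> real^'n \<Rightarrow> real^'n \<Rightarrow> real" where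
  "facet_height F m a = (SOME y. y \<in> F) \<bullet> m - a \<bullet> m"

text \<open>By affine independence facets correspond bijectively to their opposite vertices, so sums
  over facets can be reindexed by vertices.\<close>

lemma simplex_vertices:
  fixes K :: "(real^'n) set"
  assumes "int CARD('n) simplex K"
  obtains C where "finite C" "C \<noteq> {}" "K = convex hull C" "affine hull C = UNIV"
    "{F. F facet_of K} = (\<lambda>a. convex hull (C - {a})) ` C" "inj_on (\<lambda>a. convex hull (C - {a})) C"
    "card C = CARD('n) + 1"
proof -
  obtain C where C: "finite C" "\<not> affine_dependent C" "int (card C) = int CARD('n) + 1" "K = convex hull C"
    using assms by (auto simp: simplex)
  have cardC: "card C = CARD('n) + 1" using C by linarith
  have "aff_dim C = int DIM(real^'n)" using aff_dim_affine_independent[OF C(2)] C(3) by simp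
  then have "affine hull C = UNIV" using aff_dim_eq_full by blast
  moreover have "C - {a} \<noteq> {}" if "a \<in> C" for a
  proof
    assume "C - {a} = {}"
    then have "card C \<le> 1" using card_mono[of "{a}" C] by auto
    then show False using cardC by simp
  qed
  then have "{F. F facet_of K} = (\<lambda>a. convex hull (C - {a})) ` C"
    using facet_of_convex_hull_affine_independent[OF C(2)] by (auto simp: C(4))
  moreover have "inj_on (\<lambda>a. convex hull (C - {a})) C"
  proof (rule inj_onI, rule ccontr)
    fix a b assume ab: "a \<in> C" "b \<in> C" "convex hull (C - {a}) = convex hull (C - {b})" "a \<noteq> b"
    then have "a \<in> convex hull (C - {a})" by (metis DiffI empty_iff hull_inc insert_iff)
    then have "a \<in> affine hull (C - {a})" using convex_hull_subset_affine_hull by blast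
    then show False using C(2) ab(1) by (auto simp: affine_dependent_def)
  qed
  moreover have "C \<noteq> {}" using cardC by auto
  ultimately show thesis using that C cardC by blast
qed

text \<open>The height h is nonzero, since otherwise all vertices would lie in one hyperplane. A
  point u a + v b of the cone has distance u |h| from the base plane, which gives the slab bounds;
  the sign of h decides on which side K lies.\<close>

lemma simplex_facet_apex:
  fixes K :: "(real^'n) set"
  assumes K: "K = convex hull C" "affine hull C = UNIV" "a \<in> C" "finite C"
    and F: "F = convex hull (C - {a})" "F \<noteq> {}"
    and m: "norm m = 1" "\<forall>x\<in>F. \<forall>y\<in>F. (x - y) \<bullet> m = 0"
  defines "h \<equiv> facet_height F m a"
  shows "flat_facet F m (a \<bullet> m + h)" "convex F" "h \<noteq> 0" "K = convex hull (insert a F)"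
    "orient F m K = sgn h" "\<And>z. z \<in> K \<Longrightarrow> 0 \<le> sgn h * (a \<bullet> m + h - z \<bullet> m) \<and> sgn h * (a \<bullet> m + h - z \<bullet> m) \<le> \<bar>h\<bar>"
    "h < 0 \<Longrightarrow> points_out F (- m) K"
proof -
  define c where "c = a \<bullet> m + h"
  have "(SOME y. y \<in> F) \<in> F" using F(2) by (simp add: some_in_eq)
  then have plane: "y \<bullet> m = c" if "y \<in> F" for y
    using m(2)[THEN bspec, OF that, THEN bspec, of "SOME y. y \<in> F"] by (simp add: c_def h_def facet_height_def inner_diff_left)
  have "compact F" unfolding F(1) using K(4) by (simp add: finite_imp_compact_convex_hull)
  then have "flat_facet F m c" by (intro flat_facet.intro F(2) m(1) plane)
  then show "flat_facet F m (a \<bullet> m + h)" by (simp only: c_def)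
  show convF: "convex F" by (simp add: F(1))
  show "h \<noteq> 0"
  proof
    assume "h = 0"
    have "v \<bullet> m = c" if "v \<in> C" for v
    proof (cases "v = a")
      case True
      then show ?thesis using \<open>h = 0\<close> by (simp add: c_def)
    next
      case False
      then show ?thesis using that by (intro plane) (simp add: F(1) hull_inc)
    qed
    then have "C \<subseteq> {x. m \<bullet> x = c}" by (auto simp: inner_commute)
    then have "affine hull C \<subseteq> {x. m \<bullet> x = c}" by (intro hull_minimal affine_hyperplane)
    then have "0 \<in> {x. m \<bullet> x = c}" "m \<in> {x. m \<bullet> x = c}" using K(2) by blast+
    then show False using m(1) by simp
  qed
  show KF: "K = convex hull (insert a F)"
  proof -
    have "convex hull (insert a (convex hull (C - {a}))) = convex hull (insert a (C - {a}))"
      by (metis hull_insert)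
    also have "\<dots> = K" using K(1,3) by (simp add: insert_absorb)
    finally show ?thesis by (simp only: F(1))
  qed
  have slab: "0 \<le> sgn h * (c - z \<bullet> m) \<and> sgn h * (c - z \<bullet> m) \<le> \<bar>h\<bar>" if "z \<in> K" for z
  proof -
    have "z \<in> convex hull (insert a F)" using \<open>z \<in> K\<close> KF by simp
    then obtain u v b where uv: "0 \<le> u" "0 \<le> v" "u + v = 1" "b \<in> F" "z = u *\<^sub>R a + v *\<^sub>R b"
      using F(2) convF by (auto simp: convex_hull_insert hull_same)
    have v: "v = 1 - u" using uv(3) by simp
    have "z \<bullet> m = u * (a \<bullet> m) + v * c" by (simp add: uv(5) inner_add_left plane[OF uv(4)])
    also have "\<dots> = c - u * h" by (simp add: v c_def algebra_simps)
    finally have "sgn h * (c - z \<bullet> m) = u * \<bar>h\<bar>" by (simp add: sgn_if)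
    moreover have "u * \<bar>h\<bar> \<le> 1 * \<bar>h\<bar>" using uv(2,3) by (intro mult_right_mono) auto
    ultimately show ?thesis using uv(1) by simp
  qed
  then show "0 \<le> sgn h * (a \<bullet> m + h - z \<bullet> m) \<and> sgn h * (a \<bullet> m + h - z \<bullet> m) \<le> \<bar>h\<bar>" if "z \<in> K" for z
    using that by (simp only: c_def)
  have aK: "a \<in> K" using K(1,3) by (simp add: hull_inc)
  have "points_out F m K \<longleftrightarrow> 0 < h"
  proof
    assume "points_out F m K"
    moreover obtain y where y: "y \<in> F" using F(2) by blast
    ultimately have "(a - y) \<bullet> m \<le> 0" using aK unfolding points_out_def by blast
    then have "0 \<le> h" using plane[OF y] by (simp add: inner_diff_left c_def)
    then show "0 < h" using \<open>h \<noteq> 0\<close> by simp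
  next
    assume h: "0 < h"
    show "points_out F m K" unfolding points_out_def
    proof (intro ballI)
      fix x y assume "x \<in> K" "y \<in> F"
      then show "(x - y) \<bullet> m \<le> 0" using slab[of x] plane[of y] h by (simp add: inner_diff_left)
    qed
  qed
  then show "orient F m K = sgn h" using \<open>h \<noteq> 0\<close> by (simp add: orient_def sgn_if)
  show "points_out F (- m) K" if "h < 0" unfolding points_out_def
  proof (intro ballI)
    fix x y assume "x \<in> K" "y \<in> F"
    then show "(x - y) \<bullet> - m \<le> 0" using slab[of x] plane[of y] \<open>h < 0\<close> by (simp add: inner_diff_left)
  qed
qed

text \<open>Hides the vertex set: the later arguments need only an apex, the base plane and the slab
  containing K.\<close>

lemma facet_apex:
  fixes K :: "(real^'n) set"
  assumes "int CARD('n) simplex K" "unit_normals K m" "F facet_of K"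
  obtains a c where "a \<in> K" "flat_facet F (m F) c" "convex F" "a \<bullet> m F \<noteq> c" "K = convex hull (insert a F)"
    "orient F (m F) K = sgn (c - a \<bullet> m F)"
    "\<And>z. z \<in> K \<Longrightarrow> 0 \<le> sgn (c - a \<bullet> m F) * (c - z \<bullet> m F) \<and> sgn (c - a \<bullet> m F) * (c - z \<bullet> m F) \<le> \<bar>c - a \<bullet> m F\<bar>"
    "points_out F (m F) K \<or> points_out F (- m F) K"
proof -
  obtain C where C: "finite C" "C \<noteq> {}" "K = convex hull C" "affine hull C = UNIV"
    "{F. F facet_of K} = (\<lambda>a. convex hull (C - {a})) ` C" "inj_on (\<lambda>a. convex hull (C - {a})) C"
    "card C = CARD('n) + 1"
    by (rule simplex_vertices[OF assms(1)])
  obtain a where a: "a \<in> C" "F = convex hull (C - {a})" using C(5) assms(3) by blast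
  have F: "F \<noteq> {}" "norm (m F) = 1" "\<forall>x\<in>F. \<forall>y\<in>F. (x - y) \<bullet> m F = 0"
    using assms by (auto simp: facet_of_def unit_normals_def)
  note A = simplex_facet_apex[OF C(3,4) a(1) C(1) a(2) F]
  define h where "h = facet_height F (m F) a"
  have h: "a \<bullet> m F + h - a \<bullet> m F = h" by simp
  show thesis
  proof (rule that[of a "a \<bullet> m F + h"], unfold h)
    show "points_out F (m F) K \<or> points_out F (- m F) K"
    proof (cases "h < 0")
      case True
      then show ?thesis using A(7) by (simp only: h_def simp_thms)
    next
      case False
      then have "orient F (m F) K = 1" using A(3,5) by (simp add: h_def)
      then show ?thesis unfolding orient_def by (metis one_neq_neg_one)
    qed
    show "a \<in> K" using a(1) C(3) by (simp add: hull_inc)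
    show "a \<bullet> m F \<noteq> a \<bullet> m F + h" using A(3) by (simp add: h_def)
    show "0 \<le> sgn h * (a \<bullet> m F + h - z \<bullet> m F) \<and> sgn h * (a \<bullet> m F + h - z \<bullet> m F) \<le> \<bar>h\<bar>" if "z \<in> K" for z
      unfolding h_def by (rule A(6)[OF that])
    show "flat_facet F (m F) (a \<bullet> m F + h)" unfolding h_def by (rule A(1))
    show "orient F (m F) K = sgn h" unfolding h_def by (rule A(5))
  qed (rule A(2) A(4))+
qed

lemma finite_facets: "int CARD('n) simplex K \<Longrightarrow> finite {F::(real^'n) set. F facet_of K}"
  by (elim simplex_vertices) (metis finite_imageI)

lemma card_facets: "int CARD('n) simplex K \<Longrightarrow> card {F::(real^'n) set. F facet_of K} = CARD('n) + 1"
  by (elim simplex_vertices) (metis card_image)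

lemma set_integrable_compact:
  fixes g :: "'a::euclidean_space \<Rightarrow> real"
  assumes "compact K" "continuous_on UNIV g"
  shows "set_integrable lborel K g"
  unfolding set_integrable_def
  by (rule borel_integrable_compact[OF assms(1) continuous_on_subset[OF assms(2) subset_UNIV]])

lemma set_integral_sum:
  fixes f :: "'i \<Rightarrow> 'a \<Rightarrow> 'b::{banach, second_countable_topology}"
  assumes "\<And>i. i \<in> I \<Longrightarrow> set_integrable M A (f i)"
  shows "(LINT x:A|M. (\<Sum>i\<in>I. f i x)) = (\<Sum>i\<in>I. LINT x:A|M. f i x)"
  using assms unfolding set_lebesgue_integral_def set_integrable_def
  by (simp add: scaleR_sum_right)

text \<open>A constant direction \<open>e\<close> is a combination \<open>- (\<Sum>a. \<alpha> a (x - a))\<close> over the vertices, which reduces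
  the divergence theorem on a simplex to \<open>divergence_cone\<close>.\<close>

lemma divergence_simplex_direction:
  fixes K :: "(real^'n) set"
  assumes K: "int CARD('n) simplex K" and m: "unit_normals K m"
    and g: "\<And>x. GDERIV g x :> G x" and G: "continuous_on UNIV G"
  shows "(LINT z:K|lborel. e \<bullet> G z)
    = (\<Sum>F | F facet_of K. orient F (m F) K * (e \<bullet> m F) * (LINT y|facet_measure F (m F). g y))"
proof -
  obtain C where C: "finite C" "C \<noteq> {}" "K = convex hull C" "affine hull C = UNIV"
    "{F. F facet_of K} = (\<lambda>a. convex hull (C - {a})) ` C" "inj_on (\<lambda>a. convex hull (C - {a})) C"
    "card C = CARD('n) + 1"
    by (rule simplex_vertices[OF K])
  have gc: "continuous_on UNIV g" using GDERIV_continuous_on g by blast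
  have cK: "compact K" using K by (rule compact_simplex)
  obtain a0 where a0: "a0 \<in> C" using C(2) by blast
  \<comment> \<open>The vertices span the whole space affinely, so \<open>a0 + e\<close> is an
    affine combination of them. Subtracting \<open>a0\<close> leaves weights \<alpha> with sum zero
    and weighted vertex sum e.\<close>
  have "a0 + e \<in> affine hull C" by (simp add: C(4))
  then obtain u where u: "sum u C = 1" "(\<Sum>v\<in>C. u v *\<^sub>R v) = a0 + e"
    using affine_hull_finite[OF C(1)] by auto
  define \<alpha> where "\<alpha> v = u v - (if v = a0 then 1 else 0)" for v
  have \<alpha>: "sum \<alpha> C = 0" using u a0 C(1) by (simp add: \<alpha>_def sum_subtractf)
  have \<alpha>e: "(\<Sum>v\<in>C. \<alpha> v *\<^sub>R v) = e"
    using u a0 C(1) by (simp add: \<alpha>_def algebra_simps sum_subtractf if_distrib[of "\<lambda>c. c *\<^sub>R _"] cong: if_cong)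
  define Fc where "Fc a = convex hull (C - {a})" for a
  define h where "h a = facet_height (Fc a) (m (Fc a)) a" for a
  have Fc: "Fc a facet_of K" if "a \<in> C" for a using C(5) that by (auto simp: Fc_def)
  have A: "flat_facet (Fc a) (m (Fc a)) (a \<bullet> m (Fc a) + h a)" "convex (Fc a)" "h a \<noteq> 0"
    "K = convex hull (insert a (Fc a))" "orient (Fc a) (m (Fc a)) K = sgn (h a)" if "a \<in> C" for a
  proof -
    have "Fc a \<noteq> {}" "norm (m (Fc a)) = 1" "\<forall>x\<in>Fc a. \<forall>y\<in>Fc a. (x - y) \<bullet> m (Fc a) = 0"
      using Fc[OF that] m by (simp_all add: facet_of_def unit_normals_def)
    note B = simplex_facet_apex[OF C(3,4) that C(1) Fc_def this]
    show "flat_facet (Fc a) (m (Fc a)) (a \<bullet> m (Fc a) + h a)" unfolding h_def by (rule B(1))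
    show "convex (Fc a)" by (rule B(2))
    show "h a \<noteq> 0" unfolding h_def by (rule B(3))
    show "K = convex hull (insert a (Fc a))" by (rule B(4))
    show "orient (Fc a) (m (Fc a)) K = sgn (h a)" unfolding h_def by (rule B(5))
  qed
  have cone: "(LINT z:K|lborel. real CARD('n) * g z + (z - a) \<bullet> G z) = \<bar>h a\<bar> * (LINT y|facet_measure (Fc a) (m (Fc a)). g y)"
    if "a \<in> C" for a
    using flat_facet.divergence_cone[OF A(1,2)[OF that] _ g G, of a] A(3,4)[OF that] by simp
  \<comment> \<open>All vertices other than a lie in the plane of the opposite facet, so only the
    height of a survives. Multiplied by the orientation sgn h this becomes -\<alpha> |h|, the
    coefficient that the cone formula produces.\<close>
  have eh: "e \<bullet> m (Fc a) = - \<alpha> a * h a" if a: "a \<in> C" for a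
  proof -
    interpret flat_facet "Fc a" "m (Fc a)" "a \<bullet> m (Fc a) + h a" by (rule A(1)[OF a])
    have "e \<bullet> m (Fc a) = (\<Sum>v\<in>C. \<alpha> v * (v \<bullet> m (Fc a)))" by (simp add: \<alpha>e[symmetric] inner_sum_left)
    also have "\<dots> = \<alpha> a * (a \<bullet> m (Fc a)) + (\<Sum>v\<in>C - {a}. \<alpha> v * (v \<bullet> m (Fc a)))"
      using a C(1) by (simp add: sum.remove)
    also have "(\<Sum>v\<in>C - {a}. \<alpha> v * (v \<bullet> m (Fc a))) = (\<Sum>v\<in>C - {a}. \<alpha> v * (a \<bullet> m (Fc a) + h a))"
      by (intro sum.cong refl) (use F_plane in \<open>auto simp: Fc_def hull_inc\<close>)
    also have "\<dots> = (sum \<alpha> C - \<alpha> a) * (a \<bullet> m (Fc a) + h a)"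
      using a C(1) by (simp add: sum_distrib_right[symmetric] sum_diff1)
    also have "\<alpha> a * (a \<bullet> m (Fc a)) + \<dots> = - \<alpha> a * h a" by (simp add: \<alpha> algebra_simps)
    finally show ?thesis .
  qed
  have "e \<bullet> G z = (\<Sum>a\<in>C. - \<alpha> a * (real CARD('n) * g z + (z - a) \<bullet> G z))" for z
  proof -
    have "(\<Sum>a\<in>C. - \<alpha> a * (real CARD('n) * g z + (z - a) \<bullet> G z))
      = - (sum \<alpha> C) * (real CARD('n) * g z + z \<bullet> G z) + (\<Sum>a\<in>C. \<alpha> a *\<^sub>R a) \<bullet> G z"
      unfolding inner_sum_left sum_negf[symmetric] sum_distrib_right sum.distrib[symmetric]
      by (rule sum.cong) (auto simp: algebra_simps inner_diff_left)
    then show ?thesis by (simp add: \<alpha> \<alpha>e)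
  qed
  then have "(LINT z:K|lborel. e \<bullet> G z) = (LINT z:K|lborel. (\<Sum>a\<in>C. - \<alpha> a * (real CARD('n) * g z + (z - a) \<bullet> G z)))"
    by simp
  also have "\<dots> = (\<Sum>a\<in>C. (LINT z:K|lborel. - \<alpha> a * (real CARD('n) * g z + (z - a) \<bullet> G z)))"
    by (rule set_integral_sum) (use cK gc G in \<open>auto intro!: set_integrable_compact continuous_intros\<close>)
  also have "\<dots> = (\<Sum>a\<in>C. orient (Fc a) (m (Fc a)) K * (e \<bullet> m (Fc a)) * (LINT y|facet_measure (Fc a) (m (Fc a)). g y))"
  proof (rule sum.cong)
    fix a assume a: "a \<in> C"
    have "(LINT z:K|lborel. - \<alpha> a * (real CARD('n) * g z + (z - a) \<bullet> G z))
      = - \<alpha> a * (\<bar>h a\<bar> * (LINT y|facet_measure (Fc a) (m (Fc a)). g y))"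
      using cone[OF a] by (simp only: set_integral_mult_right)
    also have "\<dots> = orient (Fc a) (m (Fc a)) K * (e \<bullet> m (Fc a)) * (LINT y|facet_measure (Fc a) (m (Fc a)). g y)"
      by (simp add: eh[OF a] A(5)[OF a] abs_sgn)
    finally show "(LINT z:K|lborel. - \<alpha> a * (real CARD('n) * g z + (z - a) \<bullet> G z)) = \<dots>" .
  qed simp
  also have "\<dots> = (\<Sum>F | F facet_of K. orient F (m F) K * (e \<bullet> m F) * (LINT y|facet_measure F (m F). g y))"
    unfolding C(5) using C(6) by (simp add: sum.reindex Fc_def)
  finally show ?thesis .
qed

lemma compact_measure_facet_of:
  assumes "int CARD('n) simplex (K::(real^'n) set)" "unit_normals K m" "F facet_of K"
  shows "compact_measure (facet_measure F (m F))"
  by (rule facet_apex[OF assms]) (rule flat_facet.compact_measure_facet)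

text \<open>The directional version for the i-th unit vector and the scalar field \<phi> w_i, summed
  over i.\<close>

theorem divergence_simplex:
  fixes K :: "(real^'n) set" and J :: "real^'n \<Rightarrow> real^'n^'n"
  assumes K: "int CARD('n) simplex K" and m: "unit_normals K m"
    and \<phi>: "\<And>x. GDERIV \<phi> x :> G x" "continuous_on UNIV G"
    and w: "\<And>x. (w has_derivative (\<lambda>h. J x *v h)) (at x)" "continuous_on UNIV J"
  shows "(LINT z:K|lborel. w z \<bullet> G z + \<phi> z * (\<Sum>i\<in>UNIV. J z $ i $ i))
    = (\<Sum>F | F facet_of K. orient F (m F) K * (LINT y|facet_measure F (m F). \<phi> y * (w y \<bullet> m F)))"
proof -
  have \<phi>c: "continuous_on UNIV \<phi>" using GDERIV_continuous_on \<phi> by blast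
  have wc: "continuous_on UNIV w"
    using w(1) by (meson continuous_at_imp_continuous_on has_derivative_continuous)
  have cK: "compact K" using K by (rule compact_simplex)
  define H where "H i x = \<phi> x *\<^sub>R (row i (J x)) + (w x $ i) *\<^sub>R G x" for i x
  have dw: "GDERIV (\<lambda>x. w x $ i) x :> row i (J x)" for i x
  proof -
    have "((\<lambda>x. w x $ i) has_derivative (\<lambda>h. (J x *v h) $ i)) (at x)"
      using bounded_linear.has_derivative[OF bounded_linear_vec_nth w(1)] .
    moreover have "(J x *v h) $ i = h \<bullet> row i (J x)" for h
      by (simp add: matrix_vector_mult_def row_def inner_vec_def mult.commute)
    ultimately show ?thesis by (simp add: gderiv_def)
  qed
  have H: "GDERIV (\<lambda>x. \<phi> x * w x $ i) x :> H i x" for i x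
    unfolding H_def by (rule GDERIV_mult[OF \<phi>(1) dw])
  have rowc: "continuous_on UNIV (\<lambda>x. row i (J x))" for i
    unfolding row_def by (intro continuous_intros w)
  have Hc: "continuous_on UNIV (H i)" for i
    unfolding H_def by (intro continuous_intros rowc \<phi>c \<phi> wc)
  have "(LINT z:K|lborel. w z \<bullet> G z + \<phi> z * (\<Sum>i\<in>UNIV. J z $ i $ i)) = (LINT z:K|lborel. (\<Sum>i\<in>UNIV. axis i 1 \<bullet> H i z))"
  proof -
    have "w z \<bullet> G z + \<phi> z * (\<Sum>i\<in>UNIV. J z $ i $ i) = (\<Sum>i\<in>UNIV. axis i 1 \<bullet> H i z)" for z
      by (simp add: H_def inner_axis' row_def sum.distrib sum_distrib_left inner_vec_def[of "w z"] mult_ac)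
    then show ?thesis by simp
  qed
  also have "\<dots> = (\<Sum>i\<in>UNIV. (LINT z:K|lborel. axis i 1 \<bullet> H i z))"
    by (intro set_integral_sum set_integrable_compact[OF cK] continuous_on_inner continuous_on_const Hc)
  also have "\<dots> = (\<Sum>i\<in>UNIV. \<Sum>F | F facet_of K. orient F (m F) K * (axis i 1 \<bullet> m F) *
      (LINT y|facet_measure F (m F). \<phi> y * w y $ i))"
    by (simp only: divergence_simplex_direction[OF K m H Hc])
  also have "\<dots> = (\<Sum>F | F facet_of K. \<Sum>i\<in>UNIV. orient F (m F) K * (axis i 1 \<bullet> m F) *
      (LINT y|facet_measure F (m F). \<phi> y * w y $ i))"
    by (rule sum.swap)
  also have "\<dots> = (\<Sum>F | F facet_of K. orient F (m F) K * (LINT y|facet_measure F (m F). \<phi> y * (w y \<bullet> m F)))"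
  proof (rule sum.cong)
    fix F assume "F \<in> {F. F facet_of K}"
    then have cm: "compact_measure (facet_measure F (m F))" using compact_measure_facet_of[OF K m] by simp
    have "(LINT y|facet_measure F (m F). \<phi> y * (w y \<bullet> m F))
      = (LINT y|facet_measure F (m F). (\<Sum>i\<in>UNIV. (axis i 1 \<bullet> m F) * (\<phi> y * w y $ i)))"
      by (simp add: inner_axis' inner_vec_def[where x = "w y" for y] sum_distrib_left mult_ac)
    also have "\<dots> = (\<Sum>i\<in>UNIV. (axis i 1 \<bullet> m F) * (LINT y|facet_measure F (m F). \<phi> y * w y $ i))"
      by (subst Bochner_Integration.integral_sum)
        (auto intro!: integrable_mult_right compact_measure_integrable[OF cm] continuous_intros \<phi>c wc)
    finally show "(\<Sum>i\<in>UNIV. orient F (m F) K * (axis i 1 \<bullet> m F) * (LINT y|facet_measure F (m F). \<phi> y * w y $ i))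
      = orient F (m F) K * (LINT y|facet_measure F (m F). \<phi> y * (w y \<bullet> m F))"
      by (simp add: sum_distrib_left mult.assoc)
  qed simp
  finally show ?thesis .
qed

section \<open>Meshes\<close>

lemma simplex_full_dim:
  fixes K :: "(real^'n) set"
  assumes "int CARD('n) simplex K"
  shows "affine hull K = UNIV" "convex K" "compact K" "interior K \<noteq> {}" "rel_interior K = interior K"
    "closure (interior K) = K" "aff_dim K = int CARD('n)"
proof -
  show ad: "aff_dim K = int CARD('n)" using aff_dim_simplex[OF assms] .
  then show ah: "affine hull K = UNIV" using aff_dim_eq_full[of K] by simp
  show cv: "convex K" and cm: "compact K" using assms convex_simplex compact_simplex by auto
  show ri: "rel_interior K = interior K" using ah by (rule rel_interior_interior)
  have "K \<noteq> {}" using ah by auto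
  then show ne: "interior K \<noteq> {}" using cv ri rel_interior_eq_empty by metis
  show "closure (interior K) = K"
    using convex_closure_interior[OF cv ne] compact_imp_closed[OF cm] by simp
qed

text \<open>Both sides are affine sets of dimension d - 1, and one contains the other.\<close>

lemma facet_affine_hull:
  fixes K :: "(real^'n) set"
  assumes K: "int CARD('n) simplex K" and F: "F facet_of K" and m: "m \<noteq> 0" and c: "\<And>y. y \<in> F \<Longrightarrow> y \<bullet> m = c"
  shows "affine hull F = {y. y \<bullet> m = c}"
proof -
  have H: "{y. y \<bullet> m = c} = {y. m \<bullet> y = c}" by (simp add: inner_commute)
  show ?thesis
  proof (rule affine_dim_equal)
    show "affine {y. y \<bullet> m = c}" unfolding H by (rule affine_hyperplane)
    show "affine hull F \<noteq> {}" using F by (simp add: facet_of_def)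
    show "affine hull F \<subseteq> {y. y \<bullet> m = c}"
      unfolding H by (intro hull_minimal affine_hyperplane) (use c in \<open>auto simp: inner_commute\<close>)
    show "aff_dim (affine hull F) = aff_dim {y. y \<bullet> m = c}"
      unfolding H using F m simplex_full_dim(7)[OF K] aff_dim_hyperplane[OF m, of c]
      by (simp add: facet_of_def)
  qed simp
qed

lemma not_both_sides:
  assumes "int CARD('n) simplex (K::(real^'n) set)" "unit_normals K m" "F facet_of K"
  shows "\<not> (points_out F (m F) K \<and> points_out F (- m F) K)"
proof
  assume P: "points_out F (m F) K \<and> points_out F (- m F) K"
  show False
  proof (rule facet_apex[OF assms])
    fix a c assume a: "a \<in> K" "flat_facet F (m F) c" "a \<bullet> m F \<noteq> c"
    obtain y where y: "y \<in> F" using a(2) by (auto simp: flat_facet_def)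
    have "(a - y) \<bullet> m F \<le> 0" "(a - y) \<bullet> - m F \<le> 0" using P a(1) y unfolding points_out_def by blast+
    then have "a \<bullet> m F = y \<bullet> m F" by (simp add: inner_diff_left)
    then show False using a y by (simp add: flat_facet_def)
  qed
qed

text \<open>The intersection of two members is a face of each. If the interiors met, this face would
  be all of either simplex, so each would contain the other.\<close>

lemma triangulation_interiors:
  fixes K K' :: "(real^'n) set"
  assumes T: "triangulation \<T>" "K \<in> \<T>" "K' \<in> \<T>" "K \<noteq> K'"
    and S: "int CARD('n) simplex K" "int CARD('n) simplex K'"
  shows "interior K \<inter> interior K' = {}"
proof (rule ccontr)
  assume ne: "interior K \<inter> interior K' \<noteq> {}"
  have sub: "A \<subseteq> B" if "A \<in> \<T>" "B \<in> \<T>" "int CARD('n) simplex A" "interior A \<inter> interior B \<noteq> {}" for A B :: "(real^'n) set"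
  proof -
    have f: "(A \<inter> B) face_of A" using T(1) that by (auto simp: triangulation_def)
    have "A \<inter> B \<inter> rel_interior A \<noteq> {}"
      using that(4) interior_subset unfolding simplex_full_dim(5)[OF that(3)] by blast
    then have "A \<inter> B = A" using face_of_eq[OF f face_of_refl[OF simplex_full_dim(2)[OF that(3)]]]
      using f face_of_disjoint_rel_interior by blast
    then show ?thesis by blast
  qed
  show False using sub[of K K'] sub[of K' K] T S ne by blast
qed

text \<open>A hyperplane separating the disjoint interiors contains the common facet, hence is its
  plane, so the two apexes lie strictly on opposite sides of it. Thus each side of a facet carries
  at most one element.\<close>

lemma triangulation_facet_sides:
  fixes K K' :: "(real^'n) set"
  assumes T: "triangulation \<T>" "K \<in> \<T>" "K' \<in> \<T>" "K \<noteq> K'"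
    and S: "int CARD('n) simplex K" "int CARD('n) simplex K'"
    and m: "unit_normals K m" "unit_normals K' m" and F: "F facet_of K" "F facet_of K'"
    and P: "points_out F \<nu> K" "points_out F \<nu> K'" "\<nu> = m F \<or> \<nu> = - m F"
  shows False
proof -
  obtain a c where a: "a \<in> K" "flat_facet F (m F) c" "a \<bullet> m F \<noteq> c"
    by (rule facet_apex[OF S(1) m(1) F(1)])
  obtain a' c' where a': "a' \<in> K'" "flat_facet F (m F) c'" "a' \<bullet> m F \<noteq> c'"
    by (rule facet_apex[OF S(2) m(2) F(2)])
  interpret flat_facet F "m F" c by (rule a(2))
  obtain y0 where y0: "y0 \<in> F" using F_ne by blast
  have c': "c' = c" using a'(2) y0 F_plane by (auto simp: flat_facet_def)
  have conv: "convex (interior K)" "convex (interior K')"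
    using simplex_full_dim(2) S by (auto intro: convex_interior)
  have ne: "interior K \<noteq> {}" "interior K' \<noteq> {}"
    using simplex_full_dim(4) S by auto
  obtain p b where p: "p \<noteq> 0" "\<And>x. x \<in> interior K \<Longrightarrow> p \<bullet> x \<le> b" "\<And>x. x \<in> interior K' \<Longrightarrow> b \<le> p \<bullet> x"
    using separating_hyperplane_sets[OF conv ne triangulation_interiors[OF T S]] by metis
  have pK: "p \<bullet> x \<le> b" if "x \<in> K" for x
  proof -
    have "closure (interior K) \<subseteq> {x. p \<bullet> x \<le> b}"
      by (intro closure_minimal closed_halfspace_le) (use p in auto)
    then show ?thesis using that simplex_full_dim(6)[OF S(1)] by auto
  qed
  have pK': "b \<le> p \<bullet> x" if "x \<in> K'" for x
  proof -
    have "closure (interior K') \<subseteq> {x. p \<bullet> x \<ge> b}"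
      by (intro closure_minimal closed_halfspace_ge) (use p in auto)
    then show ?thesis using that simplex_full_dim(6)[OF S(2)] by auto
  qed
  have "F \<subseteq> K" "F \<subseteq> K'" using F by (auto dest: facet_of_imp_subset)
  then have pF: "p \<bullet> y = b" if "y \<in> F" for y using pK pK' that by (meson antisym subsetD)
  have hull: "affine hull F = {y. y \<bullet> m F = c}"
    by (rule facet_affine_hull[OF S(1) F(1)]) (use norm_m F_plane in auto)
  have "affine hull F \<subseteq> {y. p \<bullet> y = b}" by (intro hull_minimal affine_hyperplane) (use pF in auto)
  then have *: "p \<bullet> y = b" if "y \<bullet> m F = c" for y using that hull by auto
  \<comment> \<open>The part of the separating normal tangential to F. It vanishes because the
    functional p is constant on the plane of F.\<close>
  define q where "q = p - (p \<bullet> m F) *\<^sub>R m F"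
  have qm: "q \<bullet> m F = 0" by (simp add: q_def inner_diff_left m_m)
  have "(y0 + q) \<bullet> m F = c" using F_plane[OF y0] qm by (simp add: inner_add_left)
  then have "p \<bullet> q = 0" using *[of "y0 + q"] pF[OF y0] by (simp add: inner_add_right)
  then have "q \<bullet> q = 0" using qm by (simp add: q_def[of] inner_diff_left inner_commute)
  then have pm: "p = (p \<bullet> m F) *\<^sub>R m F" by (simp add: q_def)
  define \<alpha> where "\<alpha> = p \<bullet> m F"
  have \<alpha>: "\<alpha> \<noteq> 0" using pm p(1) by (auto simp: \<alpha>_def)
  have p\<alpha>: "p \<bullet> x = \<alpha> * (x \<bullet> m F)" for x using arg_cong[OF pm, of "\<lambda>z. z \<bullet> x"] by (simp add: \<alpha>_def inner_commute)
  have b: "b = \<alpha> * c" using pF[OF y0] F_plane[OF y0] p\<alpha> by simp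
  have 1: "\<alpha> * (a \<bullet> m F - c) \<le> 0" using pK[OF a(1)] by (simp add: b p\<alpha> algebra_simps)
  have 2: "\<alpha> * (a' \<bullet> m F - c) \<ge> 0" using pK'[OF a'(1)] by (simp add: b p\<alpha> algebra_simps)
  have 3: "(a - y0) \<bullet> \<nu> \<le> 0" "(a' - y0) \<bullet> \<nu> \<le> 0" using P a(1) a'(1) y0 unfolding points_out_def by blast+
  from P(3) show False
  proof
    assume "\<nu> = m F"
    then have "a \<bullet> m F - c < 0" "a' \<bullet> m F - c < 0"
      using 3 a(3) a'(3) F_plane[OF y0] c' by (auto simp: inner_diff_left)
    then show False using 1 2 \<alpha> by (metis linorder_neqE_linordered_idom mult_neg_neg mult_pos_neg not_less)
  next
    assume "\<nu> = - m F"
    then have "a \<bullet> m F - c > 0" "a' \<bullet> m F - c > 0"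
      using 3 a(3) a'(3) F_plane[OF y0] c' by (auto simp: inner_diff_left)
    then show False using 1 2 \<alpha> by (metis linorder_neqE_linordered_idom mult_pos_pos mult_neg_pos not_less)
  qed
qed

text \<open>The intersection of F and F' is a face of F that meets its relative interior, hence all
  of F. So F is a face of F', and the equal dimensions exclude a proper one.\<close>

lemma triangulation_facets_meet:
  fixes F F' :: "(real^'n) set"
  assumes T: "triangulation \<T>" "K \<in> \<T>" "K' \<in> \<T>"
    and S: "int CARD('n) simplex K" "int CARD('n) simplex K'"
    and F: "F facet_of K" "F' facet_of K'" and y: "y \<in> rel_interior F" "y \<in> F'"
  shows "F = F'"
proof -
  let ?I = "K \<inter> K'"
  have I: "?I face_of K" "?I face_of K'"
    using T unfolding triangulation_def by (blast, metis Int_commute)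
  have f: "F face_of K" "F' face_of K'" using F by (auto dest: facet_of_imp_face_of)
  have sub: "F \<subseteq> K" "F' \<subseteq> K'" using F by (auto dest: facet_of_imp_subset)
  have eq: "F \<inter> F' = (F \<inter> ?I) \<inter> (?I \<inter> F')" using sub by blast
  have "(F \<inter> ?I) face_of K" using f(1) I(1) by (rule face_of_Int)
  moreover have "(?I \<inter> F') face_of K"
  proof -
    have "(?I \<inter> F') face_of K'" using I(2) f(2) by (rule face_of_Int)
    then have "(?I \<inter> F') face_of ?I" by (rule face_of_subset) auto
    then show ?thesis using I(1) by (rule face_of_trans)
  qed
  ultimately have FF: "(F \<inter> F') face_of K" unfolding eq by (rule face_of_Int)
  then have FF1: "(F \<inter> F') face_of F" by (rule face_of_subset) (use sub in auto)
  have "F \<inter> F' = F"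
    using face_of_disjoint_rel_interior[OF FF1] y rel_interior_subset by blast
  then have "F \<subseteq> F'" by blast
  have "(F \<inter> ?I) face_of K'"
  proof -
    have "(F \<inter> ?I) face_of ?I" using \<open>(F \<inter> ?I) face_of K\<close> by (rule face_of_subset) auto
    then show ?thesis using I(2) by (rule face_of_trans)
  qed
  moreover have "F \<inter> ?I = F" using sub \<open>F \<subseteq> F'\<close> by blast
  ultimately have "F face_of K'" by simp
  then have "F face_of F'" using \<open>F \<subseteq> F'\<close> sub by (meson face_of_subset)
  moreover have "aff_dim F = aff_dim F'" using F S[THEN simplex_full_dim(7)] by (simp add: facet_of_def)
  moreover have "convex F'" using f(2) by (rule face_of_imp_convex)
  ultimately show ?thesis using face_of_aff_dim_lt by fastforce
qed

text \<open>A boundary point of a Lipschitz domain is a limit of exterior points, so \<open>\<Omega>\<close> has no slits.\<close>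

lemma Lipschitz_domain_interior_closure:
  fixes \<Omega> :: "(real^'n) set"
  assumes "Lipschitz_domain \<Omega>"
  shows "interior (closure \<Omega>) \<subseteq> \<Omega>"
proof (rule ccontr)
  assume "\<not> interior (closure \<Omega>) \<subseteq> \<Omega>"
  then obtain x where x: "x \<in> interior (closure \<Omega>)" "x \<notin> \<Omega>" by blast
  have op: "open \<Omega>" using assms by (simp add: Lipschitz_domain_def)
  then have "x \<in> frontier \<Omega>" using x interior_subset by (auto simp: frontier_def interior_open)
  then obtain e r L \<phi> where e: "norm e = 1" "0 < r" "L-lipschitz_on {y. y \<bullet> e = 0} \<phi>"
    "\<And>y. y \<in> ball x r \<Longrightarrow> y \<in> \<Omega> \<longleftrightarrow> \<phi> (y - (y \<bullet> e) *\<^sub>R e) < y \<bullet> e"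
    using assms unfolding Lipschitz_domain_def by metis
  have ee: "e \<bullet> e = 1" using e(1) by (simp add: dot_square_norm)
  define P where "P y = y - (y \<bullet> e) *\<^sub>R e" for y
  have P0: "P y \<bullet> e = 0" for y by (simp add: P_def inner_diff_left ee)
  have Pc: "continuous_on UNIV P" unfolding P_def by (intro continuous_intros)
  have "continuous_on {y. y \<bullet> e = 0} \<phi>" using e(3) by (rule lipschitz_on_continuous_on)
  then have \<phi>P: "continuous_on UNIV (\<lambda>y. \<phi> (P y))"
    by (rule continuous_on_compose2[OF _ Pc]) (use P0 in auto)
  have "open {y. y \<bullet> e < \<phi> (P y)}" by (intro open_Collect_less \<phi>P continuous_intros)
  then have opW: "open ({y. y \<bullet> e < \<phi> (P y)} \<inter> ball x r)" by auto
  have disj: "({y. y \<bullet> e < \<phi> (P y)} \<inter> ball x r) \<inter> \<Omega> = {}" using e(4) by (force simp: P_def)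
  have out: "({y. y \<bullet> e < \<phi> (P y)} \<inter> ball x r) \<inter> closure \<Omega> = {}"
    using open_Int_closure_eq_empty[OF opW] disj by blast
  obtain r' where r': "r' > 0" "ball x r' \<subseteq> interior (closure \<Omega>)"
    using x(1) open_contains_ball open_interior by blast
  \<comment> \<open>A step of length d from x against e leads below the graph, hence to an exterior
    point, which nevertheless still lies in the closure of \<Omega>.\<close>
  define d where "d = min r r' / 2"
  have d: "0 < d" "d < r" "d < r'" using e(2) r'(1) by (auto simp: d_def)
  have "x \<bullet> e \<le> \<phi> (P x)" using e(4)[of x] e(2) x(2) by (simp add: P_def)
  moreover have "P (x - d *\<^sub>R e) = P x" by (simp add: P_def inner_diff_left ee algebra_simps)
  moreover have "(x - d *\<^sub>R e) \<bullet> e = x \<bullet> e - d" by (simp add: inner_diff_left ee)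
  ultimately have "x - d *\<^sub>R e \<in> {y. y \<bullet> e < \<phi> (P y)} \<inter> ball x r"
    using d e(1) by (simp add: dist_norm)
  moreover have "x - d *\<^sub>R e \<in> closure \<Omega>"
    using r'(2) d e(1) interior_subset by (force simp: dist_norm)
  ultimately show False using out by blast
qed

section \<open>Facets of a mesh and their sides\<close>

locale dg =
  fixes D :: "('n::finite) discretization"
  assumes valid: "valid_discretization D"
begin

abbreviation "\<Omega> \<equiv> region D"
abbreviation "mh \<equiv> mesh D"
abbreviation "nu \<equiv> nrml D"
abbreviation "Fint \<equiv> interior_facets (mesh D)"
abbreviation "Fbd \<equiv> boundary_facets (mesh D)"
abbreviation "\<Sigma> F \<equiv> facet_measure F (nrml D F)"

lemma mesh_facts:
  shows "triangulation mh" "finite mh" "\<Union>mh = closure \<Omega>"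
    "\<And>K. K \<in> mh \<Longrightarrow> int CARD('n) simplex K"
    "\<And>K. K \<in> mh \<Longrightarrow> diameter K \<le> shreg D * inradius K"
    "\<And>K. K \<in> mh \<Longrightarrow> unit_normals K nu"
    "\<And>K F. F \<in> Fbd \<Longrightarrow> K \<in> mh \<Longrightarrow> F facet_of K \<Longrightarrow> points_out F (nu F) K"
    "Lipschitz_domain \<Omega>"
  using valid
  by (auto simp: valid_discretization_def simplicial_mesh_def facet_normals_def triangulation_def
      unit_normals_def facets_def)

lemma facets_Un: "facets mh = (\<Union>K\<in>mh. {F. F facet_of K})"
  by (auto simp: facets_def)

lemma finite_facets_mesh: "finite (facets mh)"
  unfolding facets_Un using mesh_facts(2,4) finite_facets by blast

lemma Fint_sub: "Fint \<subseteq> facets mh" by (auto simp: interior_facets_def facets_def)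

lemma facets_split: "facets mh = Fint \<union> Fbd" "Fint \<inter> Fbd = {}"
  using Fint_sub by (auto simp: boundary_facets_def)

lemma finite_Fint: "finite Fint" and finite_Fbd: "finite Fbd"
  using finite_facets_mesh facets_split by auto

definition adj :: "(real^'n) set \<Rightarrow> (real^'n) set set" where "adj F = {K \<in> mh. F facet_of K}"

lemma side_unique:
  assumes "K \<in> adj F" "K' \<in> adj F" "points_out F \<nu> K" "points_out F \<nu> K'" "\<nu> = nu F \<or> \<nu> = - nu F"
  shows "K = K'"
  using triangulation_facet_sides[OF mesh_facts(1), of K K' nu F \<nu>] mesh_facts(4,6) assms
  by (auto simp: adj_def)

lemma some_side:
  assumes "K \<in> adj F"
  shows "points_out F (nu F) K \<or> points_out F (- nu F) K"
    and "\<not> (points_out F (nu F) K \<and> points_out F (- nu F) K)"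
proof -
  have K: "int CARD('n) simplex K" "unit_normals K nu" "F facet_of K"
    using assms mesh_facts(4,6) by (auto simp: adj_def)
  show "points_out F (nu F) K \<or> points_out F (- nu F) K" by (rule facet_apex[OF K])
  show "\<not> (points_out F (nu F) K \<and> points_out F (- nu F) K)" by (rule not_both_sides[OF K])
qed

lemma THE_side:
  assumes "A \<in> adj F" "points_out F \<nu> A" "\<nu> = nu F \<or> \<nu> = - nu F"
  shows "(THE K. K \<in> mh \<and> F facet_of K \<and> points_out F \<nu> K) = A"
proof (rule the_equality)
  show "A \<in> mh \<and> F facet_of A \<and> points_out F \<nu> A" using assms(1,2) by (simp add: adj_def)
  show "K = A" if "K \<in> mh \<and> F facet_of K \<and> points_out F \<nu> K" for K
    by (rule side_unique[OF _ assms(1) _ assms(2,3)]) (use that in \<open>simp_all add: adj_def\<close>)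
qed

text \<open>An element lies on exactly one side of its facet and no two lie on the same side. Two
  distinct neighbours therefore occupy both sides and there is no third, which makes the
  descriptions in \<open>elem_plus\<close> and \<open>elem_minus\<close> meaningful.\<close>

lemma interior_facet_elems:
  assumes "F \<in> Fint"
  shows "elem_plus D F \<in> mh" "elem_minus D F \<in> mh" "elem_plus D F \<noteq> elem_minus D F"
    "adj F = {elem_plus D F, elem_minus D F}"
    "orient F (nu F) (elem_plus D F) = 1" "orient F (nu F) (elem_minus D F) = - 1"
proof -
  obtain K K' where K: "K \<in> adj F" "K' \<in> adj F" "K \<noteq> K'"
    using assms by (auto simp: interior_facets_def adj_def)
  have other: "A = K \<or> A = K'" "points_out F (nu F) K \<longleftrightarrow> points_out F (- nu F) K'" if "A \<in> adj F" for A
  proof -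
    have u1: "\<not> (points_out F (nu F) B \<and> points_out F (nu F) B')" "\<not> (points_out F (- nu F) B \<and> points_out F (- nu F) B')"
      if "B \<in> adj F" "B' \<in> adj F" "B \<noteq> B'" for B B'
      using side_unique[OF that(1,2)] that(3) by blast+
    note s = some_side(1)[OF K(1)] some_side(1)[OF K(2)] some_side(1)[OF that]
    show "points_out F (nu F) K \<longleftrightarrow> points_out F (- nu F) K'" using u1[OF K] s some_side(2)[OF K(1)] by argo
    show "A = K \<or> A = K'"
    proof (rule ccontr)
      assume "\<not> (A = K \<or> A = K')"
      then show False using u1[OF K] u1[OF that K(1)] u1[OF that K(2)] s by argo
    qed
  qed
  obtain A B where AB: "A \<in> adj F" "B \<in> adj F" "A \<noteq> B" "points_out F (nu F) A" "points_out F (- nu F) B"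
    "{A, B} = {K, K'}"
  proof (cases "points_out F (nu F) K")
    case True
    then show thesis using that[of K K'] K other(2)[OF K(1)] by simp
  next
    case False
    then have "points_out F (- nu F) K" "points_out F (nu F) K'"
      using other(2)[OF K(1)] some_side(1)[OF K(1)] some_side(1)[OF K(2)] by argo+
    then show thesis using that[of K' K] K by (simp add: insert_commute)
  qed
  have plus: "elem_plus D F = A" unfolding elem_plus_def by (rule THE_side[OF AB(1,4)]) simp
  have minus: "elem_minus D F = B" unfolding elem_minus_def by (rule THE_side[OF AB(2,5)]) simp
  show "elem_plus D F \<in> mh" "elem_minus D F \<in> mh" "elem_plus D F \<noteq> elem_minus D F"
    unfolding plus minus using AB(1,2,3) by (simp_all add: adj_def)
  show "adj F = {elem_plus D F, elem_minus D F}"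
    unfolding plus minus AB(6) using other(1) K(1,2) by blast
  show "orient F (nu F) (elem_plus D F) = 1" unfolding plus using AB(4) by (simp add: orient_def)
  show "orient F (nu F) (elem_minus D F) = - 1"
    unfolding minus using AB(5) some_side(2)[OF AB(2)] by (simp add: orient_def)
qed

text \<open>The prescribed normal points out of every adjacent element, so all of these lie on the
  same side and coincide.\<close>

lemma boundary_facet_elems:
  assumes "F \<in> Fbd"
  shows "elem_plus D F \<in> mh" "adj F = {elem_plus D F}" "orient F (nu F) (elem_plus D F) = 1"
proof -
  obtain A where A: "A \<in> adj F" using assms by (auto simp: boundary_facets_def facets_def adj_def)
  have pt: "points_out F (nu F) B" if "B \<in> adj F" for B
    using that mesh_facts(7)[OF assms, of B] by (simp add: adj_def)
  have plus: "elem_plus D F = A" unfolding elem_plus_def by (rule THE_side[OF A pt[OF A]]) simp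
  show "elem_plus D F \<in> mh" using A by (simp add: plus adj_def)
  have "B = A" if "B \<in> adj F" for B using side_unique[OF that A pt[OF that] pt[OF A]] by simp
  then show "adj F = {elem_plus D F}" using A unfolding plus by blast
  show "orient F (nu F) (elem_plus D F) = 1" using pt[OF A] by (simp add: plus orient_def)
qed

text \<open>Double counting of the incident pairs of elements and facets.\<close>

lemma sum_over_facets:
  fixes f :: "(real^'n) set \<Rightarrow> (real^'n) set \<Rightarrow> real"
  shows "(\<Sum>K\<in>mh. \<Sum>F | F facet_of K. f K F)
    = (\<Sum>F\<in>Fint. f (elem_plus D F) F + f (elem_minus D F) F) + (\<Sum>F\<in>Fbd. f (elem_plus D F) F)"
proof -
  have "(\<Sum>K\<in>mh. \<Sum>F | F facet_of K. f K F) = (\<Sum>K\<in>mh. \<Sum>F | F \<in> facets mh \<and> F facet_of K. f K F)"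
    by (intro sum.cong refl) (auto simp: facets_def)
  also have "\<dots> = (\<Sum>F\<in>facets mh. \<Sum>K | K \<in> mh \<and> F facet_of K. f K F)"
    using mesh_facts(2) finite_facets_mesh by (rule sum.swap_restrict)
  also have "\<dots> = (\<Sum>F\<in>Fint. \<Sum>K\<in>adj F. f K F) + (\<Sum>F\<in>Fbd. \<Sum>K\<in>adj F. f K F)"
    unfolding facets_split(1) adj_def using finite_Fint finite_Fbd facets_split(2) by (rule sum.union_disjoint)
  also have "\<dots> = (\<Sum>F\<in>Fint. f (elem_plus D F) F + f (elem_minus D F) F) + (\<Sum>F\<in>Fbd. f (elem_plus D F) F)"
    using interior_facet_elems(3,4) boundary_facet_elems(2) by (intro arg_cong2[of _ _ _ _ "(+)"] sum.cong) auto
  finally show ?thesis .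
qed

lemma facet_flat:
  assumes "F \<in> facets mh"
  obtains c where "flat_facet F (nu F) c"
proof -
  obtain K where K: "K \<in> mh" "F facet_of K" using assms by (auto simp: facets_def)
  show thesis by (rule facet_apex[OF mesh_facts(4)[OF K(1)] mesh_facts(6)[OF K(1)] K(2)]) (rule that)
qed

lemma compact_measure_\<Sigma>:
  assumes "F \<in> facets mh"
  shows "compact_measure (\<Sigma> F)"
proof -
  obtain c where "flat_facet F (nu F) c" using assms by (rule facet_flat)
  then show ?thesis by (rule flat_facet.compact_measure_facet)
qed

lemma compact_measure_mesh: "K \<in> mh \<Longrightarrow> compact_measure (density lborel (indicator K))"
  by (intro compact_measure_density_lborel compact_simplex[OF mesh_facts(4)])

text \<open>The mesh only covers the closure of \<Omega>. The Lipschitz condition prevents the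
  interior of an element from containing boundary points, so integrals over \<Omega> split into
  element integrals.\<close>

lemma interior_mesh_subset:
  assumes "K \<in> mh"
  shows "interior K \<subseteq> \<Omega>"
proof -
  have "K \<subseteq> closure \<Omega>" using assms mesh_facts(3) by blast
  then have "interior K \<subseteq> interior (closure \<Omega>)" by (rule interior_mono)
  then show ?thesis using Lipschitz_domain_interior_closure[OF mesh_facts(8)] by blast
qed

lemma interior_mesh_disjoint:
  "K \<in> mh \<Longrightarrow> K' \<in> mh \<Longrightarrow> K \<noteq> K' \<Longrightarrow> interior K \<inter> interior K' = {}"
  by (rule triangulation_interiors[OF mesh_facts(1) _ _ _ mesh_facts(4) mesh_facts(4)])

end

section \<open>Piecewise polynomial fields\<close>

definition vpoly :: "nat \<Rightarrow> (real^'n \<Rightarrow> real^'n) \<Rightarrow> bool" where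
  "vpoly k v \<longleftrightarrow> (\<forall>i. poly_le k (\<lambda>x. v x $ i))"

definition mpoly :: "nat \<Rightarrow> (real^'n \<Rightarrow> real^'n^'n) \<Rightarrow> bool" where
  "mpoly k A \<longleftrightarrow> (\<forall>i j. poly_le k (\<lambda>x. A x $ i $ j))"

lemma vpoly_continuous:
  assumes "vpoly k v" shows "continuous_on UNIV v"
proof -
  have "continuous_on UNIV (\<lambda>x. \<chi> i. v x $ i)"
    by (intro continuous_on_vec_lambda poly_le_continuous[of k]) (use assms in \<open>simp add: vpoly_def\<close>)
  then show ?thesis by simp
qed

lemma mpoly_continuous:
  assumes "mpoly k A" shows "continuous_on UNIV A"
proof -
  have "continuous_on UNIV (\<lambda>x. \<chi> i j. A x $ i $ j)"
    by (intro continuous_on_vec_lambda poly_le_continuous[of k]) (use assms in \<open>simp add: mpoly_def\<close>)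
  then show ?thesis by simp
qed

lemma jacobian_eq:
  fixes v :: "real^'n \<Rightarrow> real^'m"
  assumes "(v has_derivative (\<lambda>h. A *v h)) (at x)"
  shows "jacobian v (at x) = A"
  unfolding jacobian_def frechet_derivative_at[OF assms, symmetric] by (rule matrix_of_matrix_vector_mul)

lemma vpoly_jacobian:
  fixes v :: "real^'n \<Rightarrow> real^'n"
  assumes "vpoly k v"
  shows "(v has_derivative (\<lambda>h. jacobian v (at x) *v h)) (at x)" "mpoly k (\<lambda>x. jacobian v (at x))"
proof -
  have "\<forall>i. \<exists>g. (\<forall>x. GDERIV (\<lambda>x. v x $ i) x :> g x) \<and> (\<forall>j. poly_le k (\<lambda>x. g x $ j))"
    by (intro allI poly_le_gradient) (use assms in \<open>simp add: vpoly_def\<close>)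
  then obtain g where "\<forall>i. (\<forall>x. GDERIV (\<lambda>x. v x $ i) x :> g i x) \<and> (\<forall>j. poly_le k (\<lambda>x. g i x $ j))"
    by (rule choice[THEN exE])
  then have g: "GDERIV (\<lambda>x. v x $ i) x :> g i x" "poly_le k (\<lambda>x. g i x $ j)" for i j x by blast+
  define J where "J x = (\<chi> i. g i x)" for x
  have d: "(v has_derivative (\<lambda>h. J x *v h)) (at x)" for x
  proof (subst has_derivative_componentwise_within, intro ballI)
    fix b :: "real^'n" assume "b \<in> Basis"
    then obtain i where b: "b = axis i 1" by (auto simp: Basis_vec_def)
    have "(\<lambda>h. (J x *v h) $ i) = (\<lambda>h. h \<bullet> g i x)"
      by (simp add: J_def matrix_vector_mult_def inner_vec_def mult.commute fun_eq_iff)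
    then show "((\<lambda>x. v x \<bullet> b) has_derivative (\<lambda>h. (J x *v h) \<bullet> b)) (at x)"
      using g(1)[of i x] by (simp add: b inner_axis gderiv_def)
  qed
  have "jacobian v (at x) = J x" for x by (rule jacobian_eq[OF d])
  then show "(v has_derivative (\<lambda>h. jacobian v (at x) *v h)) (at x)" "mpoly k (\<lambda>x. jacobian v (at x))"
    using d g(2) by (simp_all add: mpoly_def J_def)
qed

lemma jacobian_sum:
  fixes c :: "'j \<Rightarrow> real^'n \<Rightarrow> real^'n"
  assumes "\<And>j. j \<in> I \<Longrightarrow> vpoly k (c j)"
  shows "jacobian (\<lambda>x. \<Sum>j\<in>I. a j *\<^sub>R c j x) (at x) = (\<Sum>j\<in>I. a j *\<^sub>R jacobian (c j) (at x))"
proof (rule jacobian_eq)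
  have "((\<lambda>x. \<Sum>j\<in>I. a j *\<^sub>R c j x) has_derivative (\<lambda>h. \<Sum>j\<in>I. a j *\<^sub>R (jacobian (c j) (at x) *v h))) (at x)"
    by (intro has_derivative_sum has_derivative_scaleR_right vpoly_jacobian(1)[OF assms])
  moreover have "(\<Sum>j\<in>I. a j *\<^sub>R (A j *v h)) = (\<Sum>j\<in>I. a j *\<^sub>R A j) *v h" for A :: "'j \<Rightarrow> real^'n^'n" and h
    by (induction I rule: infinite_finite_induct)
      (auto simp: matrix_vector_mult_add_rdistrib scaleR_matrix_vector_assoc)
  ultimately show "((\<lambda>x. \<Sum>j\<in>I. a j *\<^sub>R c j x) has_derivative (\<lambda>h. (\<Sum>j\<in>I. a j *\<^sub>R jacobian (c j) (at x)) *v h)) (at x)"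
    by simp
qed

text \<open>The Raviart-Thomas term q(x) x has degree k + 1; the same bound is used for both
  families.\<close>

lemma local_space_vpoly:
  assumes "v \<in> local_space fm k"
  shows "vpoly (Suc k) v"
proof (cases fm)
  case RT
  then obtain p q where v: "v = (\<lambda>x. p x + q x *\<^sub>R x)" "p \<in> Pk_vec k" "q \<in> Pk k"
    using assms by (auto simp: local_space_def RTk_def)
  have "poly_le (Suc k) (\<lambda>x. v x $ i)" for i
  proof -
    have 1: "poly_le (Suc k) (\<lambda>x. p x $ i)"
      using v(2) by (intro poly_le_mono[OF Pk_imp_poly_le[of _ k]]) (simp_all add: Pk_vec_def)
    have 2: "poly_le (Suc k) (\<lambda>x. q x * x $ i)"
      by (rule poly_le.mult[OF Pk_imp_poly_le[OF v(3)] poly_le.coord[of 1 i]]) simp_all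
    show ?thesis using poly_le.add[OF 1 2] by (simp add: v(1))
  qed
  then show ?thesis by (simp add: vpoly_def)
next
  case BDM
  then have "(\<lambda>x. v x $ i) \<in> Pk k" for i using assms by (simp add: local_space_def Pk_vec_def)
  then show ?thesis unfolding vpoly_def by (intro allI poly_le_mono[OF Pk_imp_poly_le[of _ k]]) simp_all
qed

lemma Pk_linear:
  assumes "p \<in> Pk k" "q \<in> Pk k"
  shows "(\<lambda>x. p x + q x) \<in> Pk k" "(\<lambda>x. a * p x) \<in> Pk k"
proof -
  obtain c d where "p = (\<lambda>x. \<Sum>\<alpha> | (\<Sum>i\<in>UNIV. \<alpha> i) \<le> k. c \<alpha> * (\<Prod>i\<in>UNIV. (x $ i) ^ \<alpha> i))"
    "q = (\<lambda>x. \<Sum>\<alpha> | (\<Sum>i\<in>UNIV. \<alpha> i) \<le> k. d \<alpha> * (\<Prod>i\<in>UNIV. (x $ i) ^ \<alpha> i))"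
    using assms by (auto simp: Pk_def)
  then have eq: "(\<lambda>x. p x + q x) = (\<lambda>x. \<Sum>\<alpha> | (\<Sum>i\<in>UNIV. \<alpha> i) \<le> k. (c \<alpha> + d \<alpha>) * (\<Prod>i\<in>UNIV. (x $ i) ^ \<alpha> i))"
    "(\<lambda>x. a * p x) = (\<lambda>x. \<Sum>\<alpha> | (\<Sum>i\<in>UNIV. \<alpha> i) \<le> k. (a * c \<alpha>) * (\<Prod>i\<in>UNIV. (x $ i) ^ \<alpha> i))"
    by (simp_all add: distrib_right sum.distrib sum_distrib_left mult.assoc)
  show "(\<lambda>x. p x + q x) \<in> Pk k" unfolding Pk_def by (rule CollectI, rule exI, rule eq(1))
  show "(\<lambda>x. a * p x) \<in> Pk k" unfolding Pk_def by (rule CollectI, rule exI, rule eq(2))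
qed

lemma Pk_zero: "(\<lambda>x. 0) \<in> Pk k"
  unfolding Pk_def by (intro CollectI exI[of _ "\<lambda>\<alpha>. 0"]) simp

lemma local_space_zero: "(\<lambda>x. 0) \<in> local_space fm k"
proof (cases fm)
  case RT
  have "(\<lambda>x. (\<lambda>x. 0) x + (\<lambda>x. 0) x *\<^sub>R x) \<in> (RTk k :: (real^'a \<Rightarrow> real^'a) set)"
    unfolding RTk_def Pk_vec_def using Pk_zero by (intro CollectI exI conjI refl) auto
  then show ?thesis using RT by (simp add: local_space_def)
qed (auto simp: local_space_def Pk_vec_def Pk_zero)

lemma local_space_add_scale:
  fixes v w :: "real^'n \<Rightarrow> real^'n"
  assumes "v \<in> local_space fm k" "w \<in> local_space fm k"
  shows "(\<lambda>x. v x + a *\<^sub>R w x) \<in> local_space fm k"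
proof -
  have P: "(\<lambda>x. p x + a * q x) \<in> Pk k" if "p \<in> Pk k" "q \<in> Pk k" for p q :: "real^'n \<Rightarrow> real"
    using Pk_linear(1)[OF that(1) Pk_linear(2)[OF that(2,2), of a]] .
  show ?thesis
  proof (cases fm)
    case RT
    obtain p q where v: "v = (\<lambda>x. p x + q x *\<^sub>R x)" "p \<in> Pk_vec k" "q \<in> Pk k"
      using assms RT by (auto simp: local_space_def RTk_def)
    obtain p' q' where w: "w = (\<lambda>x. p' x + q' x *\<^sub>R x)" "p' \<in> Pk_vec k" "q' \<in> Pk k"
      using assms RT by (auto simp: local_space_def RTk_def)
    have "(\<lambda>x. v x + a *\<^sub>R w x) = (\<lambda>x. (p x + a *\<^sub>R p' x) + (q x + a * q' x) *\<^sub>R x)"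
      by (simp add: v w algebra_simps)
    moreover have "(\<lambda>x. p x + a *\<^sub>R p' x) \<in> Pk_vec k"
      unfolding Pk_vec_def vector_add_component vector_scaleR_component real_scaleR_def
      using v(2) w(2) P[of "\<lambda>x. p x $ i" "\<lambda>x. p' x $ i" for i] by (simp add: Pk_vec_def)
    moreover have "(\<lambda>x. q x + a * q' x) \<in> Pk k" by (rule P[OF v(3) w(3)])
    ultimately have "(\<lambda>x. v x + a *\<^sub>R w x) \<in> RTk k" unfolding RTk_def
      by (intro CollectI exI[of _ "\<lambda>x. p x + a *\<^sub>R p' x"] exI[of _ "\<lambda>x. q x + a * q' x"] conjI)
    then show ?thesis using RT by (simp add: local_space_def)
  next
    case BDM
    then have "v \<in> Pk_vec k" "w \<in> Pk_vec k" using assms by (simp_all add: local_space_def)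
    then have "(\<lambda>x. v x + a *\<^sub>R w x) \<in> Pk_vec k"
      using P[of "\<lambda>x. v x $ i" "\<lambda>x. w x $ i" for i] by (simp add: Pk_vec_def)
    then show ?thesis using BDM by (simp add: local_space_def)
  qed
qed

lemma local_space_sum:
  assumes "\<And>j. j \<in> I \<Longrightarrow> c j \<in> local_space fm k"
  shows "(\<lambda>x. \<Sum>j\<in>I. a j *\<^sub>R c j x) \<in> local_space fm k"
  using assms
proof (induction I rule: infinite_finite_induct)
  case (insert j I)
  then show ?case
    using local_space_add_scale[of "\<lambda>x. \<Sum>j\<in>I. a j *\<^sub>R c j x" fm k "c j" "a j"] by (simp add: add.commute)
qed (auto simp: local_space_zero)

lemma AE_not_frontier:
  assumes "convex (K::'a::euclidean_space set)"
  shows "AE x in lborel. x \<notin> frontier K"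
proof -
  have "frontier K \<in> null_sets lebesgue"
    using negligible_convex_frontier[OF assms] by (simp add: negligible_iff_null_sets)
  then have "frontier K \<in> null_sets lborel" by (simp add: null_sets_completion_iff)
  then show ?thesis by (rule AE_not_in)
qed

section \<open>Integrals of piecewise defined fields\<close>

context dg
begin

lemma assemble_interior:
  assumes "K \<in> mh" "x \<in> interior K"
  shows "assemble D v x = v K x"
proof -
  have "{K \<in> mh. x \<in> interior K} = {K}" using assms interior_mesh_disjoint by auto
  then show ?thesis by (simp add: assemble_def)
qed

lemma assemble_outside:
  assumes "\<And>K. K \<in> mh \<Longrightarrow> x \<notin> interior K"
  shows "assemble D v x = 0"
  using assms by (auto simp: assemble_def intro!: sum.neutral)

lemma assemble_scaled_sum:
  "assemble D (\<lambda>K x. \<Sum>j\<in>I. a j *\<^sub>R c j K x) x = (\<Sum>j\<in>I. a j *\<^sub>R assemble D (c j) x)"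
  unfolding assemble_def scaleR_sum_right by (rule sum.swap)

lemma assemble_cong: "(\<And>K x. K \<in> mh \<Longrightarrow> v K x = w K x) \<Longrightarrow> assemble D v = assemble D w"
  by (auto simp: assemble_def intro!: sum.cong)

text \<open>Continuity of every piece on the whole space gives all spatial integrability, since
  elements and facets are compact.\<close>

definition cfield :: "('n, 'b::euclidean_space) broken \<Rightarrow> bool" where
  "cfield v \<longleftrightarrow> (\<forall>K\<in>mh. continuous_on UNIV (v K))"

lemma piecewise_indicator:
  fixes g :: "real^'n \<Rightarrow> 'b::euclidean_space"
  assumes "\<And>K x. K \<in> mh \<Longrightarrow> x \<in> interior K \<Longrightarrow> g x = h K x"
    and "\<And>x. (\<And>K. K \<in> mh \<Longrightarrow> x \<notin> interior K) \<Longrightarrow> g x = 0"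
  shows "indicator \<Omega> x *\<^sub>R g x = (\<Sum>K\<in>mh. indicator (interior K) x *\<^sub>R h K x)"
proof (cases "\<exists>K\<in>mh. x \<in> interior K")
  case True
  then obtain K where K: "K \<in> mh" "x \<in> interior K" by blast
  then have "x \<in> \<Omega>" using interior_mesh_subset by blast
  have "(\<Sum>K'\<in>mh. indicator (interior K') x *\<^sub>R h K' x) = (\<Sum>K'\<in>mh. if K' = K then h K x else 0)"
  proof (rule sum.cong)
    fix K' assume "K' \<in> mh"
    then show "indicator (interior K') x *\<^sub>R h K' x = (if K' = K then h K x else 0)"
      using K interior_mesh_disjoint[of K K'] by (auto simp: indicator_def)
  qed simp
  also have "\<dots> = g x" using K mesh_facts(2) assms(1) by simp
  finally show ?thesis using \<open>x \<in> \<Omega>\<close> by simp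
next
  case False
  then show ?thesis using assms(2) by (auto simp: indicator_def intro!: sum.neutral)
qed

text \<open>The element interiors are disjoint subsets of \<Omega>, g vanishes outside of them, and
  passing from an interior to the element changes only a null set.\<close>

lemma piecewise_integral:
  fixes g :: "real^'n \<Rightarrow> real"
  assumes "\<And>K x. K \<in> mh \<Longrightarrow> x \<in> interior K \<Longrightarrow> g x = h K x"
    and "\<And>x. (\<And>K. K \<in> mh \<Longrightarrow> x \<notin> interior K) \<Longrightarrow> g x = 0"
    and "\<And>K. K \<in> mh \<Longrightarrow> continuous_on UNIV (h K)"
  shows "set_integrable lborel \<Omega> g" "(LINT x:\<Omega>|lborel. g x) = (\<Sum>K\<in>mh. LINT x:K|lborel. h K x)"
proof -
  have int: "integrable lborel (\<lambda>x. indicator (interior K) x *\<^sub>R h K x)"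
    "(LINT x|lborel. indicator (interior K) x *\<^sub>R h K x) = (LINT x:K|lborel. h K x)" if "K \<in> mh" for K
  proof -
    have K: "compact K" "convex K" using simplex_full_dim[OF mesh_facts(4)[OF that]] by auto
    have [measurable]: "h K \<in> borel_measurable borel"
      using assms(3)[OF that] by (simp add: borel_measurable_continuous_onI)
    have [measurable]: "K \<in> sets borel" "interior K \<in> sets borel" using K by (auto simp: compact_imp_closed)
    have ae: "AE x in lborel. indicator (interior K) x *\<^sub>R h K x = indicator K x *\<^sub>R h K x"
      using AE_not_frontier[OF K(2)] by eventually_elim
        (use compact_imp_closed[OF K(1)] interior_subset in \<open>auto simp: indicator_def frontier_def\<close>)
    have iK: "integrable lborel (\<lambda>x. indicator K x *\<^sub>R h K x)"
      using set_integrable_compact[OF K(1) assms(3)[OF that]] by (simp add: set_integrable_def)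
    show "integrable lborel (\<lambda>x. indicator (interior K) x *\<^sub>R h K x)"
      by (rule integrable_cong_AE_imp[OF iK]) (use ae in \<open>auto\<close>)
    show "(LINT x|lborel. indicator (interior K) x *\<^sub>R h K x) = (LINT x:K|lborel. h K x)"
      unfolding set_lebesgue_integral_def by (rule integral_cong_AE) (use ae in auto)
  qed
  have eq: "indicator \<Omega> x *\<^sub>R g x = (\<Sum>K\<in>mh. indicator (interior K) x *\<^sub>R h K x)" for x
    by (rule piecewise_indicator) (fact assms)+
  show "set_integrable lborel \<Omega> g"
    unfolding set_integrable_def eq by (rule Bochner_Integration.integrable_sum) (rule int)
  show "(LINT x:\<Omega>|lborel. g x) = (\<Sum>K\<in>mh. LINT x:K|lborel. h K x)"
    unfolding set_lebesgue_integral_def[of _ \<Omega>] eq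
    by (simp only: Bochner_Integration.integral_sum[OF int(1)] int(2) cong: sum.cong)
qed

lemma L2_inner_assemble:
  fixes u v :: "('n, 'b::euclidean_space) broken"
  assumes "cfield u" "cfield v"
  shows "L2_inner \<Omega> (assemble D u) (assemble D v) = (\<Sum>K\<in>mh. LINT x:K|lborel. u K x \<bullet> v K x)"
  unfolding L2_inner_def
  by (rule piecewise_integral)
    (use assms in \<open>auto simp: assemble_interior assemble_outside cfield_def intro!: continuous_intros\<close>)

lemma L2_inner_assemble_right:
  fixes u :: "('n, 'b::euclidean_space) broken"
  assumes "cfield u" "continuous_on UNIV G"
  shows "L2_inner \<Omega> (assemble D u) G = (\<Sum>K\<in>mh. LINT x:K|lborel. u K x \<bullet> G x)"
  unfolding L2_inner_def
  by (rule piecewise_integral)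
    (use assms in \<open>auto simp: assemble_interior assemble_outside cfield_def intro!: continuous_intros\<close>)

lemma L2_on_assemble:
  fixes u :: "('n, 'b::euclidean_space) broken"
  assumes "cfield u"
  shows "L2_on \<Omega> (assemble D u)"
  unfolding L2_on_def
proof
  have "set_borel_measurable lborel \<Omega> (assemble D u)"
    unfolding set_borel_measurable_def
  proof (subst piecewise_indicator)
    show "assemble D u x = u K x" if "K \<in> mh" "x \<in> interior K" for K x using that by (rule assemble_interior)
    show "assemble D u x = 0" if "\<And>K. K \<in> mh \<Longrightarrow> x \<notin> interior K" for x using that by (rule assemble_outside)
    have "u K \<in> borel_measurable borel" if "K \<in> mh" for K
      using assms that by (simp add: cfield_def borel_measurable_continuous_onI)
    then show "(\<lambda>x. \<Sum>K\<in>mh. indicat_real (interior K) x *\<^sub>R u K x) \<in> borel_measurable lborel"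
      by (intro borel_measurable_sum borel_measurable_scaleR borel_measurable_indicator) simp_all
  qed
  then show "set_borel_measurable lborel \<Omega> (assemble D u)" .
  show "set_integrable lborel \<Omega> (\<lambda>x. (norm (assemble D u x))\<^sup>2)"
    by (rule piecewise_integral(1)[where h = "\<lambda>K x. (norm (u K x))\<^sup>2"])
      (use assms in \<open>auto simp: assemble_interior assemble_outside cfield_def intro!: continuous_intros\<close>)
qed

end

section \<open>Piecewise polynomial solenoidal fields\<close>

text \<open>For r > 0 this is positive exactly on the ball of radius r around y. Squaring the
  positive part makes it C^1, which is the regularity asked for by \<open>C1_test\<close>.\<close>

definition bump :: "real^'n \<Rightarrow> real \<Rightarrow> real^'n \<Rightarrow> real" where
  "bump y r x = (max 0 (r\<^sup>2 - (norm (x - y))\<^sup>2))\<^sup>2"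

definition bump_grad :: "real^'n \<Rightarrow> real \<Rightarrow> real^'n \<Rightarrow> real^'n" where
  "bump_grad y r x = (- 4 * max 0 (r\<^sup>2 - (norm (x - y))\<^sup>2)) *\<^sub>R (x - y)"

lemma max_0_square_deriv: "((\<lambda>t::real. (max 0 t)\<^sup>2) has_real_derivative 2 * max 0 t) (at t)"
proof -
  consider "t > 0" | "t < 0" | "t = 0" by linarith
  then show ?thesis
  proof cases
    case 1
    have "((\<lambda>t::real. t\<^sup>2) has_real_derivative 2 * max 0 t) (at t)"
      using 1 by (auto intro!: derivative_eq_intros)
    then show ?thesis
      by (rule has_field_derivative_transform_within_open[where S = "{0<..}"]) (use 1 in auto)
  next
    case 2
    have "((\<lambda>t::real. 0) has_real_derivative 2 * max 0 t) (at t)" using 2 by simp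
    then show ?thesis
      by (rule has_field_derivative_transform_within_open[where S = "{..<0}"]) (use 2 in auto)
  next
    case 3
    have "((\<lambda>h::real. (max 0 h)\<^sup>2 / h) \<longlongrightarrow> 0) (at 0)"
    proof (rule Lim_null_comparison)
      show "\<forall>\<^sub>F h::real in at 0. norm ((max 0 h)\<^sup>2 / h) \<le> \<bar>h\<bar>"
        by (auto simp: max_def power2_eq_square eventually_at_filter)
      show "((\<lambda>h::real. \<bar>h\<bar>) \<longlongrightarrow> 0) (at 0)" by (rule tendsto_rabs_zero) (rule tendsto_ident_at)
    qed
    then show ?thesis using 3 by (simp add: DERIV_def)
  qed
qed

lemma bump_C1_test: "C1_test UNIV (bump y r) (bump_grad y r)"
  unfolding C1_test_def
proof (intro conjI allI)
  fix x
  let ?q = "\<lambda>x. r\<^sup>2 - (norm (x - y))\<^sup>2"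
  have "(?q has_derivative (\<lambda>h. - 2 * ((x - y) \<bullet> h))) (at x)"
    unfolding power2_norm_eq_inner
    by (auto intro!: derivative_eq_intros simp: inner_commute)
  then have "((\<lambda>x. (max 0 (?q x))\<^sup>2) has_derivative (\<lambda>h. (- 2 * ((x - y) \<bullet> h)) * (2 * max 0 (?q x)))) (at x)"
    using max_0_square_deriv[of "?q x"] unfolding has_field_derivative_def
    by (auto dest: has_derivative_compose simp: mult.commute)
  then show "GDERIV (bump y r) x :> bump_grad y r x"
    unfolding gderiv_def bump_def[abs_def] bump_grad_def
    by (rule has_derivative_eq_rhs) (auto simp: fun_eq_iff inner_commute algebra_simps)
next
  show "continuous_on UNIV (bump_grad y r)" unfolding bump_grad_def by (intro continuous_intros)
  have "{x. bump y r x \<noteq> 0} \<subseteq> ball y \<bar>r\<bar>"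
  proof
    fix x assume "x \<in> {x. bump y r x \<noteq> 0}"
    then have "(norm (x - y))\<^sup>2 < r\<^sup>2" by (auto simp: bump_def max_def split: if_splits)
    then have "norm (x - y) < \<bar>r\<bar>" using power2_less_imp_less[of "norm (x - y)" "\<bar>r\<bar>"] by simp
    then show "x \<in> ball y \<bar>r\<bar>" by (simp add: dist_norm norm_minus_commute)
  qed
  then show "bounded {x. bump y r x \<noteq> 0}" using bounded_ball bounded_subset by blast
qed simp

lemma bump_nonneg: "0 \<le> bump y r x" by (simp add: bump_def)

lemma bump_pos_iff: "0 < r \<Longrightarrow> bump y r x \<noteq> 0 \<longleftrightarrow> x \<in> ball y r"
proof -
  assume r: "0 < r"
  have "bump y r x \<noteq> 0 \<longleftrightarrow> (norm (x - y))\<^sup>2 < r\<^sup>2" by (auto simp: bump_def max_def)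
  also have "\<dots> \<longleftrightarrow> norm (x - y) < r" using power2_less_imp_less[of "norm (x - y)" r] power_strict_mono[of "norm (x - y)" r 2] r by auto
  finally show ?thesis by (simp add: dist_norm norm_minus_commute)
qed

lemma bump_continuous: "continuous_on UNIV (bump y r)"
  unfolding bump_def by (intro continuous_intros)

text \<open>The fundamental lemma of the calculus of variations at a support point of a measure:
  were j y nonzero, j would keep its sign on a small ball, a bump there would give a nonnegative
  function with zero integral, and the ball would be null. It serves both volumes and
  facets.\<close>

lemma zero_by_bumps:
  fixes j :: "real^'n \<Rightarrow> real"
  assumes \<mu>: "compact_measure \<mu>" and j: "continuous_on UNIV j"
    and supp: "\<And>r. 0 < r \<Longrightarrow> emeasure \<mu> (ball y r) \<noteq> 0"
    and r0: "0 < r0" "\<And>r. 0 < r \<Longrightarrow> r \<le> r0 \<Longrightarrow> (LINT x|\<mu>. bump y r x * j x) = 0"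
  shows "j y = 0"
proof -
  have sets: "sets \<mu> = sets borel" using \<mu> by (simp add: compact_measure_def)
  \<comment> \<open>The factor s treats positive and negative values of j at once.\<close>
  have False if s: "s = 1 \<or> s = - 1" and pos: "0 < s * j y" for s :: real
  proof -
    have "open ((\<lambda>x. s * j x) -` {0<..})" using j by (intro open_vimage continuous_intros) auto
    moreover have "y \<in> (\<lambda>x. s * j x) -` {0<..}" using pos by simp
    ultimately obtain r1 where r1: "r1 > 0" "ball y r1 \<subseteq> (\<lambda>x. s * j x) -` {0<..}" by (rule openE)
    define r where "r = min r0 r1"
    have r: "0 < r" "r \<le> r0" "r \<le> r1" using r0 r1 by (auto simp: r_def)
    have sj: "0 < s * j x" if "x \<in> ball y r" for x using r1(2) r(3) that by (auto simp: subset_iff)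
    have nn: "0 \<le> bump y r x * (s * j x)" for x
      using sj[of x] bump_nonneg[of y r x] bump_pos_iff[OF r(1), of y x] by (cases "x \<in> ball y r") auto
    have int: "integrable \<mu> (\<lambda>x. bump y r x * (s * j x))"
      by (intro compact_measure_integrable[OF \<mu>] continuous_intros bump_continuous j)
    have "(LINT x|\<mu>. bump y r x * (s * j x)) = s * (LINT x|\<mu>. bump y r x * j x)"
      by (subst integral_mult_right_zero[symmetric]) (simp add: mult_ac)
    then have "(LINT x|\<mu>. bump y r x * (s * j x)) = 0" using r0(2)[OF r(1,2)] by simp
    then have "AE x in \<mu>. bump y r x * (s * j x) = 0"
      using integral_nonneg_eq_0_iff_AE[OF int] nn by auto
    then have "AE x in \<mu>. x \<notin> ball y r"
      by eventually_elim (use sj bump_pos_iff[OF r(1)] in force)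
    then have "emeasure \<mu> (ball y r) = 0"
      using AE_iff_null[of \<mu> "\<lambda>x. x \<notin> ball y r"] sets sets_eq_imp_space_eq[OF sets]
      by (simp add: null_sets_def del: mem_ball)
    then show False using supp r(1) by blast
  qed
  from this[of 1] this[of "- 1"] show ?thesis by (cases "j y" "0::real" rule: linorder_cases) auto
qed

lemma emeasure_lborel_open_nonzero:
  assumes "open (U::'a::euclidean_space set)" "U \<noteq> {}"
  shows "emeasure lborel U \<noteq> 0"
proof
  assume "emeasure lborel U = 0"
  then have "U \<in> null_sets lborel" using assms(1) by (simp add: null_sets_def)
  then have "negligible U" unfolding negligible_iff_null_sets by (rule null_sets_completionI)
  then show False using open_not_negligible[OF assms] by simp
qed

lemma emeasure_density_ball_nonzero:
  fixes K :: "'a::euclidean_space set"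
  assumes "compact K" "y \<in> interior K" "0 < r"
  shows "emeasure (density lborel (indicator K)) (ball y r) \<noteq> 0"
proof -
  have [measurable]: "K \<in> sets borel" using assms(1) by (simp add: compact_imp_closed)
  have "emeasure (density lborel (indicator K)) (ball y r) = (\<integral>\<^sup>+x. indicator K x * indicator (ball y r) x \<partial>lborel)"
    by (simp add: emeasure_density)
  also have "\<dots> = (\<integral>\<^sup>+x. indicator (K \<inter> ball y r) x \<partial>lborel)"
    by (intro nn_integral_cong) (simp add: indicator_inter_arith)
  also have "\<dots> = emeasure lborel (K \<inter> ball y r)" by (rule nn_integral_indicator) simp
  also have "\<dots> \<noteq> 0"
  proof
    assume 0: "emeasure lborel (K \<inter> ball y r) = 0"
    have "emeasure lborel (interior K \<inter> ball y r) \<le> emeasure lborel (K \<inter> ball y r)"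
      by (intro emeasure_mono) (use interior_subset in auto)
    moreover have "emeasure lborel (interior K \<inter> ball y r) \<noteq> 0"
      by (rule emeasure_lborel_open_nonzero) (use assms in \<open>auto intro!: exI[of _ y]\<close>)
    ultimately show False using 0 by simp
  qed
  finally show ?thesis .
qed

context flat_facet
begin

text \<open>Around y + m / 2 there is a nonempty open set of points that lie in the prism and
  project into the ball; that y is interior to F within the full plane keeps the projections in
  F.\<close>

lemma emeasure_facet_ball_nonzero:
  assumes hull: "affine hull F = {y. y \<bullet> m = c}" and y: "y \<in> rel_interior F" and r: "0 < r"
  shows "emeasure (facet_measure F m) (ball y r) \<noteq> 0"
proof -
  obtain e where e: "e > 0" "ball y e \<inter> affine hull F \<subseteq> F" and yF: "y \<in> F"
    using y by (auto simp: mem_rel_interior_ball)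
  define U where "U = {z. norm (prj z - y) < min e r} \<inter> {z. 0 < hgt z} \<inter> {z. hgt z < 1}"
  have prj_cont: "continuous_on UNIV (\<lambda>z. norm (prj z - y))"
    by (intro continuous_intros continuous_prj)
  have "open U" unfolding U_def
    by (intro open_Int open_Collect_less prj_cont continuous_hgt continuous_on_const)
  moreover have "y + (1/2) *\<^sub>R m \<in> U"
    using e(1) r by (simp add: U_def prj_def hgt_add hgt_F[OF yF])
  ultimately have U: "emeasure lborel U \<noteq> 0" using emeasure_lborel_open_nonzero by blast
  have [measurable]: "U \<in> sets borel" using \<open>open U\<close> by simp
  have sub: "indicator U z \<le> indicator {0..1} (hgt z) * (indicator F (prj z) * (indicator (ball y r) (prj z) :: ennreal))" for z
  proof (cases "z \<in> U")
    case True
    then have z: "norm (prj z - y) < e" "norm (prj z - y) < r" "0 < hgt z" "hgt z < 1" by (auto simp: U_def)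
    have "prj z \<in> affine hull F" using hgt_prj[of z] by (simp add: hull hgt_def)
    then have "prj z \<in> F" using e(2) z(1) by (auto simp: dist_norm norm_minus_commute)
    then show ?thesis using z by (simp add: dist_norm norm_minus_commute indicator_def)
  qed simp
  have "emeasure lborel U = (\<integral>\<^sup>+z. indicator U z \<partial>lborel)" by simp
  also have "\<dots> \<le> (\<integral>\<^sup>+z. indicator {0..1} (hgt z) * (indicator F (prj z) * indicator (ball y r) (prj z)) \<partial>lborel)"
    by (rule nn_integral_mono) (rule sub)
  also have "\<dots> = (\<integral>\<^sup>+y'. indicator (ball y r) y' \<partial>facet_measure F m)"
    by (rule nn_integral_facet[symmetric], rule borel_measurable_indicator) simp
  also have "\<dots> = emeasure (facet_measure F m) (ball y r)" by (rule nn_integral_indicator) simp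
  finally show ?thesis using U by auto
qed

end

section \<open>Divergence and normal components of solenoidal fields\<close>

context dg
begin

abbreviation "deg \<equiv> Suc (spdeg D)"

definition pfield :: "('n, real^'n) broken \<Rightarrow> bool" where
  "pfield v \<longleftrightarrow> (\<forall>K\<in>mh. vpoly deg (v K))"

definition div_K :: "('n, real^'n) broken \<Rightarrow> (real^'n) set \<Rightarrow> real^'n \<Rightarrow> real" where
  "div_K v K x = (\<Sum>i\<in>UNIV. grad v K x $ i $ i)"

text \<open>The fields that are solenoidal and have vanishing normal trace, expressed by a single
  family of test functions not required to vanish on the boundary.\<close>

definition dfree :: "('n, real^'n) broken \<Rightarrow> bool" where
  "dfree v \<longleftrightarrow> pfield v \<and> (\<forall>\<phi> G. C1_test UNIV \<phi> G \<longrightarrow> L2_inner \<Omega> (assemble D v) G = 0)"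

lemma pfield_cont: "pfield v \<Longrightarrow> K \<in> mh \<Longrightarrow> continuous_on UNIV (v K)"
  by (rule vpoly_continuous[of deg]) (simp add: pfield_def)

lemma pfield_cfield: "pfield v \<Longrightarrow> cfield v"
  unfolding cfield_def by (intro ballI pfield_cont)

lemma pfield_grad:
  assumes "pfield v" "K \<in> mh"
  shows "(v K has_derivative (\<lambda>h. grad v K x *v h)) (at x)" "mpoly deg (grad v K)"
proof -
  have v: "vpoly deg (v K)" using assms by (simp add: pfield_def)
  show "(v K has_derivative (\<lambda>h. grad v K x *v h)) (at x)"
    unfolding grad_def by (rule vpoly_jacobian(1)[OF v])
  show "mpoly deg (grad v K)" using vpoly_jacobian(2)[OF v] by (simp add: grad_def[abs_def])
qed

lemma pfield_grad_cont: "pfield v \<Longrightarrow> K \<in> mh \<Longrightarrow> continuous_on UNIV (grad v K)"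
  by (rule mpoly_continuous[OF pfield_grad(2)])

lemma pfield_grad_cfield: "pfield v \<Longrightarrow> cfield (grad v)"
  unfolding cfield_def by (intro ballI pfield_grad_cont)

lemma div_K_cont: "pfield v \<Longrightarrow> K \<in> mh \<Longrightarrow> continuous_on UNIV (div_K v K)"
  unfolding div_K_def by (intro continuous_on_sum continuous_on_component pfield_grad_cont)

lemma compact_mesh: "K \<in> mh \<Longrightarrow> compact K"
  by (rule compact_simplex[OF mesh_facts(4)])

lemma \<Sigma>_cong:
  fixes f g :: "real^'n \<Rightarrow> real"
  assumes F: "F \<in> facets mh" and f: "continuous_on UNIV f" "continuous_on UNIV g"
    and eq: "\<And>x. x \<in> F \<Longrightarrow> f x = g x"
  shows "(LINT x|\<Sigma> F. f x) = (LINT x|\<Sigma> F. g x)"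
proof -
  obtain c where "flat_facet F (nu F) c" using F by (rule facet_flat)
  then interpret flat_facet F "nu F" c .
  have "f \<in> borel_measurable (\<Sigma> F)" "g \<in> borel_measurable (\<Sigma> F)"
    using f by (simp_all add: borel_measurable_continuous_onI measurable_cong_sets[OF sets_facet refl])
  moreover have "AE x in \<Sigma> F. f x = g x" using AE_facet by eventually_elim (rule eq)
  ultimately show ?thesis by (rule integral_cong_AE)
qed

lemma \<Sigma>_zero:
  fixes f :: "real^'n \<Rightarrow> real"
  assumes "F \<in> facets mh" "continuous_on UNIV f" "\<And>x. x \<in> F \<Longrightarrow> f x = 0"
  shows "(LINT x|\<Sigma> F. f x) = 0"
  using \<Sigma>_cong[OF assms(1,2) continuous_on_const assms(3)] by simp

lemma \<Sigma>_integrable: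
  fixes f :: "real^'n \<Rightarrow> real"
  shows "F \<in> facets mh \<Longrightarrow> continuous_on UNIV f \<Longrightarrow> integrable (\<Sigma> F) f"
  by (rule compact_measure_integrable[OF compact_measure_\<Sigma>])

lemma set_integral_zero:
  assumes "\<And>x. x \<in> K \<Longrightarrow> f x = (0::real)"
  shows "(LINT x:K|lborel. f x) = 0"
proof -
  have "(\<lambda>x. indicator K x *\<^sub>R f x) = (\<lambda>x. 0)" using assms by (auto simp: indicator_def fun_eq_iff)
  then show ?thesis by (simp add: set_lebesgue_integral_def)
qed

text \<open>The test function may jump between elements. It is applied to a global test function, to
  exploit the weak constraints, and to |u|^2 / 2 in the convective form.\<close>

lemma divergence_mesh:
  assumes v: "pfield v" and \<phi>: "\<And>K x. K \<in> mh \<Longrightarrow> GDERIV (\<phi> K) x :> G K x"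
    and G: "\<And>K. K \<in> mh \<Longrightarrow> continuous_on UNIV (G K)"
  shows "(\<Sum>K\<in>mh. LINT x:K|lborel. v K x \<bullet> G K x) + (\<Sum>K\<in>mh. LINT x:K|lborel. \<phi> K x * div_K v K x)
    = (\<Sum>F\<in>Fint. (LINT x|\<Sigma> F. \<phi> (elem_plus D F) x * (v (elem_plus D F) x \<bullet> nu F))
          - (LINT x|\<Sigma> F. \<phi> (elem_minus D F) x * (v (elem_minus D F) x \<bullet> nu F)))
      + (\<Sum>F\<in>Fbd. LINT x|\<Sigma> F. \<phi> (elem_plus D F) x * (v (elem_plus D F) x \<bullet> nu F))"
proof -
  have "(LINT x:K|lborel. v K x \<bullet> G K x) + (LINT x:K|lborel. \<phi> K x * div_K v K x)
      = (\<Sum>F | F facet_of K. orient F (nu F) K * (LINT x|\<Sigma> F. \<phi> K x * (v K x \<bullet> nu F)))"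
    if K: "K \<in> mh" for K
  proof -
    have \<phi>c: "continuous_on UNIV (\<phi> K)" by (rule GDERIV_continuous_on[OF \<phi>[OF K]])
    have "(LINT x:K|lborel. v K x \<bullet> G K x) + (LINT x:K|lborel. \<phi> K x * div_K v K x)
      = (LINT x:K|lborel. v K x \<bullet> G K x + \<phi> K x * div_K v K x)"
      by (intro set_integral_add(2)[symmetric] set_integrable_compact compact_mesh K continuous_on_inner
          continuous_on_mult pfield_cont[OF v] G \<phi>c div_K_cont[OF v])
    also have "\<dots> = (\<Sum>F | F facet_of K. orient F (nu F) K * (LINT x|\<Sigma> F. \<phi> K x * (v K x \<bullet> nu F)))"
      unfolding div_K_def
      by (rule divergence_simplex[OF mesh_facts(4)[OF K] mesh_facts(6)[OF K] \<phi>[OF K] G[OF K]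
            pfield_grad(1)[OF v K] pfield_grad_cont[OF v K]])
    finally show ?thesis .
  qed
  then have "(\<Sum>K\<in>mh. LINT x:K|lborel. v K x \<bullet> G K x) + (\<Sum>K\<in>mh. LINT x:K|lborel. \<phi> K x * div_K v K x)
      = (\<Sum>K\<in>mh. \<Sum>F | F facet_of K. orient F (nu F) K * (LINT x|\<Sigma> F. \<phi> K x * (v K x \<bullet> nu F)))"
    by (simp add: sum.distrib[symmetric])
  also have "\<dots> = (\<Sum>F\<in>Fint. orient F (nu F) (elem_plus D F) * (LINT x|\<Sigma> F. \<phi> (elem_plus D F) x * (v (elem_plus D F) x \<bullet> nu F))
          + orient F (nu F) (elem_minus D F) * (LINT x|\<Sigma> F. \<phi> (elem_minus D F) x * (v (elem_minus D F) x \<bullet> nu F)))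
      + (\<Sum>F\<in>Fbd. orient F (nu F) (elem_plus D F) * (LINT x|\<Sigma> F. \<phi> (elem_plus D F) x * (v (elem_plus D F) x \<bullet> nu F)))"
    by (rule sum_over_facets)
  also have "\<dots> = (\<Sum>F\<in>Fint. (LINT x|\<Sigma> F. \<phi> (elem_plus D F) x * (v (elem_plus D F) x \<bullet> nu F))
          - (LINT x|\<Sigma> F. \<phi> (elem_minus D F) x * (v (elem_minus D F) x \<bullet> nu F)))
      + (\<Sum>F\<in>Fbd. LINT x|\<Sigma> F. \<phi> (elem_plus D F) x * (v (elem_plus D F) x \<bullet> nu F))"
    using interior_facet_elems(5,6) boundary_facet_elems(3) by (simp cong: sum.cong)
  finally show ?thesis .
qed

text \<open>The weak constraint balances elementwise divergences against normal jumps on interior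
  facets and normal values on boundary facets. Test functions of small support then isolate each of
  these terms.\<close>

lemma dfree_identity:
  assumes w: "dfree w" and \<phi>: "C1_test UNIV \<phi> G"
  shows "(\<Sum>K\<in>mh. LINT x:K|lborel. \<phi> x * div_K w K x)
    = (\<Sum>F\<in>Fint. (LINT x|\<Sigma> F. \<phi> x * (w (elem_plus D F) x \<bullet> nu F)) - (LINT x|\<Sigma> F. \<phi> x * (w (elem_minus D F) x \<bullet> nu F)))
      + (\<Sum>F\<in>Fbd. LINT x|\<Sigma> F. \<phi> x * (w (elem_plus D F) x \<bullet> nu F))"
proof -
  have p: "pfield w" using w by (simp add: dfree_def)
  have \<phi>': "\<And>x. GDERIV \<phi> x :> G x" "continuous_on UNIV G" using \<phi> by (simp_all add: C1_test_def)
  have "(\<Sum>K\<in>mh. LINT x:K|lborel. w K x \<bullet> G x) = 0"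
    using w \<phi> L2_inner_assemble_right[OF pfield_cfield[OF p] \<phi>'(2)] by (simp add: dfree_def)
  moreover note divergence_mesh[OF p, of "\<lambda>_. \<phi>" "\<lambda>_. G", OF \<phi>'(1) \<phi>'(2)]
  ultimately show ?thesis by (simp only: add_0)
qed

text \<open>A facet is a proper face of its own element, and it lies in the closure of that
  element's interior, which no other interior meets.\<close>

lemma facet_not_interior:
  assumes "F \<in> facets mh" "K \<in> mh" "x \<in> F"
  shows "x \<notin> interior K"
proof
  assume x: "x \<in> interior K"
  obtain K' where K': "K' \<in> mh" "F facet_of K'" using assms(1) by (auto simp: facets_def)
  show False
  proof (cases "K' = K")
    case True
    have "F face_of K" "F \<noteq> K" using K'(2) True by (auto simp: facet_of_def)
    then show False using face_of_disjoint_interior[of F K] x assms(3) by blast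
  next
    case False
    have "x \<in> closure (interior K')"
      using simplex_full_dim(6)[OF mesh_facts(4)[OF K'(1)]] facet_of_imp_subset[OF K'(2)] assms(3) by auto
    then have "interior K \<inter> interior K' \<noteq> {}"
      using x open_Int_closure_eq_empty[OF open_interior[of K], of "interior K'"] by blast
    then show False using interior_mesh_disjoint[OF assms(2) K'(1)] False by simp
  qed
qed

lemma mesh_not_interior:
  assumes "K \<in> mh" "K' \<in> mh" "K' \<noteq> K" "x \<in> K'"
  shows "x \<notin> interior K"
proof
  assume x: "x \<in> interior K"
  have "x \<in> closure (interior K')" using simplex_full_dim(6)[OF mesh_facts(4)[OF assms(2)]] assms(4) by simp
  then have "interior K \<inter> interior K' \<noteq> {}"
    using x open_Int_closure_eq_empty[OF open_interior[of K], of "interior K'"] by blast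
  then show False using interior_mesh_disjoint[OF assms(1,2)] assms(3) by simp
qed

lemma zero_on_closure:
  fixes j :: "real^'n \<Rightarrow> real"
  assumes "continuous_on UNIV j" "\<And>x. x \<in> S \<Longrightarrow> j x = 0" "y \<in> closure S"
  shows "j y = 0"
proof -
  have "closed {x. j x = 0}" using assms(1) by (intro closed_Collect_eq continuous_on_const)
  then have "closure S \<subseteq> {x. j x = 0}" by (intro closure_minimal) (use assms(2) in auto)
  then show ?thesis using assms(3) by blast
qed

text \<open>A bump supported inside one element meets neither facets nor other elements, so only its
  own divergence integral remains. Continuity carries the result from the interior to the whole
  element.\<close>

lemma dfree_div:
  assumes w: "dfree w" and K: "K \<in> mh" and y: "y \<in> K"
  shows "div_K w K y = 0"
proof -
  have p: "pfield w" using w by (simp add: dfree_def)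
  have "div_K w K y = 0" if y: "y \<in> interior K" for y
  proof -
    obtain r0 where r0: "r0 > 0" "ball y r0 \<subseteq> interior K" using y by (rule openE[OF open_interior])
    have *: "(LINT x|density lborel (indicator K). bump y r x * div_K w K x) = 0" if r: "0 < r" "r \<le> r0" for r
    proof -
      have z: "bump y r x = 0" if "x \<notin> interior K" for x
        using bump_pos_iff[OF r(1), of y x] r0(2) r(2) that by (auto simp: subset_iff)
      have c: "continuous_on UNIV (\<lambda>x. bump y r x * (w K' x \<bullet> nu F))" if "K' \<in> mh" for K' F
        by (intro continuous_on_mult bump_continuous continuous_on_inner pfield_cont[OF p that] continuous_on_const)
      have F0: "(LINT x|\<Sigma> F. bump y r x * (w K' x \<bullet> nu F)) = 0" if "F \<in> facets mh" "K' \<in> mh" for F K'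
        by (rule \<Sigma>_zero[OF that(1) c[OF that(2)]]) (simp add: z facet_not_interior[OF that(1) K])
      have i0: "(LINT x|\<Sigma> F. bump y r x * (w (elem_plus D F) x \<bullet> nu F))
          - (LINT x|\<Sigma> F. bump y r x * (w (elem_minus D F) x \<bullet> nu F)) = 0" if "F \<in> Fint" for F
      proof -
        have F: "F \<in> facets mh" using that Fint_sub by blast
        show ?thesis unfolding F0[OF F interior_facet_elems(1)[OF that]] F0[OF F interior_facet_elems(2)[OF that]] by simp
      qed
      have b0: "(LINT x|\<Sigma> F. bump y r x * (w (elem_plus D F) x \<bullet> nu F)) = 0" if "F \<in> Fbd" for F
      proof -
        have "F \<in> facets mh" using that by (simp add: boundary_facets_def)
        then show ?thesis by (rule F0[OF _ boundary_facet_elems(1)[OF that]])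
      qed
      have "(\<Sum>K'\<in>mh. LINT x:K'|lborel. bump y r x * div_K w K' x) = 0"
        unfolding dfree_identity[OF w bump_C1_test] by (simp only: i0 b0 sum.neutral_const add_0 cong: sum.cong)
      moreover have "(\<Sum>K'\<in>mh - {K}. LINT x:K'|lborel. bump y r x * div_K w K' x) = 0"
      proof (rule sum.neutral, rule ballI)
        fix K' assume "K' \<in> mh - {K}"
        then have "x \<notin> interior K" if "x \<in> K'" for x using mesh_not_interior[OF K, of K' x] that by simp
        then show "(LINT x:K'|lborel. bump y r x * div_K w K' x) = 0"
          by (intro set_integral_zero) (simp add: z)
      qed
      ultimately have "(LINT x:K|lborel. bump y r x * div_K w K x) = 0"
        using sum.remove[OF mesh_facts(2) K, of "\<lambda>K'. LINT x:K'|lborel. bump y r x * div_K w K' x"] by simp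
      moreover have "(LINT x:K|lborel. bump y r x * div_K w K x) = (LINT x|density lborel (indicator K). bump y r x * div_K w K x)"
        by (intro set_integral_eq_density borel_measurable_continuous_onI continuous_on_mult bump_continuous div_K_cont[OF p K])
          (simp add: compact_mesh[OF K] compact_imp_closed)
      ultimately show ?thesis by simp
    qed
    show ?thesis
      by (rule zero_by_bumps[OF compact_measure_mesh[OF K] div_K_cont[OF p K]
            emeasure_density_ball_nonzero[OF compact_mesh[OF K] y] r0(1) *])
  qed
  moreover have "y \<in> closure (interior K)" using simplex_full_dim(6)[OF mesh_facts(4)[OF K]] y by simp
  ultimately show ?thesis by (rule zero_on_closure[OF div_K_cont[OF p K]])
qed

text \<open>The other facets are finitely many, so their union is closed, and none of them contains
  y.\<close>

lemma facet_isolated: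
  assumes F: "F \<in> facets mh" and y: "y \<in> rel_interior F"
  obtains r0 where "r0 > 0" "\<forall>F'\<in>facets mh. F' \<noteq> F \<longrightarrow> F' \<inter> ball y r0 = {}"
proof -
  have cl: "closed (\<Union>(facets mh - {F}))"
  proof (rule closed_Union)
    show "finite (facets mh - {F})" using finite_facets_mesh by simp
    show "\<forall>F'\<in>facets mh - {F}. closed F'"
    proof
      fix F' assume "F' \<in> facets mh - {F}"
      then obtain c where "flat_facet F' (nu F') c" using facet_flat[of F'] by blast
      then show "closed F'" by (simp add: flat_facet_def compact_imp_closed)
    qed
  qed
  obtain K where K: "K \<in> mh" "F facet_of K" using F by (auto simp: facets_def)
  have "y \<notin> \<Union>(facets mh - {F})"
  proof
    assume "y \<in> \<Union>(facets mh - {F})"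
    then obtain F' where F': "F' \<in> facets mh" "F' \<noteq> F" "y \<in> F'" by blast
    then obtain K' where K': "K' \<in> mh" "F' facet_of K'" by (auto simp: facets_def)
    have "F = F'" by (rule triangulation_facets_meet[OF mesh_facts(1) K(1) K'(1) mesh_facts(4)[OF K(1)]
            mesh_facts(4)[OF K'(1)] K(2) K'(2) y F'(3)])
    then show False using F'(2) by simp
  qed
  then have yc: "y \<in> - \<Union>(facets mh - {F})" by simp
  have op: "open (- \<Union>(facets mh - {F}))" using cl by (rule open_Compl)
  obtain r0 where r0: "r0 > 0" "ball y r0 \<subseteq> - \<Union>(facets mh - {F})" by (rule openE[OF op yc])
  show thesis using r0(2) by (intro that[OF r0(1)] ballI impI) blast
qed

lemma facet_support:
  assumes F: "F \<in> facets mh" and y: "y \<in> rel_interior F" and r: "0 < r"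
  shows "emeasure (\<Sigma> F) (ball y r) \<noteq> 0"
proof -
  obtain K where K: "K \<in> mh" "F facet_of K" using F by (auto simp: facets_def)
  obtain c where c: "flat_facet F (nu F) c" using F by (rule facet_flat)
  have "affine hull F = {y. y \<bullet> nu F = c}"
    by (rule facet_affine_hull[OF mesh_facts(4)[OF K(1)] K(2)]) (use c in \<open>auto simp: flat_facet_def\<close>)
  then show ?thesis by (rule flat_facet.emeasure_facet_ball_nonzero[OF c _ y r])
qed

lemma facet_closure_rel_interior:
  assumes "F \<in> facets mh" "y \<in> F"
  shows "y \<in> closure (rel_interior F)"
proof -
  obtain K where K: "K \<in> mh" "F facet_of K" using assms by (auto simp: facets_def)
  have "convex F" using facet_of_imp_face_of[OF K(2)] by (rule face_of_imp_convex)
  then show ?thesis using assms(2) convex_closure_rel_interior[of F] closure_subset by blast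
qed

text \<open>With the elementwise divergence already zero, a bump around a relative interior point
  sees a single facet. Boundary facets are reached as well because the test functions need not
  vanish there; continuity extends both identities to all of F.\<close>

lemma dfree_jump:
  assumes w: "dfree w" and y: "y \<in> F"
  shows "F \<in> Fint \<Longrightarrow> w (elem_plus D F) y \<bullet> nu F = w (elem_minus D F) y \<bullet> nu F"
    and "F \<in> Fbd \<Longrightarrow> w (elem_plus D F) y \<bullet> nu F = 0"
proof -
  have p: "pfield w" using w by (simp add: dfree_def)
  \<comment> \<open>The normal jump, with the exterior value read as 0 on the boundary, so that both
    claims become one.\<close>
  define j where "j F x = (if F \<in> Fint then w (elem_plus D F) x \<bullet> nu F - w (elem_minus D F) x \<bullet> nu F
    else w (elem_plus D F) x \<bullet> nu F)" for F x
  have Fsub: "F \<in> facets mh" if "F \<in> Fint \<or> F \<in> Fbd" for F using that facets_split(1) by blast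
  have wc: "continuous_on UNIV (\<lambda>x. w (elem_plus D F) x \<bullet> nu F)" if "F \<in> Fint \<or> F \<in> Fbd" for F
    using that interior_facet_elems(1) boundary_facet_elems(1)
    by (intro continuous_on_inner pfield_cont[OF p] continuous_on_const) blast
  have wc': "continuous_on UNIV (\<lambda>x. w (elem_minus D F) x \<bullet> nu F)" if "F \<in> Fint" for F
    using that interior_facet_elems(2) by (intro continuous_on_inner pfield_cont[OF p] continuous_on_const)
  have jc: "continuous_on UNIV (j F)" if "F \<in> Fint \<or> F \<in> Fbd" for F
    unfolding j_def using that wc[OF that] wc' by (cases "F \<in> Fint") (simp_all add: continuous_on_diff)
  have idj: "(\<Sum>F\<in>facets mh. LINT x|\<Sigma> F. \<phi> x * j F x) = (\<Sum>K\<in>mh. LINT x:K|lborel. \<phi> x * div_K w K x)"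
    if \<phi>: "C1_test UNIV \<phi> G" for \<phi> G
  proof -
    have \<phi>c: "continuous_on UNIV \<phi>" using \<phi> by (intro GDERIV_continuous_on[of \<phi> G]) (simp add: C1_test_def)
    have 1: "(LINT x|\<Sigma> F. \<phi> x * j F x) = (LINT x|\<Sigma> F. \<phi> x * (w (elem_plus D F) x \<bullet> nu F)) - (LINT x|\<Sigma> F. \<phi> x * (w (elem_minus D F) x \<bullet> nu F))"
      if F: "F \<in> Fint" for F
    proof -
      have "(LINT x|\<Sigma> F. \<phi> x * (w (elem_plus D F) x \<bullet> nu F)) - (LINT x|\<Sigma> F. \<phi> x * (w (elem_minus D F) x \<bullet> nu F))
        = (LINT x|\<Sigma> F. \<phi> x * (w (elem_plus D F) x \<bullet> nu F) - \<phi> x * (w (elem_minus D F) x \<bullet> nu F))"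
        by (intro Bochner_Integration.integral_diff[symmetric] \<Sigma>_integrable continuous_on_mult \<phi>c wc wc' Fsub)
          (use F in simp_all)
      then show ?thesis using F by (simp add: j_def right_diff_distrib)
    qed
    have 2: "(LINT x|\<Sigma> F. \<phi> x * j F x) = (LINT x|\<Sigma> F. \<phi> x * (w (elem_plus D F) x \<bullet> nu F))" if "F \<in> Fbd" for F
      using that by (simp add: j_def boundary_facets_def)
    show ?thesis
      unfolding facets_split(1) sum.union_disjoint[OF finite_Fint finite_Fbd facets_split(2)]
        dfree_identity[OF w \<phi>] using 1 2 by (simp cong: sum.cong)
  qed
  have rel: "j F y = 0" if F: "F \<in> Fint \<or> F \<in> Fbd" and y: "y \<in> rel_interior F" for F y
  proof -
    obtain r0 where r0: "r0 > 0" "\<forall>F'\<in>facets mh. F' \<noteq> F \<longrightarrow> F' \<inter> ball y r0 = {}"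
      by (rule facet_isolated[OF Fsub[OF F] y])
    have *: "(LINT x|\<Sigma> F. bump y r x * j F x) = 0" if r: "0 < r" "r \<le> r0" for r
    proof -
      have "(LINT x:K|lborel. bump y r x * div_K w K x) = 0" if "K \<in> mh" for K
        by (rule set_integral_zero) (simp add: dfree_div[OF w that])
      then have "(\<Sum>F\<in>facets mh. LINT x|\<Sigma> F. bump y r x * j F x) = 0" using idj[OF bump_C1_test] by simp
      moreover have "(\<Sum>F'\<in>facets mh - {F}. LINT x|\<Sigma> F'. bump y r x * j F' x) = 0"
      proof (rule sum.neutral, rule ballI)
        fix F' assume F': "F' \<in> facets mh - {F}"
        then have F'': "F' \<in> Fint \<or> F' \<in> Fbd" using facets_split(1) by blast
        show "(LINT x|\<Sigma> F'. bump y r x * j F' x) = 0"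
        proof (rule \<Sigma>_zero)
          show "F' \<in> facets mh" using F' by simp
          show "continuous_on UNIV (\<lambda>x. bump y r x * j F' x)" by (intro continuous_on_mult bump_continuous jc F'')
          fix x assume "x \<in> F'"
          moreover have "F' \<inter> ball y r0 = {}" using r0(2) F' by simp
          ultimately have "x \<notin> ball y r" using r by auto
          then show "bump y r x * j F' x = 0" using bump_pos_iff[OF r(1), of y x] by simp
        qed
      qed
      ultimately show ?thesis
        using sum.remove[OF finite_facets_mesh Fsub[OF F], of "\<lambda>F. LINT x|\<Sigma> F. bump y r x * j F x"] by simp
    qed
    show ?thesis
      by (rule zero_by_bumps[OF compact_measure_\<Sigma>[OF Fsub[OF F]] jc[OF F] facet_support[OF Fsub[OF F] y] r0(1) *])
  qed
  have "j F y = 0" if F: "F \<in> Fint \<or> F \<in> Fbd"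
    by (rule zero_on_closure[OF jc[OF F] rel[OF F] facet_closure_rel_interior[OF Fsub[OF F] y]])
  then show "F \<in> Fint \<Longrightarrow> w (elem_plus D F) y \<bullet> nu F = w (elem_minus D F) y \<bullet> nu F"
    and "F \<in> Fbd \<Longrightarrow> w (elem_plus D F) y \<bullet> nu F = 0"
    by (simp_all add: j_def boundary_facets_def)
qed

end

section \<open>Coercivity and skew symmetry\<close>

lemma continuous_on_matrix_vector [continuous_intros]:
  fixes A :: "'a::topological_space \<Rightarrow> real^'n^'m" and v :: "'a \<Rightarrow> real^'n"
  assumes "continuous_on S A" "continuous_on S v"
  shows "continuous_on S (\<lambda>x. A x *v v x)"
  unfolding matrix_vector_mult_def
  by (intro continuous_on_vec_lambda continuous_on_sum continuous_on_mult continuous_on_component assms)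

lemma continuous_on_vector_matrix:
  fixes A :: "'a::topological_space \<Rightarrow> real^'n^'m" and v :: "'a \<Rightarrow> real^'m"
  assumes "continuous_on S A" "continuous_on S v"
  shows "continuous_on S (\<lambda>x. v x v* A x)"
  unfolding vector_matrix_mult_def
  by (intro continuous_on_vec_lambda continuous_on_sum continuous_on_mult continuous_on_component assms)

text \<open>The norm of a matrix as a vector of rows is the Frobenius norm; Cauchy-Schwarz is
  applied to each row.\<close>

lemma norm_matrix_vector_le:
  fixes A :: "real^'n^'m"
  shows "norm (A *v x) \<le> norm A * norm x"
proof -
  have "(norm (A *v x))\<^sup>2 = (\<Sum>i\<in>UNIV. (A $ i \<bullet> x)\<^sup>2)"
    unfolding power2_norm_eq_inner inner_vec_def[of "A *v x"]
    by (simp add: matrix_vector_mul_component power2_eq_square)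
  also have "\<dots> \<le> (\<Sum>i\<in>UNIV. (norm (A $ i))\<^sup>2 * (norm x)\<^sup>2)"
  proof (rule sum_mono)
    fix i
    have "\<bar>A $ i \<bullet> x\<bar> \<le> norm (A $ i) * norm x" by (rule Cauchy_Schwarz_ineq2)
    then have "\<bar>A $ i \<bullet> x\<bar>\<^sup>2 \<le> (norm (A $ i) * norm x)\<^sup>2" by (rule power_mono) simp
    then show "(A $ i \<bullet> x)\<^sup>2 \<le> (norm (A $ i))\<^sup>2 * (norm x)\<^sup>2" by (simp add: power_mult_distrib)
  qed
  also have "\<dots> = (norm A * norm x)\<^sup>2"
    by (simp add: sum_distrib_right[symmetric] power_mult_distrib power2_norm_eq_inner[of A] inner_vec_def power2_norm_eq_inner)
  finally show ?thesis by (rule power2_le_imp_le) simp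
qed

text \<open>Fixing the constant by choice makes it a function of the degree alone.
  \<open>penalty_threshold\<close> and \<open>stab_const\<close> are built from it, so what they
  depend on can be read off their types.\<close>

definition L1_const :: "nat \<Rightarrow> real" where
  "L1_const m = (SOME C. C > 0 \<and> (\<forall>(p::real poly) a b t. degree p \<le> m \<and> a < b \<and> t \<in> {a..b} \<longrightarrow>
     \<bar>poly p t\<bar> \<le> C / (b - a) * (LINT s:{a..b}|lborel. \<bar>poly p s\<bar>)))"

lemma L1_const:
  shows "L1_const m > 0"
    and "degree p \<le> m \<Longrightarrow> a < b \<Longrightarrow> t \<in> {a..b} \<Longrightarrow>
      \<bar>poly p t\<bar> \<le> L1_const m / (b - a) * (LINT s:{a..b}|lborel. \<bar>poly p s\<bar>)"
proof -
  have "L1_const m > 0 \<and> (\<forall>(p::real poly) a b t. degree p \<le> m \<and> a < b \<and> t \<in> {a..b} \<longrightarrow>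
     \<bar>poly p t\<bar> \<le> L1_const m / (b - a) * (LINT s:{a..b}|lborel. \<bar>poly p s\<bar>))"
    unfolding L1_const_def by (rule someI_ex[OF poly_le_L1])
  then show "L1_const m > 0"
    and "degree p \<le> m \<Longrightarrow> a < b \<Longrightarrow> t \<in> {a..b} \<Longrightarrow>
      \<bar>poly p t\<bar> \<le> L1_const m / (b - a) * (LINT s:{a..b}|lborel. \<bar>poly p s\<bar>)" by simp_all
qed

lemma L2_norm_on_sq: "(L2_norm_on S u)\<^sup>2 = L2_inner S u u"
  unfolding L2_norm_on_def L2_inner_def power2_norm_eq_inner set_lebesgue_integral_def
  by (rule real_sqrt_pow2) (intro Bochner_Integration.integral_nonneg, simp)

text \<open>\<open>2 (k + 1) + (d - 1)\<close> bounds the degree, along a ray of the cone over a facet, of the squared gradient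
  times the Jacobian of the cone coordinates.\<close>

definition penalty_threshold :: "nat \<Rightarrow> nat \<Rightarrow> real \<Rightarrow> real" where
  "penalty_threshold d k \<rho> = 4 * (real d + 1) * (\<bar>\<rho>\<bar> + 1) * L1_const (2 * Suc k + (d - 1))"

lemma penalty_threshold_pos: "0 < penalty_threshold d k \<rho>"
  unfolding penalty_threshold_def using L1_const(1) by (intro mult_pos_pos) auto

context dg
begin

text \<open>The diffusion form at a single time; \<open>ch\<close> is its convective counterpart. No
  interpolation appears in \<open>ch\<close>, because the quadrature evaluates it only at Radau
  nodes.\<close>

definition ah :: "('n, real^'n) broken \<Rightarrow> ('n, real^'n) broken \<Rightarrow> real" where
  "ah u v = L2_inner \<Omega> (assemble D (grad u)) (assemble D (grad v))
    + (\<Sum>F\<in>facets mh. - facet_inner D F (\<lambda>x. avg D F (grad u) x *v nu F) (jump D F v)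
        - facet_inner D F (jump D F u) (\<lambda>x. avg D F (grad v) x *v nu F)
        + facet_inner D F (\<lambda>x. (pen D / diameter F) *\<^sub>R jump D F u x) (jump D F v))"

definition ch :: "('n, real^'n) broken \<Rightarrow> ('n, real^'n) broken \<Rightarrow> ('n, real^'n) broken \<Rightarrow> real" where
  "ch w u v = L2_inner \<Omega> (assemble D (\<lambda>K x. grad u K x *v w K x)) (assemble D v)
    + (\<Sum>F\<in>Fint. - facet_inner D F (\<lambda>x. normal_comp D F w x *\<^sub>R jump D F u x) (avg D F v)
        + 1/2 * facet_inner D F (\<lambda>x. gammaF D F w *\<^sub>R jump D F u x) (jump D F v))"

definition jump_sq :: "(real^'n) set \<Rightarrow> ('n, real^'n) broken \<Rightarrow> real" where
  "jump_sq F u = (LINT x|\<Sigma> F. (norm (jump D F u x))\<^sup>2)"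

lemma avg_cont:
  fixes v :: "('n, 'b::euclidean_space) broken"
  assumes "cfield v" "F \<in> facets mh"
  shows "continuous_on UNIV (avg D F v)" "continuous_on UNIV (jump D F v)"
proof -
  have "continuous_on UNIV (avg D F v) \<and> continuous_on UNIV (jump D F v)"
  proof (cases "F \<in> Fint")
    case True
    then have c: "continuous_on UNIV (v (elem_plus D F))" "continuous_on UNIV (v (elem_minus D F))"
      using assms(1) interior_facet_elems(1,2) by (simp_all add: cfield_def)
    have "avg D F v = (\<lambda>x. (1/2) *\<^sub>R (v (elem_plus D F) x + v (elem_minus D F) x))"
      "jump D F v = (\<lambda>x. v (elem_plus D F) x - v (elem_minus D F) x)"
      using True by (simp_all add: avg_def[abs_def] jump_def[abs_def])
    then show ?thesis using c by (simp add: continuous_on_scaleR continuous_on_add continuous_on_diff continuous_on_const)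
  next
    case False
    then have c: "continuous_on UNIV (v (elem_plus D F))"
      using assms boundary_facet_elems(1)[of F] by (simp add: cfield_def boundary_facets_def)
    have "avg D F v = v (elem_plus D F)" "jump D F v = v (elem_plus D F)"
      using False by (simp_all add: avg_def[abs_def] jump_def[abs_def])
    then show ?thesis using c by simp
  qed
  then show "continuous_on UNIV (avg D F v)" "continuous_on UNIV (jump D F v)" by simp_all
qed

lemma normal_comp_cont: "cfield w \<Longrightarrow> F \<in> facets mh \<Longrightarrow> continuous_on UNIV (normal_comp D F w)"
  unfolding normal_comp_def by (intro continuous_on_inner continuous_on_const avg_cont(1))

text \<open>The integrand is w applied to the gradient of |u|^2 / 2, and w has zero divergence, so
  only facet terms remain. On an interior facet the normal component of w is common to both sides
  and the jump of |u|^2 / 2 is the jump of u times its average; on the boundary w has no normal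
  component.\<close>

lemma ch_first_term:
  assumes "dfree w" "pfield u"
  shows "L2_inner \<Omega> (assemble D (\<lambda>K x. grad u K x *v w K x)) (assemble D u)
    = (\<Sum>F\<in>Fint. facet_inner D F (\<lambda>x. normal_comp D F w x *\<^sub>R jump D F u x) (avg D F u))"
proof -
  have pw: "pfield w" using assms(1) by (simp add: dfree_def)
  note cu = pfield_cont[OF assms(2)] and cg = pfield_grad_cont[OF assms(2)] and cw = pfield_cont[OF pw]
  define \<phi> where "\<phi> K x = (u K x \<bullet> u K x) / 2" for K x
  define G where "G K x = u K x v* grad u K x" for K x
  have \<phi>: "GDERIV (\<phi> K) x :> G K x" if "K \<in> mh" for K x
  proof -
    have "((\<lambda>x. u K x \<bullet> u K x) has_derivative (\<lambda>h. u K x \<bullet> (grad u K x *v h) + (grad u K x *v h) \<bullet> u K x)) (at x)"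
      by (rule has_derivative_inner[OF pfield_grad(1)[OF assms(2) that] pfield_grad(1)[OF assms(2) that]])
    then have "((\<lambda>x. (u K x \<bullet> u K x) / 2) has_derivative (\<lambda>h. (u K x \<bullet> (grad u K x *v h) + (grad u K x *v h) \<bullet> u K x) / 2)) (at x)"
      by (rule bounded_linear.has_derivative[OF bounded_linear_divide])
    moreover have "(u K x \<bullet> (grad u K x *v h) + (grad u K x *v h) \<bullet> u K x) / 2 = h \<bullet> G K x" for h
      unfolding G_def inner_commute[of h] dot_lmul_matrix by (simp add: inner_commute)
    ultimately show ?thesis by (simp add: gderiv_def \<phi>_def[abs_def])
  qed
  have Gc: "continuous_on UNIV (G K)" if "K \<in> mh" for K
    unfolding G_def by (intro continuous_on_vector_matrix cu cg that)
  have \<phi>c: "continuous_on UNIV (\<phi> K)" if "K \<in> mh" for K by (rule GDERIV_continuous_on[OF \<phi>[OF that]])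
  have wG: "(grad u K x *v w K x) \<bullet> u K x = w K x \<bullet> G K x" for K x
    unfolding G_def inner_commute[of "w K x"] dot_lmul_matrix by (rule inner_commute)
  have cgw: "cfield (\<lambda>K x. grad u K x *v w K x)"
    unfolding cfield_def by (intro ballI continuous_on_matrix_vector cg cw)
  have "L2_inner \<Omega> (assemble D (\<lambda>K x. grad u K x *v w K x)) (assemble D u) = (\<Sum>K\<in>mh. LINT x:K|lborel. w K x \<bullet> G K x)"
    unfolding L2_inner_assemble[OF cgw pfield_cfield[OF assms(2)]] wG ..
  also have "\<dots> = (\<Sum>K\<in>mh. LINT x:K|lborel. w K x \<bullet> G K x) + (\<Sum>K\<in>mh. LINT x:K|lborel. \<phi> K x * div_K w K x)"
  proof -
    have "(LINT x:K|lborel. \<phi> K x * div_K w K x) = 0" if "K \<in> mh" for K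
      by (rule set_integral_zero) (simp add: dfree_div[OF assms(1) that])
    then show ?thesis by (simp cong: sum.cong)
  qed
  also have "\<dots> = (\<Sum>F\<in>Fint. (LINT x|\<Sigma> F. \<phi> (elem_plus D F) x * (w (elem_plus D F) x \<bullet> nu F))
          - (LINT x|\<Sigma> F. \<phi> (elem_minus D F) x * (w (elem_minus D F) x \<bullet> nu F)))
      + (\<Sum>F\<in>Fbd. LINT x|\<Sigma> F. \<phi> (elem_plus D F) x * (w (elem_plus D F) x \<bullet> nu F))"
    by (rule divergence_mesh[OF pw \<phi> Gc])
  also have "(\<Sum>F\<in>Fbd. LINT x|\<Sigma> F. \<phi> (elem_plus D F) x * (w (elem_plus D F) x \<bullet> nu F)) = 0"
  proof (rule sum.neutral, rule ballI)
    fix F assume F: "F \<in> Fbd"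
    show "(LINT x|\<Sigma> F. \<phi> (elem_plus D F) x * (w (elem_plus D F) x \<bullet> nu F)) = 0"
    proof (rule \<Sigma>_zero)
      show "F \<in> facets mh" using F by (simp add: boundary_facets_def)
      show "continuous_on UNIV (\<lambda>x. \<phi> (elem_plus D F) x * (w (elem_plus D F) x \<bullet> nu F))"
        by (intro continuous_on_mult continuous_on_inner continuous_on_const \<phi>c cw boundary_facet_elems(1) F)
      show "\<phi> (elem_plus D F) x * (w (elem_plus D F) x \<bullet> nu F) = 0" if "x \<in> F" for x
        using dfree_jump(2)[OF assms(1) that F] by simp
    qed
  qed
  also have "(\<Sum>F\<in>Fint. (LINT x|\<Sigma> F. \<phi> (elem_plus D F) x * (w (elem_plus D F) x \<bullet> nu F))
          - (LINT x|\<Sigma> F. \<phi> (elem_minus D F) x * (w (elem_minus D F) x \<bullet> nu F)))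
      = (\<Sum>F\<in>Fint. facet_inner D F (\<lambda>x. normal_comp D F w x *\<^sub>R jump D F u x) (avg D F u))"
  proof (rule sum.cong)
    fix F assume F: "F \<in> Fint"
    have Ff: "F \<in> facets mh" using F Fint_sub by blast
    let ?p = "elem_plus D F" and ?m = "elem_minus D F"
    have c: "continuous_on UNIV (\<lambda>x. \<phi> ?p x * (w ?p x \<bullet> nu F))" "continuous_on UNIV (\<lambda>x. \<phi> ?m x * (w ?m x \<bullet> nu F))"
      by (intro continuous_on_mult continuous_on_inner continuous_on_const \<phi>c cw interior_facet_elems F)+
    have "(LINT x|\<Sigma> F. \<phi> ?p x * (w ?p x \<bullet> nu F)) - (LINT x|\<Sigma> F. \<phi> ?m x * (w ?m x \<bullet> nu F))
      = (LINT x|\<Sigma> F. \<phi> ?p x * (w ?p x \<bullet> nu F) - \<phi> ?m x * (w ?m x \<bullet> nu F))"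
      by (rule Bochner_Integration.integral_diff[symmetric]) (rule \<Sigma>_integrable[OF Ff c(1)] \<Sigma>_integrable[OF Ff c(2)])+
    also have "\<dots> = (LINT x|\<Sigma> F. (normal_comp D F w x *\<^sub>R jump D F u x) \<bullet> avg D F u x)"
    proof (rule \<Sigma>_cong[OF Ff])
      show "continuous_on UNIV (\<lambda>x. \<phi> ?p x * (w ?p x \<bullet> nu F) - \<phi> ?m x * (w ?m x \<bullet> nu F))"
        by (intro continuous_on_diff c)
      show "continuous_on UNIV (\<lambda>x. (normal_comp D F w x *\<^sub>R jump D F u x) \<bullet> avg D F u x)"
        by (intro continuous_on_inner continuous_on_scaleR normal_comp_cont avg_cont pfield_cfield pw assms Ff)
      fix x assume x: "x \<in> F"
      have s: "w ?p x \<bullet> nu F = w ?m x \<bullet> nu F" by (rule dfree_jump(1)[OF assms(1) x F])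
      have n: "normal_comp D F w x = w ?m x \<bullet> nu F"
        using F s by (simp add: normal_comp_def avg_def inner_add_left)
      have "jump D F u x \<bullet> avg D F u x = \<phi> ?p x - \<phi> ?m x"
        using F by (simp add: jump_def avg_def \<phi>_def inner_add_right inner_diff_left inner_diff_right inner_commute field_simps)
      then have "(normal_comp D F w x *\<^sub>R jump D F u x) \<bullet> avg D F u x = (w ?m x \<bullet> nu F) * (\<phi> ?p x - \<phi> ?m x)"
        by (simp add: n)
      then show "\<phi> ?p x * (w ?p x \<bullet> nu F) - \<phi> ?m x * (w ?m x \<bullet> nu F) = (normal_comp D F w x *\<^sub>R jump D F u x) \<bullet> avg D F u x"
        by (simp add: s right_diff_distrib mult.commute)
    qed
    finally show "(LINT x|\<Sigma> F. \<phi> ?p x * (w ?p x \<bullet> nu F)) - (LINT x|\<Sigma> F. \<phi> ?m x * (w ?m x \<bullet> nu F))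
      = facet_inner D F (\<lambda>x. normal_comp D F w x *\<^sub>R jump D F u x) (avg D F u)"
      by (simp add: facet_inner_def)
  qed simp
  finally show ?thesis by simp
qed

text \<open>The volume term cancels the central flux, whatever the size of w; only the upwind
  penalty is left.\<close>

lemma ch_skew:
  assumes "dfree w" "pfield u"
  shows "ch w u u = 1/2 * (\<Sum>F\<in>Fint. gammaF D F w * jump_sq F u)"
proof -
  have "facet_inner D F (\<lambda>x. gammaF D F w *\<^sub>R jump D F u x) (jump D F u) = gammaF D F w * jump_sq F u" for F
    by (simp add: facet_inner_def jump_sq_def power2_norm_eq_inner)
  then show ?thesis
    unfolding ch_def ch_first_term[OF assms] by (simp add: sum.distrib sum_subtractf sum_negf sum_distrib_left)
qed

lemma gammaF_pos: "0 < gammaF D F w"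
  using valid by (simp add: gammaF_def valid_discretization_def less_max_iff_disj)

lemma jump_sq_nonneg: "0 \<le> jump_sq F u"
  unfolding jump_sq_def by (intro Bochner_Integration.integral_nonneg) simp

text \<open>The trace inequality on a cone involves its height. Shape regularity compares the height
  with the facet diameter, because a ball inside K has to fit between the base plane and the
  parallel plane through the apex.\<close>

lemma facet_trace:
  assumes K: "K \<in> mh" and F: "F facet_of K" and p: "poly_le k p"
  shows "diameter F * (LINT x|\<Sigma> F. (p x)\<^sup>2)
    \<le> \<bar>shreg D\<bar> * L1_const (2 * k + (CARD('n) - 1)) * (LINT x:K|lborel. (p x)\<^sup>2)"
proof (rule facet_apex[OF mesh_facts(4)[OF K] mesh_facts(6)[OF K] F])
  fix a c
  assume a: "a \<in> K" "flat_facet F (nu F) c" "convex F" "a \<bullet> nu F \<noteq> c" "K = convex hull (insert a F)"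
    and slab: "\<And>z. z \<in> K \<Longrightarrow> 0 \<le> sgn (c - a \<bullet> nu F) * (c - z \<bullet> nu F) \<and> sgn (c - a \<bullet> nu F) * (c - z \<bullet> nu F) \<le> \<bar>c - a \<bullet> nu F\<bar>"
  interpret flat_facet F "nu F" c by (rule a(2))
  let ?h = "\<bar>c - a \<bullet> nu F\<bar>" and ?I = "LINT x|\<Sigma> F. (p x)\<^sup>2" and ?C = "L1_const (2 * k + (CARD('n) - 1))"
  \<comment> \<open>The centre and the point at distance r from it in direction m both lie in K,
    hence in a slab whose width is the height.\<close>
  have r_le: "r \<le> ?h" if "0 \<le> r" "cball x r \<subseteq> K" for r x
  proof -
    have xK: "x \<in> K" "x + r *\<^sub>R nu F \<in> K" using that norm_m by (auto simp: subset_iff dist_norm)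
    have "sgn (c - a \<bullet> nu F) * (c - (x + r *\<^sub>R nu F) \<bullet> nu F)
        = sgn (c - a \<bullet> nu F) * (c - x \<bullet> nu F) - sgn (c - a \<bullet> nu F) * r"
      by (simp add: inner_add_left m_m algebra_simps)
    moreover have "sgn (c - a \<bullet> nu F) = 1 \<or> sgn (c - a \<bullet> nu F) = - 1" using a(4) by (auto simp: sgn_if)
    ultimately show ?thesis using slab[OF xK(1)] slab[OF xK(2)] by auto
  qed
  let ?R = "{r. 0 \<le> r \<and> (\<exists>x. cball x r \<subseteq> K)}"
  have R0: "0 \<in> ?R" using a(1) by (auto intro!: exI[of _ a])
  have bdd: "bdd_above ?R" by (rule bdd_aboveI[of _ ?h]) (use r_le in blast)
  have inr: "0 \<le> inradius K" "inradius K \<le> ?h"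
    unfolding inradius_def using cSup_upper[OF R0 bdd] cSup_least[of ?R ?h] R0 r_le by blast+
  have "diameter F \<le> diameter K"
    by (rule diameter_subset[OF facet_of_imp_subset[OF F] compact_imp_bounded[OF compact_mesh[OF K]]])
  also have "\<dots> \<le> shreg D * inradius K" by (rule mesh_facts(5)[OF K])
  also have "\<dots> \<le> \<bar>shreg D\<bar> * ?h"
    using inr by (intro mult_mono) auto
  finally have dF: "diameter F \<le> \<bar>shreg D\<bar> * ?h" .
  have I0: "0 \<le> ?I" by (intro Bochner_Integration.integral_nonneg) simp
  have tr: "?h * ?I \<le> ?C * (LINT z:convex hull (insert a F)|lborel. (p z)\<^sup>2)"
  proof (rule trace_inequality[OF a(3,4) p])
    fix P :: "real poly" and t :: real
    assume "degree P \<le> 2 * k + (CARD('n) - 1)" "t \<in> {0..1}"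
    then show "\<bar>poly P t\<bar> \<le> ?C * (LINT s:{0..1}|lborel. \<bar>poly P s\<bar>)"
      using L1_const(2)[of P "2 * k + (CARD('n) - 1)" 0 1 t] by simp
  qed
  have "diameter F * ?I \<le> (\<bar>shreg D\<bar> * ?h) * ?I" using dF I0 by (rule mult_right_mono)
  also have "\<dots> = \<bar>shreg D\<bar> * (?h * ?I)" by simp
  also have "\<dots> \<le> \<bar>shreg D\<bar> * (?C * (LINT z:K|lborel. (p z)\<^sup>2))"
    using tr unfolding a(5)[symmetric] by (rule mult_left_mono) simp
  finally show ?thesis by (simp add: mult.assoc)
qed

lemma norm_matrix_sq: "(norm (A::real^'a^'b))\<^sup>2 = (\<Sum>i\<in>UNIV. \<Sum>j\<in>UNIV. (A $ i $ j)\<^sup>2)"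
  unfolding power2_norm_eq_inner inner_vec_def by (simp add: power2_eq_square)

lemma facet_trace_matrix:
  assumes K: "K \<in> mh" and F: "F facet_of K" and A: "mpoly k A"
  shows "diameter F * (LINT x|\<Sigma> F. (norm (A x))\<^sup>2)
    \<le> \<bar>shreg D\<bar> * L1_const (2 * k + (CARD('n) - 1)) * (LINT x:K|lborel. (norm (A x))\<^sup>2)"
proof -
  let ?C = "\<bar>shreg D\<bar> * L1_const (2 * k + (CARD('n) - 1))"
  have Ff: "F \<in> facets mh" using K F by (auto simp: facets_def)
  have p: "poly_le k (\<lambda>x. A x $ i $ j)" for i j using A by (simp add: mpoly_def)
  have c: "continuous_on UNIV (\<lambda>x. (A x $ i $ j)\<^sup>2)" for i j
    by (intro continuous_on_power poly_le_continuous[OF p])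
  have 1: "(LINT x|\<Sigma> F. (norm (A x))\<^sup>2) = (\<Sum>i\<in>UNIV. \<Sum>j\<in>UNIV. LINT x|\<Sigma> F. (A x $ i $ j)\<^sup>2)"
    unfolding norm_matrix_sq
    by (simp only: Bochner_Integration.integral_sum Bochner_Integration.integrable_sum \<Sigma>_integrable[OF Ff c])
  have 2: "(LINT x:K|lborel. (norm (A x))\<^sup>2) = (\<Sum>i\<in>UNIV. \<Sum>j\<in>UNIV. LINT x:K|lborel. (A x $ i $ j)\<^sup>2)"
  proof -
    have "(LINT x:K|lborel. (norm (A x))\<^sup>2) = (\<Sum>i\<in>UNIV. LINT x:K|lborel. (\<Sum>j\<in>UNIV. (A x $ i $ j)\<^sup>2))"
      unfolding norm_matrix_sq
      by (intro set_integral_sum set_integrable_compact compact_mesh[OF K] continuous_on_sum c)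
    also have "\<dots> = (\<Sum>i\<in>UNIV. \<Sum>j\<in>UNIV. LINT x:K|lborel. (A x $ i $ j)\<^sup>2)"
      by (intro sum.cong refl set_integral_sum set_integrable_compact compact_mesh[OF K] c)
    finally show ?thesis .
  qed
  show ?thesis unfolding 1 2 sum_distrib_left by (intro sum_mono facet_trace K F p)
qed

text \<open>A single point has affine dimension 0, a facet d - 1. Positivity keeps the penalty
  weight \<sigma> / h_F from being a division by zero.\<close>

lemma facet_diameter_pos:
  assumes "2 \<le> CARD('n)" "F \<in> facets mh"
  shows "0 < diameter F"
proof (rule ccontr)
  assume n: "\<not> 0 < diameter F"
  obtain K where K: "K \<in> mh" "F facet_of K" using assms(2) by (auto simp: facets_def)
  obtain c where c: "flat_facet F (nu F) c" using assms(2) by (rule facet_flat)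
  then have b: "bounded F" and ne: "F \<noteq> {}" by (auto simp: flat_facet_def compact_imp_bounded)
  obtain y where y: "y \<in> F" using ne by blast
  have "x = y" if "x \<in> F" for x using diameter_bounded_bound[OF b that y] n zero_le_dist[of x y] by (metis dist_eq_0_iff dual_order.antisym not_less order_trans)
  then have "F = {y}" using y by blast
  then have "aff_dim F = 0" by simp
  moreover have "aff_dim F = int CARD('n) - 1"
    using K(2) simplex_full_dim(7)[OF mesh_facts(4)[OF K(1)]] by (simp add: facet_of_def)
  ultimately show False using assms(1) by simp
qed

text \<open>The square of a mean of two is at most the sum of the squares, so the facet integral is
  charged to the adjacent elements.\<close>

lemma avg_grad_bound:
  assumes u: "pfield u" and F: "F \<in> facets mh"
  shows "(LINT x|\<Sigma> F. (norm (avg D F (grad u) x *v nu F))\<^sup>2) \<le> (\<Sum>K\<in>adj F. LINT x|\<Sigma> F. (norm (grad u K x))\<^sup>2)"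
proof -
  have adj: "K \<in> mh" if "K \<in> adj F" for K using that by (simp add: adj_def)
  have fin: "finite (adj F)" using mesh_facts(2) by (simp add: adj_def)
  have n1: "norm (nu F) = 1"
  proof -
    obtain c where "flat_facet F (nu F) c" using F by (rule facet_flat)
    then show ?thesis by (rule flat_facet.norm_m)
  qed
  have c: "continuous_on UNIV (\<lambda>x. (norm (grad u K x))\<^sup>2)" if "K \<in> adj F" for K
    by (intro continuous_on_power continuous_on_norm pfield_grad_cont[OF u adj[OF that]])
  have pt: "(norm (avg D F (grad u) x *v nu F))\<^sup>2 \<le> (\<Sum>K\<in>adj F. (norm (grad u K x))\<^sup>2)" for x
  proof -
    have "(norm (avg D F (grad u) x *v nu F))\<^sup>2 \<le> (norm (avg D F (grad u) x))\<^sup>2"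
      using norm_matrix_vector_le[of "avg D F (grad u) x" "nu F"] n1 by (intro power_mono) auto
    also have "\<dots> \<le> (\<Sum>K\<in>adj F. (norm (grad u K x))\<^sup>2)"
    proof (cases "F \<in> Fint")
      case True
      let ?A = "grad u (elem_plus D F) x" and ?B = "grad u (elem_minus D F) x"
      have "norm ((1/2) *\<^sub>R (?A + ?B)) \<le> (norm ?A + norm ?B) / 2"
        using norm_triangle_ineq[of ?A ?B] by simp
      then have "(norm ((1/2) *\<^sub>R (?A + ?B)))\<^sup>2 \<le> ((norm ?A + norm ?B) / 2)\<^sup>2" by (rule power_mono) simp
      also have "\<dots> \<le> (norm ?A)\<^sup>2 + (norm ?B)\<^sup>2"
      proof -
        have "((p + q) / 2)\<^sup>2 \<le> p\<^sup>2 + q\<^sup>2" for p q :: real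
        proof -
          have "((p + q) / 2)\<^sup>2 + 0 \<le> ((p + q) / 2)\<^sup>2 + ((p - q)\<^sup>2 / 4 + (p\<^sup>2 + q\<^sup>2) / 2)"
            by (intro add_left_mono) simp
          also have "\<dots> = p\<^sup>2 + q\<^sup>2" by (simp add: power2_eq_square field_simps)
          finally show ?thesis by simp
        qed
        then show ?thesis .
      qed
      finally show ?thesis using True interior_facet_elems(3,4)[OF True] by (simp add: avg_def)
    next
      case False
      then have "F \<in> Fbd" using F by (simp add: boundary_facets_def)
      then show ?thesis using boundary_facet_elems(2)[of F] False by (simp add: avg_def)
    qed
    finally show ?thesis .
  qed
  have "(LINT x|\<Sigma> F. (norm (avg D F (grad u) x *v nu F))\<^sup>2) \<le> (LINT x|\<Sigma> F. (\<Sum>K\<in>adj F. (norm (grad u K x))\<^sup>2))"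
  proof (rule integral_mono)
    show "integrable (\<Sigma> F) (\<lambda>x. (norm (avg D F (grad u) x *v nu F))\<^sup>2)"
      by (intro \<Sigma>_integrable[OF F] continuous_on_power continuous_on_norm continuous_on_matrix_vector
          avg_cont(1)[OF pfield_grad_cfield[OF u] F] continuous_on_const)
    show "integrable (\<Sigma> F) (\<lambda>x. \<Sum>K\<in>adj F. (norm (grad u K x))\<^sup>2)"
      by (intro \<Sigma>_integrable[OF F] continuous_on_sum c)
  qed (rule pt)
  also have "\<dots> = (\<Sum>K\<in>adj F. LINT x|\<Sigma> F. (norm (grad u K x))\<^sup>2)"
    by (intro Bochner_Integration.integral_sum \<Sigma>_integrable[OF F] c)
  finally show ?thesis .
qed

text \<open>Young's inequality splits the consistency terms into half of the penalty and a facet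
  integral of averaged gradients. The trace inequality moves the latter to the elements, where a
  large \<sigma> makes it at most half of the gradient term.\<close>

lemma ah_coercive:
  assumes u: "pfield u" and d: "2 \<le> CARD('n)" and pen: "penalty_threshold CARD('n) (spdeg D) (shreg D) \<le> pen D"
  shows "1/2 * Ah_norm_sq D u \<le> ah u u"
proof -
  let ?\<sigma> = "pen D" and ?C = "\<bar>shreg D\<bar> * L1_const (2 * deg + (CARD('n) - 1))"
  define S where "S = L2_inner \<Omega> (assemble D (grad u)) (assemble D (grad u))"
  define g where "g F = (LINT x|\<Sigma> F. (norm (avg D F (grad u) x *v nu F))\<^sup>2)" for F
  define q where "q F = (LINT x|\<Sigma> F. (avg D F (grad u) x *v nu F) \<bullet> jump D F u x)" for F
  have \<sigma>: "0 < ?\<sigma>" using pen penalty_threshold_pos less_le_trans by blast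
  have C0: "0 \<le> ?C" using L1_const(1) by (simp add: less_imp_le)
  have S: "S = (\<Sum>K\<in>mh. LINT x:K|lborel. (norm (grad u K x))\<^sup>2)"
    unfolding S_def L2_inner_assemble[OF pfield_grad_cfield[OF u] pfield_grad_cfield[OF u]] power2_norm_eq_inner ..
  have young: "2 * q F \<le> 2 * diameter F / ?\<sigma> * g F + ?\<sigma> / (2 * diameter F) * jump_sq F u" if F: "F \<in> facets mh" for F
  proof -
    let ?h = "diameter F"
    have h: "0 < ?h" by (rule facet_diameter_pos[OF d F])
    have ca: "continuous_on UNIV (\<lambda>x. avg D F (grad u) x *v nu F)"
      by (intro continuous_on_matrix_vector avg_cont(1)[OF pfield_grad_cfield[OF u] F] continuous_on_const)
    have cj: "continuous_on UNIV (jump D F u)" by (rule avg_cont(2)[OF pfield_cfield[OF u] F])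
    have ia: "integrable (\<Sigma> F) (\<lambda>x. (norm (avg D F (grad u) x *v nu F))\<^sup>2)"
      by (intro \<Sigma>_integrable[OF F] continuous_on_power continuous_on_norm ca)
    have ij: "integrable (\<Sigma> F) (\<lambda>x. (norm (jump D F u x))\<^sup>2)"
      by (intro \<Sigma>_integrable[OF F] continuous_on_power continuous_on_norm cj)
    have iq: "integrable (\<Sigma> F) (\<lambda>x. (avg D F (grad u) x *v nu F) \<bullet> jump D F u x)"
      by (intro \<Sigma>_integrable[OF F] continuous_on_inner ca cj)
    have pt: "2 * (a \<bullet> b) \<le> 2 * ?h / ?\<sigma> * (norm a)\<^sup>2 + ?\<sigma> / (2 * ?h) * (norm b)\<^sup>2" for a b :: "real^'n"
    proof -
      \<comment> \<open>With this weight the jump receives \<sigma> / (2 h_F), exactly half of the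
        penalty.\<close>
      define t where "t = 2 * ?h / ?\<sigma>"
      have t: "0 < t" "?\<sigma> / (2 * ?h) = 1 / t" using h \<sigma> by (simp_all add: t_def)
      have "0 \<le> (norm (t *\<^sub>R a - b))\<^sup>2" by simp
      also have "\<dots> = t\<^sup>2 * (norm a)\<^sup>2 - 2 * t * (a \<bullet> b) + (norm b)\<^sup>2"
        unfolding power2_norm_eq_inner by (simp add: inner_diff_left inner_diff_right inner_commute power2_eq_square)
      finally have "t * (2 * (a \<bullet> b)) \<le> t * (t * (norm a)\<^sup>2 + 1 / t * (norm b)\<^sup>2)"
        using t(1) by (simp add: distrib_left power2_eq_square)
      then show ?thesis using t by (simp add: t_def[symmetric])
    qed
    have "2 * q F = (LINT x|\<Sigma> F. 2 * ((avg D F (grad u) x *v nu F) \<bullet> jump D F u x))"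
      by (simp add: q_def)
    also have "\<dots> \<le> (LINT x|\<Sigma> F. 2 * ?h / ?\<sigma> * (norm (avg D F (grad u) x *v nu F))\<^sup>2 + ?\<sigma> / (2 * ?h) * (norm (jump D F u x))\<^sup>2)"
      by (intro integral_mono Bochner_Integration.integrable_add integrable_mult_right ia ij iq pt)
    also have "\<dots> = 2 * ?h / ?\<sigma> * g F + ?\<sigma> / (2 * ?h) * jump_sq F u"
      unfolding g_def jump_sq_def
      by (subst Bochner_Integration.integral_add) (intro integrable_mult_right ia ij | simp)+
    finally show ?thesis .
  qed
  have "(\<Sum>F\<in>facets mh. diameter F * g F) \<le> (\<Sum>F\<in>facets mh. \<Sum>K\<in>adj F. ?C * (LINT x:K|lborel. (norm (grad u K x))\<^sup>2))"
  proof (rule sum_mono)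
    fix F assume F: "F \<in> facets mh"
    have "diameter F * g F \<le> diameter F * (\<Sum>K\<in>adj F. LINT x|\<Sigma> F. (norm (grad u K x))\<^sup>2)"
      unfolding g_def using facet_diameter_pos[OF d F] by (intro mult_left_mono avg_grad_bound u F) simp
    also have "\<dots> \<le> (\<Sum>K\<in>adj F. ?C * (LINT x:K|lborel. (norm (grad u K x))\<^sup>2))"
      unfolding sum_distrib_left
    proof (rule sum_mono)
      fix K assume "K \<in> adj F"
      then have K: "K \<in> mh" "F facet_of K" by (simp_all add: adj_def)
      show "diameter F * (LINT x|\<Sigma> F. (norm (grad u K x))\<^sup>2) \<le> ?C * (LINT x:K|lborel. (norm (grad u K x))\<^sup>2)"
        by (rule facet_trace_matrix[OF K pfield_grad(2)[OF u K(1)]])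
    qed
    finally show "diameter F * g F \<le> (\<Sum>K\<in>adj F. ?C * (LINT x:K|lborel. (norm (grad u K x))\<^sup>2))" .
  qed
  also have "\<dots> = (\<Sum>K\<in>mh. \<Sum>F | F \<in> facets mh \<and> F facet_of K. ?C * (LINT x:K|lborel. (norm (grad u K x))\<^sup>2))"
    unfolding adj_def using finite_facets_mesh mesh_facts(2) by (rule sum.swap_restrict)
  \<comment> \<open>Each element is charged once by each of its d + 1 facets.\<close>
  also have "\<dots> = (\<Sum>K\<in>mh. (real CARD('n) + 1) * (?C * (LINT x:K|lborel. (norm (grad u K x))\<^sup>2)))"
  proof (rule sum.cong)
    fix K assume K: "K \<in> mh"
    have "{F. F \<in> facets mh \<and> F facet_of K} = {F. F facet_of K}" using K by (auto simp: facets_def)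
    then show "(\<Sum>F | F \<in> facets mh \<and> F facet_of K. ?C * (LINT x:K|lborel. (norm (grad u K x))\<^sup>2))
      = (real CARD('n) + 1) * (?C * (LINT x:K|lborel. (norm (grad u K x))\<^sup>2))"
      using card_facets[OF mesh_facts(4)[OF K]] by (simp add: add.commute)
  qed simp
  also have "\<dots> = (real CARD('n) + 1) * ?C * S"
    unfolding S by (simp add: sum_distrib_left mult.assoc)
  finally have G: "(\<Sum>F\<in>facets mh. diameter F * g F) \<le> (real CARD('n) + 1) * ?C * S" .
  have S0: "0 \<le> S" unfolding S_def L2_norm_on_sq[symmetric] by simp
  have "4 * ((real CARD('n) + 1) * ?C) \<le> penalty_threshold CARD('n) (spdeg D) (shreg D)"
  proof -
    have "?C \<le> (\<bar>shreg D\<bar> + 1) * L1_const (2 * deg + (CARD('n) - 1))"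
      using L1_const(1)[of "2 * deg + (CARD('n) - 1)"] by (intro mult_right_mono) auto
    then have "(4 * (real CARD('n) + 1)) * ?C \<le> (4 * (real CARD('n) + 1)) * ((\<bar>shreg D\<bar> + 1) * L1_const (2 * deg + (CARD('n) - 1)))"
      by (rule mult_left_mono) simp
    then show ?thesis unfolding penalty_threshold_def by (simp only: mult.assoc)
  qed
  then have \<sigma>C: "4 * ((real CARD('n) + 1) * ?C) \<le> ?\<sigma>" using pen by linarith
  \<comment> \<open>The factor 4 of the threshold arises here: 2 / \<sigma> times the element bound
    must not exceed S / 2.\<close>
  have GS: "2 / ?\<sigma> * (\<Sum>F\<in>facets mh. diameter F * g F) \<le> S / 2"
  proof -
    have "2 / ?\<sigma> * (\<Sum>F\<in>facets mh. diameter F * g F) \<le> 2 / ?\<sigma> * ((real CARD('n) + 1) * ?C * S)"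
      using G \<sigma> by (intro mult_left_mono) auto
    also have "\<dots> = 4 * ((real CARD('n) + 1) * ?C) / ?\<sigma> * (S / 2)" by simp
    also have "\<dots> \<le> 1 * (S / 2)" using \<sigma>C \<sigma> S0 by (intro mult_right_mono) auto
    finally show ?thesis by simp
  qed
  have "(\<Sum>F\<in>facets mh. 2 * q F) \<le> (\<Sum>F\<in>facets mh. 2 * diameter F / ?\<sigma> * g F + ?\<sigma> / (2 * diameter F) * jump_sq F u)"
    by (intro sum_mono young)
  also have "\<dots> = 2 / ?\<sigma> * (\<Sum>F\<in>facets mh. diameter F * g F) + 1/2 * (\<Sum>F\<in>facets mh. ?\<sigma> / diameter F * jump_sq F u)"
    by (simp add: sum.distrib sum_distrib_left mult.assoc)
  finally have Q: "(\<Sum>F\<in>facets mh. 2 * q F) \<le> S / 2 + 1/2 * (\<Sum>F\<in>facets mh. ?\<sigma> / diameter F * jump_sq F u)"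
    using GS by linarith
  have "ah u u = S + (\<Sum>F\<in>facets mh. - q F - q F + ?\<sigma> / diameter F * jump_sq F u)"
    unfolding ah_def S_def[symmetric]
    by (simp add: facet_inner_def q_def jump_sq_def power2_norm_eq_inner inner_commute)
  also have "\<dots> = S - (\<Sum>F\<in>facets mh. 2 * q F) + (\<Sum>F\<in>facets mh. ?\<sigma> / diameter F * jump_sq F u)"
    by (simp add: sum.distrib sum_subtractf sum_negf sum_distrib_left[symmetric])
  finally have A: "ah u u = S - (\<Sum>F\<in>facets mh. 2 * q F) + (\<Sum>F\<in>facets mh. ?\<sigma> / diameter F * jump_sq F u)" .
  have "Ah_norm_sq D u = S + (\<Sum>F\<in>facets mh. ?\<sigma> / diameter F * jump_sq F u)"
    unfolding Ah_norm_sq_def L2_norm_on_sq S_def jump_sq_def by simp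
  then show ?thesis using A Q by (simp only:) (simp add: algebra_simps)
qed

end

section \<open>Polynomials in time and the Radau rule\<close>

lemma L2_on_integrable:
  fixes u v :: "real^'n \<Rightarrow> 'b::euclidean_space"
  assumes "L2_on S u" "L2_on S v"
  shows "integrable lborel (\<lambda>x. (indicator S x *\<^sub>R u x) \<bullet> (indicator S x *\<^sub>R v x))"
proof (rule Bochner_Integration.integrable_bound)
  have m: "(\<lambda>x. indicator S x *\<^sub>R u x) \<in> borel_measurable lborel" "(\<lambda>x. indicator S x *\<^sub>R v x) \<in> borel_measurable lborel"
    using assms by (simp_all add: L2_on_def set_borel_measurable_def)
  show "(\<lambda>x. (indicator S x *\<^sub>R u x) \<bullet> (indicator S x *\<^sub>R v x)) \<in> borel_measurable lborel"
    using m by (rule borel_measurable_inner)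
  show "integrable lborel (\<lambda>x. indicator S x *\<^sub>R (norm (u x))\<^sup>2 + indicator S x *\<^sub>R (norm (v x))\<^sup>2)"
    using assms by (intro Bochner_Integration.integrable_add) (simp_all add: L2_on_def set_integrable_def)
  have "\<bar>a \<bullet> b\<bar> \<le> (norm a)\<^sup>2 + (norm b)\<^sup>2" for a b :: 'b
  proof -
    have "2 * (norm a * norm b) \<le> (norm a)\<^sup>2 + (norm b)\<^sup>2"
      using zero_le_power2[of "norm a - norm b"] by (simp add: power2_diff)
    moreover have "0 \<le> norm a * norm b" by simp
    ultimately show ?thesis using Cauchy_Schwarz_ineq2[of a b] by linarith
  qed
  then show "AE x in lborel. norm ((indicator S x *\<^sub>R u x) \<bullet> (indicator S x *\<^sub>R v x))
      \<le> norm (indicator S x *\<^sub>R (norm (u x))\<^sup>2 + indicator S x *\<^sub>R (norm (v x))\<^sup>2)"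
    by (intro AE_I2) (auto simp: indicator_def abs_le_iff intro: order_trans)
qed

lemma L2_inner_indicator: "L2_inner S u v = (LINT x|lborel. (indicator S x *\<^sub>R u x) \<bullet> (indicator S x *\<^sub>R v x))"
  unfolding L2_inner_def set_lebesgue_integral_def
  by (intro Bochner_Integration.integral_cong) (auto simp: indicator_def)

lemma L2_inner_self_nonneg: "0 \<le> L2_inner S u u"
  by (metis L2_norm_on_sq zero_le_power2)

lemma L2_norm_on_nonneg: "0 \<le> L2_norm_on S u"
  unfolding L2_norm_on_def set_lebesgue_integral_def
  by (intro real_sqrt_ge_zero Bochner_Integration.integral_nonneg) simp

text \<open>The squared norm of t u - v is a nonnegative quadratic in t, evaluated at t = c / a when
  a > 0.\<close>

lemma L2_Cauchy_Schwarz: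
  fixes u v :: "real^'n \<Rightarrow> 'b::euclidean_space"
  assumes "L2_on S u" "L2_on S v"
  shows "\<bar>L2_inner S u v\<bar> \<le> L2_norm_on S u * L2_norm_on S v"
proof -
  define a b c where "a = L2_inner S u u" and "b = L2_inner S v v" and "c = L2_inner S u v"
  let ?U = "\<lambda>x. indicator S x *\<^sub>R u x" and ?V = "\<lambda>x. indicator S x *\<^sub>R v x"
  note i = L2_on_integrable[OF assms] L2_on_integrable[OF assms(1,1)] L2_on_integrable[OF assms(2,2)]
  have ab: "0 \<le> a" "0 \<le> b" by (simp_all add: a_def b_def L2_inner_self_nonneg)
  have pt: "(t *\<^sub>R x - y) \<bullet> (t *\<^sub>R x - y) = t\<^sup>2 * (x \<bullet> x) - 2 * t * (x \<bullet> y) + y \<bullet> y" for t and x y :: 'b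
    by (simp add: inner_diff_left inner_diff_right inner_commute power2_eq_square algebra_simps)
  have q: "0 \<le> t\<^sup>2 * a - 2 * t * c + b" for t
  proof -
    have "0 \<le> (LINT x|lborel. (t *\<^sub>R ?U x - ?V x) \<bullet> (t *\<^sub>R ?U x - ?V x))"
      by (intro Bochner_Integration.integral_nonneg) simp
    also have "\<dots> = (LINT x|lborel. (t\<^sup>2 * (?U x \<bullet> ?U x) - 2 * t * (?U x \<bullet> ?V x)) + ?V x \<bullet> ?V x)"
      by (simp only: pt)
    also have "\<dots> = (LINT x|lborel. t\<^sup>2 * (?U x \<bullet> ?U x) - 2 * t * (?U x \<bullet> ?V x)) + b"
      unfolding b_def L2_inner_indicator
      by (intro Bochner_Integration.integral_add Bochner_Integration.integrable_diff integrable_mult_right i)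
    also have "(LINT x|lborel. t\<^sup>2 * (?U x \<bullet> ?U x) - 2 * t * (?U x \<bullet> ?V x)) = t\<^sup>2 * a - 2 * t * c"
      unfolding a_def c_def L2_inner_indicator
      by (subst Bochner_Integration.integral_diff) (intro integrable_mult_right i | simp)+
    finally show ?thesis .
  qed
  have "c\<^sup>2 \<le> a * b"
  proof (cases "a = 0")
    case True
    have "c = 0"
    proof (rule ccontr)
      assume "c \<noteq> 0"
      \<comment> \<open>For a = 0 the quadratic is affine in t, and this value of t would make it
        -1.\<close>
      then have *: "2 * ((b + 1) / (2 * c)) * c = b + 1" by (simp add: field_simps)
      show False using q[of "(b + 1) / (2 * c)"] unfolding True * by simp
    qed
    then show ?thesis using True by simp
  next
    case False
    then have "0 < a" using ab by simp
    have "0 \<le> (c / a)\<^sup>2 * a - 2 * (c / a) * c + b" by (rule q)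
    also have "\<dots> = b - c\<^sup>2 / a" using \<open>0 < a\<close> by (simp add: power2_eq_square field_simps)
    finally show ?thesis using \<open>0 < a\<close> by (simp add: field_simps)
  qed
  also have "a * b = (L2_norm_on S u * L2_norm_on S v)\<^sup>2"
    by (simp add: a_def b_def power_mult_distrib L2_norm_on_sq)
  finally have "\<bar>c\<bar>\<^sup>2 \<le> (L2_norm_on S u * L2_norm_on S v)\<^sup>2" by simp
  then show ?thesis unfolding c_def by (rule power2_le_imp_le) (simp add: L2_norm_on_nonneg)
qed

text \<open>Polynomials in time with spatial coefficients. Separating the variables lets spatial
  integrals be taken coefficient by coefficient, against any measure for which continuous functions
  are integrable.\<close>

definition tpf :: "nat \<Rightarrow> (real \<Rightarrow> 'a::euclidean_space \<Rightarrow> 'b::euclidean_space) \<Rightarrow> bool" where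
  "tpf m U \<longleftrightarrow> (\<exists>c. (\<forall>j\<le>m. continuous_on UNIV (c j)) \<and> (\<forall>t x. U t x = (\<Sum>j\<le>m. t ^ j *\<^sub>R c j x)))"

definition tpoly :: "nat \<Rightarrow> (real \<Rightarrow> real) \<Rightarrow> bool" where
  "tpoly m f \<longleftrightarrow> (\<exists>p. degree p \<le> m \<and> (\<forall>t. f t = poly p t))"

lemma tpfI:
  assumes "\<And>j. j \<le> m \<Longrightarrow> continuous_on UNIV (c j)" "\<And>t x. U t x = (\<Sum>j\<le>m. t ^ j *\<^sub>R c j x)"
  shows "tpf m U"
  unfolding tpf_def by (rule exI[of _ c]) (simp add: assms)

lemma tpf_linear:
  assumes "tpf m U" "bounded_linear T"
  shows "tpf m (\<lambda>t x. T (U t x))"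
proof -
  obtain c where c: "\<forall>j\<le>m. continuous_on UNIV (c j)" "\<forall>t x. U t x = (\<Sum>j\<le>m. t ^ j *\<^sub>R c j x)"
    using assms(1) unfolding tpf_def by (elim exE conjE)
  interpret T: bounded_linear T by (rule assms(2))
  show ?thesis
  proof (rule tpfI[of _ "\<lambda>j x. T (c j x)"])
    show "continuous_on UNIV (\<lambda>x. T (c j x))" if "j \<le> m" for j
      using c(1) that by (intro T.continuous_on) simp
    show "T (U t x) = (\<Sum>j\<le>m. t ^ j *\<^sub>R T (c j x))" for t x
      using c(2) by (simp add: T.sum T.scaleR)
  qed
qed

lemma tpf_combine:
  assumes "tpf m U" "tpf m V"
  shows "tpf m (\<lambda>t x. a *\<^sub>R U t x + b *\<^sub>R V t x)"
proof -
  obtain c where c: "\<forall>j\<le>m. continuous_on UNIV (c j)" "\<forall>t x. U t x = (\<Sum>j\<le>m. t ^ j *\<^sub>R c j x)"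
    using assms(1) unfolding tpf_def by (elim exE conjE)
  obtain d where d: "\<forall>j\<le>m. continuous_on UNIV (d j)" "\<forall>t x. V t x = (\<Sum>j\<le>m. t ^ j *\<^sub>R d j x)"
    using assms(2) unfolding tpf_def by (elim exE conjE)
  show ?thesis
  proof (rule tpfI[of _ "\<lambda>j x. a *\<^sub>R c j x + b *\<^sub>R d j x"])
    show "continuous_on UNIV (\<lambda>x. a *\<^sub>R c j x + b *\<^sub>R d j x)" if "j \<le> m" for j
      using c(1) d(1) that by (intro continuous_on_add continuous_on_scaleR continuous_on_const) simp_all
    show "a *\<^sub>R U t x + b *\<^sub>R V t x = (\<Sum>j\<le>m. t ^ j *\<^sub>R (a *\<^sub>R c j x + b *\<^sub>R d j x))" for t x
      using c(2) d(2) by (simp add: sum.distrib scaleR_right_distrib scaleR_sum_right mult.commute)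
  qed
qed

lemma tpf_continuous:
  assumes "tpf m U" shows "continuous_on UNIV (U t)"
proof -
  obtain c where c: "\<forall>j\<le>m. continuous_on UNIV (c j)" "\<forall>t x. U t x = (\<Sum>j\<le>m. t ^ j *\<^sub>R c j x)"
    using assms(1) unfolding tpf_def by (elim exE conjE)
  have "continuous_on UNIV (\<lambda>x. \<Sum>j\<le>m. t ^ j *\<^sub>R c j x)"
    using c(1) by (intro continuous_on_sum continuous_on_scaleR continuous_on_const) simp
  moreover have "U t = (\<lambda>x. \<Sum>j\<le>m. t ^ j *\<^sub>R c j x)" using c(2) by (simp add: fun_eq_iff)
  ultimately show ?thesis by simp
qed

lemma tpoly_add: "tpoly m f \<Longrightarrow> tpoly m g \<Longrightarrow> tpoly m (\<lambda>t. f t + g t)"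
  unfolding tpoly_def by (elim exE conjE, rule_tac x = "p + pa" in exI) (simp add: degree_add_le)

lemma tpoly_const: "tpoly m (\<lambda>t. c)"
  unfolding tpoly_def by (rule exI[of _ "[:c:]"]) simp

lemma tpoly_sum: "(\<And>i. i \<in> I \<Longrightarrow> tpoly m (f i)) \<Longrightarrow> tpoly m (\<lambda>t. \<Sum>i\<in>I. f i t)"
proof (induction I rule: infinite_finite_induct)
  case (insert i I)
  then show ?case using tpoly_add[of m "f i" "\<lambda>t. \<Sum>i\<in>I. f i t"] by simp
qed (simp_all add: tpoly_const)

lemma tpoly_cmult: "tpoly m f \<Longrightarrow> tpoly m (\<lambda>t. a * f t)"
  unfolding tpoly_def by (elim exE conjE, rule_tac x = "smult a p" in exI) (simp add: order_trans[OF degree_smult_le])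

text \<open>The coefficients are sums of pairings of the spatial coefficients. Two factors of degree
  \<ell> give degree 2 \<ell>, up to which the Radau rule is exact.\<close>

lemma tpf_inner_integral:
  fixes \<mu> :: "'a::euclidean_space measure" and U V :: "real \<Rightarrow> 'a \<Rightarrow> 'b::euclidean_space"
  assumes \<mu>: "compact_measure \<mu>" and "tpf m U" "tpf k V"
  shows "tpoly (m + k) (\<lambda>t. LINT x|\<mu>. U t x \<bullet> V t x)"
proof -
  obtain c where c: "\<forall>j\<le>m. continuous_on UNIV (c j)" "\<forall>t x. U t x = (\<Sum>j\<le>m. t ^ j *\<^sub>R c j x)"
    using assms(2) unfolding tpf_def by (elim exE conjE)
  obtain d where d: "\<forall>j\<le>k. continuous_on UNIV (d j)" "\<forall>t x. V t x = (\<Sum>j\<le>k. t ^ j *\<^sub>R d j x)"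
    using assms(3) unfolding tpf_def by (elim exE conjE)
  have int: "integrable \<mu> (\<lambda>x. t ^ i * (t ^ j * (c i x \<bullet> d j x)))" if "i \<le> m" "j \<le> k" for i j t
    using c(1) d(1) that
    by (intro integrable_mult_right compact_measure_integrable[OF \<mu>] continuous_on_inner) simp_all
  define p where "p = (\<Sum>i\<le>m. \<Sum>j\<le>k. monom (LINT x|\<mu>. c i x \<bullet> d j x) (i + j))"
  have "(LINT x|\<mu>. U t x \<bullet> V t x) = poly p t" for t
  proof -
    have "(LINT x|\<mu>. U t x \<bullet> V t x) = (LINT x|\<mu>. (\<Sum>i\<le>m. \<Sum>j\<le>k. t ^ i * (t ^ j * (c i x \<bullet> d j x))))"
    proof -
      have "U t x \<bullet> V t x = (\<Sum>i\<le>m. \<Sum>j\<le>k. t ^ i * (t ^ j * (c i x \<bullet> d j x)))" for x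
      proof -
        have "U t x \<bullet> V t x = (\<Sum>i\<le>m. (t ^ i *\<^sub>R c i x) \<bullet> V t x)" using c(2) by (simp add: inner_sum_left)
        also have "\<dots> = (\<Sum>i\<le>m. \<Sum>j\<le>k. t ^ i * (t ^ j * (c i x \<bullet> d j x)))"
          using d(2) by (simp add: inner_sum_right sum_distrib_left mult.left_commute)
        finally show ?thesis .
      qed
      then show ?thesis by simp
    qed
    also have "\<dots> = (\<Sum>i\<le>m. LINT x|\<mu>. (\<Sum>j\<le>k. t ^ i * (t ^ j * (c i x \<bullet> d j x))))"
      by (intro Bochner_Integration.integral_sum Bochner_Integration.integrable_sum int) simp_all
    also have "\<dots> = (\<Sum>i\<le>m. \<Sum>j\<le>k. LINT x|\<mu>. t ^ i * (t ^ j * (c i x \<bullet> d j x)))"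
      by (intro sum.cong refl Bochner_Integration.integral_sum int) simp_all
    also have "\<dots> = poly p t"
      by (simp add: p_def poly_sum poly_monom power_add mult_ac)
    finally show ?thesis .
  qed
  moreover have "degree p \<le> m + k"
    unfolding p_def by (intro degree_sum_le order_trans[OF degree_monom_le]) simp_all
  ultimately show ?thesis unfolding tpoly_def by (intro exI[of _ p]) simp
qed

text \<open>Change from a nodal to the monomial basis in time: the discrete spaces are defined with
  monomials, the test functions by nodal values.\<close>

lemma sum_poly_scaleR:
  fixes g :: "'i \<Rightarrow> 'b::real_vector"
  assumes "\<And>i. i \<in> I \<Longrightarrow> degree (q i) \<le> m"
  shows "(\<Sum>i\<in>I. poly (q i) t *\<^sub>R g i) = (\<Sum>j\<le>m. t ^ j *\<^sub>R (\<Sum>i\<in>I. coeff (q i) j *\<^sub>R g i))"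
proof -
  have "poly (q i) t = (\<Sum>j\<le>m. t ^ j * coeff (q i) j)" if "i \<in> I" for i
  proof -
    have "poly (q i) t = (\<Sum>j\<le>degree (q i). t ^ j * coeff (q i) j)" by (simp add: poly_altdef mult.commute)
    also have "\<dots> = (\<Sum>j\<le>m. t ^ j * coeff (q i) j)"
      by (rule sum.mono_neutral_left) (use assms[OF that] in \<open>auto simp: coeff_eq_0\<close>)
    finally show ?thesis .
  qed
  then have "(\<Sum>i\<in>I. poly (q i) t *\<^sub>R g i) = (\<Sum>i\<in>I. \<Sum>j\<le>m. (t ^ j * coeff (q i) j) *\<^sub>R g i)"
    by (simp add: scaleR_sum_left)
  also have "\<dots> = (\<Sum>j\<le>m. \<Sum>i\<in>I. (t ^ j * coeff (q i) j) *\<^sub>R g i)" by (rule sum.swap)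
  finally show ?thesis by (simp add: scaleR_sum_right)
qed

lemma tpf_poly_coeff:
  assumes "\<And>i. i \<in> I \<Longrightarrow> degree (q i) \<le> m" "\<And>i. i \<in> I \<Longrightarrow> continuous_on UNIV (g i)"
  shows "tpf m (\<lambda>t x. \<Sum>i\<in>I. poly (q i) t *\<^sub>R g i x)"
proof (rule tpfI[of _ "\<lambda>j x. \<Sum>i\<in>I. coeff (q i) j *\<^sub>R g i x"])
  show "continuous_on UNIV (\<lambda>x. \<Sum>i\<in>I. coeff (q i) j *\<^sub>R g i x)" if "j \<le> m" for j
    using assms(2) by (intro continuous_on_sum continuous_on_scaleR continuous_on_const)
qed (rule sum_poly_scaleR[OF assms(1)])

section \<open>Exactness of the quadrature for discrete fields\<close>

context dg
begin

definition rset :: "nat set" where "rset = {1..tdeg D + 1}"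

definition lag :: "nat \<Rightarrow> nat \<Rightarrow> real poly" where
  "lag n i = lagrange_basis (rnode D n) rset i"

definition Q :: "nat \<Rightarrow> (real \<Rightarrow> real) \<Rightarrow> real" where
  "Q n f = (\<Sum>i\<in>rset. rwt D n i * f (rnode D n i))"

lemma rset_facts: "finite rset" "1 \<in> rset" "card rset = tdeg D + 1"
  by (simp_all add: rset_def)

lemma time_facts:
  shows "1 \<le> steps D" "tpt D 0 = 0" "tpt D (steps D) = final D" "0 < final D"
    "\<And>n m. n < m \<Longrightarrow> m \<le> steps D \<Longrightarrow> tpt D n < tpt D m"
  using valid by (auto simp: valid_discretization_def strict_mono_on_def)

lemma step_pos: "n \<in> {1..steps D} \<Longrightarrow> tpt D (n - 1) < tpt D n"
  by (rule time_facts(5)) auto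

lemma radau:
  assumes "n \<in> {1..steps D}"
  shows "rnode D n 1 = tpt D (n - 1)" "inj_on (rnode D n) rset"
    "\<And>i. i \<in> rset \<Longrightarrow> rnode D n i \<in> {tpt D (n - 1)..tpt D n}" "\<And>i. i \<in> rset \<Longrightarrow> 0 < rwt D n i"
    "\<And>p. degree p \<le> 2 * tdeg D \<Longrightarrow> Q n (poly p) = (LINT t:{tpt D (n - 1)..tpt D n}|lborel. poly p t)"
proof -
  have L: "left_Gauss_Radau (tpt D (n - 1)) (tpt D n) (tdeg D) (rwt D n) (rnode D n)"
    using valid assms by (simp add: valid_discretization_def)
  show "rnode D n 1 = tpt D (n - 1)" using L by (simp add: left_Gauss_Radau_def)
  have "strict_mono_on {1..tdeg D + 1} (rnode D n)" using L by (simp add: left_Gauss_Radau_def)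
  then show "inj_on (rnode D n) rset" unfolding rset_def by (rule strict_mono_on_imp_inj_on)
  show "\<And>i. i \<in> rset \<Longrightarrow> rnode D n i \<in> {tpt D (n - 1)..tpt D n}" "\<And>i. i \<in> rset \<Longrightarrow> 0 < rwt D n i"
    using L unfolding left_Gauss_Radau_def rset_def by blast+
  show "\<And>p. degree p \<le> 2 * tdeg D \<Longrightarrow> Q n (poly p) = (LINT t:{tpt D (n - 1)..tpt D n}|lborel. poly p t)"
    using L unfolding left_Gauss_Radau_def Q_def rset_def by blast
qed

lemma set_integral_tint:
  fixes f :: "real \<Rightarrow> real"
  assumes [measurable]: "f \<in> borel_measurable borel"
  shows "(LINT t:tint D n|lborel. f t) = (LINT t:{tpt D (n - 1)..tpt D n}|lborel. f t)"
  unfolding set_lebesgue_integral_def tint_def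
proof (rule integral_cong_AE)
  have "AE t in lborel. t \<noteq> tpt D (n - 1)" "AE t in lborel. t \<noteq> tpt D n" by (rule AE_lborel_singleton)+
  then show "AE t in lborel. indicator {tpt D (n - 1)<..<tpt D n} t *\<^sub>R f t = indicator {tpt D (n - 1)..tpt D n} t *\<^sub>R f t"
    by eventually_elim (auto simp: indicator_def)
qed measurable

lemma quadrature:
  assumes n: "n \<in> {1..steps D}" and f: "tpoly (2 * tdeg D) f"
  shows "(LINT t:tint D n|lborel. f t) = Q n f"
proof -
  obtain p where p: "degree p \<le> 2 * tdeg D" "\<forall>t. f t = poly p t" using f unfolding tpoly_def by (elim exE conjE)
  have fp: "f = poly p" using p(2) by (simp add: fun_eq_iff)
  have "poly p \<in> borel_measurable borel"
    by (intro borel_measurable_continuous_onI continuous_on_poly continuous_on_id)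
  then show ?thesis unfolding fp using set_integral_tint radau(5)[OF n p(1)] by simp
qed

lemma lag_degree: "i \<in> rset \<Longrightarrow> degree (lag n i) \<le> tdeg D"
  using degree_lagrange_basis[OF rset_facts(1), of i "rnode D n"] by (simp add: lag_def rset_facts(3))

lemma lag_node:
  "n \<in> {1..steps D} \<Longrightarrow> i \<in> rset \<Longrightarrow> k \<in> rset \<Longrightarrow> poly (lag n i) (rnode D n k) = (if i = k then 1 else 0)"
  unfolding lag_def by (rule lagrange_basis_node[OF rset_facts(1) radau(2)])

lemma radau_interp_eq: "radau_interp D n g t = (\<Sum>i\<in>rset. poly (lag n i) t *\<^sub>R g (rnode D n i))"
  by (simp add: radau_interp_def lag_def poly_lagrange_basis rset_def)

lemma sum_lag_node:
  fixes g :: "nat \<Rightarrow> 'b::real_vector"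
  assumes "n \<in> {1..steps D}" "k \<in> rset"
  shows "(\<Sum>i\<in>rset. poly (lag n i) (rnode D n k) *\<^sub>R g i) = g k"
proof -
  have "(\<Sum>i\<in>rset. poly (lag n i) (rnode D n k) *\<^sub>R g i) = (\<Sum>i\<in>rset. if i = k then g i else 0)"
    by (intro sum.cong refl) (simp add: lag_node[OF assms(1)] assms(2))
  then show ?thesis using assms(2) rset_facts(1) by simp
qed

lemma radau_interp_node: "n \<in> {1..steps D} \<Longrightarrow> k \<in> rset \<Longrightarrow> radau_interp D n g (rnode D n k) = g (rnode D n k)"
  unfolding radau_interp_eq by (rule sum_lag_node)

lemma Q_cong: "(\<And>i. i \<in> rset \<Longrightarrow> f (rnode D n i) = g (rnode D n i)) \<Longrightarrow> Q n f = Q n g"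
  unfolding Q_def by (intro sum.cong) simp_all

lemma Q_add: "Q n (\<lambda>t. f t + g t) = Q n f + Q n g"
  by (simp add: Q_def sum.distrib distrib_left)

lemma Q_diff: "Q n (\<lambda>t. f t - g t) = Q n f - Q n g"
  by (simp add: Q_def sum_subtractf right_diff_distrib)

lemma Q_minus: "Q n (\<lambda>t. - f t) = - Q n f"
  by (simp add: Q_def sum_negf)

lemma Q_cmult: "Q n (\<lambda>t. a * f t) = a * Q n f"
  by (simp add: Q_def sum_distrib_left mult_ac)

lemma Q_sum: "Q n (\<lambda>t. \<Sum>F\<in>A. f F t) = (\<Sum>F\<in>A. Q n (f F))"
  unfolding Q_def sum_distrib_left by (rule sum.swap)

lemma Q_mono:
  assumes "n \<in> {1..steps D}" "\<And>i. i \<in> rset \<Longrightarrow> f (rnode D n i) \<le> g (rnode D n i)"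
  shows "Q n f \<le> Q n g"
  unfolding Q_def using assms radau(4)[OF assms(1)] by (intro sum_mono mult_left_mono) (simp_all add: less_imp_le)

lemma Q_one: "n \<in> {1..steps D} \<Longrightarrow> Q n (\<lambda>t. c) = c * (tpt D n - tpt D (n - 1))"
proof -
  assume n: "n \<in> {1..steps D}"
  have "poly [:c:] = (\<lambda>t. c)" by (simp add: fun_eq_iff)
  then show ?thesis using radau(5)[OF n, of "[:c:]"] step_pos[OF n] by (simp add: set_integral_const)
qed

text \<open>The max-mean inequality on one time step: nonnegativity turns the L^1 norm into an
  integral, and the degree turns the integral into a Radau sum.\<close>

lemma tpoly_le_average:
  assumes n: "n \<in> {1..steps D}" and f: "tpoly (2 * tdeg D) f" "\<And>t. 0 \<le> f t" and t: "t \<in> {tpt D (n - 1)..tpt D n}"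
  shows "f t \<le> L1_const (2 * tdeg D) / (tpt D n - tpt D (n - 1)) * Q n f"
proof -
  obtain p where p: "degree p \<le> 2 * tdeg D" "\<forall>t. f t = poly p t" using f(1) unfolding tpoly_def by (elim exE conjE)
  have fp: "f = poly p" using p(2) by (simp add: fun_eq_iff)
  have abs: "\<bar>poly p s\<bar> = poly p s" for s using f(2)[of s] fp by simp
  show ?thesis using L1_const(2)[OF p(1) step_pos[OF n] t] unfolding abs fp radau(5)[OF n p(1)] .
qed

definition sc :: "real \<Rightarrow> ('n, 'b::real_vector) broken \<Rightarrow> ('n, 'b) broken" where
  "sc a v = (\<lambda>K x. a *\<^sub>R v K x)"

lemma assemble_sc: "assemble D (sc a v) x = a *\<^sub>R assemble D v x"
  by (simp add: assemble_def sc_def scaleR_sum_right)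

lemma L2_inner_sc_right: "L2_inner \<Omega> U (assemble D (sc a v)) = a * L2_inner \<Omega> U (assemble D v)"
  unfolding L2_inner_def assemble_sc inner_scaleR_right by (rule set_integral_mult_right)

lemma avg_sc: "avg D F (sc a v) x = a *\<^sub>R avg D F v x" "jump D F (sc a v) x = a *\<^sub>R jump D F v x"
  by (simp_all add: avg_def jump_def sc_def algebra_simps)

lemma avg_cong:
  assumes "F \<in> facets mh" "\<And>K x. K \<in> mh \<Longrightarrow> v K x = w K x"
  shows "avg D F v x = avg D F w x"
proof (cases "F \<in> Fint")
  case True
  then show ?thesis using assms(2) interior_facet_elems(1,2)[OF True] by (simp add: avg_def)
next
  case False
  then have "F \<in> Fbd" using assms(1) by (simp add: boundary_facets_def)
  then show ?thesis using assms(2) boundary_facet_elems(1)[of F] False by (simp add: avg_def)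
qed

lemma facet_inner_sc_right:
  "facet_inner D F U (\<lambda>x. a *\<^sub>R V x) = a * facet_inner D F U V"
  by (simp add: facet_inner_def)

lemma grad_sum:
  assumes "K \<in> mh" "\<And>j. j \<in> I \<Longrightarrow> vpoly deg (c j K)" "\<And>x. v K x = (\<Sum>j\<in>I. a j *\<^sub>R c j K x)"
  shows "grad v K x = (\<Sum>j\<in>I. a j *\<^sub>R grad (c j) K x)"
proof -
  have "v K = (\<lambda>x. \<Sum>j\<in>I. a j *\<^sub>R c j K x)" by (rule ext) (rule assms(3))
  then show ?thesis unfolding grad_def using jacobian_sum[OF assms(2)] by simp
qed

lemma grad_sc: "pfield v \<Longrightarrow> K \<in> mh \<Longrightarrow> grad (sc a v) K x = a *\<^sub>R grad v K x"
  using grad_sum[of K "{0::nat}" "\<lambda>j. v" "sc a v" "\<lambda>j. a" x] by (simp add: sc_def pfield_def)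

lemma ah_sc:
  assumes "pfield v"
  shows "ah u (sc a v) = a * ah u v"
proof -
  have gs: "grad (sc a v) K x = sc a (grad v) K x" if "K \<in> mh" for K x
    unfolding sc_def[of a "grad v"] by (rule grad_sc[OF assms that])
  have 1: "assemble D (grad (sc a v)) = assemble D (sc a (grad v))"
    by (rule assemble_cong) (rule gs)
  have 2: "avg D F (grad (sc a v)) x *v nu F = a *\<^sub>R (avg D F (grad v) x *v nu F)" if "F \<in> facets mh" for F x
  proof -
    have "avg D F (grad (sc a v)) x = avg D F (sc a (grad v)) x"
      by (rule avg_cong[OF that gs])
    then show ?thesis by (simp add: avg_sc scaleR_matrix_vector_assoc)
  qed
  have 3: "jump D F (sc a v) = (\<lambda>x. a *\<^sub>R jump D F v x)" for F by (simp add: avg_sc fun_eq_iff)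
  show ?thesis
    unfolding ah_def 1 L2_inner_sc_right 3 facet_inner_sc_right distrib_left sum_distrib_left
    by (intro arg_cong2[of _ _ _ _ "(+)"] refl sum.cong) (simp add: 2 facet_inner_sc_right algebra_simps)
qed

lemma ch_sc: "ch w u (sc a v) = a * ch w u v"
proof -
  have 3: "jump D F (sc a v) = (\<lambda>x. a *\<^sub>R jump D F v x)" "avg D F (sc a v) = (\<lambda>x. a *\<^sub>R avg D F v x)" for F
    by (simp_all add: avg_sc fun_eq_iff)
  show ?thesis
    unfolding ch_def L2_inner_sc_right 3 facet_inner_sc_right distrib_left sum_distrib_left
    by (intro arg_cong2[of _ _ _ _ "(+)"] refl sum.cong) (simp_all add: algebra_simps)
qed

lemma Vh_vpoly: "c \<in> Vh D \<Longrightarrow> pfield c"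
  unfolding pfield_def by (intro ballI local_space_vpoly[of _ "fam D"]) (simp add: Vh_def)

lemma Vht_coeffs:
  assumes "u \<in> Vht D" "n \<in> {1..steps D}"
  obtains c where "\<forall>j\<le>tdeg D. c j \<in> Vh D"
    "\<forall>t. \<forall>K\<in>mh. \<forall>x. u n t K x = (\<Sum>j\<le>tdeg D. t ^ j *\<^sub>R c j K x)"
proof -
  have "\<exists>c. (\<forall>j\<le>tdeg D. c j \<in> Vh D) \<and> (\<forall>t. \<forall>K\<in>mh. \<forall>x. u n t K x = (\<Sum>j\<le>tdeg D. t ^ j *\<^sub>R c j K x))"
    using assms unfolding Vht_def by blast
  then show thesis using that by (elim exE conjE)
qed

text \<open>The derivative of \<open>t ^ j\<close> is written with \<open>pderiv\<close>, so that
  the exponent j - 1 never appears and j = 0 is no special case.\<close>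

lemma time_deriv_sum:
  assumes "\<And>t. u n t K x = (\<Sum>j\<le>m. t ^ j *\<^sub>R c j K x)"
  shows "time_deriv u n t K x = (\<Sum>j\<le>m. poly (pderiv (monom 1 j)) t *\<^sub>R c j K x)"
proof -
  have "((\<lambda>r. poly (monom 1 j) r *\<^sub>R c j K x) has_vector_derivative poly (pderiv (monom 1 j)) t *\<^sub>R c j K x) (at t)" for j
    using has_vector_derivative_scaleR[OF poly_DERIV[of "monom 1 j" t] has_vector_derivative_const[of "c j K x"]] by simp
  then have "((\<lambda>r. \<Sum>j\<le>m. poly (monom 1 j) r *\<^sub>R c j K x) has_vector_derivative
      (\<Sum>j\<le>m. poly (pderiv (monom 1 j)) t *\<^sub>R c j K x)) (at t)"
    by (intro has_vector_derivative_sum)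
  then show ?thesis
    unfolding time_deriv_def assms by (intro vector_derivative_at) (simp add: poly_monom)
qed

lemma Vht_fields:
  assumes u: "u \<in> Vht D" and n: "n \<in> {1..steps D}" and K: "K \<in> mh"
  shows "u n t K \<in> local_space (fam D) (spdeg D)" "tpf (tdeg D) (\<lambda>t. u n t K)" "tpf (tdeg D) (\<lambda>t. grad (u n t) K)"
    "tpf (tdeg D) (\<lambda>t. time_deriv u n t K)"
proof -
  obtain c where c0: "\<forall>j\<le>tdeg D. c j \<in> Vh D"
    "\<forall>t. \<forall>K\<in>mh. \<forall>x. u n t K x = (\<Sum>j\<le>tdeg D. t ^ j *\<^sub>R c j K x)"
    by (rule Vht_coeffs[OF u n])
  have c: "j \<le> tdeg D \<Longrightarrow> c j \<in> Vh D" "K \<in> mh \<Longrightarrow> u n t K x = (\<Sum>j\<le>tdeg D. t ^ j *\<^sub>R c j K x)" for j t K x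
    using c0 by simp_all
  have ls: "c j K \<in> local_space (fam D) (spdeg D)" if "j \<in> {..tdeg D}" for j
    using c(1)[of j] that K by (simp add: Vh_def)
  have vp: "vpoly deg (c j K)" if "j \<in> {..tdeg D}" for j by (rule local_space_vpoly[OF ls[OF that]])
  have uK: "u n t K = (\<lambda>x. \<Sum>j\<le>tdeg D. t ^ j *\<^sub>R c j K x)" for t by (rule ext) (rule c(2)[OF K])
  show "u n t K \<in> local_space (fam D) (spdeg D)" unfolding uK by (rule local_space_sum[OF ls])
  show "tpf (tdeg D) (\<lambda>t. u n t K)"
  proof (rule tpfI[of _ "\<lambda>j. c j K"])
    show "continuous_on UNIV (c j K)" if "j \<le> tdeg D" for j using vpoly_continuous[OF vp] that by simp
  qed (rule c(2)[OF K])
  show "tpf (tdeg D) (\<lambda>t. grad (u n t) K)"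
  proof (rule tpfI[of _ "\<lambda>j. grad (c j) K"])
    show "continuous_on UNIV (grad (c j) K)" if "j \<le> tdeg D" for j
      by (rule pfield_grad_cont[OF Vh_vpoly[OF c(1)[OF that]] K])
    show "grad (u n t) K x = (\<Sum>j\<le>tdeg D. t ^ j *\<^sub>R grad (c j) K x)" for t x
      by (rule grad_sum[where v = "u n t" and K = K and c = c and a = "\<lambda>j. t ^ j" and I = "{..tdeg D}", OF K vp c(2)[OF K]])
  qed
  note td = time_deriv_sum[where u = u and n = n and K = K and m = "tdeg D" and c = c, OF c(2)[OF K]]
  have "tpf (tdeg D) (\<lambda>t x. \<Sum>j\<le>tdeg D. poly (pderiv (monom 1 j)) t *\<^sub>R c j K x)"
  proof (rule tpf_poly_coeff)
    show "degree (pderiv (monom (1::real) j)) \<le> tdeg D" if "j \<in> {..tdeg D}" for j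
      using that degree_monom_le[of "1::real" j] by (simp add: degree_pderiv)
    show "continuous_on UNIV (c j K)" if "j \<in> {..tdeg D}" for j using vpoly_continuous[OF vp[OF that]] .
  qed
  moreover have "(\<lambda>t. time_deriv u n t K) = (\<lambda>t x. \<Sum>j\<le>tdeg D. poly (pderiv (monom 1 j)) t *\<^sub>R c j K x)"
    by (intro ext td)
  ultimately show "tpf (tdeg D) (\<lambda>t. time_deriv u n t K)" by simp
qed

lemma Vht_pfield: "u \<in> Vht D \<Longrightarrow> n \<in> {1..steps D} \<Longrightarrow> pfield (u n t)"
  unfolding pfield_def by (intro ballI local_space_vpoly[OF Vht_fields(1)])

definition tfield :: "(real \<Rightarrow> ('n, 'b::euclidean_space) broken) \<Rightarrow> bool" where
  "tfield g \<longleftrightarrow> (\<forall>K\<in>mh. tpf (tdeg D) (\<lambda>t. g t K))"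

lemma tfield_cfield: "tfield g \<Longrightarrow> cfield (g t)"
  unfolding tfield_def cfield_def using tpf_continuous by blast

lemma Vht_tfields:
  assumes "u \<in> Vht D" "n \<in> {1..steps D}"
  shows "tfield (u n)" "tfield (\<lambda>t. grad (u n t))" "tfield (time_deriv u n)"
  unfolding tfield_def by (intro ballI Vht_fields assms; assumption)+

lemma tpoly_L2:
  fixes g h :: "real \<Rightarrow> ('n, 'b::euclidean_space) broken"
  assumes "tfield g" "tfield h"
  shows "tpoly (2 * tdeg D) (\<lambda>t. L2_inner \<Omega> (assemble D (g t)) (assemble D (h t)))"
proof -
  have "(LINT x:K|lborel. g t K x \<bullet> h t K x) = (LINT x|density lborel (indicator K). g t K x \<bullet> h t K x)" if K: "K \<in> mh" for K t
  proof (rule set_integral_eq_density)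
    show "K \<in> sets borel" using compact_mesh[OF K] by (simp add: compact_imp_closed)
    have "continuous_on UNIV (g t K)" "continuous_on UNIV (h t K)"
      using tfield_cfield[OF assms(1)] tfield_cfield[OF assms(2)] K by (simp_all add: cfield_def)
    then show "(\<lambda>x. g t K x \<bullet> h t K x) \<in> borel_measurable borel"
      by (intro borel_measurable_continuous_onI continuous_on_inner)
  qed
  then have "L2_inner \<Omega> (assemble D (g t)) (assemble D (h t)) = (\<Sum>K\<in>mh. LINT x|density lborel (indicator K). g t K x \<bullet> h t K x)" for t
    unfolding L2_inner_assemble[OF tfield_cfield[OF assms(1)] tfield_cfield[OF assms(2)]] by (intro sum.cong refl)
  moreover have "tpoly (2 * tdeg D) (\<lambda>t. \<Sum>K\<in>mh. LINT x|density lborel (indicator K). g t K x \<bullet> h t K x)"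
  proof (rule tpoly_sum)
    fix K assume K: "K \<in> mh"
    have "tpf (tdeg D) (\<lambda>t. g t K)" "tpf (tdeg D) (\<lambda>t. h t K)" using assms K by (simp_all add: tfield_def)
    then show "tpoly (2 * tdeg D) (\<lambda>t. LINT x|density lborel (indicator K). g t K x \<bullet> h t K x)"
      unfolding mult_2 by (rule tpf_inner_integral[OF compact_measure_mesh[OF K]])
  qed
  ultimately show ?thesis by simp
qed

lemma tpoly_facet:
  assumes "F \<in> facets mh" "tpf (tdeg D) U" "tpf (tdeg D) V"
  shows "tpoly (2 * tdeg D) (\<lambda>t. facet_inner D F (U t) (V t))"
  unfolding facet_inner_def mult_2 by (rule tpf_inner_integral[OF compact_measure_\<Sigma>[OF assms(1)] assms(2,3)])

lemma tpf_avg: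
  fixes g :: "real \<Rightarrow> ('n, 'b::euclidean_space) broken"
  assumes g: "tfield g" and F: "F \<in> facets mh"
  shows "tpf (tdeg D) (\<lambda>t. avg D F (g t))" "tpf (tdeg D) (\<lambda>t. jump D F (g t))"
proof -
  have "tpf (tdeg D) (\<lambda>t. avg D F (g t)) \<and> tpf (tdeg D) (\<lambda>t. jump D F (g t))"
  proof (cases "F \<in> Fint")
    case True
    then have t: "tpf (tdeg D) (\<lambda>t. g t (elem_plus D F))" "tpf (tdeg D) (\<lambda>t. g t (elem_minus D F))"
      using g interior_facet_elems(1,2) by (simp_all add: tfield_def)
    have "(\<lambda>t. avg D F (g t)) = (\<lambda>t x. (1/2) *\<^sub>R g t (elem_plus D F) x + (1/2) *\<^sub>R g t (elem_minus D F) x)"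
      "(\<lambda>t. jump D F (g t)) = (\<lambda>t x. 1 *\<^sub>R g t (elem_plus D F) x + (- 1) *\<^sub>R g t (elem_minus D F) x)"
      using True by (simp_all add: avg_def jump_def fun_eq_iff scaleR_add_right)
    then show ?thesis using tpf_combine[OF t, of "1/2" "1/2"] tpf_combine[OF t, of 1 "- 1"] by simp
  next
    case False
    then have t: "tpf (tdeg D) (\<lambda>t. g t (elem_plus D F))"
      using g F boundary_facet_elems(1)[of F] by (simp add: tfield_def boundary_facets_def)
    have "(\<lambda>t. avg D F (g t)) = (\<lambda>t. g t (elem_plus D F))" "(\<lambda>t. jump D F (g t)) = (\<lambda>t. g t (elem_plus D F))"
      using False by (simp_all add: avg_def jump_def fun_eq_iff)
    then show ?thesis using t by simp
  qed
  then show "tpf (tdeg D) (\<lambda>t. avg D F (g t))" "tpf (tdeg D) (\<lambda>t. jump D F (g t))" by simp_all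
qed

lemma bounded_linear_matrix_left: "bounded_linear (\<lambda>A::real^'a^'b. A *v m)"
proof (rule bounded_linear_intro[of _ "norm m"])
  show "norm (A *v m) \<le> norm A * norm m" for A :: "real^'a^'b" by (rule norm_matrix_vector_le)
qed (simp_all add: matrix_vector_mult_add_rdistrib scaleR_matrix_vector_assoc)

lemma tpf_radau:
  assumes "\<And>r. continuous_on UNIV (g r)"
  shows "tpf (tdeg D) (\<lambda>t x. radau_interp D n (\<lambda>r. g r x) t)"
  unfolding radau_interp_eq by (rule tpf_poly_coeff[OF lag_degree assms])

text \<open>Each integrand is a product of two fields of degree at most \<ell> in time, so the
  quadrature is exact.\<close>

lemma a_form_nodes:
  assumes u: "u \<in> Vht D" and z: "z \<in> Vht D"
  shows "a_form D u z = (\<Sum>n=1..steps D. Q n (\<lambda>t. ah (u n t) (z n t)))"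
  unfolding a_form_def
proof (rule sum.cong)
  fix n assume n: "n \<in> {1..steps D}"
  note U = Vht_tfields[OF u n] and Z = Vht_tfields[OF z n]
  have b: "bounded_linear (\<lambda>A. A *v nu F)" for F by (rule bounded_linear_matrix_left)
  have s: "bounded_linear (\<lambda>x::real^'n. c *\<^sub>R x)" for c by (rule bounded_linear_scaleR_right)
  have 0: "(LINT t:tint D n|lborel. L2_inner \<Omega> (assemble D (grad (u n t))) (assemble D (grad (z n t))))
      = Q n (\<lambda>t. L2_inner \<Omega> (assemble D (grad (u n t))) (assemble D (grad (z n t))))"
    by (rule quadrature[OF n tpoly_L2[OF U(2) Z(2)]])
  have 1: "(LINT t:tint D n|lborel. facet_inner D F (\<lambda>x. avg D F (grad (u n t)) x *v nu F) (jump D F (z n t)))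
      = Q n (\<lambda>t. facet_inner D F (\<lambda>x. avg D F (grad (u n t)) x *v nu F) (jump D F (z n t)))" if F: "F \<in> facets mh" for F
    by (rule quadrature[OF n tpoly_facet[OF F tpf_linear[OF tpf_avg(1)[OF U(2) F] b] tpf_avg(2)[OF Z(1) F]]])
  have 2: "(LINT t:tint D n|lborel. facet_inner D F (jump D F (u n t)) (\<lambda>x. avg D F (grad (z n t)) x *v nu F))
      = Q n (\<lambda>t. facet_inner D F (jump D F (u n t)) (\<lambda>x. avg D F (grad (z n t)) x *v nu F))" if F: "F \<in> facets mh" for F
    by (rule quadrature[OF n tpoly_facet[OF F tpf_avg(2)[OF U(1) F] tpf_linear[OF tpf_avg(1)[OF Z(2) F] b]]])
  have 3: "(LINT t:tint D n|lborel. facet_inner D F (\<lambda>x. (pen D / diameter F) *\<^sub>R jump D F (u n t) x) (jump D F (z n t)))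
      = Q n (\<lambda>t. facet_inner D F (\<lambda>x. (pen D / diameter F) *\<^sub>R jump D F (u n t) x) (jump D F (z n t)))" if F: "F \<in> facets mh" for F
    by (rule quadrature[OF n tpoly_facet[OF F tpf_linear[OF tpf_avg(2)[OF U(1) F] s] tpf_avg(2)[OF Z(1) F]]])
  have "(\<Sum>F\<in>facets mh. - (LINT t:tint D n|lborel. facet_inner D F (\<lambda>x. avg D F (grad (u n t)) x *v nu F) (jump D F (z n t)))
      - (LINT t:tint D n|lborel. facet_inner D F (jump D F (u n t)) (\<lambda>x. avg D F (grad (z n t)) x *v nu F))
      + (LINT t:tint D n|lborel. facet_inner D F (\<lambda>x. (pen D / diameter F) *\<^sub>R jump D F (u n t) x) (jump D F (z n t))))
    = (\<Sum>F\<in>facets mh. - Q n (\<lambda>t. facet_inner D F (\<lambda>x. avg D F (grad (u n t)) x *v nu F) (jump D F (z n t)))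
      - Q n (\<lambda>t. facet_inner D F (jump D F (u n t)) (\<lambda>x. avg D F (grad (z n t)) x *v nu F))
      + Q n (\<lambda>t. facet_inner D F (\<lambda>x. (pen D / diameter F) *\<^sub>R jump D F (u n t) x) (jump D F (z n t))))"
    by (rule sum.cong[OF refl]) (simp only: 1 2 3)
  then show "(LINT t:tint D n|lborel. L2_inner \<Omega> (assemble D (grad (u n t))) (assemble D (grad (z n t))))
      + (\<Sum>F\<in>facets mh. - (LINT t:tint D n|lborel. facet_inner D F (\<lambda>x. avg D F (grad (u n t)) x *v nu F) (jump D F (z n t)))
      - (LINT t:tint D n|lborel. facet_inner D F (jump D F (u n t)) (\<lambda>x. avg D F (grad (z n t)) x *v nu F))
      + (LINT t:tint D n|lborel. facet_inner D F (\<lambda>x. (pen D / diameter F) *\<^sub>R jump D F (u n t) x) (jump D F (z n t))))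
    = Q n (\<lambda>t. ah (u n t) (z n t))"
    unfolding 0 ah_def Q_add Q_sum Q_diff Q_minus by (simp only:)
qed simp

lemma c_form_nodes:
  assumes w: "w \<in> Vht D" and u: "u \<in> Vht D" and z: "z \<in> Vht D"
  shows "c_form D w u z = (\<Sum>n=1..steps D. Q n (\<lambda>t. ch (w n t) (u n t) (z n t)))"
  unfolding c_form_def
proof (rule sum.cong)
  fix n assume n: "n \<in> {1..steps D}"
  note U = Vht_tfields[OF u n] and Z = Vht_tfields[OF z n] and W = Vht_tfields[OF w n]
  have Ff: "F \<in> facets mh" if "F \<in> Fint" for F using that Fint_sub by blast
  have g1: "continuous_on UNIV (\<lambda>x. grad (u n r) K x *v w n r K x)" if "K \<in> mh" for r K
    using tfield_cfield[OF U(2)] tfield_cfield[OF W(1)] that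
    by (intro continuous_on_matrix_vector) (simp_all add: cfield_def)
  have g2: "continuous_on UNIV (\<lambda>x. normal_comp D F (w n r) x *\<^sub>R jump D F (u n r) x)" if "F \<in> Fint" for r F
    by (intro continuous_on_scaleR normal_comp_cont avg_cont(2) tfield_cfield[OF U(1)] tfield_cfield[OF W(1)] Ff that)
  have g3: "continuous_on UNIV (\<lambda>x. gammaF D F (w n r) *\<^sub>R jump D F (u n r) x)" if "F \<in> Fint" for r F
    by (intro continuous_on_scaleR continuous_on_const avg_cont(2) tfield_cfield[OF U(1)] Ff that)
  define R1 where "R1 t = (\<lambda>K x. radau_interp D n (\<lambda>r. grad (u n r) K x *v w n r K x) t)" for t
  define R2 where "R2 F t = (\<lambda>x. radau_interp D n (\<lambda>r. normal_comp D F (w n r) x *\<^sub>R jump D F (u n r) x) t)" for F t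
  define R3 where "R3 F t = (\<lambda>x. radau_interp D n (\<lambda>r. gammaF D F (w n r) *\<^sub>R jump D F (u n r) x) t)" for F t
  have T1: "tfield R1" unfolding tfield_def R1_def by (intro ballI tpf_radau g1)
  have T2: "tpf (tdeg D) (R2 F)" if "F \<in> Fint" for F unfolding R2_def by (rule tpf_radau[OF g2[OF that]])
  have T3: "tpf (tdeg D) (R3 F)" if "F \<in> Fint" for F unfolding R3_def by (rule tpf_radau[OF g3[OF that]])
  have 0: "(LINT t:tint D n|lborel. L2_inner \<Omega> (assemble D (R1 t)) (assemble D (z n t)))
      = Q n (\<lambda>t. L2_inner \<Omega> (assemble D (\<lambda>K x. grad (u n t) K x *v w n t K x)) (assemble D (z n t)))"
    unfolding quadrature[OF n tpoly_L2[OF T1 Z(1)]]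
    by (rule Q_cong) (simp only: R1_def radau_interp_node[OF n])
  have 1: "(LINT t:tint D n|lborel. facet_inner D F (R2 F t) (avg D F (z n t)))
      = Q n (\<lambda>t. facet_inner D F (\<lambda>x. normal_comp D F (w n t) x *\<^sub>R jump D F (u n t) x) (avg D F (z n t)))" if F: "F \<in> Fint" for F
    unfolding quadrature[OF n tpoly_facet[OF Ff[OF F] T2[OF F] tpf_avg(1)[OF Z(1) Ff[OF F]]]]
    by (rule Q_cong) (simp only: R2_def radau_interp_node[OF n])
  have 2: "(LINT t:tint D n|lborel. facet_inner D F (R3 F t) (jump D F (z n t)))
      = Q n (\<lambda>t. facet_inner D F (\<lambda>x. gammaF D F (w n t) *\<^sub>R jump D F (u n t) x) (jump D F (z n t)))" if F: "F \<in> Fint" for F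
    unfolding quadrature[OF n tpoly_facet[OF Ff[OF F] T3[OF F] tpf_avg(2)[OF Z(1) Ff[OF F]]]]
    by (rule Q_cong) (simp only: R3_def radau_interp_node[OF n])
  have "(\<Sum>F\<in>Fint. - (LINT t:tint D n|lborel. facet_inner D F (R2 F t) (avg D F (z n t)))
      + 1/2 * (LINT t:tint D n|lborel. facet_inner D F (R3 F t) (jump D F (z n t))))
    = (\<Sum>F\<in>Fint. - Q n (\<lambda>t. facet_inner D F (\<lambda>x. normal_comp D F (w n t) x *\<^sub>R jump D F (u n t) x) (avg D F (z n t)))
      + 1/2 * Q n (\<lambda>t. facet_inner D F (\<lambda>x. gammaF D F (w n t) *\<^sub>R jump D F (u n t) x) (jump D F (z n t))))"
    by (rule sum.cong[OF refl]) (simp only: 1 2)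
  then show "(LINT t:tint D n|lborel. L2_inner \<Omega>
           (assemble D (\<lambda>K x. radau_interp D n (\<lambda>r. grad (u n r) K x *v w n r K x) t)) (assemble D (z n t)))
      + (\<Sum>F\<in>Fint.
          - (LINT t:tint D n|lborel. facet_inner D F
               (\<lambda>x. radau_interp D n (\<lambda>r. normal_comp D F (w n r) x *\<^sub>R jump D F (u n r) x) t) (avg D F (z n t)))
          + 1/2 * (LINT t:tint D n|lborel. facet_inner D F
               (\<lambda>x. radau_interp D n (\<lambda>r. gammaF D F (w n r) *\<^sub>R jump D F (u n r) x) t) (jump D F (z n t))))
    = Q n (\<lambda>t. ch (w n t) (u n t) (z n t))"
    unfolding R1_def[symmetric] R2_def[symmetric] R3_def[symmetric] 0 ch_def Q_add Q_sum Q_minus Q_cmult by (simp only:)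
qed simp

end

section \<open>Test functions\<close>

lemma L2_inner_commute: "L2_inner S u v = L2_inner S v u"
  unfolding L2_inner_def by (simp add: inner_commute)

lemma L2_inner_sum_left:
  fixes U :: "'i \<Rightarrow> real^'n \<Rightarrow> 'b::euclidean_space"
  assumes "\<And>i. i \<in> I \<Longrightarrow> L2_on S (U i)" "L2_on S V"
  shows "L2_inner S (\<lambda>x. \<Sum>i\<in>I. a i *\<^sub>R U i x) V = (\<Sum>i\<in>I. a i * L2_inner S (U i) V)"
proof -
  have "L2_inner S (\<lambda>x. \<Sum>i\<in>I. a i *\<^sub>R U i x) V
      = (LINT x|lborel. (\<Sum>i\<in>I. a i * ((indicator S x *\<^sub>R U i x) \<bullet> (indicator S x *\<^sub>R V x))))"
    unfolding L2_inner_indicator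
    by (intro Bochner_Integration.integral_cong refl)
      (simp add: scaleR_sum_right inner_sum_left sum_distrib_left mult_ac)
  also have "\<dots> = (\<Sum>i\<in>I. LINT x|lborel. a i * ((indicator S x *\<^sub>R U i x) \<bullet> (indicator S x *\<^sub>R V x)))"
    by (intro Bochner_Integration.integral_sum integrable_mult_right L2_on_integrable assms)
  also have "\<dots> = (\<Sum>i\<in>I. a i * L2_inner S (U i) V)"
    unfolding L2_inner_indicator by (intro sum.cong refl integral_mult_right_zero)
  finally show ?thesis .
qed

lemma L2_inner_diff_left:
  fixes a b c :: "real^'n \<Rightarrow> 'b::euclidean_space"
  assumes "L2_on S a" "L2_on S b" "L2_on S c"
  shows "L2_inner S (\<lambda>x. a x - b x) c = L2_inner S a c - L2_inner S b c"
proof -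
  have "L2_inner S (\<lambda>x. a x - b x) c = (LINT x|lborel. (indicator S x *\<^sub>R a x) \<bullet> (indicator S x *\<^sub>R c x)
      - (indicator S x *\<^sub>R b x) \<bullet> (indicator S x *\<^sub>R c x))"
    unfolding L2_inner_indicator
    by (intro Bochner_Integration.integral_cong refl) (simp add: inner_diff_left right_diff_distrib)
  also have "\<dots> = L2_inner S a c - L2_inner S b c"
    unfolding L2_inner_indicator by (intro Bochner_Integration.integral_diff L2_on_integrable assms)
  finally show ?thesis .
qed

lemma L2_on_zero: "L2_on S (\<lambda>x. 0)"
  by (simp add: L2_on_def set_borel_measurable_def set_integrable_def)

context dg
begin

text \<open>Linearity keeps combinations of nodal values of u, and hence the test functions,
  solenoidal.\<close>

lemma dfree_sum:
  assumes v: "\<And>i. i \<in> I \<Longrightarrow> dfree (v i)"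
  shows "dfree (\<lambda>K x. \<Sum>i\<in>I. a i *\<^sub>R v i K x)"
proof -
  let ?s = "\<lambda>K x. \<Sum>i\<in>I. a i *\<^sub>R v i K x"
  have pv: "pfield (v i)" if "i \<in> I" for i using v[OF that] by (simp add: dfree_def)
  have ps: "pfield ?s"
    unfolding pfield_def vpoly_def
  proof (intro ballI allI)
    fix K j assume K: "K \<in> mh"
    have "poly_le deg (\<lambda>x. \<Sum>i\<in>I. a i * v i K x $ j)"
    proof (rule poly_le_sum)
      fix i assume "i \<in> I"
      then have "poly_le deg (\<lambda>x. v i K x $ j)" using pv K by (simp add: pfield_def vpoly_def)
      then show "poly_le deg (\<lambda>x. a i * v i K x $ j)" by (rule poly_le.mult[OF poly_le.const[of 0]]) simp
    qed
    then show "poly_le deg (\<lambda>x. (\<Sum>i\<in>I. a i *\<^sub>R v i K x) $ j)" by (simp add: sum_component)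
  qed
  have "L2_inner \<Omega> (assemble D ?s) G = 0" if t: "C1_test UNIV \<phi> G" for \<phi> G
  proof -
    have Gc: "continuous_on UNIV G" using t by (simp add: C1_test_def)
    have int: "set_integrable lborel K (\<lambda>x. a i * (v i K x \<bullet> G x))" if "K \<in> mh" "i \<in> I" for K i
      by (intro set_integrable_compact compact_mesh that continuous_on_mult continuous_on_const continuous_on_inner
          pfield_cont pv Gc)
    have "L2_inner \<Omega> (assemble D ?s) G = (\<Sum>K\<in>mh. LINT x:K|lborel. (\<Sum>i\<in>I. a i * (v i K x \<bullet> G x)))"
      unfolding L2_inner_assemble_right[OF pfield_cfield[OF ps] Gc] by (simp add: inner_sum_left)
    also have "\<dots> = (\<Sum>K\<in>mh. \<Sum>i\<in>I. LINT x:K|lborel. a i * (v i K x \<bullet> G x))"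
      by (intro sum.cong refl set_integral_sum int)
    also have "\<dots> = (\<Sum>i\<in>I. \<Sum>K\<in>mh. LINT x:K|lborel. a i * (v i K x \<bullet> G x))" by (rule sum.swap)
    also have "\<dots> = (\<Sum>i\<in>I. a i * L2_inner \<Omega> (assemble D (v i)) G)"
    proof (rule sum.cong)
      fix i assume "i \<in> I"
      then show "(\<Sum>K\<in>mh. LINT x:K|lborel. a i * (v i K x \<bullet> G x)) = a i * L2_inner \<Omega> (assemble D (v i)) G"
        unfolding L2_inner_assemble_right[OF pfield_cfield[OF pv[OF \<open>i \<in> I\<close>]] Gc] by (simp add: sum_distrib_left)
    qed simp
    also have "\<dots> = 0" using v t by (intro sum.neutral ballI) (simp add: dfree_def)
    finally show ?thesis .
  qed
  then show ?thesis using ps unfolding dfree_def by blast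
qed

lemma Zht_test:
  assumes w: "w \<in> Zht D" and n: "n \<in> {1..steps D}" and t: "t \<in> tint D n" and \<phi>: "C1_test UNIV \<phi> G"
  shows "L2_inner \<Omega> (assemble D (w n t)) G = 0"
proof -
  have "weak_div \<Omega> (assemble D (w n t)) (\<lambda>x. 0)" "zero_normal_trace \<Omega> (assemble D (w n t))"
    using w n t unfolding Zht_def Vht_def by blast+
  then have "L2_inner \<Omega> (assemble D (w n t)) G + L2_inner \<Omega> (\<lambda>x. 0) \<phi> = 0"
    using \<phi> unfolding zero_normal_trace_def by blast
  then show ?thesis by (simp add: L2_inner_def set_lebesgue_integral_def)
qed

text \<open>The space imposes its constraints at interior times only. The pairing with a fixed test
  gradient is a polynomial in t with infinitely many zeros, so it vanishes for every t. This
  includes the left endpoint, which is a Radau node.\<close>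

lemma Zht_dfree:
  assumes w: "w \<in> Zht D" and n: "n \<in> {1..steps D}"
  shows "dfree (w n t)"
proof -
  have wV: "w \<in> Vht D" using w by (simp add: Zht_def)
  have "L2_inner \<Omega> (assemble D (w n t)) G = 0" if \<phi>: "C1_test UNIV \<phi> G" for \<phi> G
  proof -
    have Gc: "continuous_on UNIV G" using \<phi> by (simp add: C1_test_def)
    have cf: "cfield (\<lambda>K. G)" using Gc by (simp add: cfield_def)
    have "tpf (tdeg D) (\<lambda>t. G)"
    proof (rule tpfI[of _ "\<lambda>j x. if j = 0 then G x else 0"])
      show "continuous_on UNIV (\<lambda>x. if j = 0 then G x else 0)" for j by (cases "j = 0") (simp_all add: Gc)
      show "G x = (\<Sum>j\<le>tdeg D. t ^ j *\<^sub>R (if j = 0 then G x else 0))" for t x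
        by (simp add: if_distrib[of "\<lambda>y. _ *\<^sub>R y"] sum.delta cong: if_cong)
    qed
    then have tG: "tfield (\<lambda>t K. G)" by (simp add: tfield_def)
    have eq: "L2_inner \<Omega> (assemble D (w n t)) G = L2_inner \<Omega> (assemble D (w n t)) (assemble D (\<lambda>K. G))" for t
      unfolding L2_inner_assemble_right[OF tfield_cfield[OF Vht_tfields(1)[OF wV n]] Gc]
        L2_inner_assemble[OF tfield_cfield[OF Vht_tfields(1)[OF wV n]] cf] ..
    obtain p where p: "\<forall>t. L2_inner \<Omega> (assemble D (w n t)) (assemble D (\<lambda>K. G)) = poly p t"
      using tpoly_L2[OF Vht_tfields(1)[OF wV n] tG] unfolding tpoly_def by (elim exE conjE)
    have "p = 0"
    proof (rule ccontr)
      assume "p \<noteq> 0"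
      then have "finite {t. poly p t = 0}" by (rule poly_roots_finite)
      moreover have "tint D n \<subseteq> {t. poly p t = 0}" using Zht_test[OF w n _ \<phi>] eq p by auto
      ultimately have "finite (tint D n)" by (rule finite_subset[rotated])
      then show False using step_pos[OF n] unfolding tint_def by (simp add: infinite_Ioo)
    qed
    then show ?thesis using eq p by simp
  qed
  then show ?thesis using Vht_pfield[OF wV n] unfolding dfree_def by blast
qed

lemma dfree_weak_div:
  assumes "dfree v" shows "weak_div \<Omega> (assemble D v) (\<lambda>x. 0)"
  unfolding weak_div_def
proof (intro conjI allI impI L2_on_zero)
  fix \<phi> G assume "C1_test \<Omega> \<phi> G"
  then have "C1_test UNIV \<phi> G" by (simp add: C1_test_def)
  then have "L2_inner \<Omega> (assemble D v) G = 0" using assms unfolding dfree_def by blast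
  then show "L2_inner \<Omega> (assemble D v) G = - L2_inner \<Omega> (\<lambda>x. 0) \<phi>"
    by (simp add: L2_inner_def set_lebesgue_integral_def)
qed

text \<open>The normal trace is tested against every weak divergence \<open>g\<close> of the field.  Such a \<open>g\<close> is also
  a weak divergence of any other divergence-free field, for which the trace is known to vanish.\<close>

lemma dfree_zero_normal_trace:
  assumes v: "dfree v" and u: "dfree u" "zero_normal_trace \<Omega> (assemble D u)"
  shows "zero_normal_trace \<Omega> (assemble D v)"
  unfolding zero_normal_trace_def
proof (intro allI impI, elim conjE)
  fix g and \<phi> :: "real^'n \<Rightarrow> real" and G assume g: "weak_div \<Omega> (assemble D v) g" and \<phi>: "C1_test UNIV \<phi> G"
  have v0: "L2_inner \<Omega> (assemble D v) G = 0" if "C1_test UNIV \<phi> G" for \<phi> G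
    using v that unfolding dfree_def by blast
  have u0: "L2_inner \<Omega> (assemble D u) G = 0" if "C1_test UNIV \<phi> G" for \<phi> G
    using u(1) that unfolding dfree_def by blast
  have "weak_div \<Omega> (assemble D u) g"
    unfolding weak_div_def
  proof (intro conjI allI impI)
    show "L2_on \<Omega> g" using g by (simp add: weak_div_def)
    fix \<phi> G assume t: "C1_test \<Omega> \<phi> G"
    then have t': "C1_test UNIV \<phi> G" by (simp add: C1_test_def)
    have "L2_inner \<Omega> (assemble D v) G = - L2_inner \<Omega> g \<phi>" using g t unfolding weak_div_def by blast
    then show "L2_inner \<Omega> (assemble D u) G = - L2_inner \<Omega> g \<phi>" using u0[OF t'] v0[OF t'] by simp
  qed
  then have "L2_inner \<Omega> (assemble D u) G + L2_inner \<Omega> g \<phi> = 0"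
    using u(2) \<phi> unfolding zero_normal_trace_def by blast
  then show "L2_inner \<Omega> (assemble D v) G + L2_inner \<Omega> g \<phi> = 0" using u0[OF \<phi>] v0[OF \<phi>] by simp
qed

text \<open>The spatial forms only see the values at the Radau nodes, where this test function is the multiple
  \<open>\<theta> n i\<close> of \<open>u\<close>.\<close>

definition tst :: "('n, real^'n) st_broken \<Rightarrow> (nat \<Rightarrow> nat \<Rightarrow> real) \<Rightarrow> ('n, real^'n) st_broken" where
  "tst u \<theta> n t = (\<lambda>K x. \<Sum>i\<in>rset. poly (lag n i) t *\<^sub>R (\<theta> n i *\<^sub>R u n (rnode D n i) K x))"

lemma tst_node:
  "n \<in> {1..steps D} \<Longrightarrow> k \<in> rset \<Longrightarrow> tst u \<theta> n (rnode D n k) = sc (\<theta> n k) (u n (rnode D n k))"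
  unfolding tst_def sc_def by (intro ext) (rule sum_lag_node)

lemma tst_dfree:
  assumes u: "u \<in> Zht D" and n: "n \<in> {1..steps D}"
  shows "dfree (tst u \<theta> n t)"
  unfolding tst_def scaleR_scaleR by (rule dfree_sum) (rule Zht_dfree[OF u n])

text \<open>Membership asks for monomial coefficients in \<open>Vh\<close>. These are combinations
  of nodal values of u, so they inherit the local space and, through \<open>dfree\<close>, a weak
  divergence.\<close>

lemma tst_Zht:
  assumes u: "u \<in> Zht D"
  shows "tst u \<theta> \<in> Zht D"
proof -
  have uV: "u \<in> Vht D" using u by (simp add: Zht_def)
  have "\<exists>c. (\<forall>j\<le>tdeg D. c j \<in> Vh D) \<and>
      (\<forall>t. \<forall>K\<in>mh. \<forall>x. tst u \<theta> n t K x = (\<Sum>j\<le>tdeg D. t ^ j *\<^sub>R c j K x))" if n: "n \<in> {1..steps D}" for n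
  proof (intro exI conjI allI ballI impI)
    define d where "d j = (\<lambda>K x. \<Sum>i\<in>rset. (coeff (lag n i) j * \<theta> n i) *\<^sub>R u n (rnode D n i) K x)" for j
    show "tst u \<theta> n t K x = (\<Sum>j\<le>tdeg D. t ^ j *\<^sub>R d j K x)" for t K x
      unfolding tst_def d_def using sum_poly_scaleR[where I = rset and q = "lag n" and m = "tdeg D" and t = t
          and g = "\<lambda>i. \<theta> n i *\<^sub>R u n (rnode D n i) K x", OF lag_degree]
      by simp
    show "d j \<in> Vh D" for j
    proof -
      have df: "dfree (d j)" unfolding d_def by (rule dfree_sum) (rule Zht_dfree[OF u n])
      have "d j K \<in> local_space (fam D) (spdeg D)" if "K \<in> mh" for K
        unfolding d_def by (rule local_space_sum) (rule Vht_fields(1)[OF uV n that])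
      moreover have "L2_on \<Omega> (assemble D (d j))"
        using df by (intro L2_on_assemble pfield_cfield) (simp add: dfree_def)
      ultimately show ?thesis using dfree_weak_div[OF df] unfolding Vh_def Hdiv_def by blast
    qed
  qed
  moreover have "zero_normal_trace \<Omega> (assemble D (tst u \<theta> n t))" if n: "n \<in> {1..steps D}" and t: "t \<in> tint D n" for n t
  proof (rule dfree_zero_normal_trace[OF tst_dfree[OF u n] Zht_dfree[OF u n]])
    show "zero_normal_trace \<Omega> (assemble D (u n t))" using uV n t unfolding Vht_def by blast
  qed
  moreover have "weak_div \<Omega> (assemble D (tst u \<theta> n t)) (\<lambda>x. 0)" if n: "n \<in> {1..steps D}" for n t
    by (rule dfree_weak_div[OF tst_dfree[OF u n]])
  ultimately show ?thesis unfolding Zht_def Vht_def by blast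
qed

definition En :: "('n, real^'n) st_broken \<Rightarrow> nat \<Rightarrow> real \<Rightarrow> real" where
  "En u n t = L2_inner \<Omega> (assemble D (u n t)) (assemble D (u n t))"

text \<open>Expansion in time-independent coefficients expresses the energy and its time derivative
  by the same Gram matrix.\<close>

lemma L2_gram:
  assumes "\<And>j. j \<in> I \<Longrightarrow> cfield (c j)"
    and "\<And>K x. K \<in> mh \<Longrightarrow> A K x = (\<Sum>j\<in>I. a j *\<^sub>R c j K x)" "\<And>K x. K \<in> mh \<Longrightarrow> B K x = (\<Sum>j\<in>I. b j *\<^sub>R c j K x)"
  shows "L2_inner \<Omega> (assemble D A) (assemble D B)
    = (\<Sum>i\<in>I. \<Sum>j\<in>I. a i * (b j * L2_inner \<Omega> (assemble D (c i)) (assemble D (c j :: ('n, 'b::euclidean_space) broken))))"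
proof -
  have AB: "assemble D A = (\<lambda>x. \<Sum>j\<in>I. a j *\<^sub>R assemble D (c j) x)" "assemble D B = (\<lambda>x. \<Sum>j\<in>I. b j *\<^sub>R assemble D (c j) x)"
    unfolding assemble_scaled_sum[symmetric] by (rule ext, rule fun_cong[OF assemble_cong], rule assms, assumption)+
  have L: "L2_on \<Omega> (assemble D (c j))" if "j \<in> I" for j by (rule L2_on_assemble[OF assms(1)[OF that]])
  have "L2_on \<Omega> (assemble D (\<lambda>K x. \<Sum>j\<in>I. b j *\<^sub>R c j K x))"
  proof (rule L2_on_assemble, unfold cfield_def, rule ballI)
    fix K assume "K \<in> mh"
    then have "continuous_on UNIV (c j K)" if "j \<in> I" for j using assms(1)[OF that] by (simp add: cfield_def)
    then show "continuous_on UNIV (\<lambda>x. \<Sum>j\<in>I. b j *\<^sub>R c j K x)"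
      by (intro continuous_on_sum continuous_on_scaleR continuous_on_const)
  qed
  then have LB: "L2_on \<Omega> (\<lambda>x. \<Sum>j\<in>I. b j *\<^sub>R assemble D (c j) x)"
    unfolding assemble_scaled_sum[abs_def] .
  have "L2_inner \<Omega> (assemble D (c i)) (\<lambda>x. \<Sum>j\<in>I. b j *\<^sub>R assemble D (c j) x)
      = (\<Sum>j\<in>I. b j * L2_inner \<Omega> (assemble D (c i)) (assemble D (c j)))" if "i \<in> I" for i
  proof -
    have "L2_inner \<Omega> (assemble D (c i)) (\<lambda>x. \<Sum>j\<in>I. b j *\<^sub>R assemble D (c j) x)
        = L2_inner \<Omega> (\<lambda>x. \<Sum>j\<in>I. b j *\<^sub>R assemble D (c j) x) (assemble D (c i))"
      by (rule L2_inner_commute)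
    also have "\<dots> = (\<Sum>j\<in>I. b j * L2_inner \<Omega> (assemble D (c j)) (assemble D (c i)))"
      by (rule L2_inner_sum_left[where U = "\<lambda>j. assemble D (c j)", OF L L[OF that]])
    also have "\<dots> = (\<Sum>j\<in>I. b j * L2_inner \<Omega> (assemble D (c i)) (assemble D (c j)))"
      by (intro sum.cong refl arg_cong2[of _ _ _ _ "(*)"] L2_inner_commute)
    finally show ?thesis .
  qed
  moreover have "L2_inner \<Omega> (\<lambda>x. \<Sum>j\<in>I. a j *\<^sub>R assemble D (c j) x) (\<lambda>x. \<Sum>j\<in>I. b j *\<^sub>R assemble D (c j) x)
      = (\<Sum>i\<in>I. a i * L2_inner \<Omega> (assemble D (c i)) (\<lambda>x. \<Sum>j\<in>I. b j *\<^sub>R assemble D (c j) x))"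
    by (rule L2_inner_sum_left[where U = "\<lambda>j. assemble D (c j)", OF L LB])
  ultimately show ?thesis unfolding AB by (simp add: sum_distrib_left cong: sum.cong)
qed

text \<open>The energy is differentiated in its Gram expansion; symmetry of the Gram matrix makes
  both halves of the product rule equal, whence the factor 1/2. Uniqueness of the derivative
  identifies the result with \<open>pderiv p\<close>.\<close>

lemma En_poly:
  assumes u: "u \<in> Vht D" and n: "n \<in> {1..steps D}"
  obtains p where "degree p \<le> 2 * tdeg D" "\<forall>t. En u n t = poly p t"
    "\<forall>t. L2_inner \<Omega> (assemble D (time_deriv u n t)) (assemble D (u n t)) = poly (pderiv p) t / 2"
proof -
  obtain p where p: "degree p \<le> 2 * tdeg D" "\<forall>t. En u n t = poly p t"
    using tpoly_L2[OF Vht_tfields(1)[OF u n] Vht_tfields(1)[OF u n]] unfolding tpoly_def En_def by (elim exE conjE)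
  obtain c where c0: "\<forall>j\<le>tdeg D. c j \<in> Vh D"
    "\<forall>t. \<forall>K\<in>mh. \<forall>x. u n t K x = (\<Sum>j\<le>tdeg D. t ^ j *\<^sub>R c j K x)"
    by (rule Vht_coeffs[OF u n])
  have cf: "cfield (c j)" if "j \<in> {..tdeg D}" for j using c0(1) that by (intro pfield_cfield Vh_vpoly) simp
  have uc: "u n t K x = (\<Sum>j\<le>tdeg D. t ^ j *\<^sub>R c j K x)" if "K \<in> mh" for t K x using c0(2) that by simp
  define g where "g i j = L2_inner \<Omega> (assemble D (c i)) (assemble D (c j))" for i j
  have gs: "g i j = g j i" for i j unfolding g_def by (rule L2_inner_commute)
  let ?I = "{..tdeg D}" and ?d = "\<lambda>i t. poly (pderiv (monom (1::real) i)) t"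
  have E: "En u n t = (\<Sum>i\<in>?I. \<Sum>j\<in>?I. t ^ i * (t ^ j * g i j))" for t
    unfolding En_def g_def by (rule L2_gram[OF cf uc uc])
  have T: "L2_inner \<Omega> (assemble D (time_deriv u n t)) (assemble D (u n t)) = (\<Sum>i\<in>?I. \<Sum>j\<in>?I. ?d i t * (t ^ j * g i j))" for t
  proof -
    have td: "time_deriv u n t K x = (\<Sum>j\<in>?I. ?d j t *\<^sub>R c j K x)" if "K \<in> mh" for t K x
      by (rule time_deriv_sum[where m = "tdeg D" and c = c]) (rule uc[OF that])
    show ?thesis unfolding g_def by (rule L2_gram[OF cf td uc])
  qed
  have "L2_inner \<Omega> (assemble D (time_deriv u n t)) (assemble D (u n t)) = poly (pderiv p) t / 2" for t
  proof -
    have dm: "((\<lambda>t. t ^ i) has_real_derivative ?d i t) (at t)" for i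
      using poly_DERIV[of "monom 1 i" t] by (simp add: poly_monom)
    have "((\<lambda>t. t ^ i * (t ^ j * g i j)) has_real_derivative (?d i t * (t ^ j * g i j) + ?d j t * (t ^ i * g i j))) (at t)" for i j
      using DERIV_mult[OF dm[of i] DERIV_cmult_right[OF dm[of j], of "g i j"]] by (simp add: mult_ac)
    then have "((\<lambda>t. \<Sum>i\<in>?I. \<Sum>j\<in>?I. t ^ i * (t ^ j * g i j)) has_real_derivative
        (\<Sum>i\<in>?I. \<Sum>j\<in>?I. ?d i t * (t ^ j * g i j) + ?d j t * (t ^ i * g i j))) (at t)"
      by (intro DERIV_sum)
    moreover have "(\<lambda>t. \<Sum>i\<in>?I. \<Sum>j\<in>?I. t ^ i * (t ^ j * g i j)) = poly p" using E p(2) by (simp add: fun_eq_iff)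
    ultimately have "(poly p has_real_derivative (\<Sum>i\<in>?I. \<Sum>j\<in>?I. ?d i t * (t ^ j * g i j) + ?d j t * (t ^ i * g i j))) (at t)"
      by simp
    then have "(\<Sum>i\<in>?I. \<Sum>j\<in>?I. ?d i t * (t ^ j * g i j) + ?d j t * (t ^ i * g i j)) = poly (pderiv p) t"
      by (rule DERIV_unique[OF _ poly_DERIV])
    moreover have "(\<Sum>i\<in>?I. \<Sum>j\<in>?I. ?d j t * (t ^ i * g i j)) = (\<Sum>i\<in>?I. \<Sum>j\<in>?I. ?d i t * (t ^ j * g i j))"
      by (subst sum.swap) (simp only: gs)
    ultimately show ?thesis unfolding T by (simp add: sum.distrib)
  qed
  then show thesis by (intro that[of p] p allI)
qed

lemma cfield_L2: "u \<in> Vht D \<Longrightarrow> n \<in> {1..steps D} \<Longrightarrow> L2_on \<Omega> (assemble D (u n t))"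
  by (intro L2_on_assemble pfield_cfield Vht_pfield)

definition Jn :: "('n, real^'n) st_broken \<Rightarrow> nat \<Rightarrow> real" where
  "Jn u n = (L2_norm_on \<Omega> (assemble D (time_jump D u n)))\<^sup>2"

text \<open>The identity 2 (a - b) \<bullet> b = |a|^2 - |a - b|^2 - |b|^2, where a and b are the
  limits from the left and from the right.\<close>

lemma jump_inner:
  assumes u: "u \<in> Vht D" and n: "n \<in> {1..steps D - 1}"
  shows "L2_inner \<Omega> (assemble D (time_jump D u n)) (assemble D (u (n + 1) (tpt D n)))
    = (En u n (tpt D n) - Jn u n - En u (n + 1) (tpt D n)) / 2"
proof -
  let ?a = "assemble D (u n (tpt D n))" and ?b = "assemble D (u (n + 1) (tpt D n))"
  have n': "n \<in> {1..steps D}" "n + 1 \<in> {1..steps D}" using n by auto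
  have L: "L2_on \<Omega> ?a" "L2_on \<Omega> ?b" by (rule cfield_L2[OF u n'(1)], rule cfield_L2[OF u n'(2)])
  have j: "assemble D (time_jump D u n) = (\<lambda>x. ?a x - ?b x)"
    by (simp add: assemble_def time_jump_def sum_subtractf fun_eq_iff)
  have "cfield (time_jump D u n)"
    unfolding cfield_def time_jump_def
    by (intro ballI continuous_on_diff pfield_cont Vht_pfield u n')
  then have Lj: "L2_on \<Omega> (\<lambda>x. ?a x - ?b x)" unfolding j[symmetric] by (rule L2_on_assemble)
  have 1: "L2_inner \<Omega> (\<lambda>x. ?a x - ?b x) ?b = L2_inner \<Omega> ?a ?b - L2_inner \<Omega> ?b ?b"
    by (rule L2_inner_diff_left[OF L L(2)])
  have 2: "L2_inner \<Omega> (\<lambda>x. ?a x - ?b x) ?a = L2_inner \<Omega> ?a ?a - L2_inner \<Omega> ?b ?a"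
    by (rule L2_inner_diff_left[OF L L(1)])
  have "L2_inner \<Omega> (\<lambda>x. ?a x - ?b x) (\<lambda>x. ?a x - ?b x) = L2_inner \<Omega> ?a (\<lambda>x. ?a x - ?b x) - L2_inner \<Omega> ?b (\<lambda>x. ?a x - ?b x)"
    by (rule L2_inner_diff_left[OF L Lj])
  then have "Jn u n = L2_inner \<Omega> ?a ?a - L2_inner \<Omega> ?b ?a - (L2_inner \<Omega> ?a ?b - L2_inner \<Omega> ?b ?b)"
    unfolding Jn_def L2_norm_on_sq j using 1 2 L2_inner_commute[of \<Omega> ?a "\<lambda>x. ?a x - ?b x"] L2_inner_commute[of \<Omega> ?b "\<lambda>x. ?a x - ?b x"]
    by simp
  then show ?thesis unfolding j 1 En_def using L2_inner_commute[of \<Omega> ?a ?b] by (simp add: field_simps)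
qed

text \<open>On each step the integrand has degree at most 2 \<ell>, so it becomes a Radau sum in
  which the test function is \<theta> u. Node 1 is the left endpoint of the step; therefore the
  right limits in the jump terms are multiples of u too, with weight
  \<open>\<theta> (n + 1) 1\<close>.\<close>

lemma m_form_tst:
  assumes u: "u \<in> Zht D"
    and p: "\<And>n t. n \<in> {1..steps D} \<Longrightarrow>
      L2_inner \<Omega> (assemble D (time_deriv u n t)) (assemble D (u n t)) = poly (pderiv (p n)) t / 2"
  shows "m_form D u (tst u \<theta>)
    = (\<Sum>n=1..steps D. (\<Sum>i\<in>rset. rwt D n i * (\<theta> n i * poly (pderiv (p n)) (rnode D n i))) / 2)
      - (\<Sum>n=1..steps D - 1. \<theta> (n + 1) 1 * ((En u n (tpt D n) - Jn u n - En u (n + 1) (tpt D n)) / 2))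
      + \<theta> 1 1 * En u 1 0"
proof -
  have uV: "u \<in> Vht D" using u by (simp add: Zht_def)
  have zV: "tst u \<theta> \<in> Vht D" using tst_Zht[OF u] by (simp add: Zht_def)
  have 1: "(LINT t:tint D n|lborel. L2_inner \<Omega> (assemble D (time_deriv u n t)) (assemble D (tst u \<theta> n t)))
      = (\<Sum>i\<in>rset. rwt D n i * (\<theta> n i * poly (pderiv (p n)) (rnode D n i))) / 2" if n: "n \<in> {1..steps D}" for n
  proof -
    have "(LINT t:tint D n|lborel. L2_inner \<Omega> (assemble D (time_deriv u n t)) (assemble D (tst u \<theta> n t)))
      = Q n (\<lambda>t. L2_inner \<Omega> (assemble D (time_deriv u n t)) (assemble D (tst u \<theta> n t)))"
      by (rule quadrature[OF n tpoly_L2[OF Vht_tfields(3)[OF uV n] Vht_tfields(1)[OF zV n]]])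
    also have "\<dots> = (\<Sum>i\<in>rset. rwt D n i * (\<theta> n i * (poly (pderiv (p n)) (rnode D n i) / 2)))"
      unfolding Q_def by (intro sum.cong refl) (simp only: tst_node[OF n] L2_inner_sc_right p[OF n])
    finally show ?thesis by (simp add: sum_divide_distrib)
  qed
  have 2: "L2_inner \<Omega> (assemble D (time_jump D u n)) (assemble D (tst u \<theta> (n + 1) (tpt D n)))
      = \<theta> (n + 1) 1 * ((En u n (tpt D n) - Jn u n - En u (n + 1) (tpt D n)) / 2)" if n: "n \<in> {1..steps D - 1}" for n
  proof -
    have n': "n + 1 \<in> {1..steps D}" using n by auto
    have "tst u \<theta> (n + 1) (tpt D n) = sc (\<theta> (n + 1) 1) (u (n + 1) (tpt D n))"
      using tst_node[OF n' rset_facts(2), of u \<theta>] radau(1)[OF n'] by simp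
    then show ?thesis unfolding jump_inner[OF uV n, symmetric] by (simp only: L2_inner_sc_right)
  qed
  have n1: "1 \<in> {1..steps D}" using time_facts(1) by simp
  have "tst u \<theta> 1 0 = sc (\<theta> 1 1) (u 1 0)"
    using tst_node[OF n1 rset_facts(2), of u \<theta>] radau(1)[OF n1] time_facts(2) by simp
  then have 3: "L2_inner \<Omega> (assemble D (u 1 0)) (assemble D (tst u \<theta> 1 0)) = \<theta> 1 1 * En u 1 0"
    by (simp only: L2_inner_sc_right En_def)
  show ?thesis unfolding m_form_def 3
    by (intro arg_cong2[of _ _ _ _ "(+)"] arg_cong2[of _ _ _ _ "(-)"] refl sum.cong 1 2)
qed

end

section \<open>Energy stability\<close>

lemma set_integral_pderiv:
  fixes p :: "real poly"
  assumes "a \<le> b"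
  shows "(LINT t:{a..b}|lborel. poly (pderiv p) t) = poly p b - poly p a"
proof -
  have "(LBINT t. indicator {a..b} t *\<^sub>R poly (pderiv p) t) = poly p b - poly p a"
  proof (rule integral_FTC_atLeastAtMost[OF assms])
    show "(poly p has_vector_derivative poly (pderiv p) t) (at t within {a..b})" for t
      using poly_DERIV[of p t] has_field_derivative_at_within has_real_derivative_iff_has_vector_derivative by metis
    show "continuous_on {a..b} (poly (pderiv p))" by (intro continuous_on_poly continuous_on_id)
  qed
  then show ?thesis by (simp add: set_lebesgue_integral_def)
qed

text \<open>The weight \<open>(b - t) / (b - a)\<close> against the derivative of \<open>p\<close>: its negative slope produces the
  mean value of \<open>p\<close>, and the degree of the integrand is still at most that of \<open>p\<close>.\<close>

lemma weighted_pderiv: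
  fixes p :: "real poly" and a b :: real
  assumes "a < b"
  defines "q \<equiv> smult (1 / (b - a)) ([:b, - 1:] * pderiv p)"
  shows "degree q \<le> degree p" "\<And>t. poly q t = (b - t) / (b - a) * poly (pderiv p) t"
    "(LINT t:{a..b}|lborel. poly q t) = - poly p a + 1 / (b - a) * (LINT t:{a..b}|lborel. poly p t)"
proof -
  show "degree q \<le> degree p"
  proof (cases "pderiv p = 0")
    case False
    then have "degree p \<noteq> 0" by (simp add: pderiv_eq_0_iff)
    have "degree q \<le> degree ([:b, - 1:] * pderiv p)" unfolding q_def by (rule degree_smult_le)
    also have "\<dots> \<le> degree [:b, - 1:] + degree (pderiv p)" by (rule degree_mult_le)
    also have "\<dots> \<le> 1 + (degree p - 1)" by (intro add_mono) (simp_all add: degree_pderiv)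
    finally show ?thesis using \<open>degree p \<noteq> 0\<close> by simp
  qed (simp add: q_def)
  define l where "l = [:b, - 1::real:]"
  have l: "poly l t = b - t" "pderiv l = [:- 1:]" for t by (simp_all add: l_def pderiv_pCons)
  have q: "q = smult (1 / (b - a)) (l * pderiv p)" by (simp only: q_def l_def)
  show pq: "poly q t = (b - t) / (b - a) * poly (pderiv p) t" for t by (simp add: q l)
  \<comment> \<open>Integration by parts: r equals p at a, vanishes at b, and its derivative plus p
    / (b - a) is q.\<close>
  let ?r = "smult (1 / (b - a)) (l * p)"
  have r: "poly ?r a = poly p a" "poly ?r b = 0" using assms(1) by (simp_all add: l)
  have "poly q t = poly (pderiv ?r) t + 1 / (b - a) * poly p t" for t
    by (simp add: pq pderiv_smult pderiv_mult l add_divide_distrib[symmetric])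
  then have "(LINT t:{a..b}|lborel. poly q t) = (LINT t:{a..b}|lborel. poly (pderiv ?r) t + 1 / (b - a) * poly p t)"
    by simp
  also have "\<dots> = (LINT t:{a..b}|lborel. poly (pderiv ?r) t) + (LINT t:{a..b}|lborel. 1 / (b - a) * poly p t)"
    by (intro set_integral_add(2) set_integrable_poly set_integrable_mult_right)
  also have "\<dots> = - poly p a + 1 / (b - a) * (LINT t:{a..b}|lborel. poly p t)"
    unfolding set_integral_mult_right set_integral_pderiv[OF less_imp_le[OF assms(1)]] r by simp
  finally show "(LINT t:{a..b}|lborel. poly q t) = - poly p a + 1 / (b - a) * (LINT t:{a..b}|lborel. poly p t)" .
qed

text \<open>In the application a and b are the energies at the left and right ends of the steps and
  j the squared time jumps. The energies at intermediate time levels cancel, and half of every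
  squared jump survives.\<close>

lemma jump_telescope:
  fixes a b j :: "nat \<Rightarrow> real"
  assumes "1 \<le> m"
  shows "(\<Sum>n=1..m. (b n - a n) / 2) - (\<Sum>n=1..m - 1. (b n - j n - a (n + 1)) / 2) + a 1
    = b m / 2 + (\<Sum>n=1..m - 1. j n) / 2 + a 1 / 2"
  using assms
proof (induction m rule: dec_induct)
  case (step m)
  have "{1..Suc m - 1} = insert m {1..m - 1}" using step.hyps by auto
  then have "(\<Sum>n=1..Suc m - 1. f n) = f m + (\<Sum>n=1..m - 1. f n)" for f :: "nat \<Rightarrow> real"
    using step.hyps by simp
  then show ?case using step.IH by (simp add: field_simps)
qed (simp add: field_simps)

text \<open>With a = 1 + sqrt C and X the sum of the two data norms, the proof yields M \<le> 4 C a
  X and a right-hand side of at most a X M; the squared energy norm is at most M^2 plus twice that.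
  The leading 2 comes from bounding X^2 by twice the sum of squares.\<close>

definition stab_const :: "nat \<Rightarrow> real" where
  "stab_const l = (let C = L1_const (2 * l); a = 1 + sqrt C in 2 * (16 * C\<^sup>2 * a\<^sup>2 + 8 * C * a\<^sup>2))"

context dg
begin

lemma tpt_mono: "a \<le> b \<Longrightarrow> b \<le> steps D \<Longrightarrow> tpt D a \<le> tpt D b"
  using time_facts(5)[of a b] by (cases "a = b") simp_all

lemma st_assemble_tint:
  assumes n: "n \<in> {1..steps D}" and t: "t \<in> tint D n"
  shows "st_assemble D z t = assemble D (z n t)"
proof -
  have "m = n" if m: "m \<in> {1..steps D}" "t \<in> tint D m" for m
  proof (rule ccontr)
    assume "m \<noteq> n"
    then consider "m \<le> n - 1" | "n \<le> m - 1" by linarith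
    then show False
    proof cases
      case 1
      then have "tpt D m \<le> tpt D (n - 1)" using n by (intro tpt_mono) auto
      then show False using t m(2) by (simp add: tint_def)
    next
      case 2
      then have "tpt D n \<le> tpt D (m - 1)" using m(1) by (intro tpt_mono) auto
      then show False using t m(2) by (simp add: tint_def)
    qed
  qed
  then have "{m. m \<in> {1..steps D} \<and> t \<in> tint D m} = {n}" using n t by blast
  then show ?thesis by (simp add: st_assemble_def fun_eq_iff)
qed

lemma st_assemble_else:
  assumes "\<And>n. n \<in> {1..steps D} \<Longrightarrow> t \<notin> tint D n"
  shows "st_assemble D z t = (\<lambda>x. 0)"
proof -
  have "{m. m \<in> {1..steps D} \<and> t \<in> tint D m} = {}" using assms by blast
  then show ?thesis unfolding st_assemble_def by (simp only: sum.empty)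
qed

lemma L2_norm_zero: "L2_norm_on \<Omega> (\<lambda>x. 0::real^'n) = 0"
  by (simp add: L2_norm_on_def set_lebesgue_integral_def)

text \<open>At the time levels and outside (0, T) the assembled field is 0, which satisfies the
  bound as well.\<close>

lemma st_assemble_bound:
  assumes z: "z \<in> Vht D" and B: "0 \<le> B"
    and bd: "\<And>n t. n \<in> {1..steps D} \<Longrightarrow> t \<in> tint D n \<Longrightarrow> L2_norm_on \<Omega> (assemble D (z n t)) \<le> B"
  shows "L2_on \<Omega> (st_assemble D z t)" "L2_norm_on \<Omega> (st_assemble D z t) \<le> B"
proof -
  have "L2_on \<Omega> (st_assemble D z t) \<and> L2_norm_on \<Omega> (st_assemble D z t) \<le> B"
  proof (cases "\<exists>n\<in>{1..steps D}. t \<in> tint D n")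
    case True
    then obtain n where n: "n \<in> {1..steps D}" "t \<in> tint D n" by blast
    then show ?thesis unfolding st_assemble_tint[OF n] using bd[OF n] cfield_L2[OF z n(1)] by simp
  next
    case False
    then have "st_assemble D z t = (\<lambda>x. 0)" by (intro st_assemble_else) blast
    then show ?thesis using B by (simp add: L2_norm_zero L2_on_zero)
  qed
  then show "L2_on \<Omega> (st_assemble D z t)" "L2_norm_on \<Omega> (st_assemble D z t) \<le> B" by simp_all
qed

text \<open>The source is only integrable in time, so the test function has to be bounded uniformly
  in time.\<close>

lemma source_bound:
  assumes f: "L1_L2 (final D) \<Omega> f" and z: "z \<in> Vht D" and B: "0 \<le> B"
    and bd: "\<And>n t. n \<in> {1..steps D} \<Longrightarrow> t \<in> tint D n \<Longrightarrow> L2_norm_on \<Omega> (assemble D (z n t)) \<le> B"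
  shows "source_form D f z \<le> L1_L2_norm (final D) \<Omega> f * B"
proof -
  let ?T = "{0<..<final D}"
  note st = st_assemble_bound[OF z B bd]
  let ?g = "\<lambda>t. indicator ?T t *\<^sub>R L2_inner \<Omega> (f t) (st_assemble D z t)"
  let ?h = "\<lambda>t. indicator ?T t *\<^sub>R L2_norm_on \<Omega> (f t)"
  have ih: "integrable lborel ?h" using f by (simp add: L1_L2_def set_integrable_def)
  have h0: "0 \<le> ?h t" for t by (simp add: L2_norm_on_nonneg)
  have "AE t in lborel. t \<in> ?T \<longrightarrow> L2_on \<Omega> (f t)" using f by (simp add: L1_L2_def)
  then have ae: "AE t in lborel. ?g t \<le> ?h t * B"
  proof eventually_elim
    case (elim t)
    show ?case
    proof (cases "t \<in> ?T")
      case True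
      have "L2_inner \<Omega> (f t) (st_assemble D z t) \<le> \<bar>L2_inner \<Omega> (f t) (st_assemble D z t)\<bar>" by simp
      also have "\<dots> \<le> L2_norm_on \<Omega> (f t) * L2_norm_on \<Omega> (st_assemble D z t)"
        using elim True by (intro L2_Cauchy_Schwarz st) simp
      also have "\<dots> \<le> L2_norm_on \<Omega> (f t) * B" by (intro mult_left_mono st L2_norm_on_nonneg)
      finally show ?thesis using True by simp
    qed simp
  qed
  have "source_form D f z = (LINT t|lborel. ?g t)" by (simp add: source_form_def set_lebesgue_integral_def)
  also have "\<dots> \<le> (LINT t|lborel. ?h t * B)"
  proof (cases "integrable lborel ?g")
    case True
    then show ?thesis using ih ae by (intro integral_mono_AE integrable_mult_left)
  next
    \<comment> \<open>A pairing that is not integrable in time has integral 0 by convention, and the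
      bound is nonnegative.\<close>
    case False
    then have "(LINT t|lborel. ?g t) = 0" by (rule not_integrable_integral_eq)
    also have "0 \<le> (LINT t|lborel. ?h t * B)" using h0 B by (intro Bochner_Integration.integral_nonneg mult_nonneg_nonneg)
    finally show ?thesis .
  qed
  also have "\<dots> = L1_L2_norm (final D) \<Omega> f * B"
    by (simp add: L1_L2_norm_def set_lebesgue_integral_def)
  finally show ?thesis .
qed

lemma L1_L2_norm_nonneg: "0 \<le> L1_L2_norm T \<Omega> f"
  unfolding L1_L2_norm_def set_lebesgue_integral_def
  by (intro Bochner_Integration.integral_nonneg) (simp add: L2_norm_on_nonneg)

lemma En_nonneg: "0 \<le> En u n t"
  unfolding En_def by (rule L2_inner_self_nonneg)

lemma En_sqrt: "L2_norm_on \<Omega> (assemble D (u n t)) = sqrt (En u n t)"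
  unfolding En_def L2_norm_on_sq[symmetric] by (simp add: L2_norm_on_nonneg)

lemma Jn_nonneg: "0 \<le> Jn u n" by (simp add: Jn_def)

text \<open>A lower bound for \<nu> times the diffusion form plus the convective form at one time:
  \<nu> / 2 is what coercivity leaves, and the second term is the upwind penalty.\<close>

definition node_dissipation :: "real \<Rightarrow> ('n, real^'n) st_broken \<Rightarrow> ('n, real^'n) st_broken \<Rightarrow> nat \<Rightarrow> real \<Rightarrow> real" where
  "node_dissipation \<nu> w u n t = \<nu> / 2 * Ah_norm_sq D (u n t) + 1/2 * (\<Sum>F\<in>Fint. gammaF D F (w n t) * jump_sq F (u n t))"

lemma Ah_norm_sq_nonneg:
  assumes "0 < pen D" shows "0 \<le> Ah_norm_sq D u"
proof -
  have "0 \<le> (LINT x|\<Sigma> F. pen D / diameter F * (norm (jump D F u x))\<^sup>2)" if F: "F \<in> facets mh" for F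
  proof -
    obtain c where "flat_facet F (nu F) c" using F by (rule facet_flat)
    then have "0 \<le> diameter F" by (intro diameter_ge_0 compact_imp_bounded) (simp add: flat_facet_def)
    then have "0 \<le> pen D / diameter F" using assms by simp
    then show ?thesis by (intro Bochner_Integration.integral_nonneg mult_nonneg_nonneg) simp_all
  qed
  then show ?thesis unfolding Ah_norm_sq_def by (intro add_nonneg_nonneg sum_nonneg) simp_all
qed

lemma node_dissipation_nonneg: "0 < pen D \<Longrightarrow> 0 < \<nu> \<Longrightarrow> 0 \<le> node_dissipation \<nu> w u n t"
  unfolding node_dissipation_def
  by (intro add_nonneg_nonneg mult_nonneg_nonneg sum_nonneg Ah_norm_sq_nonneg jump_sq_nonneg less_imp_le[OF gammaF_pos]) simp_all

text \<open>At a node the test function is \<theta> u, so coercivity and skew symmetry apply node by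
  node. Summation keeps the inequality because the Radau weights and \<theta> are
  nonnegative.\<close>

lemma dissipation:
  assumes w: "w \<in> Zht D" and u: "u \<in> Zht D" and \<theta>: "\<And>n i. 0 \<le> \<theta> n i" and \<nu>: "0 < \<nu>"
    and d: "2 \<le> CARD('n)" and pen: "penalty_threshold CARD('n) (spdeg D) (shreg D) \<le> pen D"
  shows "(\<Sum>n=1..steps D. \<Sum>i\<in>rset. rwt D n i * (\<theta> n i * node_dissipation \<nu> w u n (rnode D n i)))
    \<le> \<nu> * a_form D u (tst u \<theta>) + c_form D w u (tst u \<theta>)"
proof -
  have uV: "u \<in> Vht D" and wV: "w \<in> Vht D" using u w by (simp_all add: Zht_def)
  have zV: "tst u \<theta> \<in> Vht D" using tst_Zht[OF u] by (simp add: Zht_def)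
  have "(\<Sum>i\<in>rset. rwt D n i * (\<theta> n i * node_dissipation \<nu> w u n (rnode D n i)))
      \<le> \<nu> * Q n (\<lambda>t. ah (u n t) (tst u \<theta> n t)) + Q n (\<lambda>t. ch (w n t) (u n t) (tst u \<theta> n t))" if n: "n \<in> {1..steps D}" for n
  proof -
    have "(\<Sum>i\<in>rset. rwt D n i * (\<theta> n i * node_dissipation \<nu> w u n (rnode D n i)))
        \<le> (\<Sum>i\<in>rset. rwt D n i * (\<nu> * ah (u n (rnode D n i)) (tst u \<theta> n (rnode D n i))
             + ch (w n (rnode D n i)) (u n (rnode D n i)) (tst u \<theta> n (rnode D n i))))"
    proof (rule sum_mono)
      fix i assume i: "i \<in> rset"
      let ?t = "rnode D n i"
      have p: "pfield (u n ?t)" by (rule Vht_pfield[OF uV n])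
      have "\<nu> * (1/2 * Ah_norm_sq D (u n ?t)) \<le> \<nu> * ah (u n ?t) (u n ?t)"
        using \<nu> ah_coercive[OF p d pen] by (intro mult_left_mono) simp_all
      then have "node_dissipation \<nu> w u n ?t \<le> \<nu> * ah (u n ?t) (u n ?t) + ch (w n ?t) (u n ?t) (u n ?t)"
        unfolding node_dissipation_def ch_skew[OF Zht_dfree[OF w n] p] by simp
      then have "\<theta> n i * node_dissipation \<nu> w u n ?t \<le> \<theta> n i * (\<nu> * ah (u n ?t) (u n ?t) + ch (w n ?t) (u n ?t) (u n ?t))"
        using \<theta> by (rule mult_left_mono)
      also have "\<dots> = \<nu> * ah (u n ?t) (tst u \<theta> n ?t) + ch (w n ?t) (u n ?t) (tst u \<theta> n ?t)"
        unfolding tst_node[OF n i] ah_sc[OF p] ch_sc by (simp add: algebra_simps)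
      finally show "rwt D n i * (\<theta> n i * node_dissipation \<nu> w u n ?t) \<le> rwt D n i * (\<nu> * ah (u n ?t) (tst u \<theta> n ?t) + ch (w n ?t) (u n ?t) (tst u \<theta> n ?t))"
        using radau(4)[OF n i] by (intro mult_left_mono) simp_all
    qed
    also have "\<dots> = \<nu> * Q n (\<lambda>t. ah (u n t) (tst u \<theta> n t)) + Q n (\<lambda>t. ch (w n t) (u n t) (tst u \<theta> n t))"
      unfolding Q_cmult[symmetric] Q_add[symmetric] by (simp add: Q_def)
    finally show ?thesis .
  qed
  then have "(\<Sum>n=1..steps D. \<Sum>i\<in>rset. rwt D n i * (\<theta> n i * node_dissipation \<nu> w u n (rnode D n i)))
      \<le> (\<Sum>n=1..steps D. \<nu> * Q n (\<lambda>t. ah (u n t) (tst u \<theta> n t)) + Q n (\<lambda>t. ch (w n t) (u n t) (tst u \<theta> n t)))"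
    by (rule sum_mono)
  also have "\<dots> = \<nu> * a_form D u (tst u \<theta>) + c_form D w u (tst u \<theta>)"
    unfolding a_form_nodes[OF uV zV] c_form_nodes[OF wV uV zV] by (simp add: sum.distrib sum_distrib_left)
  finally show ?thesis .
qed

text \<open>Between the nodes the interpolant of \<theta> u need not be a multiple of u. Its squared
  norm, of degree at most 2 \<ell>, is bounded by its mean, a Radau sum, which only sees nodal
  values, where |\<theta>| \<le> 1.\<close>

lemma tst_L2_bound:
  assumes u: "u \<in> Zht D" and \<theta>: "\<And>n i. i \<in> rset \<Longrightarrow> \<bar>\<theta> n i\<bar> \<le> 1"
    and M: "\<And>n t. n \<in> {1..steps D} \<Longrightarrow> t \<in> {tpt D (n - 1)..tpt D n} \<Longrightarrow> En u n t \<le> M\<^sup>2" "0 \<le> M"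
    and n: "n \<in> {1..steps D}" and t: "t \<in> tint D n"
  shows "L2_norm_on \<Omega> (assemble D (tst u \<theta> n t)) \<le> sqrt (L1_const (2 * tdeg D)) * M"
proof -
  have zV: "tst u \<theta> \<in> Vht D" using tst_Zht[OF u] by (simp add: Zht_def)
  let ?C = "L1_const (2 * tdeg D)" and ?\<tau> = "tpt D n - tpt D (n - 1)"
  have \<tau>: "0 < ?\<tau>" using step_pos[OF n] by simp
  have "En (tst u \<theta>) n t \<le> ?C / ?\<tau> * Q n (En (tst u \<theta>) n)"
  proof (rule tpoly_le_average[OF n])
    show "tpoly (2 * tdeg D) (En (tst u \<theta>) n)"
      unfolding En_def[abs_def] by (rule tpoly_L2[OF Vht_tfields(1)[OF zV n] Vht_tfields(1)[OF zV n]])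
    show "t \<in> {tpt D (n - 1)..tpt D n}" using t by (simp add: tint_def)
  qed (rule En_nonneg)
  also have "\<dots> \<le> ?C / ?\<tau> * Q n (\<lambda>t. M\<^sup>2)"
  proof (intro mult_left_mono Q_mono[OF n])
    fix i assume i: "i \<in> rset"
    have "En (tst u \<theta>) n (rnode D n i) = (\<theta> n i)\<^sup>2 * En u n (rnode D n i)"
      unfolding En_def tst_node[OF n i] L2_inner_sc_right L2_inner_commute[of \<Omega> "assemble D (sc (\<theta> n i) (u n (rnode D n i)))"]
      by (simp add: power2_eq_square)
    also have "\<dots> \<le> 1 * M\<^sup>2"
      using \<theta>[OF i, of n] M(1)[OF n radau(3)[OF n i]] En_nonneg
      by (intro mult_mono) (simp_all add: abs_square_le_1)
    finally show "En (tst u \<theta>) n (rnode D n i) \<le> M\<^sup>2" by simp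
  qed (use \<tau> L1_const(1)[of "2 * tdeg D"] in simp)
  also have "\<dots> = ?C * M\<^sup>2" using \<tau> by (simp add: Q_one[OF n])
  finally have "sqrt (En (tst u \<theta>) n t) \<le> sqrt (?C * M\<^sup>2)" by (rule real_sqrt_le_mono)
  then show ?thesis using M(2) by (simp add: En_sqrt real_sqrt_mult)
qed

text \<open>The integrand has degree at most 2 \<ell> in time, so control at the nodes is control of
  the whole time integral.\<close>

lemma A_norm_sq_nodes:
  assumes u: "u \<in> Vht D"
  shows "A_norm_sq D u = (\<Sum>n=1..steps D. Q n (\<lambda>t. Ah_norm_sq D (u n t)))"
  unfolding A_norm_sq_def
proof (rule sum.cong)
  fix n assume n: "n \<in> {1..steps D}"
  note U = Vht_tfields[OF u n]
  have "Ah_norm_sq D (u n t) = L2_inner \<Omega> (assemble D (grad (u n t))) (assemble D (grad (u n t)))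
      + (\<Sum>F\<in>facets mh. pen D / diameter F * facet_inner D F (jump D F (u n t)) (jump D F (u n t)))" for t
    unfolding Ah_norm_sq_def L2_norm_on_sq facet_inner_def power2_norm_eq_inner by simp
  moreover have "tpoly (2 * tdeg D) (\<lambda>t. L2_inner \<Omega> (assemble D (grad (u n t))) (assemble D (grad (u n t)))
      + (\<Sum>F\<in>facets mh. pen D / diameter F * facet_inner D F (jump D F (u n t)) (jump D F (u n t))))"
    by (intro tpoly_add tpoly_L2[OF U(2) U(2)] tpoly_sum tpoly_cmult tpoly_facet tpf_avg(2)[OF U(1)])
  ultimately have "tpoly (2 * tdeg D) (\<lambda>t. Ah_norm_sq D (u n t))" by simp
  then show "(LINT t:tint D n|lborel. Ah_norm_sq D (u n t)) = Q n (\<lambda>t. Ah_norm_sq D (u n t))"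
    by (rule quadrature[OF n])
qed simp

text \<open>With unit weights the nodal dissipation is the diffusion and upwind part of the energy
  norm, up to the factor 1/2 on the first.\<close>

lemma dissipation_total:
  assumes u: "u \<in> Vht D"
  shows "(\<Sum>n=1..steps D. \<Sum>i\<in>rset. rwt D n i * node_dissipation \<nu> w u n (rnode D n i)) = \<nu> / 2 * A_norm_sq D u + gamma_norm_sq D w u"
proof -
  have "(\<Sum>i\<in>rset. rwt D n i * node_dissipation \<nu> w u n (rnode D n i))
      = \<nu> / 2 * Q n (\<lambda>t. Ah_norm_sq D (u n t)) + 1/2 * (\<Sum>F\<in>Fint. Q n (\<lambda>t. gammaF D F (w n t) * jump_sq F (u n t)))" for n
    unfolding Q_cmult[symmetric] Q_sum[symmetric] Q_add[symmetric] by (simp add: Q_def node_dissipation_def)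
  then have "(\<Sum>n=1..steps D. \<Sum>i\<in>rset. rwt D n i * node_dissipation \<nu> w u n (rnode D n i))
      = \<nu> / 2 * A_norm_sq D u + 1/2 * (\<Sum>n=1..steps D. \<Sum>F\<in>Fint. Q n (\<lambda>t. gammaF D F (w n t) * jump_sq F (u n t)))"
    unfolding A_norm_sq_nodes[OF u] by (simp add: sum.distrib sum_distrib_left)
  also have "(\<Sum>n=1..steps D. \<Sum>F\<in>Fint. Q n (\<lambda>t. gammaF D F (w n t) * jump_sq F (u n t)))
      = (\<Sum>F\<in>Fint. \<Sum>n=1..steps D. Q n (\<lambda>t. gammaF D F (w n t) * jump_sq F (u n t)))" by (rule sum.swap)
  also have "1/2 * \<dots> = gamma_norm_sq D w u"
    unfolding gamma_norm_sq_def radau_quad_def Q_def jump_sq_def rset_def ..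
  finally show ?thesis .
qed

lemma Linf_bound:
  assumes u: "u \<in> Vht D" and M: "0 \<le> M"
    and bd: "\<And>n t. n \<in> {1..steps D} \<Longrightarrow> t \<in> tint D n \<Longrightarrow> L2_norm_on \<Omega> (assemble D (u n t)) \<le> M"
  shows "(Linf_norm (restrict_space lborel {0<..<final D}) (\<lambda>t. L2_norm_on \<Omega> (st_assemble D u t)))\<^sup>2 \<le> M\<^sup>2"
proof -
  let ?S = "{c. 0 \<le> c \<and> (AE t in restrict_space lborel {0<..<final D}. \<bar>L2_norm_on \<Omega> (st_assemble D u t)\<bar> \<le> c)}"
  have "\<bar>L2_norm_on \<Omega> (st_assemble D u t)\<bar> \<le> M" for t
    using st_assemble_bound(2)[OF u M bd] by (simp add: L2_norm_on_nonneg)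
  then have MS: "M \<in> ?S" using M by simp
  have "bdd_below ?S" by (rule bdd_belowI[of _ 0]) simp
  then have "Inf ?S \<le> M" using MS by (rule cInf_lower[rotated])
  moreover have "0 \<le> Inf ?S" using MS by (intro cInf_greatest) auto
  ultimately show ?thesis unfolding Linf_norm_def by (rule power_mono)
qed

lemma energy_stability:
  assumes d: "2 \<le> CARD('n)" and pen: "penalty_threshold CARD('n) (spdeg D) (shreg D) \<le> pen D" and \<nu>: "0 < \<nu>"
    and f: "L1_L2 (final D) \<Omega> f" and u0: "L2_on \<Omega> u0" and w: "w \<in> Zht D"
    and sol: "solves_linearized D \<nu> f u0 w u"
  shows "energy_norm_sq D \<nu> w u \<le> stab_const (tdeg D) * ((L1_L2_norm (final D) \<Omega> f)\<^sup>2 + (L2_norm_on \<Omega> u0)\<^sup>2)"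
proof -
  define N where "N = steps D"
  define C where "C = L1_const (2 * tdeg D)"
  define Fn where "Fn = L1_L2_norm (final D) \<Omega> f"
  define Gu where "Gu = L2_norm_on \<Omega> u0"
  have C: "0 < C" unfolding C_def by (rule L1_const(1))
  have FU: "0 \<le> Fn" "0 \<le> Gu" unfolding Fn_def Gu_def by (rule L1_L2_norm_nonneg, rule L2_norm_on_nonneg)
  have N1: "1 \<le> N" unfolding N_def by (rule time_facts(1))
  have p0: "0 < pen D" using pen penalty_threshold_pos less_le_trans by blast
  have u: "u \<in> Zht D" using sol by (simp add: solves_linearized_def)
  have uV: "u \<in> Vht D" using u by (simp add: Zht_def)
  have "\<forall>n\<in>{1..N}. \<exists>q. degree q \<le> 2 * tdeg D \<and> (\<forall>t. En u n t = poly q t) \<and>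
    (\<forall>t. L2_inner \<Omega> (assemble D (time_deriv u n t)) (assemble D (u n t)) = poly (pderiv q) t / 2)"
  proof
    fix n assume "n \<in> {1..N}"
    then have n: "n \<in> {1..steps D}" by (simp add: N_def)
    show "\<exists>q. degree q \<le> 2 * tdeg D \<and> (\<forall>t. En u n t = poly q t) \<and>
      (\<forall>t. L2_inner \<Omega> (assemble D (time_deriv u n t)) (assemble D (u n t)) = poly (pderiv q) t / 2)"
      by (rule En_poly[OF uV n], intro exI conjI)
  qed
  then obtain p where "\<forall>n\<in>{1..N}. degree (p n) \<le> 2 * tdeg D \<and> (\<forall>t. En u n t = poly (p n) t) \<and>
    (\<forall>t. L2_inner \<Omega> (assemble D (time_deriv u n t)) (assemble D (u n t)) = poly (pderiv (p n)) t / 2)"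
    by (rule bchoice[THEN exE])
  then have pd: "n \<in> {1..N} \<Longrightarrow> degree (p n) \<le> 2 * tdeg D" and pE: "n \<in> {1..N} \<Longrightarrow> En u n t = poly (p n) t"
    and pT: "n \<in> {1..N} \<Longrightarrow> L2_inner \<Omega> (assemble D (time_deriv u n t)) (assemble D (u n t)) = poly (pderiv (p n)) t / 2" for n t
    by simp_all
  note sp = step_pos[folded N_def]

  have "\<forall>n\<in>{1..N}. \<exists>t\<in>{tpt D (n - 1)..tpt D n}. \<forall>s\<in>{tpt D (n - 1)..tpt D n}. En u n s \<le> En u n t"
  proof
    fix n assume n: "n \<in> {1..N}"
    have "\<exists>t\<in>{tpt D (n - 1)..tpt D n}. \<forall>s\<in>{tpt D (n - 1)..tpt D n}. poly (p n) s \<le> poly (p n) t"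
      using sp[OF n] by (intro continuous_attains_sup continuous_on_poly continuous_on_id) auto
    then show "\<exists>t\<in>{tpt D (n - 1)..tpt D n}. \<forall>s\<in>{tpt D (n - 1)..tpt D n}. En u n s \<le> En u n t"
      by (simp only: pE[OF n])
  qed
  then obtain tm where tm: "\<forall>n\<in>{1..N}. tm n \<in> {tpt D (n - 1)..tpt D n} \<and> (\<forall>s\<in>{tpt D (n - 1)..tpt D n}. En u n s \<le> En u n (tm n))"
    unfolding Bex_def by (rule bchoice[THEN exE])
  have fS: "finite {1..N}" "{1..N} \<noteq> {}" using N1 by auto
  obtain n0 where n0: "n0 \<in> {1..N}" "Max ((\<lambda>n. En u n (tm n)) ` {1..N}) = En u n0 (tm n0)"
    using obtains_MAX[OF fS, of "\<lambda>n. En u n (tm n)"] by metis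
  \<comment> \<open>The maximum is taken over closed steps, each with its own polynomial, so both
    one-sided limits at every inner time level are included.\<close>
  define M where "M = sqrt (En u n0 (tm n0))"
  have M0: "0 \<le> M" and M2: "M\<^sup>2 = En u n0 (tm n0)" using En_nonneg by (simp_all add: M_def)
  have EM: "En u n t \<le> M\<^sup>2" if n: "n \<in> {1..N}" and t: "t \<in> {tpt D (n - 1)..tpt D n}" for n t
  proof -
    have "En u n t \<le> En u n (tm n)" using tm n t by blast
    also have "\<dots> \<le> M\<^sup>2" unfolding M2 n0(2)[symmetric] using fS n by (intro Max_ge) auto
    finally show ?thesis .
  qed
  \<comment> \<open>A common bound of the right-hand side for all admissible weights. The source
    sees the test function between the nodes and pays sqrt C; the initial datum sees it at time 0, a
    Radau node, and pays nothing.\<close>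
  define K0 where "K0 = Fn * (sqrt C * M) + Gu * M"
  have n1: "1 \<in> {1..N}" using N1 by simp
  have t0: "(0::real) \<in> {tpt D (1 - 1)..tpt D 1}" using sp[OF n1] time_facts(2) by simp

  have test: "m_form D u (tst u \<theta>) + (\<Sum>n=1..N. \<Sum>i\<in>rset. rwt D n i * (\<theta> n i * node_dissipation \<nu> w u n (rnode D n i))) \<le> K0"
    if \<theta>: "\<forall>n i. 0 \<le> \<theta> n i" "\<forall>n i. i \<in> rset \<longrightarrow> \<theta> n i \<le> 1" for \<theta>
  proof -
    have z: "tst u \<theta> \<in> Zht D" by (rule tst_Zht[OF u])
    have zV: "tst u \<theta> \<in> Vht D" using z by (simp add: Zht_def)
    have eq: "m_form D u (tst u \<theta>) + \<nu> * a_form D u (tst u \<theta>) + c_form D w u (tst u \<theta>)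
      = source_form D f (tst u \<theta>) + L2_inner \<Omega> u0 (assemble D (tst u \<theta> 1 0))"
      using sol z unfolding solves_linearized_def by blast
    have "source_form D f (tst u \<theta>) \<le> Fn * (sqrt C * M)"
      unfolding Fn_def
    proof (rule source_bound[OF f zV])
      show "0 \<le> sqrt C * M" using C M0 by simp
      show "L2_norm_on \<Omega> (assemble D (tst u \<theta> n t)) \<le> sqrt C * M" if "n \<in> {1..steps D}" "t \<in> tint D n" for n t
        unfolding C_def using \<theta> by (intro tst_L2_bound[OF u _ EM[unfolded N_def] M0 that]) simp_all
    qed
    moreover have "L2_inner \<Omega> u0 (assemble D (tst u \<theta> 1 0)) \<le> Gu * M"
    proof -
      have n1': "1 \<in> {1..steps D}" using n1 by (simp add: N_def)
      have z0: "tst u \<theta> 1 0 = sc (\<theta> 1 1) (u 1 0)"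
        using tst_node[OF n1' rset_facts(2), of u \<theta>] radau(1)[OF n1'] time_facts(2) by simp
      have "\<bar>L2_inner \<Omega> u0 (assemble D (u 1 0))\<bar> \<le> Gu * L2_norm_on \<Omega> (assemble D (u 1 0))"
        unfolding Gu_def by (rule L2_Cauchy_Schwarz[OF u0 cfield_L2[OF uV n1']])
      also have "\<dots> \<le> Gu * M"
        unfolding En_sqrt using FU(2) real_sqrt_le_mono[OF EM[OF n1 t0]] M0 by (intro mult_left_mono) simp_all
      finally have b: "\<bar>L2_inner \<Omega> u0 (assemble D (u 1 0))\<bar> \<le> Gu * M" .
      have "L2_inner \<Omega> u0 (assemble D (tst u \<theta> 1 0)) \<le> \<theta> 1 1 * \<bar>L2_inner \<Omega> u0 (assemble D (u 1 0))\<bar>"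
        unfolding z0 L2_inner_sc_right using \<theta>(1) by (intro mult_left_mono) simp_all
      also have "\<dots> \<le> 1 * (Gu * M)" using \<theta> rset_facts(2) b by (intro mult_mono) simp_all
      finally show ?thesis by simp
    qed
    ultimately have "m_form D u (tst u \<theta>) + (\<nu> * a_form D u (tst u \<theta>) + c_form D w u (tst u \<theta>)) \<le> K0"
      using eq by (simp add: K0_def)
    moreover have "(\<Sum>n=1..N. \<Sum>i\<in>rset. rwt D n i * (\<theta> n i * node_dissipation \<nu> w u n (rnode D n i)))
        \<le> \<nu> * a_form D u (tst u \<theta>) + c_form D w u (tst u \<theta>)"
      unfolding N_def using \<theta>(1) by (intro dissipation w u \<nu> d pen) simp
    ultimately show ?thesis by linarith
  qed

  have dis0: "0 \<le> (\<Sum>n=1..N. \<Sum>i\<in>rset. rwt D n i * (\<theta> n i * node_dissipation \<nu> w u n (rnode D n i)))"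
    if \<theta>: "\<forall>n i. 0 \<le> \<theta> n i" for \<theta>
  proof (intro sum_nonneg mult_nonneg_nonneg node_dissipation_nonneg p0 \<nu> \<theta>[rule_format])
    fix n i assume "n \<in> {1..N}" "i \<in> rset"
    then show "0 \<le> rwt D n i" using radau(4)[of n i] by (simp add: N_def)
  qed

  \<comment> \<open>The weight is constant on each step, so the Radau sum of \<open>pderiv\<close>
    is a difference of endpoint energies. The jump at \<open>tpt D m\<close> carries the weight of
    step \<open>m + 1\<close>, which is 0; hence the jumps end at \<open>m - 1\<close>.\<close>
  have trunc: "m_form D u (tst u (\<lambda>n i. if n \<le> m then 1 else 0))
      = En u m (tpt D m) / 2 + (\<Sum>n=1..m - 1. Jn u n) / 2 + En u 1 0 / 2" if m: "m \<in> {1..N}" for m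
  proof -
    let ?\<theta> = "\<lambda>n (i::nat). if n \<le> m then 1 else (0::real)"
    have q: "(\<Sum>i\<in>rset. rwt D n i * (?\<theta> n i * poly (pderiv (p n)) (rnode D n i))) / 2
        = (if n \<le> m then (En u n (tpt D n) - En u n (tpt D (n - 1))) / 2 else 0)" if n: "n \<in> {1..N}" for n
    proof (cases "n \<le> m")
      case True
      have n': "n \<in> {1..steps D}" using n by (simp add: N_def)
      have "degree (pderiv (p n)) \<le> 2 * tdeg D" using pd[OF n] by (simp add: degree_pderiv)
      then have "Q n (poly (pderiv (p n))) = En u n (tpt D n) - En u n (tpt D (n - 1))"
        unfolding pE[OF n] using radau(5)[OF n'] set_integral_pderiv[OF less_imp_le[OF sp[OF n]], of "p n"] by simp
      then show ?thesis using True by (simp add: Q_def)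
    qed simp
    have "(\<Sum>n=1..N. (\<Sum>i\<in>rset. rwt D n i * (?\<theta> n i * poly (pderiv (p n)) (rnode D n i))) / 2)
        = (\<Sum>n=1..N. if n \<le> m then (En u n (tpt D n) - En u n (tpt D (n - 1))) / 2 else 0)"
      by (rule sum.cong[OF refl q])
    also have "\<dots> = (\<Sum>n | n \<in> {1..N} \<and> n \<le> m. (En u n (tpt D n) - En u n (tpt D (n - 1))) / 2)"
      by (rule sum.inter_filter[symmetric]) simp
    also have "{n. n \<in> {1..N} \<and> n \<le> m} = {1..m}" using m by auto
    finally have s1: "(\<Sum>n=1..N. (\<Sum>i\<in>rset. rwt D n i * (?\<theta> n i * poly (pderiv (p n)) (rnode D n i))) / 2)
        = (\<Sum>n=1..m. (En u n (tpt D n) - En u n (tpt D (n - 1))) / 2)" .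
    have "(\<Sum>n=1..N - 1. ?\<theta> (n + 1) 1 * ((En u n (tpt D n) - Jn u n - En u (n + 1) (tpt D n)) / 2))
        = (\<Sum>n=1..N - 1. if n + 1 \<le> m then (En u n (tpt D n) - Jn u n - En u (n + 1) (tpt D n)) / 2 else 0)"
      by (intro sum.cong refl) simp
    also have "\<dots> = (\<Sum>n | n \<in> {1..N - 1} \<and> n + 1 \<le> m. (En u n (tpt D n) - Jn u n - En u (n + 1) (tpt D n)) / 2)"
      by (rule sum.inter_filter[symmetric]) simp
    also have "{n. n \<in> {1..N - 1} \<and> n + 1 \<le> m} = {1..m - 1}" using m by auto
    finally have s2: "(\<Sum>n=1..N - 1. ?\<theta> (n + 1) 1 * ((En u n (tpt D n) - Jn u n - En u (n + 1) (tpt D n)) / 2))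
        = (\<Sum>n=1..m - 1. (En u n (tpt D n) - Jn u n - En u (n + 1) (tpt D n)) / 2)" .
    have "m_form D u (tst u ?\<theta>) = (\<Sum>n=1..m. (En u n (tpt D n) - En u n (tpt D (n - 1))) / 2)
        - (\<Sum>n=1..m - 1. (En u n (tpt D n) - Jn u n - En u (n + 1) (tpt D n)) / 2) + En u 1 0"
      using m_form_tst[OF u pT[unfolded N_def], of ?\<theta>] s1 s2 m unfolding N_def[symmetric] by simp
    also have "\<dots> = En u m (tpt D m) / 2 + (\<Sum>n=1..m - 1. Jn u n) / 2 + En u 1 0 / 2"
      using jump_telescope[of m "\<lambda>n. En u n (tpt D n)" "\<lambda>n. En u n (tpt D (n - 1))" "Jn u"] m time_facts(2) by simp
    finally show ?thesis .
  qed

  \<comment> \<open>A bound for the limits from the left only, which is what the weighted test needs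
    from the preceding step.\<close>
  have left: "En u m (tpt D m) \<le> 2 * K0" if m: "m \<in> {1..N}" for m
  proof -
    let ?\<theta> = "\<lambda>n (i::nat). if n \<le> m then 1 else (0::real)"
    have "m_form D u (tst u ?\<theta>) \<le> K0" 
      by (rule order_trans[OF _ test[of ?\<theta>]], simp only: le_add_same_cancel1, rule dis0) simp_all
    moreover have "0 \<le> (\<Sum>n=1..m - 1. Jn u n)" by (intro sum_nonneg Jn_nonneg)
    ultimately show ?thesis using trunc[OF m] En_nonneg[of u 1 0] by simp
  qed
  have K00: "0 \<le> K0" using FU C M0 by (simp add: K0_def)

  have avg: "1 / (tpt D n0 - tpt D (n0 - 1)) * Q n0 (En u n0) \<le> 4 * K0"
  proof -
    let ?a = "tpt D (n0 - 1)" and ?b = "tpt D n0"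
    have n0': "n0 \<in> {1..steps D}" using n0(1) by (simp add: N_def)
    have ab: "?a < ?b" by (rule sp[OF n0(1)])
    \<comment> \<open>At node 1, the left endpoint, the weight is 1, so the jump into step
      \<open>n0\<close> enters in full.\<close>
    define \<theta> where "\<theta> n i = (if n = n0 \<and> i \<in> rset then (?b - rnode D n0 i) / (?b - ?a) else 0)" for n i
    have \<theta>0: "\<forall>n i. 0 \<le> \<theta> n i" and \<theta>1: "\<forall>n i. i \<in> rset \<longrightarrow> \<theta> n i \<le> 1"
      using radau(3)[OF n0'] ab by (auto simp: \<theta>_def divide_simps)
    have \<theta>n: "\<theta> n (Suc 0) = (if n = n0 then 1 else 0)" for n
      using radau(1)[OF n0'] rset_facts(2) ab by (simp add: \<theta>_def)
    have q: "(\<Sum>i\<in>rset. rwt D n i * (\<theta> n i * poly (pderiv (p n)) (rnode D n i))) / 2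
        = (if n = n0 then (- En u n0 ?a + 1 / (?b - ?a) * Q n0 (En u n0)) / 2 else 0)" for n
    proof (cases "n = n0")
      case True
      let ?q = "smult (1 / (?b - ?a)) ([:?b, - 1:] * pderiv (p n0))"
      note wp = weighted_pderiv[OF ab, of "p n0"]
      have pe: "En u n0 = poly (p n0)" using pE[OF n0(1)] by (simp add: fun_eq_iff)
      have "(\<Sum>i\<in>rset. rwt D n0 i * (\<theta> n0 i * poly (pderiv (p n0)) (rnode D n0 i))) = Q n0 (poly ?q)"
        unfolding Q_def by (intro sum.cong refl) (simp only: wp(2) \<theta>_def simp_thms if_True)
      also have "\<dots> = (LINT t:{?a..?b}|lborel. poly ?q t)"
        by (rule radau(5)[OF n0']) (use wp(1) pd[OF n0(1)] in linarith)
      also have "\<dots> = - En u n0 ?a + 1 / (?b - ?a) * Q n0 (En u n0)"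
        unfolding wp(3) pe radau(5)[OF n0' pd[OF n0(1)]] ..
      finally show ?thesis using True by simp
    qed (simp add: \<theta>_def)
    have s1: "(\<Sum>n=1..N. (\<Sum>i\<in>rset. rwt D n i * (\<theta> n i * poly (pderiv (p n)) (rnode D n i))) / 2)
        = (- En u n0 ?a + 1 / (?b - ?a) * Q n0 (En u n0)) / 2"
      unfolding q using n0(1) by simp
    \<comment> \<open>Only the jump at the left end of step \<open>n0\<close> has nonzero weight.
      For \<open>n0 = 1\<close> there is none, and the initial term of the form takes its
      place.\<close>
    have s2: "(\<Sum>n=1..N - 1. \<theta> (n + 1) 1 * ((En u n (tpt D n) - Jn u n - En u (n + 1) (tpt D n)) / 2))
        = (if n0 = 1 then 0 else (En u (n0 - 1) ?a - Jn u (n0 - 1) - En u n0 ?a) / 2)"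
    proof -
      have "(\<Sum>n=1..N - 1. \<theta> (n + 1) 1 * ((En u n (tpt D n) - Jn u n - En u (n + 1) (tpt D n)) / 2))
        = (\<Sum>n=1..N - 1. if n = n0 - 1 then (En u (n0 - 1) ?a - Jn u (n0 - 1) - En u n0 ?a) / 2 else 0)"
        by (rule sum.cong[OF refl]) (use n0(1) in \<open>auto simp: \<theta>n split: if_splits\<close>)
      also have "\<dots> = (if n0 = 1 then 0 else (En u (n0 - 1) ?a - Jn u (n0 - 1) - En u n0 ?a) / 2)"
        using n0(1) by (auto simp: sum.delta)
      finally show ?thesis .
    qed
    define X where "X = 1 / (?b - ?a) * Q n0 (En u n0)"
    have "m_form D u (tst u \<theta>) \<le> K0" using test[OF \<theta>0 \<theta>1] dis0[OF \<theta>0] by linarith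
    then have mf: "(- En u n0 ?a + X) / 2
        - (if n0 = 1 then 0 else (En u (n0 - 1) ?a - Jn u (n0 - 1) - En u n0 ?a) / 2)
        + \<theta> 1 1 * En u 1 0 \<le> K0"
      using m_form_tst[OF u pT[unfolded N_def], of \<theta>] unfolding N_def[symmetric] s1 s2 X_def by linarith
    \<comment> \<open>Here e is the energy just after the left end of the step, e' the one just
      before and j the squared jump. In the second case e cancels against the jump term and e'
      remains; the bound 4 \<open>K0\<close> is 2 \<open>K0\<close> from the test and 2
      \<open>K0\<close> from \<open>left\<close>.\<close>
    have lin: "(- e + X) / 2 + e \<le> K0 \<Longrightarrow> 0 \<le> e \<Longrightarrow> X \<le> 4 * K0"
      "(- e + X) / 2 - (e' - j - e) / 2 \<le> K0 \<Longrightarrow> e' \<le> 2 * K0 \<Longrightarrow> 0 \<le> j \<Longrightarrow> X \<le> 4 * K0" for e e' j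
      using K00 by (simp_all add: field_simps)
    have "X \<le> 4 * K0"
    proof (cases "n0 = 1")
      case True
      then have "En u n0 ?a = En u 1 0" "\<theta> 1 1 = 1" using time_facts(2) by (simp_all add: \<theta>n)
      then show ?thesis using mf[unfolded True if_P[OF refl]] K00 En_nonneg[of u 1 0] True by (intro lin(1)[of "En u 1 0"]) simp_all
    next
      case False
      then have m1: "n0 - 1 \<in> {1..N}" and "\<theta> 1 1 = 0" using n0(1) by (auto simp: \<theta>n)
      then have "(- En u n0 ?a + X) / 2 - (En u (n0 - 1) ?a - Jn u (n0 - 1) - En u n0 ?a) / 2 \<le> K0"
        using mf False by (simp only: if_False simp_thms mult_zero_left add_0_right)
      then show ?thesis using left[OF m1] Jn_nonneg[of u "n0 - 1"] by (intro lin(2))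
    qed
    then show ?thesis by (simp only: X_def)
  qed
  \<comment> \<open>\<open>K0\<close> is linear in M while the left-hand side is M^2, so one factor
    M is divided out; this requires M to be nonzero.\<close>
  have M_le: "M \<le> 4 * C * (1 + sqrt C) * (Fn + Gu)"
  proof (cases "M = 0")
    case True
    then show ?thesis using C FU by simp
  next
    case False
    then have Mp: "0 < M" using M0 by simp
    have n0': "n0 \<in> {1..steps D}" using n0(1) by (simp add: N_def)
    have "M\<^sup>2 \<le> C / (tpt D n0 - tpt D (n0 - 1)) * Q n0 (En u n0)"
      unfolding M2 C_def
    proof (rule tpoly_le_average[OF n0'])
      show "tpoly (2 * tdeg D) (En u n0)"
        unfolding En_def[abs_def] by (rule tpoly_L2[OF Vht_tfields(1)[OF uV n0'] Vht_tfields(1)[OF uV n0']])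
      show "tm n0 \<in> {tpt D (n0 - 1)..tpt D n0}" using tm n0(1) by blast
    qed (rule En_nonneg)
    also have "\<dots> = C * (1 / (tpt D n0 - tpt D (n0 - 1)) * Q n0 (En u n0))" by simp
    also have "\<dots> \<le> C * (4 * K0)" using avg C by (intro mult_left_mono) simp_all
    also have "\<dots> = 4 * C * (Fn * sqrt C + Gu) * M" by (simp add: K0_def algebra_simps)
    finally have "M * M \<le> 4 * C * (Fn * sqrt C + Gu) * M" by (simp add: power2_eq_square)
    then have "M \<le> 4 * C * (Fn * sqrt C + Gu)" using Mp by simp
    also have "\<dots> \<le> 4 * C * ((1 + sqrt C) * (Fn + Gu))"
      using C FU by (intro mult_left_mono) (simp_all add: algebra_simps)
    finally show ?thesis by (simp add: mult.assoc)
  qed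
  have K0_le: "K0 \<le> (1 + sqrt C) * (Fn + Gu) * M"
  proof -
    have "(Fn * sqrt C + Gu) * M \<le> ((1 + sqrt C) * (Fn + Gu)) * M"
      using C FU M0 by (intro mult_right_mono) (simp_all add: algebra_simps)
    then show ?thesis by (simp add: K0_def algebra_simps)
  qed

  have linf: "(Linf_norm (restrict_space lborel {0<..<final D}) (\<lambda>t. L2_norm_on \<Omega> (st_assemble D u t)))\<^sup>2 \<le> M\<^sup>2"
  proof (rule Linf_bound[OF uV M0])
    fix n t assume "n \<in> {1..steps D}" "t \<in> tint D n"
    then have "En u n t \<le> M\<^sup>2" by (intro EM) (simp_all add: N_def tint_def)
    then have "sqrt (En u n t) \<le> sqrt (M\<^sup>2)" by (rule real_sqrt_le_mono)
    then show "L2_norm_on \<Omega> (assemble D (u n t)) \<le> M" using M0 by (simp add: En_sqrt)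
  qed
  have full: "J_norm_sq D u + (\<nu> / 2 * A_norm_sq D u + gamma_norm_sq D w u) \<le> K0"
  proof -
    let ?\<theta> = "\<lambda>n (i::nat). if n \<le> N then 1 else (0::real)"
    have NN: "N \<in> {1..N}" using N1 by simp
    have "(\<Sum>n=1..N. \<Sum>i\<in>rset. rwt D n i * (?\<theta> n i * node_dissipation \<nu> w u n (rnode D n i)))
        = (\<Sum>n=1..N. \<Sum>i\<in>rset. rwt D n i * node_dissipation \<nu> w u n (rnode D n i))"
      by (intro sum.cong refl) simp
    also have "\<dots> = \<nu> / 2 * A_norm_sq D u + gamma_norm_sq D w u"
      unfolding N_def by (rule dissipation_total[OF uV])
    finally have 1: "(\<Sum>n=1..N. \<Sum>i\<in>rset. rwt D n i * (?\<theta> n i * node_dissipation \<nu> w u n (rnode D n i)))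
        = \<nu> / 2 * A_norm_sq D u + gamma_norm_sq D w u" .
    have "m_form D u (tst u ?\<theta>) = En u N (tpt D N) / 2 + (\<Sum>n=1..N - 1. Jn u n) / 2 + En u 1 0 / 2"
      by (rule trunc[OF NN])
    also have "\<dots> = J_norm_sq D u"
      unfolding J_norm_sq_def Jn_def L2_norm_on_sq En_def N_def time_facts(3) by (simp add: algebra_simps)
    finally have "m_form D u (tst u ?\<theta>) = J_norm_sq D u" .
    then show ?thesis using test[of ?\<theta>] 1 by simp
  qed
  have "0 \<le> J_norm_sq D u" unfolding J_norm_sq_def by (intro mult_nonneg_nonneg add_nonneg_nonneg sum_nonneg) simp_all
  moreover have "0 \<le> gamma_norm_sq D w u"
    unfolding gamma_norm_sq_def radau_quad_def
  proof (intro mult_nonneg_nonneg sum_nonneg less_imp_le[OF gammaF_pos] Bochner_Integration.integral_nonneg)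
    fix n i assume "n \<in> {1..steps D}" "i \<in> {1..tdeg D + 1}"
    then show "0 \<le> rwt D n i" using radau(4)[of n i] by (simp add: rset_def)
  qed simp_all
  \<comment> \<open>\<open>K0\<close> is doubled to compensate for the factor \<nu> / 2 left by
    coercivity.\<close>
  ultimately have "energy_norm_sq D \<nu> w u \<le> M\<^sup>2 + 2 * K0"
    unfolding energy_norm_sq_def using linf full by simp
  also have "\<dots> \<le> (4 * C * (1 + sqrt C) * (Fn + Gu))\<^sup>2 + 2 * ((1 + sqrt C) * (Fn + Gu) * (4 * C * (1 + sqrt C) * (Fn + Gu)))"
  proof (intro add_mono power_mono M_le M0 mult_left_mono)
    show "K0 \<le> (1 + sqrt C) * (Fn + Gu) * (4 * C * (1 + sqrt C) * (Fn + Gu))"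
      using K0_le M_le C FU by (elim order_trans) (intro mult_left_mono, simp_all)
  qed simp
  also have "\<dots> = (stab_const (tdeg D) / 2) * (Fn + Gu)\<^sup>2"
  proof -
    have "(4 * C * a * X)\<^sup>2 + 2 * (a * X * (4 * C * a * X)) = (2 * (16 * C\<^sup>2 * a\<^sup>2 + 8 * C * a\<^sup>2) / 2) * X\<^sup>2" for a X
      by (simp add: power2_eq_square algebra_simps)
    then show ?thesis unfolding stab_const_def Let_def C_def[symmetric] .
  qed
  also have "\<dots> \<le> (stab_const (tdeg D) / 2) * (2 * (Fn\<^sup>2 + Gu\<^sup>2))"
  proof (rule mult_left_mono)
    show "(Fn + Gu)\<^sup>2 \<le> 2 * (Fn\<^sup>2 + Gu\<^sup>2)"
      using zero_le_power2[of "Fn - Gu"] by (simp add: power2_eq_square algebra_simps)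
    show "0 \<le> stab_const (tdeg D) / 2" using C unfolding stab_const_def Let_def C_def[symmetric] by simp
  qed
  also have "\<dots> = stab_const (tdeg D) * (Fn\<^sup>2 + Gu\<^sup>2)" by simp
  finally show ?thesis unfolding Fn_def Gu_def .
qed

end

text \<open>Stated for every dimension from 2 on, so that both type instances share one
  constant.\<close>

lemma stability_estimate:
  fixes D :: "'n::finite discretization"
  assumes "2 \<le> CARD('n)" and D: "valid_discretization D"
    and "penalty_threshold CARD('n) (spdeg D) (shreg D) \<le> pen D" "0 < \<nu>"
    and "L1_L2 (final D) (region D) f" and u0: "u0 \<in> solenoidal (region D)"
    and "w \<in> Zht D" "solves_linearized D \<nu> f u0 w u"
  shows "energy_norm_sq D \<nu> w u
    \<le> stab_const (tdeg D) * ((L1_L2_norm (final D) (region D) f)\<^sup>2 + (L2_norm_on (region D) u0)\<^sup>2)"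
proof -
  interpret dg D using D by unfold_locales
  have "L2_on (region D) u0" using u0 by (simp add: solenoidal_def Hdiv_def)
  then show ?thesis using assms by (intro energy_stability)
qed

text \<open>The requirement of a sufficiently large penalty becomes a threshold function fixed
  before \<ell> and all data. The dimension is a type, so the two admissible ones are separate
  instances, with C chosen ahead of both.\<close>

theorem proposition3p5:
  shows "\<exists>\<sigma>0 :: nat \<Rightarrow> nat \<Rightarrow> real \<Rightarrow> real.
    (\<forall>d k \<rho>. 0 < \<sigma>0 d k \<rho>) \<and>
    (\<forall>l. \<exists>C>0.
      (\<forall>(D :: 2 discretization) \<nu> f u0 w u.
         valid_discretization D \<and> tdeg D = l \<and> \<sigma>0 2 (spdeg D) (shreg D) \<le> pen D \<and> 0 < \<nu> \<and>
         L1_L2 (final D) (region D) f \<and> u0 \<in> solenoidal (region D) \<and> w \<in> Zht D \<and>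
         solves_linearized D \<nu> f u0 w u \<longrightarrow>
         energy_norm_sq D \<nu> w u
           \<le> C * ((L1_L2_norm (final D) (region D) f)\<^sup>2 + (L2_norm_on (region D) u0)\<^sup>2)) \<and>
      (\<forall>(D :: 3 discretization) \<nu> f u0 w u.
         valid_discretization D \<and> tdeg D = l \<and> \<sigma>0 3 (spdeg D) (shreg D) \<le> pen D \<and> 0 < \<nu> \<and>
         L1_L2 (final D) (region D) f \<and> u0 \<in> solenoidal (region D) \<and> w \<in> Zht D \<and>
         solves_linearized D \<nu> f u0 w u \<longrightarrow>
         energy_norm_sq D \<nu> w u
           \<le> C * ((L1_L2_norm (final D) (region D) f)\<^sup>2 + (L2_norm_on (region D) u0)\<^sup>2)))"
proof -
  have C: "0 < stab_const l" for l
  proof -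
    have c: "0 < L1_const (2 * l)" by (rule L1_const(1))
    then have "0 < 1 + sqrt (L1_const (2 * l))" by (intro add_pos_pos) simp_all
    then show ?thesis
      unfolding stab_const_def Let_def using c by (intro mult_pos_pos add_pos_pos zero_less_power) simp_all
  qed
  show ?thesis
  proof (intro exI[of _ penalty_threshold] conjI allI impI penalty_threshold_pos)
    fix l
    show "\<exists>C>0.
      (\<forall>(D :: 2 discretization) \<nu> f u0 w u.
         valid_discretization D \<and> tdeg D = l \<and> penalty_threshold 2 (spdeg D) (shreg D) \<le> pen D \<and> 0 < \<nu> \<and>
         L1_L2 (final D) (region D) f \<and> u0 \<in> solenoidal (region D) \<and> w \<in> Zht D \<and>
         solves_linearized D \<nu> f u0 w u \<longrightarrow>
         energy_norm_sq D \<nu> w u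
           \<le> C * ((L1_L2_norm (final D) (region D) f)\<^sup>2 + (L2_norm_on (region D) u0)\<^sup>2)) \<and>
      (\<forall>(D :: 3 discretization) \<nu> f u0 w u.
         valid_discretization D \<and> tdeg D = l \<and> penalty_threshold 3 (spdeg D) (shreg D) \<le> pen D \<and> 0 < \<nu> \<and>
         L1_L2 (final D) (region D) f \<and> u0 \<in> solenoidal (region D) \<and> w \<in> Zht D \<and>
         solves_linearized D \<nu> f u0 w u \<longrightarrow>
         energy_norm_sq D \<nu> w u
           \<le> C * ((L1_L2_norm (final D) (region D) f)\<^sup>2 + (L2_norm_on (region D) u0)\<^sup>2))"
      using C[of l] stability_estimate[where 'n = 2] stability_estimate[where 'n = 3]
      by (intro exI[of _ "stab_const l"] conjI allI impI) auto
  qed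
qed

end
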